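(* Let $d\geq 1$ be an integer, $R>0$, $T>0$, let $\Omega=\mathbb{B}(0;R)\subset\mathbb{R}^d$ be the ball of radius $R$ centred at the origin, and let $V_0\in\big(0;\mathrm{Vol}((0;T)\times\Omega)\big)$. Let $$\mathcal{F}:=\Big\{f\in L^\infty((0;T)\times\Omega)\,:\ 0\leq f\leq 1\text{ a.e.},\ \iint_{(0;T)\times\Omega}f=V_0\Big\},$$ and for $f\in\mathcal{F}$ let $u_f$ be the solution of the heat equation with source $f$, homogeneous Dirichlet boundary conditions and zero initial datum. Then there exists no $f^*\in\mathcal{F}$ such that $$\forall f\in\mathcal{F},\quad u_f(T,\cdot)\prec u_{f^*}(T,\cdot).$$
   Context: For $f\in L^\infty((0;T)\times\Omega)$, $u_f$ denotes the unique solution of $$\begin{cases}\frac{\partial u_f}{\partial t}-\Delta u_f=f&\text{in }(0;T)\times\Omega,\\ u_f(t,\cdot)=0&\text{on }(0;T)\times\partial\Omega,\\ u_f(0,\cdot)=0&\text{in }\Omega.\end{cases}$$ For a non-negative $g\in L^2(\Omega)$, its Schwarz rearrangement $g^\#\in L^2(\Omega)$ is the unique radially symmetric, non-negative, (radially) non-increasing function with the same distribution function as $g$, i.e. $\mathrm{Vol}(\{g\geq t\})=\mathrm{Vol}(\{g^\#\geq t\})$ for all $t\geq 0$. For non-negative $f,g\in L^2(\Omega)$, one writes $f\prec g$ if and only if $\int_{\mathbb{B}(0;r)}f^\#\leq\int_{\mathbb{B}(0;r)}g^\#$ for all $r\in(0;R)$. Equivalently, for every $V\in(0;\mathrm{Vol}(\Omega))$,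 $\sup_{E\subset\Omega,\,\mathrm{Vol}(E)=V}\int_E f\leq\sup_{E\subset\Omega,\,\mathrm{Vol}(E)=V}\int_E g$. *)

theory Defs
  imports "HOL-Analysis.Analysis"
begin

text \<open>
  Elements of $L^p$ are represented by functions that are Borel measurable on the set under
  consideration (every Lebesgue class has such a representative).
\<close>

definition L2_on :: "'b::euclidean_space set \<Rightarrow> ('b \<Rightarrow> 'c::euclidean_space) \<Rightarrow> bool" where
  "L2_on S g \<longleftrightarrow> set_borel_measurable lborel S g \<and> set_integrable lborel S (\<lambda>x. (norm (g x))\<^sup>2)"

text \<open>\<open>C1_compact \<Omega> \<phi> D\<close>: \<open>\<phi>\<close> belongs to $C^1_c(\Omega)$ and has gradient \<open>D\<close>.\<close>

definition C1_compact :: "'a::euclidean_space set \<Rightarrow> ('a \<Rightarrow> real) \<Rightarrow> ('a \<Rightarrow> 'a) \<Rightarrow> bool" where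
  "C1_compact \<Omega> \<phi> D \<longleftrightarrow>
     (\<forall>x. GDERIV \<phi> x :> D x) \<and> continuous_on UNIV D \<and>
     (\<exists>K. compact K \<and> K \<subseteq> \<Omega> \<and> (\<forall>x. x \<notin> K \<longrightarrow> \<phi> x = 0))"

text \<open>
  \<open>H10 \<Omega> v G\<close>: \<open>v\<close> belongs to $H^1_0(\Omega)$, the closure of $C^1_c(\Omega)$ in the $H^1$ norm,
  and \<open>G\<close> is its weak gradient. (The closure of $C^\infty_c(\Omega)$ is the same space.)
\<close>

definition H10 :: "'a::euclidean_space set \<Rightarrow> ('a \<Rightarrow> real) \<Rightarrow> ('a \<Rightarrow> 'a) \<Rightarrow> bool" where
  "H10 \<Omega> v G \<longleftrightarrow>
     L2_on \<Omega> v \<and> L2_on \<Omega> G \<and>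
     (\<exists>\<phi> D. (\<forall>n::nat. C1_compact \<Omega> (\<phi> n) (D n)) \<and>
        (\<lambda>n. LINT x:\<Omega>|lborel. (\<phi> n x - v x)\<^sup>2) \<longlonglongrightarrow> 0 \<and>
        (\<lambda>n. LINT x:\<Omega>|lborel. (norm (D n x - G x))\<^sup>2) \<longlonglongrightarrow> 0)"

text \<open>
  Weak solutions of $\partial_t u - \Delta u = f$ in $(0,T) \times \Omega$ with $u = 0$ on
  $(0,T) \times \partial\Omega$ and $u(0,\cdot) = 0$, in the usual class
  $u \in C([0,T]; L^2(\Omega)) \cap L^2(0,T; H^1_0(\Omega))$. The Dirichlet condition is the
  membership $u(t,\cdot) \in H^1_0(\Omega)$ for almost every $t$, with \<open>G t\<close> the spatial
  gradient of \<open>u t\<close>. The equation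
  $\langle \partial_t u, v \rangle + \int_\Omega \nabla u \cdot \nabla v = \int_\Omega f v$ for all
  $v \in H^1_0(\Omega)$ and almost every $t$ is written integrated over $(0,t)$, using the initial
  condition.
\<close>

definition is_heat_solution ::
  "'a::euclidean_space set \<Rightarrow> real \<Rightarrow> (real \<times> 'a \<Rightarrow> real) \<Rightarrow> (real \<Rightarrow> 'a \<Rightarrow> real) \<Rightarrow> bool" where
  "is_heat_solution \<Omega> T f u \<longleftrightarrow>
     (\<forall>t\<in>{0..T}. L2_on \<Omega> (u t)) \<and>
     (\<forall>t\<in>{0..T}. ((\<lambda>s. LINT x:\<Omega>|lborel. (u s x - u t x)\<^sup>2) \<longlongrightarrow> 0) (at t within {0..T})) \<and>
     (AE x\<in>\<Omega> in lborel. u 0 x = 0) \<and>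
     L2_on ({0<..<T} \<times> \<Omega>) (\<lambda>(t, x). u t x) \<and>
     (\<exists>G :: real \<Rightarrow> 'a \<Rightarrow> 'a.
        L2_on ({0<..<T} \<times> \<Omega>) (\<lambda>(t, x). G t x) \<and>
        (AE t\<in>{0<..<T} in lborel. H10 \<Omega> (u t) (G t)) \<and>
        (\<forall>v H. H10 \<Omega> v H \<longrightarrow>
          (\<forall>t\<in>{0..T}.
             (LINT x:\<Omega>|lborel. u t x * v x)
             + (LINT (s, x):{0<..<t} \<times> \<Omega>|lborel. G s x \<bullet> H x)
             = (LINT (s, x):{0<..<t} \<times> \<Omega>|lborel. f (s, x) * v x))))"

text \<open>
  The solution $u_f$. It is unique only up to null sets of $\Omega$ for each $t \in [0,T]$, hence
  the choice of a representative instead of a definite description.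
\<close>

definition heat_solution ::
  "'a::euclidean_space set \<Rightarrow> real \<Rightarrow> (real \<times> 'a \<Rightarrow> real) \<Rightarrow> real \<Rightarrow> 'a \<Rightarrow> real" where
  "heat_solution \<Omega> T f = (SOME u. is_heat_solution \<Omega> T f u)"

definition admissible_sources ::
  "'a::euclidean_space set \<Rightarrow> real \<Rightarrow> real \<Rightarrow> (real \<times> 'a \<Rightarrow> real) set" where
  "admissible_sources \<Omega> T V\<^sub>0 =
     {f. set_borel_measurable lborel ({0<..<T} \<times> \<Omega>) f \<and>
         (AE z\<in>{0<..<T} \<times> \<Omega> in lborel. 0 \<le> f z \<and> f z \<le> 1) \<and>
         (LINT z:{0<..<T} \<times> \<Omega>|lborel. f z) = V\<^sub>0}"

text \<open>
  \<open>h\<close> is a Schwarz rearrangement of \<open>g\<close> on the ball of radius \<open>R\<close>. The second condition says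
  that \<open>h\<close> is both radially symmetric (points of equal norm) and radially non-increasing; it makes
  \<open>h\<close> measurable, and the last condition makes \<open>h\<close> square integrable whenever \<open>g\<close> is. The origin
  is exempt because the rearrangement of an unbounded \<open>g\<close> blows up there.
\<close>

definition is_schwarz_rearrangement ::
  "real \<Rightarrow> ('a::euclidean_space \<Rightarrow> real) \<Rightarrow> ('a \<Rightarrow> real) \<Rightarrow> bool" where
  "is_schwarz_rearrangement R g h \<longleftrightarrow>
     (\<forall>x\<in>ball 0 R. 0 \<le> h x) \<and>
     (\<forall>x\<in>ball 0 R - {0}. \<forall>y\<in>ball 0 R - {0}. norm x \<le> norm y \<longrightarrow> h y \<le> h x) \<and>
     (\<forall>s\<ge>0. measure lborel {x \<in> ball 0 R. g x \<ge> s} = measure lborel {x \<in> ball 0 R. h x \<ge> s})"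

text \<open>
  Also unique only up to a null set (the values on spheres where the radial profile jumps are free).
\<close>

definition schwarz_rearrangement ::
  "real \<Rightarrow> ('a::euclidean_space \<Rightarrow> real) \<Rightarrow> 'a \<Rightarrow> real" where
  "schwarz_rearrangement R g = (SOME h. is_schwarz_rearrangement R g h)"

text \<open>The relation $f \prec g$, for \<open>f\<close>, \<open>g\<close> non-negative and square integrable on the ball.\<close>

definition less_concentrated ::
  "real \<Rightarrow> ('a::euclidean_space \<Rightarrow> real) \<Rightarrow> ('a \<Rightarrow> real) \<Rightarrow> bool" where
  "less_concentrated R f g \<longleftrightarrow>
     (\<forall>r\<in>{0<..<R}. (LINT x:ball 0 r|lborel. schwarz_rearrangement R f x)
                 \<le> (LINT x:ball 0 r|lborel. schwarz_rearrangement R g x))"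

end

theory Submission
  imports Defs "HOL-Library.Diagonal_Subsequence"
begin

text \<open>
  Suppose \<open>f\<close> is optimal. By duality \<open>\<integral>\<^sub>E u\<^sub>f(T) = \<integral>\<integral> f p\<^sub>E\<close>, where \<open>p\<^sub>E\<close> is the backward heat flow with
  final datum \<open>1\<^sub>E\<close>, and the integral of the rearrangement of \<open>u\<^sub>f(T)\<close> over the ball of radius \<open>r\<close> is
  the maximum of \<open>\<integral>\<^sub>E u\<^sub>f(T)\<close> over the sets \<open>E\<close> with the volume of that ball. If \<open>E\<close> attains it, then \<open>f\<close>
  maximises \<open>\<integral>\<integral> f p\<^sub>E\<close> under the volume constraint, so there is a level \<open>c\<close> with \<open>f = 1\<close> on
  \<open>{p\<^sub>E > c}\<close> and \<open>f = 0\<close> on \<open>{p\<^sub>E < c}\<close>. Strict positivity of \<open>p\<^sub>E\<close> gives \<open>c > 0\<close>, and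
  \<open>\<integral>\<integral> p\<^sub>E\<^sup>2 \<le> T |E|\<close> gives \<open>c \<le> 1/2\<close> when \<open>r\<close> is small. Hence \<open>|f(t,.) - 1\<^sub>E| \<le> (p\<^sub>E(t,.) - 1\<^sub>E)\<^sup>2 / c\<^sup>2\<close>,
  so \<open>f(t,.)\<close> tends to \<open>1\<^sub>E\<close> in \<open>L\<^sup>1\<close> as \<open>t\<close> tends to \<open>T\<close>. Two small radii yield sets of different volumes
  with the same limit, a contradiction.

  The heat flow is expanded in Dirichlet eigenfunctions. Its strict positivity comes from the energy
  \<open>\<integral> \<phi> ln (1 + u/\<epsilon>)\<close> with a cut-off \<open>\<phi>\<close>: it is almost nondecreasing in time, and its dissipation
  together with Poincare's inequality shows, as \<open>\<epsilon>\<close> tends to \<open>0\<close>, that at suitable times \<open>u\<close> is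
  almost everywhere positive or almost everywhere zero on a given ball.
\<close>

subsection \<open>The Hilbert space of square integrable functions\<close>

text \<open>Both \<open>heat_solution\<close> and \<open>schwarz_rearrangement\<close> are chosen by
  \<open>SOME\<close>, so only what holds for every candidate can be used. This is why existence of
  weak solutions, their uniqueness at the final time, and existence of a rearrangement are all
  proved, the first two by one eigenfunction expansion that also yields the duality formula.

  Strict positivity enters at one point: were the level c at most 0, f would be 1 almost everywhere,
  against \<open>V\<^sub>0\<close> being smaller than the full volume. The bound c <= 1/2 lets one
  estimate serve inside and outside E. Its right side is a square because the flow is known to be
  continuous at time 0 in L^2, and nothing finer is at hand for an indicator as datum.

  The logarithm is chosen because ln (1 + u/\<epsilon>) / ln (1/\<epsilon>) tends to the indicator
  of {u > 0}, while its gradient energy over a time interval is of the order of ln (1/\<epsilon>)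
  before division by the square of this number. In the limit there remains an indicator with zero
  gradient, which is constant on a ball; monotonicity in time then decides which constant.\<close>

definition L2_fun :: "('a::euclidean_space => 'b::euclidean_space) => bool" where
  "L2_fun f \<longleftrightarrow> f \<in> borel_measurable lborel \<and> integrable lborel (%x. (norm (f x))\<^sup>2)"

lemma L2_fun_inner:
  assumes "L2_fun f" "L2_fun g"
  shows "integrable lborel (%x. f x \<bullet> g x)"
proof (rule Bochner_Integration.integrable_bound)
  show "integrable lborel (%x. (norm (f x))\<^sup>2 + (norm (g x))\<^sup>2)"
    using assms by (auto simp: L2_fun_def)
  show "(%x. f x \<bullet> g x) \<in> borel_measurable lborel"
    using assms by (auto simp: L2_fun_def)
  have "\<bar>a \<bullet> b\<bar> <= (norm a)\<^sup>2 + (norm b)\<^sup>2" for a b :: 'b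
  proof -
    have "\<bar>a \<bullet> b\<bar> <= norm a * norm b" by (rule Cauchy_Schwarz_ineq2)
    also have "\<dots> <= (norm a)\<^sup>2 + (norm b)\<^sup>2"
      using sum_squares_bound[of "norm a" "norm b"] mult_nonneg_nonneg[OF norm_ge_zero[of a] norm_ge_zero[of b]]
      by linarith
    finally show ?thesis .
  qed
  then show "AE x in lborel. norm (f x \<bullet> g x) <= norm ((norm (f x))\<^sup>2 + (norm (g x))\<^sup>2)"
    by auto
qed

lemma L2_fun_zero: "L2_fun (%x. 0)"
  by (simp add: L2_fun_def)

lemma L2_fun_scaleR: "L2_fun f ==> L2_fun (%x. c *\<^sub>R f x)"
  by (auto simp: L2_fun_def power_mult_distrib)

lemma L2_fun_add:
  assumes "L2_fun f" "L2_fun g"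
  shows "L2_fun (%x. f x + g x)"
proof -
  have "(norm (f x + g x))\<^sup>2 = (norm (f x))\<^sup>2 + 2 * (f x \<bullet> g x) + (norm (g x))\<^sup>2" for x
    by (simp add: power2_norm_eq_inner inner_add_left inner_add_right inner_commute)
  then show ?thesis
    using assms L2_fun_inner[OF assms] by (auto simp: L2_fun_def)
qed

lemma L2_fun_uminus: "L2_fun f ==> L2_fun (%x. - f x)"
  by (auto simp: L2_fun_def)

lemma L2_fun_diff:
  "L2_fun f ==> L2_fun g ==> L2_fun (%x. f x - g x)"
  using L2_fun_add[of f "%x. - g x"] L2_fun_uminus[of g] by simp

lemma L2_fun_bound:
  fixes f :: "'a::euclidean_space => 'b::euclidean_space" and g :: "'a => 'c::euclidean_space"
  assumes "L2_fun g" "f \<in> borel_measurable lborel" "AE x in lborel. norm (f x) <= norm (g x)"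
  shows "L2_fun f"
  unfolding L2_fun_def
proof (rule conjI[OF assms(2) Bochner_Integration.integrable_bound[of lborel "%x. (norm (g x))\<^sup>2"]])
  show "integrable lborel (%x. (norm (g x))\<^sup>2)" using assms by (auto simp: L2_fun_def)
  show "(%x. (norm (f x))\<^sup>2) \<in> borel_measurable lborel" using assms(2) by measurable
  show "AE x in lborel. norm ((norm (f x))\<^sup>2) <= norm ((norm (g x))\<^sup>2)"
    using assms(3) by eventually_elim (auto intro: power_mono)
qed

lemma L2_fun_bounded_mult:
  fixes f :: "'a::euclidean_space => 'b::euclidean_space"
  assumes "L2_fun f" "c \<in> borel_measurable lborel" "\<And>x. \<bar>c x\<bar> <= B"
  shows "L2_fun (%x. c x *\<^sub>R f x)"
proof (rule L2_fun_bound[OF L2_fun_scaleR[OF assms(1), of B]])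
  show "(%x. c x *\<^sub>R f x) \<in> borel_measurable lborel"
    using assms by (auto simp: L2_fun_def)
  have "\<bar>c x\<bar> <= \<bar>B\<bar>" for x using assms(3)[of x] by linarith
  then show "AE x in lborel. norm (c x *\<^sub>R f x) <= norm (B *\<^sub>R f x)"
    by (intro AE_I2) (auto intro: mult_right_mono)
qed

\<comment> \<open>Classes of functions on the whole space. A function on a domain is treated as one
  that vanishes outside it, so a single Hilbert space serves all domains and no type depends on the
  radius. The quotient is partial because only square integrable functions represent a
  class.\<close>
quotient_type (overloaded) ('a, 'b) L2 = "'a::euclidean_space => 'b::euclidean_space" / partial:
  "%f g. L2_fun f \<and> L2_fun g \<and> (AE x in lborel. f x = g x)"
proof (rule part_equivpI)
  show "\<exists>f::'a => 'b. L2_fun f \<and> L2_fun f \<and> (AE x in lborel. f x = f x)"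
    by (rule exI[of _ "%x. 0"]) (auto simp: L2_fun_zero)
  show "symp (%f g::'a => 'b. L2_fun f \<and> L2_fun g \<and> (AE x in lborel. f x = g x))"
    by (intro sympI) (auto elim: eventually_mono)
  show "transp (%f g::'a => 'b. L2_fun f \<and> L2_fun g \<and> (AE x in lborel. f x = g x))"
    by (intro transpI) (auto elim: eventually_elim2)
qed

abbreviation cls :: "('a::euclidean_space => 'b::euclidean_space) => ('a, 'b) L2" where
  "cls \<equiv> abs_L2"

lemma cls_rep_L2 [simp]: "cls (rep_L2 z) = z"
  using Quotient3_L2 by (rule Quotient3_abs_rep)

lemma L2_fun_rep_L2 [simp]: "L2_fun (rep_L2 z)"
  using Quotient3_rep_reflp[OF Quotient3_L2, of z] by auto

lemma measurable_rep_L2 [measurable]: "rep_L2 z \<in> borel_measurable borel"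
  using L2_fun_rep_L2[of z] by (simp add: L2_fun_def)

lemma cls_eq_iff:
  assumes "L2_fun f" "L2_fun g"
  shows "cls f = cls g \<longleftrightarrow> (AE x in lborel. f x = g x)"
  using Quotient3_rel[OF Quotient3_L2, of f g] assms by auto

lemma rep_L2_cls:
  assumes "L2_fun f"
  shows "AE x in lborel. rep_L2 (cls f) x = f x"
  using cls_eq_iff[OF L2_fun_rep_L2[of "cls f"] assms] by simp

instantiation L2 :: (euclidean_space, euclidean_space) real_vector
begin

lift_definition zero_L2 :: "('a, 'b) L2" is "%x. 0"
  by (simp add: L2_fun_zero)

lift_definition plus_L2 :: "('a, 'b) L2 => ('a, 'b) L2 => ('a, 'b) L2" is "%f g x. f x + g x"
  by (auto intro: L2_fun_add elim: eventually_elim2)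

lift_definition uminus_L2 :: "('a, 'b) L2 => ('a, 'b) L2" is "%f x. - f x"
  by (auto intro: L2_fun_uminus elim: eventually_mono)

lift_definition minus_L2 :: "('a, 'b) L2 => ('a, 'b) L2 => ('a, 'b) L2" is "%f g x. f x - g x"
  by (auto intro: L2_fun_diff elim: eventually_elim2)

lift_definition scaleR_L2 :: "real => ('a, 'b) L2 => ('a, 'b) L2" is "%c f x. c *\<^sub>R f x"
  by (auto intro: L2_fun_scaleR elim: eventually_mono)

instance
proof
  fix x y z :: "('a, 'b) L2" and a b :: real
  show "x + y + z = x + (y + z)"
    by transfer (auto simp: add.assoc intro!: L2_fun_add)
  show "x + y = y + x"
    by transfer (auto simp: add.commute intro!: L2_fun_add)
  show "0 + x = x"
    by transfer auto
  show "- x + x = 0"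
    by transfer (auto simp: L2_fun_zero)
  show "x - y = x + - y"
    by transfer (auto intro!: L2_fun_diff)
  show "a *\<^sub>R (x + y) = a *\<^sub>R x + a *\<^sub>R y"
    by transfer (auto simp: scaleR_add_right intro!: L2_fun_add L2_fun_scaleR)
  show "(a + b) *\<^sub>R x = a *\<^sub>R x + b *\<^sub>R x"
    by transfer (auto simp: scaleR_add_left intro!: L2_fun_add L2_fun_scaleR)
  show "a *\<^sub>R b *\<^sub>R x = (a * b) *\<^sub>R x"
    by transfer (auto intro!: L2_fun_scaleR)
  show "1 *\<^sub>R x = x"
    by transfer auto
qed

end

instantiation L2 :: (euclidean_space, euclidean_space) real_inner
begin

lift_definition inner_L2 :: "('a, 'b) L2 => ('a, 'b) L2 => real" is "%f g. LBINT x. f x \<bullet> g x"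
proof -
  fix f f' g g' :: "'a => 'b"
  assume a: "L2_fun f \<and> L2_fun f' \<and> (AE x in lborel. f x = f' x)"
    and b: "L2_fun g \<and> L2_fun g' \<and> (AE x in lborel. g x = g' x)"
  show "(LBINT x. f x \<bullet> g x) = (LBINT x. f' x \<bullet> g' x)"
  proof (rule integral_cong_AE)
    show "(%x. f x \<bullet> g x) \<in> borel_measurable lborel" "(%x. f' x \<bullet> g' x) \<in> borel_measurable lborel"
      using a b by (auto simp: L2_fun_def)
    show "AE x in lborel. f x \<bullet> g x = f' x \<bullet> g' x"
      using a b by (auto elim: eventually_elim2)
  qed
qed

definition norm_L2 :: "('a, 'b) L2 => real" where "norm_L2 x = sqrt (x \<bullet> x)"
definition dist_L2 :: "('a, 'b) L2 => ('a, 'b) L2 => real" where "dist_L2 x y = norm (x - y)"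
definition sgn_L2 :: "('a, 'b) L2 => ('a, 'b) L2" where "sgn_L2 x = x /\<^sub>R norm x"
definition uniformity_L2 :: "(('a, 'b) L2 \<times> ('a, 'b) L2) filter" where
  "uniformity_L2 = (INF e\<in>{0<..}. principal {(x, y). dist x y < e})"
definition open_L2 :: "('a, 'b) L2 set => bool" where
  "open_L2 U \<longleftrightarrow> (\<forall>x\<in>U. \<forall>\<^sub>F (x', y) in uniformity. x' = x --> y \<in> U)"

instance
proof
  fix x y z :: "('a, 'b) L2" and r :: real and U :: "('a, 'b) L2 set"
  show "dist x y = norm (x - y)" by (rule dist_L2_def)
  show "sgn x = x /\<^sub>R norm x" by (rule sgn_L2_def)
  show "uniformity = (INF e\<in>{0<..}. principal {(x, y::('a, 'b) L2). dist x y < e})"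
    by (rule uniformity_L2_def)
  show "open U \<longleftrightarrow> (\<forall>x\<in>U. \<forall>\<^sub>F (x', y) in uniformity. x' = x --> y \<in> U)" by (rule open_L2_def)
  show "x \<bullet> y = y \<bullet> x" by transfer (simp add: inner_commute)
  show "(x + y) \<bullet> z = x \<bullet> z + y \<bullet> z"
    by transfer (simp add: inner_add_left L2_fun_inner)
  show "r *\<^sub>R x \<bullet> y = r * (x \<bullet> y)"
    by transfer (simp add: L2_fun_inner)
  show "0 <= x \<bullet> x" by transfer simp
  show "x \<bullet> x = 0 \<longleftrightarrow> x = 0"
  proof transfer
    fix f :: "'a => 'b"
    assume f: "L2_fun f \<and> L2_fun f \<and> (AE x in lborel. f x = f x)"
    have "(LBINT x. f x \<bullet> f x) = 0 \<longleftrightarrow> (AE x in lborel. f x \<bullet> f x = 0)"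
      using f L2_fun_inner[of f f] by (intro integral_nonneg_eq_0_iff_AE) auto
    then show "(LBINT x. f x \<bullet> f x) = 0 \<longleftrightarrow>
      L2_fun f \<and> L2_fun (%x. 0::'b) \<and> (AE x in lborel. f x = 0)"
      using f by (simp add: L2_fun_zero)
  qed
  show "norm x = sqrt (x \<bullet> x)" by (rule norm_L2_def)
qed

end

lemma cls_add: "L2_fun f ==> L2_fun g ==> cls f + cls g = cls (%x. f x + g x)"
  by (simp add: plus_L2.abs_eq)

lemma cls_diff: "L2_fun f ==> L2_fun g ==> cls f - cls g = cls (%x. f x - g x)"
  by (simp add: minus_L2.abs_eq)

lemma cls_scaleR: "L2_fun f ==> c *\<^sub>R cls f = cls (%x. c *\<^sub>R f x)"
  by (simp add: scaleR_L2.abs_eq)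

lemma cls_zero: "0 = cls (%x. 0)"
  by (simp add: zero_L2_def)

lemma inner_cls: "L2_fun f ==> L2_fun g ==> cls f \<bullet> cls g = (LBINT x. f x \<bullet> g x)"
  by (simp add: inner_L2.abs_eq)

lemma norm_cls: "L2_fun f ==> (norm (cls f))\<^sup>2 = (LBINT x. (norm (f x))\<^sup>2)"
  by (simp add: power2_norm_eq_inner inner_cls)

lemma norm_cls_diff:
  "L2_fun f ==> L2_fun g ==>
    (norm (cls f - cls g))\<^sup>2 = (LBINT x. (norm (f x - g x))\<^sup>2)"
  by (simp add: cls_diff norm_cls L2_fun_diff)

lemma rep_L2_scaleR: "AE x in lborel. rep_L2 (c *\<^sub>R z) x = c *\<^sub>R rep_L2 z x"
  using rep_L2_cls[OF L2_fun_scaleR[OF L2_fun_rep_L2[of z]], of c]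
    cls_scaleR[OF L2_fun_rep_L2[of z], of c] by simp

lemma rep_L2_diff: "AE x in lborel. rep_L2 (z - w) x = rep_L2 z x - rep_L2 w x"
  using rep_L2_cls[OF L2_fun_diff[OF L2_fun_rep_L2[of z] L2_fun_rep_L2[of w]]]
    cls_diff[OF L2_fun_rep_L2[of z] L2_fun_rep_L2[of w]] by simp

lemma inner_L2_eq: "z \<bullet> w = (LBINT x. rep_L2 z x \<bullet> rep_L2 w x)"
  using inner_cls[of "rep_L2 z" "rep_L2 w"] by simp

text \<open>The bound telescopes: \<open>2 * H * (1/2) ^ n\<close> minus
  \<open>2 * H * (1/2) ^ Suc n\<close> is exactly the increment allowed at \<open>n\<close>.\<close>

lemma geometric_increments_converge:
  fixes f :: "nat => 'b::banach"
  assumes "\<And>n. norm (f (Suc n) - f n) <= H * (1/2) ^ n"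
  shows "f \<longlonglongrightarrow> lim f" "norm (f n - lim f) <= 2 * H * (1/2) ^ n"
proof -
  have H: "0 <= H" using order_trans[OF norm_ge_zero assms[of 0]] by simp
  have *: "norm (f (n + k) - f n) <= 2 * H * ((1/2) ^ n - (1/2) ^ (n + k))" for n k
  proof (induction k)
    case (Suc k)
    have "norm (f (n + Suc k) - f n) <= norm (f (Suc (n + k)) - f (n + k)) + norm (f (n + k) - f n)"
      using norm_triangle_ineq[of "f (Suc (n + k)) - f (n + k)" "f (n + k) - f n"] by simp
    also have "\<dots> <= H * (1/2) ^ (n + k) + 2 * H * ((1/2) ^ n - (1/2) ^ (n + k))"
      using assms Suc by (intro add_mono) auto
    also have "\<dots> = 2 * H * ((1/2) ^ n - (1/2) ^ (n + Suc k))" by (simp add: algebra_simps)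
    finally show ?case .
  qed simp
  have **: "norm (f (n + k) - f n) <= 2 * H * (1/2) ^ n" for n k
    using *[of n k] H mult_left_mono[of "(1/2) ^ n - (1/2::real) ^ (n + k)" "(1/2) ^ n" "2 * H"] by simp
  have "(%n. 2 * H * (1/2) ^ n) \<longlonglongrightarrow> 2 * H * 0"
    by (intro tendsto_intros) (auto intro: LIMSEQ_power_zero)
  then have z: "(%n. 2 * H * (1/2) ^ n) \<longlonglongrightarrow> 0" by simp
  have "Cauchy f"
  proof (rule CauchyI')
    fix e :: real assume "0 < e"
    with z obtain M where M: "\<And>n. n \<ge> M ==> norm (2 * H * (1/2) ^ n - 0) < e"
      unfolding LIMSEQ_iff by blast
    show "\<exists>M. \<forall>m\<ge>M. \<forall>n>m. dist (f m) (f n) < e"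
    proof (intro exI[of _ M] allI impI)
      fix m n assume "m \<ge> M" "n > m"
      then show "dist (f m) (f n) < e"
        unfolding dist_norm
        using **[of m "n - m"] M[of m] by (simp add: norm_minus_commute)
    qed
  qed
  then show l: "f \<longlonglongrightarrow> lim f" using Cauchy_convergent convergent_LIMSEQ_iff by blast
  have "(%k. norm (f (k + n) - f n)) \<longlonglongrightarrow> norm (lim f - f n)"
    by (intro tendsto_intros LIMSEQ_ignore_initial_segment l)
  then have "norm (lim f - f n) <= 2 * H * (1/2) ^ n"
    by (rule LIMSEQ_le_const2) (use **[of n] in \<open>auto simp: add.commute\<close>)
  then show "norm (f n - lim f) <= 2 * H * (1/2) ^ n" by (simp add: norm_minus_commute)
qed

text \<open>The limit is the pointwise one, so it can be taken jointly in a parameter.\<close>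

lemma fast_L2_convergence:
  fixes f :: "nat => 'a::euclidean_space => 'b::euclidean_space"
  assumes f: "\<And>n. L2_fun (f n)"
    and fast: "\<And>n. (norm (cls (f (Suc n)) - cls (f n)))\<^sup>2 <= (1/16) ^ n"
  shows "L2_fun (%x. lim (%n. f n x))" (is "L2_fun ?g")
    and "(%n. cls (f n)) \<longlonglongrightarrow> cls (%x. lim (%n. f n x))"
    and "AE x in lborel. (%n. f n x) \<longlonglongrightarrow> lim (%n. f n x)"
proof -
  define d where "d n x = (norm (f (Suc n) x - f n x))\<^sup>2" for n x
  have [measurable]: "f n \<in> borel_measurable borel" for n
    using f[of n] by (simp add: L2_fun_def)
  have [measurable]: "?g \<in> borel_measurable borel" "d n \<in> borel_measurable borel" for n
    unfolding d_def by measurable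
  have dnn: "0 <= d n x" for n x by (simp add: d_def)
  have dint: "integrable lborel (d n)" for n
    using L2_fun_diff[OF f f, of "Suc n" n] unfolding d_def L2_fun_def by simp
  have dI: "(LBINT x. d n x) <= (1/16) ^ n" for n
    using fast[of n] unfolding norm_cls_diff[OF f f] by (subst Bochner_Integration.integral_cong[OF refl d_def])
  have "(\<integral>\<^sup>+x. (\<Sum>n. ennreal (4 ^ n * d n x)) \<partial>lborel) = (\<Sum>n. \<integral>\<^sup>+x. ennreal (4 ^ n * d n x) \<partial>lborel)"
    by (rule nn_integral_suminf) measurable
  also have "\<dots> = (\<Sum>n. ennreal (4 ^ n * (LBINT x. d n x)))"
    by (intro suminf_cong, subst nn_integral_eq_integral) (auto simp: dnn dint)
  also have "\<dots> <= (\<Sum>n. ennreal ((1/4) ^ n))"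
  proof (intro suminf_le ennreal_leI)
    fix n
    have "4 ^ n * (LBINT x. d n x) <= 4 ^ n * (1/16) ^ n"
      using dI[of n] by (intro mult_left_mono) auto
    also have "\<dots> = (1/4) ^ n" by (simp flip: power_mult_distrib)
    finally show "4 ^ n * (LBINT x. d n x) <= (1/4) ^ n" .
  qed auto
  also have "\<dots> = ennreal (\<Sum>n. (1/4) ^ n)"
    by (intro suminf_ennreal2) (auto intro: summable_geometric)
  also have "\<dots> < \<infinity>" by simp
  finally have fin: "(\<integral>\<^sup>+x. (\<Sum>n. ennreal (4 ^ n * d n x)) \<partial>lborel) < \<infinity>" .
  \<comment> \<open>The weight \<open>4 ^ n\<close> against increments of order
    \<open>(1/16) ^ n\<close> keeps the integral of \<open>h\<close> finite; where \<open>h\<close>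
    is finite, the increments are at most \<open>sqrt (h x)\<close> times \<open>(1/2) ^ n\<close>.
    The same square root then dominates the distance to the limit in L^2.\<close>
  define h where "h x = (\<Sum>n. ennreal (4 ^ n * d n x))" for x
  have [measurable]: "h \<in> borel_measurable borel" unfolding h_def by measurable
  have hfin: "AE x in lborel. h x \<noteq> \<infinity>"
    using nn_integral_PInf_AE[of h lborel] fin[folded h_def] by auto
  define H where "H x = sqrt (enn2real (h x))" for x
  have [measurable]: "H \<in> borel_measurable borel" unfolding H_def by measurable
  have H2: "integrable lborel (%x. (norm (H x))\<^sup>2)"
  proof (rule integrableI_nonneg)
    have "(\<integral>\<^sup>+x. ennreal ((norm (H x))\<^sup>2) \<partial>lborel) <= (\<integral>\<^sup>+x. h x \<partial>lborel)"
      unfolding H_def by (intro nn_integral_mono) (auto simp: ennreal_enn2real_if)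
    then show "(\<integral>\<^sup>+x. ennreal ((norm (H x))\<^sup>2) \<partial>lborel) < \<infinity>"
      using fin unfolding h_def by (rule le_less_trans)
  qed auto
  then have Hsq: "L2_fun H" by (simp add: L2_fun_def)
  have step: "norm (f (Suc n) x - f n x) <= H x * (1/2) ^ n" if "h x \<noteq> \<infinity>" for n x
  proof -
    have "(\<Sum>k\<in>{n}. ennreal (4 ^ k * d k x)) <= h x"
      unfolding h_def by (rule sum_le_suminf) auto
    then have "ennreal (4 ^ n * d n x) <= h x" by simp
    then have "4 ^ n * d n x <= enn2real (h x)"
      using that by (cases "h x") (auto simp: d_def)
    also have "\<dots> = (H x)\<^sup>2" by (simp add: H_def)
    finally have "(2 ^ n * norm (f (Suc n) x - f n x))\<^sup>2 <= (H x)\<^sup>2"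
      by (simp add: d_def power_mult_distrib) (simp add: power2_eq_square flip: power_mult_distrib)
    then have "2 ^ n * norm (f (Suc n) x - f n x) <= H x"
      by (rule power2_le_imp_le) (simp add: H_def)
    then show ?thesis by (simp add: field_simps)
  qed
  have AE: "AE x in lborel. \<forall>n. (f n x - ?g x) = f n x - ?g x \<and> norm (f n x - ?g x) <= 2 * H x * (1/2) ^ n"
    using hfin by eventually_elim (auto intro!: geometric_increments_converge(2) step)
  show "AE x in lborel. (%n. f n x) \<longlonglongrightarrow> ?g x"
    using hfin by eventually_elim (auto intro!: geometric_increments_converge(1) step)
  have fg: "L2_fun (%x. f n x - ?g x)" for n
    by (rule L2_fun_bound[OF L2_fun_scaleR[OF Hsq, of "2 * (1/2) ^ n"]])
      (measurable, use AE in eventually_elim, auto simp: H_def mult_ac)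
  then show g: "L2_fun ?g"
    using L2_fun_diff[OF f fg, of 0 0] by (simp add: diff_diff_eq2)
  have "(norm (cls (f n) - cls ?g))\<^sup>2 <= (4 * (norm (cls H))\<^sup>2) * (1/4) ^ n" for n
  proof -
    have "(norm (cls (f n) - cls ?g))\<^sup>2 = (LBINT x. (norm (f n x - ?g x))\<^sup>2)"
      by (rule norm_cls_diff[OF f g])
    also have "\<dots> <= (LBINT x. (4 * (1/4) ^ n) * (norm (H x))\<^sup>2)"
    proof (rule integral_mono_AE)
      show "integrable lborel (%x. (norm (f n x - ?g x))\<^sup>2)"
        using fg by (simp add: L2_fun_def)
      show "integrable lborel (%x. (4 * (1/4) ^ n) * (norm (H x))\<^sup>2)" using H2 by simp
      show "AE x in lborel. (norm (f n x - ?g x))\<^sup>2 <= (4 * (1/4) ^ n) * (norm (H x))\<^sup>2"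
        using AE
      proof eventually_elim
        case (elim x)
        then have "(norm (f n x - ?g x))\<^sup>2 <= (2 * H x * (1/2) ^ n)\<^sup>2" by (intro power_mono) auto
        also have "\<dots> = 4 * ((1/2) ^ n)\<^sup>2 * (H x)\<^sup>2" by (simp add: power_mult_distrib)
        also have "((1/2::real) ^ n)\<^sup>2 = (1/4) ^ n"
          by (simp add: power2_eq_square flip: power_mult_distrib)
        finally show ?case by simp
      qed
    qed
    also have "\<dots> = (4 * (norm (cls H))\<^sup>2) * (1/4) ^ n"
      using norm_cls[OF Hsq] by simp
    finally show ?thesis .
  qed
  moreover have "(%n. (4 * (norm (cls H))\<^sup>2) * (1/4) ^ n) \<longlonglongrightarrow> (4 * (norm (cls H))\<^sup>2) * 0"
    by (intro tendsto_intros) (auto intro: LIMSEQ_power_zero)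
  ultimately have "(%n. (norm (cls (f n) - cls ?g))\<^sup>2) \<longlonglongrightarrow> 0"
    by (intro tendsto_sandwich[of "%_. 0" "%n. (norm (cls (f n) - cls ?g))\<^sup>2" sequentially]) auto
  then have "(%n. sqrt ((norm (cls (f n) - cls ?g))\<^sup>2)) \<longlonglongrightarrow> sqrt 0"
    by (rule tendsto_real_sqrt)
  then have "(%n. cls (f n) - cls ?g) \<longlonglongrightarrow> 0"
    by (simp add: tendsto_norm_zero_iff)
  then show "(%n. cls (f n)) \<longlonglongrightarrow> cls ?g"
    by (rule LIM_zero_cancel)
qed

lemma Cauchy_fast_subseq:
  fixes X :: "nat => 'a::real_normed_vector"
  assumes "Cauchy X" and pos: "\<And>n. 0 < \<epsilon> n"
  obtains r :: "nat => nat" where "strict_mono r" "\<And>n. norm (X (r (Suc n)) - X (r n)) < \<epsilon> n"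
proof -
  have "\<forall>n. \<exists>M. \<forall>m\<ge>M. \<forall>k\<ge>M. norm (X m - X k) < \<epsilon> n"
    using assms unfolding Cauchy_iff by blast
  then obtain M where M: "\<And>n m k. m \<ge> M n ==> k \<ge> M n ==> norm (X m - X k) < \<epsilon> n" by metis
  define r where "r n = n + (\<Sum>i\<le>n. M i)" for n
  have "strict_mono r" unfolding r_def strict_mono_Suc_iff by simp
  moreover have "M n <= (\<Sum>i\<le>n. M i)" for n
    by (rule member_le_sum) auto
  then have "M n <= r n" for n by (simp add: r_def trans_le_add2)
  then have "norm (X (r (Suc n)) - X (r n)) < \<epsilon> n" for n
    using M[of n "r (Suc n)" "r n"] strict_monoD[OF \<open>strict_mono r\<close>, of n "Suc n"]
    by (meson le_trans less_imp_le lessI)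
  ultimately show thesis by (rule that)
qed

instance L2 :: (euclidean_space, euclidean_space) complete_space
proof
  fix X :: "nat => ('a, 'b) L2"
  assume X: "Cauchy X"
  then obtain r where r: "strict_mono r" "\<And>n. norm (X (r (Suc n)) - X (r n)) < (1/4) ^ n"
    using Cauchy_fast_subseq[of X "%n. (1/4) ^ n"] by auto
  have "(norm (cls (rep_L2 (X (r (Suc n)))) - cls (rep_L2 (X (r n)))))\<^sup>2 <= (1/16) ^ n" for n
  proof -
    have "(norm (X (r (Suc n)) - X (r n)))\<^sup>2 <= ((1/4) ^ n)\<^sup>2"
      using r(2)[of n] by (intro power_mono) auto
    also have "\<dots> = (1/16) ^ n" by (simp add: power2_eq_square flip: power_mult_distrib)
    finally show ?thesis by simp
  qed
  then have "(%n. cls (rep_L2 (X (r n)))) \<longlonglongrightarrow> cls (%x. lim (%n. rep_L2 (X (r n)) x))"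
    by (intro fast_L2_convergence(2)) auto
  then have "(X \<circ> r) \<longlonglongrightarrow> cls (%x. lim (%n. rep_L2 (X (r n)) x))"
    by (simp add: comp_def)
  with X r(1) have "\<exists>l. X \<longlonglongrightarrow> l"
    using Cauchy_converges_subseq by blast
  then show "convergent X" by (simp add: convergent_def)
qed

instance L2 :: (euclidean_space, euclidean_space) banach ..

subsection \<open>A spectral theorem for compactly embedded form domains\<close>

text \<open>At \<open>t = - b / D\<close> the linear term contributes
  \<open>- 2 * b\<^sup>2 / D\<close> and the quadratic one at most \<open>b\<^sup>2 / D\<close>, so
  the sum is negative unless \<open>b = 0\<close>. The summand 1 in \<open>D\<close> keeps the
  denominator positive when \<open>c = 0\<close>.\<close>

lemma nonneg_quadratic_zero_linear:
  fixes b c :: real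
  assumes "\<And>t. 0 <= 2 * t * b + t\<^sup>2 * c"
  shows "b = 0"
proof (rule ccontr)
  assume b: "b \<noteq> 0"
  define D where "D = \<bar>c\<bar> + 1"
  have D: "0 < D" by (simp add: D_def)
  define t where "t = - b / D"
  have "t\<^sup>2 * c <= t\<^sup>2 * D"
    by (intro mult_left_mono) (auto simp: D_def)
  moreover have "t\<^sup>2 * D = b\<^sup>2 / D" "t * b = - (b\<^sup>2 / D)"
    using D by (auto simp: t_def power2_eq_square field_simps)
  moreover have "0 < b\<^sup>2 / D" using b D by simp
  ultimately show False using assms[of t] by linarith
qed

text \<open>
  The Rayleigh quotient \<open>|fst z|^2 / |z|^2\<close> attains its supremum: by the parallelogram law a
  maximising sequence with convergent first components is Cauchy. The zero vector is taken when the
  supremum vanishes.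
\<close>

lemma rayleigh_maximiser:
  fixes V :: "('h::{real_inner,complete_space} \<times> 'w::{real_inner,complete_space}) set"
  assumes V: "subspace V" "closed V"
    and cpt: "\<And>z. (\<And>n::nat. z n \<in> V \<and> norm (z n) <= 1) ==>
      \<exists>r. strict_mono (r::nat => nat) \<and> convergent (%n. fst (z (r n)))"
  obtains z \<mu> where "z \<in> V" "0 <= \<mu>" "\<mu> <= 1" "\<mu> = 0 ==> z = 0" "\<mu> \<noteq> 0 ==> norm z = 1"
    "\<And>w. w \<in> V ==> (norm (fst w))\<^sup>2 <= \<mu> * (norm w)\<^sup>2"
    "\<And>w. w \<in> V ==> fst w \<bullet> fst z = \<mu> * (w \<bullet> z)"
proof -
  define S where "S = {(norm (fst w))\<^sup>2 |w. w \<in> V \<and> norm w <= 1}"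
  define \<mu> where "\<mu> = Sup S"
  have "0 \<in> V" using V by (simp add: subspace_0)
  have fst_le: "norm (fst w) <= norm w" for w :: "'h \<times> 'w"
    by (cases w) (simp add: norm_Pair real_le_rsqrt)
  have S0: "0 \<in> S" unfolding S_def using \<open>0 \<in> V\<close> by (intro CollectI exI[of _ 0]) auto
  have S1: "s <= 1" if "s \<in> S" for s
  proof -
    from that obtain w where "w \<in> V" "s = (norm (fst w))\<^sup>2" "norm w <= 1" unfolding S_def by blast
    then show ?thesis using fst_le[of w] by (simp add: power_le_one)
  qed
  have bdd: "bdd_above S" using S1 by (intro bdd_aboveI[of S 1])
  have \<mu>0: "0 <= \<mu>" unfolding \<mu>_def using S0 bdd by (rule cSup_upper)
  have \<mu>1: "\<mu> <= 1" unfolding \<mu>_def using S0 S1 by (intro cSup_least) auto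
  have ray: "(norm (fst w))\<^sup>2 <= \<mu> * (norm w)\<^sup>2" if "w \<in> V" for w
  proof (cases "w = 0")
    case False
    have "inverse (norm w) *\<^sub>R w \<in> V" using V that by (simp add: subspace_scale)
    then have "(norm (fst (inverse (norm w) *\<^sub>R w)))\<^sup>2 \<in> S"
      unfolding S_def using False by (intro CollectI exI[of _ "inverse (norm w) *\<^sub>R w"]) auto
    then have "(norm (fst (inverse (norm w) *\<^sub>R w)))\<^sup>2 <= \<mu>"
      unfolding \<mu>_def using bdd by (rule cSup_upper)
    then show ?thesis using False by (simp add: power_mult_distrib power_inverse field_simps)
  qed auto
  show thesis
  proof (cases "\<mu> = 0")
    case True
    show thesis
      by (rule that[of 0 \<mu>]) (use True \<open>0 \<in> V\<close> ray in auto)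
  next
    case False
    then have pos: "0 < \<mu>" using \<mu>0 by simp
    have "\<exists>w. w \<in> V \<and> norm w <= 1 \<and> \<mu> - inverse (real (Suc n)) < (norm (fst w))\<^sup>2" for n
    proof -
      have "\<mu> - inverse (real (Suc n)) < Sup S" unfolding \<mu>_def by simp
      then obtain s where "s \<in> S" "\<mu> - inverse (real (Suc n)) < s"
        using less_cSup_iff[of S] S0 bdd by blast
      then show ?thesis unfolding S_def by blast
    qed
    then obtain w where w: "\<And>n. w n \<in> V" "\<And>n. norm (w n) <= 1"
      "\<And>n. \<mu> - inverse (real (Suc n)) < (norm (fst (w n)))\<^sup>2" by metis
    from cpt[of w] w obtain r l where r: "strict_mono (r::nat => nat)"
      and l: "(%n. fst (w (r n))) \<longlonglongrightarrow> l" unfolding convergent_def by blast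
    define y where "y n = w (r n)" for n
    have y: "y n \<in> V" "norm (y n) <= 1" for n using w by (auto simp: y_def)
    have lim1: "(%n. (norm (fst (y n)))\<^sup>2) \<longlonglongrightarrow> \<mu>"
    proof (rule tendsto_sandwich[of "%n. \<mu> - inverse (real (Suc n))" _ _ "%_. \<mu>"])
      show "\<forall>\<^sub>F n in sequentially. \<mu> - inverse (real (Suc n)) <= (norm (fst (y n)))\<^sup>2"
      proof (intro always_eventually allI)
        fix n
        have "inverse (real (Suc (r n))) <= inverse (real (Suc n))"
          using seq_suble[OF r, of n] by (intro le_imp_inverse_le) auto
        then show "\<mu> - inverse (real (Suc n)) <= (norm (fst (y n)))\<^sup>2"
          using w(3)[of "r n"] unfolding y_def by linarith
      qed
      have "(norm (fst (y n)))\<^sup>2 <= \<mu>" for n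
        unfolding \<mu>_def
      proof (rule cSup_upper[OF _ bdd])
        show "(norm (fst (y n)))\<^sup>2 \<in> S"
          unfolding S_def by (rule CollectI, rule exI[of _ "y n"]) (simp add: y)
      qed
      then show "\<forall>\<^sub>F n in sequentially. (norm (fst (y n)))\<^sup>2 <= \<mu>" by auto
      show "(%n. \<mu> - inverse (real (Suc n))) \<longlonglongrightarrow> \<mu>"
        using tendsto_diff[OF tendsto_const[of \<mu>] LIMSEQ_inverse_real_of_nat] by simp
    qed auto
    have "(%n. (norm (fst (y n)))\<^sup>2) \<longlonglongrightarrow> (norm l)\<^sup>2"
      using l unfolding y_def by (intro tendsto_intros)
    then have l\<mu>: "(norm l)\<^sup>2 = \<mu>" using lim1 LIMSEQ_unique by blast
    have "Cauchy y"
    proof (rule CauchyI)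
      fix e :: real assume e: "0 < e"
      \<comment> \<open>The parallelogram law below leaves \<open>5 * \<delta>\<close>: 4 from the
        two squared norms falling short of \<open>\<mu>\<close>, 1 from the distance of the first
        components. Then 5/16 < 1.\<close>
      define \<delta> where "\<delta> = e\<^sup>2 / 16"
      have \<delta>: "0 < \<delta>" using e by (simp add: \<delta>_def)
      have "(%n. (norm (fst (y n) + l))\<^sup>2) \<longlonglongrightarrow> (norm (l + l))\<^sup>2"
        using l unfolding y_def by (intro tendsto_intros)
      have "Cauchy (%n. fst (y n))" using l unfolding y_def by (intro LIMSEQ_imp_Cauchy)
      then obtain N where N: "\<And>m n. m \<ge> N ==> n \<ge> N ==> norm (fst (y m) - fst (y n)) < sqrt (\<mu> * \<delta>)"
        using \<delta> pos by (meson CauchyD mult_pos_pos real_sqrt_gt_0_iff)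
      obtain M where M: "\<And>n. n \<ge> M ==> \<bar>(norm (fst (y n)))\<^sup>2 - \<mu>\<bar> < \<mu> * \<delta>"
        using lim1 \<delta> pos unfolding LIMSEQ_iff by (metis mult_pos_pos real_norm_def)
      show "\<exists>M. \<forall>m\<ge>M. \<forall>n\<ge>M. norm (y m - y n) < e"
      proof (intro exI[of _ "max M N"] allI impI)
        fix m n assume mn: "m \<ge> max M N" "n \<ge> max M N"
        have par: "(norm (a + b))\<^sup>2 + (norm (a - b))\<^sup>2 = 2 * (norm a)\<^sup>2 + 2 * (norm b)\<^sup>2"
          for a b :: "'c::real_inner"
          by (simp add: power2_norm_eq_inner inner_add_left inner_add_right inner_diff_left inner_diff_right inner_commute)
        have "(norm (fst (y m) - fst (y n)))\<^sup>2 <= \<mu> * \<delta>"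
          using N[of m n] mn \<delta> pos power_mono[of "norm (fst (y m) - fst (y n))" "sqrt (\<mu> * \<delta>)" 2] by simp
        then have "4 * \<mu> - 5 * (\<mu> * \<delta>) <= (norm (fst (y m) + fst (y n)))\<^sup>2"
          using par[of "fst (y m)" "fst (y n)"] M[of m] M[of n] mn by simp
        also have "\<dots> <= \<mu> * (norm (y m + y n))\<^sup>2"
          using ray[of "y m + y n"] y V by (simp add: subspace_add)
        finally have "\<mu> * (4 - 5 * \<delta>) <= \<mu> * (norm (y m + y n))\<^sup>2" by (simp add: algebra_simps)
        then have "4 - 5 * \<delta> <= (norm (y m + y n))\<^sup>2" using pos by simp
        moreover have "(norm (y m))\<^sup>2 <= 1" "(norm (y n))\<^sup>2 <= 1" using y by (auto simp: power_le_one)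
        ultimately have "(norm (y m - y n))\<^sup>2 <= 5 * \<delta>"
          using par[of "y m" "y n"] by linarith
        also have "\<dots> < e\<^sup>2" using e by (simp add: \<delta>_def)
        finally show "norm (y m - y n) < e" by (rule power2_less_imp_less) (use e in simp)
      qed
    qed
    then obtain z where z: "y \<longlonglongrightarrow> z" using Cauchy_convergent convergent_def by blast
    have zV: "z \<in> V" using V(2) y(1) z by (meson closed_sequentially)
    have "(%n. fst (y n)) \<longlonglongrightarrow> fst z" using z by (rule tendsto_fst)
    then have "fst z = l" using l unfolding y_def by (rule LIMSEQ_unique)
    then have fz: "(norm (fst z))\<^sup>2 = \<mu>" using l\<mu> by simp
    have nz: "norm z <= 1" using z y(2) by (auto intro: LIMSEQ_le_const2 tendsto_norm)
    have "\<mu> <= \<mu> * (norm z)\<^sup>2" using ray[OF zV] fz by simp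
    then have "1 <= (norm z)\<^sup>2" using pos by simp
    then have "1 <= norm z" using abs_le_square_iff[of 1 "norm z"] by simp
    then have nz1: "norm z = 1" using nz by simp
    show thesis
    proof (rule that[of z \<mu>])
      fix v assume v: "v \<in> V"
      \<comment> \<open>First variation:
        \<open>\<mu> * (norm w)\<^sup>2 - (norm (fst w))\<^sup>2\<close> is nonnegative on
        \<open>V\<close> and vanishes at \<open>z\<close>, so its linear part in every direction
        \<open>v\<close> vanishes.\<close>
      have "0 <= 2 * t * (\<mu> * (v \<bullet> z) - fst v \<bullet> fst z) + t\<^sup>2 * (\<mu> * (norm v)\<^sup>2 - (norm (fst v))\<^sup>2)" for t
      proof -
        have "(norm (fst (z + t *\<^sub>R v)))\<^sup>2 <= \<mu> * (norm (z + t *\<^sub>R v))\<^sup>2"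
          by (rule ray[OF subspace_add[OF V(1) zV subspace_scale[OF V(1) v]]])
        moreover have ex: "(norm (a + t *\<^sub>R b))\<^sup>2 = (norm a)\<^sup>2 + 2 * t * (b \<bullet> a) + t\<^sup>2 * (norm b)\<^sup>2"
          for a b :: "'c::real_inner"
          by (simp only: power2_norm_eq_inner) (simp add: inner_add_left inner_add_right inner_commute power2_eq_square)
        ultimately have "(norm (fst z))\<^sup>2 + 2 * t * (fst v \<bullet> fst z) + t\<^sup>2 * (norm (fst v))\<^sup>2
          <= \<mu> * ((norm z)\<^sup>2 + 2 * t * (v \<bullet> z) + t\<^sup>2 * (norm v)\<^sup>2)"
          by (simp only: ex fst_add fst_scaleR)
        then show ?thesis using fz nz1 by (simp add: algebra_simps)
      qed
      then have "\<mu> * (v \<bullet> z) - fst v \<bullet> fst z = 0" by (rule nonneg_quadratic_zero_linear)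
      then show "fst v \<bullet> fst z = \<mu> * (v \<bullet> z)" by simp
    qed (use zV \<mu>0 \<mu>1 nz1 ray False in auto)
  qed
qed

text \<open>\<open>V\<close> is meant to be the graph of a gradient, so its norm is the form norm.
  Maximising the Rayleigh quotient over the complement of the earlier maximisers diagonalises
  \<open>fst\<close> on \<open>V\<close>: the relation
  \<open>fst w \<bullet> fst z = \<mu> * (w \<bullet> z)\<close> rearranges to the eigenvalue
  equation with \<open>l = 1 / \<mu> - 1\<close>. If \<open>V\<close> is exhausted after finitely
  many steps, the maximiser is 0; this is why \<open>e k\<close> may be 0. The expansion is claimed
  for first components of elements of \<open>V\<close>, since their density is a separate
  matter.\<close>

theorem compact_form_spectral:
  fixes V :: "('h::{real_inner,complete_space} \<times> 'w::{real_inner,complete_space}) set"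
  assumes V: "subspace V" "closed V"
    and cpt: "\<And>z. (\<And>n::nat. z n \<in> V \<and> norm (z n) <= 1) ==>
      \<exists>r. strict_mono (r::nat => nat) \<and> convergent (%n. fst (z (r n)))"
  obtains e g l where
    "\<And>k::nat. (e k, g k) \<in> V" "\<And>k. 0 <= l k"
    "\<And>k v h. (v, h) \<in> V ==> h \<bullet> g k = l k * (v \<bullet> e k)"
    "\<And>j k. j \<noteq> k ==> e j \<bullet> e k = 0"
    "\<And>k. norm (e k) = 0 \<or> norm (e k) = 1"
    "\<And>v h. (v, h) \<in> V ==> (%k. (v \<bullet> e k) *\<^sub>R e k) sums v"
proof -
  define U where "U f n = {w \<in> V. \<forall>j<n. w \<bullet> fst (f j :: ('h \<times> 'w) \<times> real) = 0}" for f and n :: nat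
  define P where "P f n = (%p. fst p \<in> U f n \<and> 0 <= snd p \<and> snd p <= 1 \<and> (snd p = 0 --> fst p = 0) \<and>
    (snd p \<noteq> 0 --> norm (fst p) = 1) \<and>
    (\<forall>w\<in>U f n. (norm (fst w))\<^sup>2 <= snd p * (norm w)\<^sup>2) \<and>
    (\<forall>w\<in>U f n. fst w \<bullet> fst (fst p) = snd p * (w \<bullet> fst p)))" for f n
  have Usub: "subspace (U f n)" for f n
    using V unfolding U_def subspace_def by (auto simp: inner_add_left)
  have Uclosed: "closed (U f n)" for f n
  proof -
    have "U f n = V \<inter> (\<Inter>j\<in>{..<n}. {w. w \<bullet> fst (f j) = 0})" unfolding U_def by auto
    moreover have "closed {w. w \<bullet> fst (f j) = 0}" for j
      by (intro closed_Collect_eq continuous_intros)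
    ultimately show ?thesis using V by (auto intro!: closed_Int closed_INT)
  qed
  have "\<exists>F. \<forall>n. P F n (F n)"
  proof (rule dependent_wellorder_choice)
    fix r and f g :: "nat => ('h \<times> 'w) \<times> real" and n :: nat assume "\<And>y. y < n ==> f y = g y"
    then have "U f n = U g n" by (auto simp: U_def)
    then show "P f n r = P g n r" unfolding P_def by simp
  next
    fix n and f :: "nat => ('h \<times> 'w) \<times> real"
    obtain z \<mu> where z: "z \<in> U f n" "0 <= \<mu>" "\<mu> <= 1" "\<mu> = 0 ==> z = 0" "\<mu> \<noteq> 0 ==> norm z = 1"
      "\<And>w. w \<in> U f n ==> (norm (fst w))\<^sup>2 <= \<mu> * (norm w)\<^sup>2"
      "\<And>w. w \<in> U f n ==> fst w \<bullet> fst z = \<mu> * (w \<bullet> z)"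
    proof (rule rayleigh_maximiser[OF Usub Uclosed, of f n])
      fix y :: "nat => 'h \<times> 'w" assume "\<And>k. y k \<in> U f n \<and> norm (y k) <= 1"
      then show "\<exists>r. strict_mono (r::nat => nat) \<and> convergent (%k. fst (y (r k)))"
        by (intro cpt) (auto simp: U_def)
    qed blast
    then have "P f n (z, \<mu>)" unfolding P_def by auto
    then show "\<exists>r. P f n r" ..
  qed
  then obtain F where F: "\<And>n. P F n (F n)" by blast
  define z where "z n = fst (F n)" for n
  define \<mu> where "\<mu> n = snd (F n)" for n
  define W where "W n = U F n" for n
  have Wdef: "W n = {w \<in> V. \<forall>j<n. w \<bullet> z j = 0}" for n unfolding W_def U_def z_def ..
  have zW: "z n \<in> W n" and \<mu>: "0 <= \<mu> n" "\<mu> n <= 1" and \<mu>0: "\<mu> n = 0 ==> z n = 0" and \<mu>1: "\<mu> n \<noteq> 0 ==> norm (z n) = 1"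
    and ray: "\<And>w. w \<in> W n ==> (norm (fst w))\<^sup>2 <= \<mu> n * (norm w)\<^sup>2"
    and el: "\<And>w. w \<in> W n ==> fst w \<bullet> fst (z n) = \<mu> n * (w \<bullet> z n)" for n
    using F[of n] unfolding P_def z_def \<mu>_def W_def by auto
  have zV: "z n \<in> V" for n using zW by (auto simp: Wdef)
  have orth_less: "z k \<bullet> z j = 0" if "j < k" for j k using zW[of k] that by (auto simp: Wdef)
  have orth: "z j \<bullet> z k = 0" if "j \<noteq> k" for j k
    using orth_less[of j k] orth_less[of k j] that by (cases "j < k") (auto simp: inner_commute)
  have zz: "z n \<bullet> z n = (if \<mu> n = 0 then 0 else 1)" for n
    using \<mu>0[of n] \<mu>1[of n] by (auto simp: norm_eq_1)
  define Q where "Q n w = w - (\<Sum>j<n. (w \<bullet> z j) *\<^sub>R z j)" for n w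
  have zproj: "(w \<bullet> z j) * (z j \<bullet> z j) = w \<bullet> z j" for w j
    using zz[of j] \<mu>0[of j] by auto
  have QW: "Q n w \<in> W n" if "w \<in> V" for n w
  proof -
    have "Q n w \<in> V" unfolding Q_def using V that zV
      by (intro subspace_diff subspace_sum subspace_scale) auto
    moreover have "Q n w \<bullet> z i = 0" if "i < n" for i
    proof -
      have "(\<Sum>j<n. (w \<bullet> z j) *\<^sub>R z j) \<bullet> z i = (\<Sum>j<n. if j = i then w \<bullet> z i else 0)"
        unfolding inner_sum_left using orth zproj by (intro sum.cong) auto
      then show ?thesis using that by (simp add: Q_def inner_diff_left)
    qed
    ultimately show ?thesis unfolding Wdef by auto
  qed
  have fst_orth: "fst (z j) \<bullet> fst (z k) = 0" if "j < k" for j k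
  proof -
    have "z k \<in> W j" using zW[of k] that by (auto simp: Wdef)
    then show ?thesis using el[of "z k" j] orth[of k j] that by (simp add: inner_commute)
  qed
  have el': "fst w \<bullet> fst (z n) = \<mu> n * (w \<bullet> z n)" if "w \<in> V" for w n
  proof -
    have "fst (Q n w) \<bullet> fst (z n) = \<mu> n * (Q n w \<bullet> z n)" by (rule el[OF QW[OF that]])
    moreover have "fst (Q n w) \<bullet> fst (z n) = fst w \<bullet> fst (z n)"
      unfolding Q_def by (simp add: inner_diff_left fst_sum inner_sum_left fst_orth)
    moreover have "Q n w \<bullet> z n = w \<bullet> z n"
      unfolding Q_def by (simp add: inner_diff_left inner_sum_left orth)
    ultimately show ?thesis by simp
  qed
  have fzz: "(norm (fst (z n)))\<^sup>2 = \<mu> n" for n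
    using el'[OF zV, of n n] zz[of n] by (simp add: power2_norm_eq_inner split: if_splits)
  have \<mu>dec: "\<mu> n <= \<mu> m" if "m <= n" for m n
  proof -
    have "z n \<in> W m" using zW[of n] that by (auto simp: Wdef)
    then have "\<mu> n <= \<mu> m * (norm (z n))\<^sup>2" using ray[of "z n" m] fzz by simp
    also have "\<dots> <= \<mu> m"
      using \<mu>[of m] zz[of n] by (auto simp: power2_norm_eq_inner)
    finally show ?thesis .
  qed
  \<comment> \<open>Otherwise the \<open>fst (z n)\<close> are orthogonal with squared norms at
    least \<open>d\<close>, and no subsequence of them is Cauchy.\<close>
  have \<mu>lim: "\<mu> \<longlonglongrightarrow> 0"
  proof (rule ccontr)
    assume "\<not> \<mu> \<longlonglongrightarrow> 0"
    then obtain d where d: "0 < d" and "\<forall>N. \<exists>n\<ge>N. \<not> \<bar>\<mu> n\<bar> < d"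
      unfolding LIMSEQ_iff by auto
    then have big: "d <= \<mu> n" for n
      by (smt (verit) \<mu>(1) \<mu>dec)
    have "norm (z n) <= 1" for n using \<mu>0[of n] \<mu>1[of n] by (cases "\<mu> n = 0") auto
    then obtain r where r: "strict_mono (r::nat => nat)" "convergent (%n. fst (z (r n)))"
      using cpt[of z] zV by blast
    then have "Cauchy (%n. fst (z (r n)))" by (simp add: convergent_Cauchy)
    then obtain N where N: "\<And>m n. m \<ge> N ==> n \<ge> N ==> norm (fst (z (r m)) - fst (z (r n))) < sqrt d"
      using d by (meson CauchyD real_sqrt_gt_0_iff)
    have "r N < r (Suc N)" using r(1) by (simp add: strict_monoD)
    then have "(norm (fst (z (r N)) - fst (z (r (Suc N)))))\<^sup>2 = \<mu> (r N) + \<mu> (r (Suc N))"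
      using fst_orth[of "r N" "r (Suc N)"]
      by (simp add: power2_norm_eq_inner inner_diff_left inner_diff_right inner_commute flip: fzz)
    moreover have "(norm (fst (z (r N)) - fst (z (r (Suc N)))))\<^sup>2 < d"
      using N[of N "Suc N"] d power_strict_mono[of "norm (fst (z (r N)) - fst (z (r (Suc N))))" "sqrt d" 2] by simp
    ultimately show False using big[of "r N"] big[of "r (Suc N)"] d by simp
  qed
  define c where "c n = inverse (sqrt (\<mu> n))" for n
  define e where "e n = c n *\<^sub>R fst (z n)" for n
  define g where "g n = c n *\<^sub>R snd (z n)" for n
  define l where "l n = (if \<mu> n = 0 then 0 else inverse (\<mu> n) - 1)" for n
  have c2: "c n * c n = inverse (\<mu> n)" for n
    unfolding c_def using \<mu>(1)[of n] by (simp flip: inverse_mult_distrib)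
  show thesis
  proof (rule that[of e g l])
    show "(e k, g k) \<in> V" for k
    proof -
      have "(e k, g k) = c k *\<^sub>R z k" by (simp add: e_def g_def prod_eq_iff)
      then show ?thesis using subspace_scale[OF V(1) zV] by simp
    qed
    show "0 <= l k" for k using \<mu>[of k] by (auto simp: l_def one_le_inverse_iff)
    show "h \<bullet> g k = l k * (v \<bullet> e k)" if vh: "(v, h) \<in> V" for v h k
    proof (cases "\<mu> k = 0")
      case True
      then show ?thesis using \<mu>0[of k] by (simp add: e_def g_def)
    next
      case False
      have "v \<bullet> fst (z k) = \<mu> k * (v \<bullet> fst (z k) + h \<bullet> snd (z k))"
        using el'[OF vh, of k] by (simp add: inner_prod_def)
      then have "h \<bullet> snd (z k) = (inverse (\<mu> k) - 1) * (v \<bullet> fst (z k))"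
        using False by (simp add: field_simps)
      then show ?thesis using False by (simp add: e_def g_def l_def)
    qed
    show "e j \<bullet> e k = 0" if "j \<noteq> k" for j k
      using fst_orth[of j k] fst_orth[of k j] that by (cases "j < k") (auto simp: e_def inner_commute)
    show "norm (e k) = 0 \<or> norm (e k) = 1" for k
    proof (cases "\<mu> k = 0")
      case True
      then show ?thesis using \<mu>0[of k] by (simp add: e_def)
    next
      case False
      have "norm (fst (z k)) = sqrt (\<mu> k)" using fzz[of k] by (metis norm_ge_zero real_sqrt_abs2 real_sqrt_unique)
      then show ?thesis using False \<mu>(1)[of k] by (simp add: e_def c_def)
    qed
    show "(%k. (v \<bullet> e k) *\<^sub>R e k) sums v" if vh: "(v, h) \<in> V" for v h
    proof -
      let ?w = "(v, h)"
      have term_eq: "(v \<bullet> e k) *\<^sub>R e k = (?w \<bullet> z k) *\<^sub>R fst (z k)" for k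
      proof (cases "\<mu> k = 0")
        case True
        then show ?thesis using \<mu>0[of k] by (simp add: e_def)
      next
        case False
        have "(v \<bullet> e k) *\<^sub>R e k = (c k * c k * (v \<bullet> fst (z k))) *\<^sub>R fst (z k)" by (simp add: e_def mult_ac)
        also have "v \<bullet> fst (z k) = \<mu> k * (?w \<bullet> z k)" using el'[OF vh, of k] by simp
        finally show ?thesis using False unfolding c2 by simp
      qed
      have part: "v - (\<Sum>k<n. (v \<bullet> e k) *\<^sub>R e k) = fst (Q n ?w)" for n
        unfolding term_eq Q_def by (simp add: fst_sum)
      \<comment> \<open>The remainder of the expansion lies in \<open>W n\<close>, where the
        Rayleigh quotient is at most \<open>\<mu> n\<close>, and this tends to 0.\<close>
      have "(norm (fst (Q n ?w)))\<^sup>2 <= \<mu> n * (norm ?w)\<^sup>2" for n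
      proof -
        have "(norm ?w)\<^sup>2 = (norm (Q n ?w))\<^sup>2 + (norm (\<Sum>j<n. (?w \<bullet> z j) *\<^sub>R z j))\<^sup>2"
        proof -
          have "Q n ?w \<bullet> (\<Sum>j<n. (?w \<bullet> z j) *\<^sub>R z j) = 0"
            using QW[OF vh, of n] by (simp add: inner_sum_right Wdef)
          moreover have "?w = Q n ?w + (\<Sum>j<n. (?w \<bullet> z j) *\<^sub>R z j)" by (simp add: Q_def)
          ultimately show ?thesis
            using norm_add_Pythagorean[of "Q n ?w" "\<Sum>j<n. (?w \<bullet> z j) *\<^sub>R z j"] by (simp add: orthogonal_def)
        qed
        then have "(norm (Q n ?w))\<^sup>2 <= (norm ?w)\<^sup>2" by simp
        then have "\<mu> n * (norm (Q n ?w))\<^sup>2 <= \<mu> n * (norm ?w)\<^sup>2" using \<mu>(1) by (rule mult_left_mono)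
        then show ?thesis using ray[OF QW[OF vh, of n]] by simp
      qed
      moreover have "(%n. \<mu> n * (norm ?w)\<^sup>2) \<longlonglongrightarrow> 0 * (norm ?w)\<^sup>2"
        by (intro tendsto_intros \<mu>lim)
      ultimately have "(%n. (norm (fst (Q n ?w)))\<^sup>2) \<longlonglongrightarrow> 0"
        by (intro tendsto_sandwich[of "%_. 0" "%n. (norm (fst (Q n ?w)))\<^sup>2" sequentially]) auto
      then have "(%n. sqrt ((norm (fst (Q n ?w)))\<^sup>2)) \<longlonglongrightarrow> sqrt 0" by (rule tendsto_real_sqrt)
      then have "(%n. v - (\<Sum>k<n. (v \<bullet> e k) *\<^sub>R e k)) \<longlonglongrightarrow> 0"
        unfolding part by (simp add: tendsto_norm_zero_iff)
      then have "(%n. v - (v - (\<Sum>k<n. (v \<bullet> e k) *\<^sub>R e k))) \<longlonglongrightarrow> v - 0"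
        by (intro tendsto_intros)
      then show ?thesis unfolding sums_def by simp
    qed
  qed
qed

subsection \<open>Orthogonal series and the heat flow of a spectral form\<close>

lemma orthogonal_norm_sum:
  fixes b :: "nat => 'h::real_inner"
  assumes orth: "\<forall>j k. j \<noteq> k --> b j \<bullet> b k = 0" and "finite A"
  shows "(norm (\<Sum>k\<in>A. c k *\<^sub>R b k))\<^sup>2 = (\<Sum>k\<in>A. (c k)\<^sup>2 * (norm (b k))\<^sup>2)"
  using assms(2)
proof induction
  case (insert j A)
  have "(c j *\<^sub>R b j) \<bullet> (\<Sum>k\<in>A. c k *\<^sub>R b k) = 0"
    unfolding inner_sum_right
  proof (intro sum.neutral ballI)
    fix k assume "k \<in> A"
    then have "j \<noteq> k" using insert(2) by blast
    then show "c j *\<^sub>R b j \<bullet> c k *\<^sub>R b k = 0" using orth by simp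
  qed
  then have "orthogonal (c j *\<^sub>R b j) (\<Sum>k\<in>A. c k *\<^sub>R b k)" by (simp add: orthogonal_def)
  then show ?case using insert by (simp add: norm_add_Pythagorean power_mult_distrib)
qed simp

text \<open>The remainder is bounded through a majorant \<open>M\<close> rather than through the
  coefficients themselves. For coefficients depending on time, convergence is then uniform as soon
  as \<open>M\<close> does not depend on time.\<close>

lemma orthogonal_series:
  fixes b :: "nat => 'h::{real_inner,banach}"
  assumes orth: "\<forall>j k. j \<noteq> k --> b j \<bullet> b k = 0"
    and le: "\<And>k. (c k)\<^sup>2 * (norm (b k))\<^sup>2 <= M k" and M: "summable M"
  shows "summable (%k. c k *\<^sub>R b k)"
    and "(norm ((\<Sum>k. c k *\<^sub>R b k) - (\<Sum>k<n. c k *\<^sub>R b k)))\<^sup>2 <= (\<Sum>k. M (k + n))"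
proof -
  have M0: "0 <= M k" for k using le[of k] by (meson order_trans zero_le_mult_iff zero_le_power2)
  have fin: "(norm (\<Sum>k\<in>A. c k *\<^sub>R b k))\<^sup>2 <= sum M A" if "finite A" for A
    unfolding orthogonal_norm_sum[of b, OF orth that] by (intro sum_mono le)
  show s: "summable (%k. c k *\<^sub>R b k)"
    unfolding summable_Cauchy
  proof (intro allI impI)
    fix \<epsilon> :: real assume \<epsilon>: "0 < \<epsilon>"
    with M obtain N where N: "\<And>m n. m \<ge> N ==> norm (sum M {m..<n}) < \<epsilon>\<^sup>2"
      unfolding summable_Cauchy by (meson zero_less_power)
    show "\<exists>N. \<forall>m\<ge>N. \<forall>n. norm (\<Sum>k = m..<n. c k *\<^sub>R b k) < \<epsilon>"
    proof (intro exI[of _ N] allI impI)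
      fix m n assume "m \<ge> N"
      have "(norm (\<Sum>k = m..<n. c k *\<^sub>R b k))\<^sup>2 <= sum M {m..<n}" by (rule fin) simp
      also have "\<dots> <= norm (sum M {m..<n})" by simp
      also have "\<dots> < \<epsilon>\<^sup>2" using N[OF \<open>m \<ge> N\<close>] .
      finally show "norm (\<Sum>k = m..<n. c k *\<^sub>R b k) < \<epsilon>"
        by (rule power2_less_imp_less) (use \<epsilon> in simp)
    qed
  qed
  have "(%N. (norm ((\<Sum>k<N. c k *\<^sub>R b k) - (\<Sum>k<n. c k *\<^sub>R b k)))\<^sup>2) \<longlonglongrightarrow>
    (norm ((\<Sum>k. c k *\<^sub>R b k) - (\<Sum>k<n. c k *\<^sub>R b k)))\<^sup>2"
    by (intro tendsto_intros summable_LIMSEQ s)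
  then show "(norm ((\<Sum>k. c k *\<^sub>R b k) - (\<Sum>k<n. c k *\<^sub>R b k)))\<^sup>2 <= (\<Sum>k. M (k + n))"
  proof (rule LIMSEQ_le_const2)
    show "\<exists>N. \<forall>m\<ge>N. (norm ((\<Sum>k<m. c k *\<^sub>R b k) - (\<Sum>k<n. c k *\<^sub>R b k)))\<^sup>2 <= (\<Sum>k. M (k + n))"
    proof (intro exI[of _ n] allI impI)
      fix m assume "m \<ge> n"
      then have "(\<Sum>k<m. c k *\<^sub>R b k) - (\<Sum>k<n. c k *\<^sub>R b k) = (\<Sum>k\<in>{n..<m}. c k *\<^sub>R b k)"
        by (simp add: sum_diff_nat_ivl lessThan_atLeast0)
      moreover have "sum M {n..<m} = (\<Sum>k<m - n. M (k + n))"
        using \<open>m \<ge> n\<close> sum.shift_bounds_nat_ivl[of M 0 n "m - n"] by (simp add: lessThan_atLeast0)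
      moreover have "\<dots> <= (\<Sum>k. M (k + n))"
        using M M0 by (intro sum_le_suminf) (auto simp: summable_iff_shift)
      ultimately show "(norm ((\<Sum>k<m. c k *\<^sub>R b k) - (\<Sum>k<n. c k *\<^sub>R b k)))\<^sup>2 <= (\<Sum>k. M (k + n))"
        using fin[of "{n..<m}"] by simp
    qed
  qed
qed

lemma has_vector_derivative_quadratic:
  fixes f :: "real => 'b::real_normed_vector"
  assumes "0 < \<delta>" and q: "\<And>t. \<bar>t - s\<bar> < \<delta> ==> norm (f t - f s - (t - s) *\<^sub>R D) <= C * (t - s)\<^sup>2"
  shows "(f has_vector_derivative D) (at s)"
  unfolding has_vector_derivative_def
proof (rule has_derivativeI_sandwich[OF \<open>0 < \<delta>\<close>, where H = "%t. C * norm (t - s)"])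
  show "bounded_linear (%x. x *\<^sub>R D)" by (rule bounded_linear_scaleR_left)
  show "norm (f t - f s - (t - s) *\<^sub>R D) / norm (t - s) <= C * norm (t - s)"
    if "t \<in> UNIV" "t \<noteq> s" "dist t s < \<delta>" for t
  proof -
    have "C * (t - s)\<^sup>2 = (C * norm (t - s)) * norm (t - s)"
      unfolding real_norm_def mult.assoc abs_mult_self_eq power2_eq_square ..
    then show ?thesis using q[of t] that by (simp only: dist_real_def pos_divide_le_eq zero_less_norm_iff right_minus_eq not_False_eq_True)
  qed
  have "((%t. C * norm (t - s)) \<longlongrightarrow> C * norm (s - s)) (at s)"
    by (intro tendsto_intros)
  then show "((%t. C * norm (t - s)) \<longlongrightarrow> 0) (at s)" by simp
qed

text \<open>Both signs of \<open>y\<close> occur, as \<open>y\<close> will be an eigenvalue times a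
  time difference. The maximum is the larger value of the exponential at the two ends 0 and
  \<open>- y\<close> of the range of expansion.\<close>

lemma exp_neg_bounds:
  fixes y :: real
  shows "\<bar>exp (- y) - 1\<bar> <= \<bar>y\<bar> * max 1 (exp (- y))"
    and "\<bar>exp (- y) - 1 + y\<bar> <= y\<^sup>2 * max 1 (exp (- y))"
proof -
  have a: "1 - y <= exp (- y)" using exp_ge_add_one_self[of "- y"] by simp
  have "exp (- y) * (1 + y) <= exp (- y) * exp y"
    using exp_ge_add_one_self[of y] by (intro mult_left_mono) auto
  then have b: "exp (- y) - 1 <= - (y * exp (- y))" by (simp add: algebra_simps flip: exp_add)
  show c: "\<bar>exp (- y) - 1\<bar> <= \<bar>y\<bar> * max 1 (exp (- y))"
  proof (cases "0 <= y")
    case True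
    then have "exp (- y) <= 1" by simp
    then show ?thesis using a True by (auto simp: max_def)
  next
    case False
    then have "1 <= exp (- y)" by simp
    then show ?thesis using b False by (auto simp: max_def)
  qed
  have "exp (- y) - 1 + y <= y * (1 - exp (- y))" using b by (simp add: algebra_simps)
  also have "\<dots> <= \<bar>y\<bar> * \<bar>exp (- y) - 1\<bar>" by (metis abs_ge_self abs_minus_commute abs_mult)
  also have "\<dots> <= \<bar>y\<bar> * (\<bar>y\<bar> * max 1 (exp (- y)))" using c by (rule mult_left_mono) simp
  also have "\<dots> = y\<^sup>2 * max 1 (exp (- y))" by (simp add: power2_eq_square)
  finally show "\<bar>exp (- y) - 1 + y\<bar> <= y\<^sup>2 * max 1 (exp (- y))" using a by simp
qed

text \<open>Both come from \<open>x * exp (- x) <= 1\<close>; the first is its square at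
  \<open>x = l * s / 2\<close>, whence the 4. Being uniform in \<open>l\<close>, these bounds
  express the smoothing of the flow at positive times.\<close>

lemma power2_exp_neg_bound:
  fixes l s :: real
  assumes "0 <= l" "0 < s"
  shows "l\<^sup>2 * exp (- (l * s)) <= 4 / s\<^sup>2" "l * exp (- (l * s)) <= 1 / s"
proof -
  have *: "x * exp (- x) <= 1" for x :: real
  proof -
    have "x <= exp x" using exp_ge_add_one_self[of x] by linarith
    then show ?thesis by (simp add: exp_minus field_simps)
  qed
  show "l * exp (- (l * s)) <= 1 / s" using *[of "l * s"] assms by (simp add: field_simps)
  have "(l * s / 2 * exp (- (l * s / 2)))\<^sup>2 <= 1\<^sup>2"
    by (intro power_mono *) (use assms in auto)
  also have "(l * s / 2 * exp (- (l * s / 2)))\<^sup>2 = (l * s / 2)\<^sup>2 * exp (- (l * s))"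
    by (simp add: power_mult_distrib power2_eq_square flip: exp_add)
  finally show "l\<^sup>2 * exp (- (l * s)) <= 4 / s\<^sup>2" using assms by (simp add: power_mult_distrib field_simps)
qed

section \<open>The heat semigroup attached to given spectral data\<close>

locale form_spectrum =
  fixes V :: "('h::{real_inner,banach} \<times> 'w::{real_inner,banach}) set"
    and e :: "nat => 'h" and g :: "nat => 'w" and l :: "nat => real"
  assumes subV: "subspace V" and closedV: "closed V"
    and eV: "\<And>k. (e k, g k) \<in> V" and l0: "\<And>k. 0 <= l k"
    and eig: "\<And>k v h. (v, h) \<in> V ==> h \<bullet> g k = l k * (v \<bullet> e k)"
    and orth_e: "\<And>j k. j \<noteq> k ==> e j \<bullet> e k = 0"
    and norm_e: "\<And>k. norm (e k) = 0 \<or> norm (e k) = 1"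
    and expand_V: "\<And>v h. (v, h) \<in> V ==> (%k. (v \<bullet> e k) *\<^sub>R e k) sums v"
begin

lemma orth_e_all: "\<forall>j k. j \<noteq> k --> e j \<bullet> e k = 0" using orth_e by simp

lemma norm_e_le: "norm (e k) <= 1" using norm_e[of k] by auto

lemma coeff_norm_e: "(w \<bullet> e k) * (e k \<bullet> e k) = w \<bullet> e k"
  using norm_e[of k] by (auto simp: norm_eq_1)

lemma coeff_sq_norm_e: "(w \<bullet> e k)\<^sup>2 * (norm (e k))\<^sup>2 = (w \<bullet> e k)\<^sup>2"
  using norm_e[of k] by auto

lemma orth_z_all: "\<forall>j k. j \<noteq> k --> (e j, g j) \<bullet> (e k, g k) = 0"
  using eig[OF eV] orth_e by simp

lemma norm_g: "(norm (g k))\<^sup>2 = l k * (norm (e k))\<^sup>2"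
  using eig[OF eV, of k k] by (simp add: power2_norm_eq_inner)

lemma orth_g_all: "\<forall>j k. j \<noteq> k --> g j \<bullet> g k = 0"
  using eig[OF eV] orth_e by simp

lemma norm_z: "(norm (e k, g k))\<^sup>2 = (1 + l k) * (norm (e k))\<^sup>2"
  using norm_g[of k] by (simp add: power2_norm_eq_inner algebra_simps)

lemma bessel_finite: "finite A ==> (\<Sum>k\<in>A. (w \<bullet> e k)\<^sup>2) <= (norm w)\<^sup>2"
proof -
  assume "finite A"
  let ?p = "\<Sum>k\<in>A. (w \<bullet> e k) *\<^sub>R e k"
  have np: "(norm ?p)\<^sup>2 = (\<Sum>k\<in>A. (w \<bullet> e k)\<^sup>2)"
    unfolding orthogonal_norm_sum[of e, OF orth_e_all \<open>finite A\<close>] coeff_sq_norm_e ..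
  have "w \<bullet> ?p = (\<Sum>k\<in>A. (w \<bullet> e k)\<^sup>2)"
    by (simp add: inner_sum_right power2_eq_square)
  then have "(norm (w - ?p))\<^sup>2 = (norm w)\<^sup>2 - (\<Sum>k\<in>A. (w \<bullet> e k)\<^sup>2)"
    using np by (simp add: power2_norm_eq_inner inner_diff_left inner_diff_right inner_commute)
  then show ?thesis using zero_le_power2[of "norm (w - ?p)"] by linarith
qed

lemma bessel: "summable (%k. (w \<bullet> e k)\<^sup>2)" "(\<Sum>k. (w \<bullet> e k)\<^sup>2) <= (norm w)\<^sup>2"
proof -
  show s: "summable (%k. (w \<bullet> e k)\<^sup>2)"
    by (rule summableI_nonneg_bounded[of _ "(norm w)\<^sup>2"]) (auto intro: bessel_finite)
  show "(\<Sum>k. (w \<bullet> e k)\<^sup>2) <= (norm w)\<^sup>2"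
    by (rule suminf_le_const[OF s]) (auto intro: bessel_finite)
qed

text \<open>The spectral multiplier m(A), for the operator A with eigenvalues \<open>l k\<close>. It
  annihilates what is orthogonal to all \<open>e k\<close>, so the multiplier 1 is a projection and
  not yet the identity.\<close>

definition mult :: "(nat => real) => 'h => 'h" where
  "mult m w = (\<Sum>k. (m k * (w \<bullet> e k)) *\<^sub>R e k)"

lemma mult_bound_sq:
  assumes "\<And>k. \<bar>m k\<bar> <= B"
  shows "(m k * (w \<bullet> e k))\<^sup>2 * (norm (e k))\<^sup>2 <= B\<^sup>2 * (w \<bullet> e k)\<^sup>2"
proof -
  have "(m k)\<^sup>2 <= B\<^sup>2" using assms[of k] by (metis abs_ge_zero power2_abs power_mono)
  then have "(m k)\<^sup>2 * (w \<bullet> e k)\<^sup>2 <= B\<^sup>2 * (w \<bullet> e k)\<^sup>2" by (rule mult_right_mono) simp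
  then show ?thesis unfolding power_mult_distrib mult.assoc coeff_sq_norm_e .
qed

lemma mult_summable:
  assumes "\<And>k. \<bar>m k\<bar> <= B"
  shows "summable (%k. (m k * (w \<bullet> e k)) *\<^sub>R e k)"
  by (rule orthogonal_series(1)[of e, OF orth_e_all mult_bound_sq[of m B, OF assms]])
    (auto intro!: summable_mult bessel)

lemma norm_mult_le:
  assumes "\<And>k. \<bar>m k\<bar> <= B"
  shows "norm (mult m w) <= B * norm w"
proof -
  have "0 <= B" using assms[of 0] by simp
  have "(norm (mult m w - (\<Sum>k<0. (m k * (w \<bullet> e k)) *\<^sub>R e k)))\<^sup>2 <= (\<Sum>k. B\<^sup>2 * (w \<bullet> e (k + 0))\<^sup>2)"
    unfolding mult_def
    by (rule orthogonal_series(2)[of e, OF orth_e_all mult_bound_sq[of m B, OF assms]])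
      (auto intro!: summable_mult bessel)
  also have "\<dots> = B\<^sup>2 * (\<Sum>k. (w \<bullet> e k)\<^sup>2)" by (simp add: suminf_mult bessel)
  also have "\<dots> <= B\<^sup>2 * (norm w)\<^sup>2" by (intro mult_left_mono bessel) simp
  finally have "(norm (mult m w))\<^sup>2 <= (B * norm w)\<^sup>2" by (simp add: power_mult_distrib)
  then show ?thesis by (rule power2_le_imp_le) (use \<open>0 <= B\<close> in simp)
qed

lemma mult_lin:
  assumes "\<And>k. \<bar>m k\<bar> <= B" "\<And>k. \<bar>m' k\<bar> <= B'"
  shows "mult m w + c *\<^sub>R mult m' w = mult (%k. m k + c * m' k) w"
proof -
  have "mult m w + c *\<^sub>R mult m' w =
      (\<Sum>k. (m k * (w \<bullet> e k)) *\<^sub>R e k + c *\<^sub>R ((m' k * (w \<bullet> e k)) *\<^sub>R e k))"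
    unfolding mult_def
    using mult_summable[of m B w, OF assms(1)] mult_summable[of m' B' w, OF assms(2)]
    by (simp only: suminf_add suminf_scaleR_right summable_scaleR_right)
  then show ?thesis unfolding mult_def by (simp add: algebra_simps)
qed

lemma mult_diff:
  assumes "\<And>k. \<bar>m k\<bar> <= B" "\<And>k. \<bar>m' k\<bar> <= B'"
  shows "mult m w - mult m' w = mult (%k. m k - m' k) w"
  using mult_lin[of m B m' B' w "-1", OF assms] by simp

lemma inner_mult:
  assumes "\<And>k. \<bar>m k\<bar> <= B"
  shows "(%k. m k * (w \<bullet> e k) * (x \<bullet> e k)) sums (mult m w \<bullet> x)"
proof -
  have "(%k. (m k * (w \<bullet> e k)) *\<^sub>R e k) sums mult m w"
    unfolding mult_def by (rule summable_sums[OF mult_summable[of m B, OF assms]])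
  then have "(%k. ((m k * (w \<bullet> e k)) *\<^sub>R e k) \<bullet> x) sums (mult m w \<bullet> x)"
    by (rule bounded_linear.sums[OF bounded_linear_inner_left])
  then show ?thesis by (simp add: inner_commute)
qed

text \<open>The semigroup exp(-sA), its time derivative -A exp(-sA), and the gradient of exp(-sA) w.
  At \<open>s = 0\<close> the flow is only the projection onto the closed span of the eigenvectors;
  \<open>flow_0\<close> therefore assumes that \<open>w\<close> has an expansion.\<close>

definition flow :: "real => 'h => 'h" where "flow s = mult (%k. exp (- (l k * s)))"
definition flow' :: "real => 'h => 'h" where "flow' s = mult (%k. - l k * exp (- (l k * s)))"
definition grad_flow :: "real => 'h => 'w" where
  "grad_flow s w = (\<Sum>k. (exp (- (l k * s)) * (w \<bullet> e k)) *\<^sub>R g k)"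

lemma flow_bd: "0 <= s ==> \<bar>exp (- (l k * s))\<bar> <= 1" using l0[of k] by simp

lemma flow'_bd: "0 < s ==> \<bar>- l k * exp (- (l k * s))\<bar> <= 1 / s"
  using l0[of k] power2_exp_neg_bound(2)[of "l k" s] by simp

lemma norm_flow_le: "0 <= s ==> norm (flow s w) <= norm w"
  using norm_mult_le[of "%k. exp (- (l k * s))" 1 w, OF flow_bd] by (simp add: flow_def)

lemma flow_0: "(%k. (w \<bullet> e k) *\<^sub>R e k) sums w ==> flow 0 w = w"
  by (simp add: flow_def mult_def sums_iff)

text \<open>The squared form norm of the k-th term carries the factor
  \<open>(1 + l k) * (exp (- (l k * s)))\<^sup>2\<close>, which is at most \<open>1 + 1 / s\<close>
  for every \<open>k\<close>. Hence the series converges in \<open>V\<close> at any positive time,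
  whatever \<open>w\<close> is.\<close>

lemma flow_in_V:
  assumes "0 < s"
  shows "(flow s w, grad_flow s w) \<in> V"
proof -
  let ?c = "%k. exp (- (l k * s)) * (w \<bullet> e k)"
  have "(?c k)\<^sup>2 * (norm (e k, g k))\<^sup>2 <= (1 + 1 / s) * (w \<bullet> e k)\<^sup>2" for k
  proof -
    have a: "exp (- (l k * s)) <= 1" using l0[of k] assms by simp
    have "l k * (exp (- (l k * s)))\<^sup>2 <= l k * exp (- (l k * s))"
      using a l0[of k] by (intro mult_left_mono) (auto simp: power2_eq_square)
    also have "\<dots> <= 1 / s" using power2_exp_neg_bound(2)[OF l0 assms] .
    finally have "(1 + l k) * (exp (- (l k * s)))\<^sup>2 <= 1 + 1 / s"
      using power_le_one[OF _ a, of 2] by (simp add: algebra_simps)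
    then have "((1 + l k) * (exp (- (l k * s)))\<^sup>2) * (w \<bullet> e k)\<^sup>2 <= (1 + 1 / s) * (w \<bullet> e k)\<^sup>2"
      by (rule mult_right_mono) simp
    also have "((1 + l k) * (exp (- (l k * s)))\<^sup>2) * (w \<bullet> e k)\<^sup>2 = (?c k)\<^sup>2 * (norm (e k, g k))\<^sup>2"
      unfolding norm_z by (subst coeff_sq_norm_e[symmetric]) (simp add: power_mult_distrib mult_ac)
    finally show ?thesis .
  qed
  from orthogonal_series(1)[of "%k. (e k, g k)", OF orth_z_all this]
  have s: "summable (%k. ?c k *\<^sub>R (e k, g k))" by (simp add: summable_mult bessel)
  then have lim: "(%n. \<Sum>k<n. ?c k *\<^sub>R (e k, g k)) \<longlonglongrightarrow> (\<Sum>k. ?c k *\<^sub>R (e k, g k))"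
    by (rule summable_LIMSEQ)
  have "(\<Sum>k<n. ?c k *\<^sub>R (e k, g k)) \<in> V" for n
    by (intro subspace_sum subspace_scale subV eV)
  with lim have "(\<Sum>k. ?c k *\<^sub>R (e k, g k)) \<in> V" by (meson closedV closed_sequentially)
  moreover have "fst (\<Sum>k. ?c k *\<^sub>R (e k, g k)) = flow s w" "snd (\<Sum>k. ?c k *\<^sub>R (e k, g k)) = grad_flow s w"
    unfolding flow_def mult_def grad_flow_def
    using bounded_linear.suminf[OF bounded_linear_fst s] bounded_linear.suminf[OF bounded_linear_snd s] by simp_all
  ultimately show ?thesis by (metis prod.collapse)
qed

text \<open>The weak form of u' = -A u. In the gradient series paired with \<open>h\<close>,
  \<open>eig\<close> turns each gradient product into \<open>l k\<close> times the product of the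
  values.\<close>

lemma flow'_inner:
  assumes "0 < s" "(v, h) \<in> V"
  shows "flow' s w \<bullet> v = - (grad_flow s w \<bullet> h)"
proof -
  let ?c = "%k. exp (- (l k * s)) * (w \<bullet> e k)"
  have "(?c k)\<^sup>2 * (norm (g k))\<^sup>2 <= (1 / s) * (w \<bullet> e k)\<^sup>2" for k
  proof -
    have a: "exp (- (l k * s)) <= 1" using l0[of k] assms by simp
    have "l k * (exp (- (l k * s)))\<^sup>2 <= l k * exp (- (l k * s))"
      using a l0[of k] by (intro mult_left_mono) (auto simp: power2_eq_square)
    also have "\<dots> <= 1 / s" using power2_exp_neg_bound(2)[OF l0 assms(1)] .
    finally have "(l k * (exp (- (l k * s)))\<^sup>2) * (w \<bullet> e k)\<^sup>2 <= (1 / s) * (w \<bullet> e k)\<^sup>2"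
      by (rule mult_right_mono) simp
    also have "(l k * (exp (- (l k * s)))\<^sup>2) * (w \<bullet> e k)\<^sup>2 = (?c k)\<^sup>2 * (norm (g k))\<^sup>2"
      unfolding norm_g by (subst coeff_sq_norm_e[symmetric]) (simp add: power_mult_distrib mult_ac)
    finally show ?thesis .
  qed
  from orthogonal_series(1)[of g, OF orth_g_all this]
  have s: "summable (%k. ?c k *\<^sub>R g k)" by (simp add: summable_mult bessel)
  then have "(%k. ?c k *\<^sub>R g k) sums grad_flow s w"
    unfolding grad_flow_def by (rule summable_sums)
  then have "(%k. (?c k *\<^sub>R g k) \<bullet> h) sums (grad_flow s w \<bullet> h)"
    by (rule bounded_linear.sums[OF bounded_linear_inner_left])
  then have "(%k. - ((?c k *\<^sub>R g k) \<bullet> h)) sums - (grad_flow s w \<bullet> h)" by (rule sums_minus)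
  moreover have "- ((?c k *\<^sub>R g k) \<bullet> h) = - l k * exp (- (l k * s)) * (w \<bullet> e k) * (v \<bullet> e k)" for k
    using eig[OF assms(2), of k] by (simp add: inner_commute)
  ultimately have "(%k. - l k * exp (- (l k * s)) * (w \<bullet> e k) * (v \<bullet> e k)) sums - (grad_flow s w \<bullet> h)"
    by (simp only:)
  then show ?thesis
    using inner_mult[of "%k. - l k * exp (- (l k * s))", OF flow'_bd[OF assms(1)], of w v]
    unfolding flow'_def by (simp add: sums_iff)
qed

text \<open>With y = l (t - s) the Taylor remainder of each mode is exp(-l s) (exp(-y) - 1 + y), at
  most l^2 (t - s)^2 exp(-l s / 2) as long as \<open>t\<close> stays above \<open>s / 2\<close>;
  that is why \<open>\<delta> = s/2\<close>. The bound 4 / s^2 taken at half the time gives the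
  constant 16.\<close>

lemma flow_has_derivative:
  assumes "0 < s"
  shows "((%s. flow s w) has_vector_derivative flow' s w) (at s)"
proof (rule has_vector_derivative_quadratic[where \<delta> = "s/2" and C = "16 / s\<^sup>2 * norm w"])
  fix t assume t: "\<bar>t - s\<bar> < s / 2"
  then have t0: "s / 2 < t" "0 <= t" using assms by linarith+
  have "flow t w - flow s w - (t - s) *\<^sub>R flow' s w
    = mult (%k. (exp (- (l k * t)) - exp (- (l k * s))) + (-(t - s)) * (- l k * exp (- (l k * s)))) w"
  proof -
    have b: "\<bar>exp (- (l k * t)) - exp (- (l k * s))\<bar> <= 2" for k
      using flow_bd[of t k] flow_bd[of s k] t0 assms by linarith
    show ?thesis
      unfolding flow_def flow'_def
      using mult_diff[of "%k. exp (- (l k * t))" 1 "%k. exp (- (l k * s))" 1 w, OF flow_bd[OF t0(2)] flow_bd] assms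
        mult_lin[of "%k. exp (- (l k * t)) - exp (- (l k * s))" 2 "%k. - l k * exp (- (l k * s))",
          OF b flow'_bd[OF assms], of w "-(t - s)"]
      by (simp add: scaleR_left_diff_distrib diff_diff_eq2 add_diff_eq)
  qed
  also have "norm \<dots> <= (16 / s\<^sup>2 * (t - s)\<^sup>2) * norm w"
  proof (rule norm_mult_le)
    fix k
    let ?y = "l k * (t - s)"
    have "exp (- (l k * t)) - exp (- (l k * s)) + (-(t - s)) * (- l k * exp (- (l k * s)))
      = exp (- (l k * s)) * (exp (- ?y) - 1 + ?y)"
      by (simp add: algebra_simps flip: exp_add)
    also have "\<bar>\<dots>\<bar> <= exp (- (l k * s)) * (?y\<^sup>2 * max 1 (exp (- ?y)))"
      unfolding abs_mult using exp_neg_bounds(2)[of ?y] by (auto intro: mult_left_mono)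
    also have "\<dots> = (l k)\<^sup>2 * (exp (- (l k * s)) * max 1 (exp (- ?y))) * (t - s)\<^sup>2"
      by (simp add: power_mult_distrib)
    also have "\<dots> <= (l k)\<^sup>2 * exp (- (l k * (s / 2))) * (t - s)\<^sup>2"
    proof (intro mult_right_mono mult_left_mono)
      have "exp (- (l k * s)) * exp (- ?y) = exp (- (l k * t))" by (simp add: algebra_simps flip: exp_add)
      moreover have "exp (- (l k * t)) <= exp (- (l k * (s / 2)))" "exp (- (l k * s)) <= exp (- (l k * (s / 2)))"
        using l0[of k] t0 assms mult_left_mono[of "s/2" t "l k"] mult_left_mono[of "s/2" s "l k"] by auto
      ultimately show "exp (- (l k * s)) * max 1 (exp (- ?y)) <= exp (- (l k * (s / 2)))"
        by (auto simp: max_def)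
    qed auto
    also have "\<dots> <= 16 / s\<^sup>2 * (t - s)\<^sup>2"
      using power2_exp_neg_bound(1)[OF l0, of "s/2" k] assms
      by (intro mult_right_mono) (auto simp: power_divide)
    finally show "\<bar>exp (- (l k * t)) - exp (- (l k * s)) + (-(t - s)) * (- l k * exp (- (l k * s)))\<bar>
      <= 16 / s\<^sup>2 * (t - s)\<^sup>2" .
  qed
  finally show "norm (flow t w - flow s w - (t - s) *\<^sub>R flow' s w) <= 16 / s\<^sup>2 * norm w * (t - s)\<^sup>2"
    by (simp add: mult_ac)
qed (use assms in simp)

text \<open>Bessel's inequality bounds the tails of the series independently of \<open>t\<close>, so
  the partial sums converge uniformly.\<close>

lemma continuous_on_mult:
  fixes m :: "real => nat => real"
  assumes bd: "\<And>t k. t \<in> A ==> \<bar>m t k\<bar> <= B" and cont: "\<And>k. continuous_on A (%t. m t k)"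
  shows "continuous_on A (%t. mult (m t) w)"
proof (rule uniform_limit_theorem)
  show "\<forall>\<^sub>F n in sequentially. continuous_on A (%t. \<Sum>k<n. (m t k * (w \<bullet> e k)) *\<^sub>R e k)"
    by (intro always_eventually allI continuous_intros cont)
  have tail: "(%n. \<Sum>k. B\<^sup>2 * (w \<bullet> e (k + n))\<^sup>2) \<longlonglongrightarrow> 0"
    by (rule suminf_exist_split2[OF summable_mult[OF bessel(1)], of "B\<^sup>2" w])
  show "uniform_limit A (%n t. \<Sum>k<n. (m t k * (w \<bullet> e k)) *\<^sub>R e k) (%t. mult (m t) w) sequentially"
  proof (rule uniform_limitI)
    fix \<epsilon> :: real assume \<epsilon>: "0 < \<epsilon>"
    then have "\<forall>\<^sub>F n in sequentially. (\<Sum>k. B\<^sup>2 * (w \<bullet> e (k + n))\<^sup>2) < \<epsilon>\<^sup>2"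
      using order_tendstoD(2)[OF tail, of "\<epsilon>\<^sup>2"] by simp
    then show "\<forall>\<^sub>F n in sequentially. \<forall>t\<in>A. dist (\<Sum>k<n. (m t k * (w \<bullet> e k)) *\<^sub>R e k) (mult (m t) w) < \<epsilon>"
    proof eventually_elim
      case (elim n)
      show ?case
      proof
        fix t assume t: "t \<in> A"
        have "(norm (mult (m t) w - (\<Sum>k<n. (m t k * (w \<bullet> e k)) *\<^sub>R e k)))\<^sup>2 <= (\<Sum>k. B\<^sup>2 * (w \<bullet> e (k + n))\<^sup>2)"
          unfolding mult_def
          by (rule orthogonal_series(2)[of e, OF orth_e_all mult_bound_sq[of "m t" B, OF bd[OF t]]])
            (auto intro!: summable_mult bessel)
        then have "norm (mult (m t) w - (\<Sum>k<n. (m t k * (w \<bullet> e k)) *\<^sub>R e k)) < \<epsilon>"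
          using elim \<epsilon> by (intro power2_less_imp_less[of _ \<epsilon>]) auto
        then show "dist (\<Sum>k<n. (m t k * (w \<bullet> e k)) *\<^sub>R e k) (mult (m t) w) < \<epsilon>"
          by (simp add: dist_norm norm_minus_commute)
      qed
    qed
  qed
qed auto

lemma continuous_on_flow: "continuous_on {0..} (%s. flow s w)"
  unfolding flow_def by (rule continuous_on_mult[where B = 1]) (auto intro!: continuous_intros flow_bd simp: l0)

lemma continuous_on_flow':
  assumes "0 < a"
  shows "continuous_on {a..} (%s. flow' s w)"
  unfolding flow'_def
proof (rule continuous_on_mult[where B = "1 / a"])
  fix t k assume "t \<in> {a..}"
  then have "\<bar>- l k * exp (- (l k * t))\<bar> <= 1 / t" using assms by (intro flow'_bd) auto
  also have "\<dots> <= 1 / a" using assms \<open>t \<in> {a..}\<close> by (simp add: frac_le)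
  finally show "\<bar>- l k * exp (- (l k * t))\<bar> <= 1 / a" .
qed (auto intro!: continuous_intros)

end

subsection \<open>Duhamel's formula\<close>

lemma set_integrable_bounded:
  fixes f :: "'a::euclidean_space => 'b::{banach, second_countable_topology}"
  assumes "f \<in> borel_measurable borel" "\<And>x. x \<in> A ==> norm (f x) <= B" "A \<in> sets borel" "emeasure lborel A < \<infinity>"
  shows "set_integrable lborel A f"
  unfolding set_integrable_def
  by (rule integrableI_bounded_set_indicator[of A lborel f B]) (use assms in auto)

lemma emeasure_Ioo_finite: "emeasure lborel {a<..<b::real} < top"
  using emeasure_bounded_finite[of "{a<..<b}"] by simp

lemma set_integral_Ioo_const: "a <= b ==> (LBINT x:{a<..<b}. c) = c * (b - a)" for a b c :: real
  by (simp add: set_lebesgue_integral_def)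

lemma integral_Icc_eq_Ioo:
  fixes f :: "real => real"
  assumes [measurable]: "f \<in> borel_measurable borel"
  shows "(\<integral>r. f r * indicator {s..t} r \<partial>lborel) = (LBINT r:{s<..<t}. f r)"
proof -
  have "AE r in lborel. r \<noteq> s" "AE r in lborel. r \<noteq> t" by (rule AE_lborel_singleton)+
  then have "AE r in lborel. f r * indicator {s..t} r = indicator {s<..<t} r *\<^sub>R f r"
    by eventually_elim (auto simp: indicator_def)
  then show ?thesis unfolding set_lebesgue_integral_def by (intro integral_cong_AE) auto
qed

lemma set_integral_nonneg:
  fixes f :: "'a => real"
  assumes "\<And>x. x \<in> A ==> 0 <= f x"
  shows "0 <= (LINT x:A|M. f x)"
  unfolding set_lebesgue_integral_def
  by (rule integral_nonneg_AE) (use assms in \<open>auto simp: indicator_def\<close>)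

lemma abs_set_integral_Ioo_le:
  fixes f :: "real => real"
  assumes "f \<in> borel_measurable borel" "\<And>x. \<bar>f x\<bar> <= B" "a <= b"
  shows "\<bar>LBINT x:{a<..<b}. f x\<bar> <= B * (b - a)"
proof -
  have i: "set_integrable lborel {a<..<b} f"
    by (rule set_integrable_bounded[where B = B]) (use assms in \<open>auto simp: emeasure_Ioo_finite\<close>)
  have "\<bar>LBINT x:{a<..<b}. f x\<bar> <= (LBINT x:{a<..<b}. \<bar>f x\<bar>)"
    using integral_norm_bound[of lborel "%x. indicator {a<..<b} x *\<^sub>R f x"]
    by (simp add: set_lebesgue_integral_def abs_mult)
  also have "\<dots> <= (LBINT x:{a<..<b}. B)"
    using i assms by (intro set_integral_mono set_integrable_abs)
      (auto intro!: set_integrable_bounded simp: emeasure_Ioo_finite)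
  also have "\<dots> = B * (b - a)" using assms(3) by (rule set_integral_Ioo_const)
  finally show ?thesis .
qed

lemma set_integral_Ioo_split:
  fixes f :: "real => real"
  assumes "set_integrable lborel {a<..<c} f" "a <= b" "b <= c"
  shows "(LBINT x:{a<..<c}. f x) = (LBINT x:{a<..<b}. f x) + (LBINT x:{b<..<c}. f x)"
proof -
  have i: "set_integrable lborel {a<..<b} f" "set_integrable lborel {b<..<c} f"
    using assms by (auto intro: set_integrable_subset[OF assms(1)])
  have "AE x in lborel. x \<noteq> b" by (rule AE_lborel_singleton)
  then have "AE x in lborel. indicator {a<..<c} x *\<^sub>R f x = indicator {a<..<b} x *\<^sub>R f x + indicator {b<..<c} x *\<^sub>R f x"
    by eventually_elim (use assms in \<open>auto simp: indicator_def\<close>)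
  then have "(LBINT x:{a<..<c}. f x) = (\<integral>x. indicator {a<..<b} x *\<^sub>R f x + indicator {b<..<c} x *\<^sub>R f x \<partial>lborel)"
    unfolding set_lebesgue_integral_def using assms(1) i
    by (intro integral_cong_AE) (auto simp: set_integrable_def)
  then show ?thesis using i unfolding set_lebesgue_integral_def set_integrable_def by simp
qed

lemma continuous_on_integral_Ioo:
  fixes f :: "real => real"
  assumes "f \<in> borel_measurable borel" "\<And>x. \<bar>f x\<bar> <= B"
  shows "continuous_on {0..} (%t. LBINT x:{0<..<t}. f x)"
proof -
  have *: "\<bar>(LBINT x:{0<..<t}. f x) - (LBINT x:{0<..<s}. f x)\<bar> <= B * (t - s)" if "0 <= s" "s <= t" for s t
  proof -
    have "set_integrable lborel {0<..<t} f"
      by (rule set_integrable_bounded[where B = B]) (use assms in \<open>auto simp: emeasure_Ioo_finite\<close>)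
    then show ?thesis
      using set_integral_Ioo_split[of 0 t f s] that abs_set_integral_Ioo_le[of f B s t] assms by simp
  qed
  have "B-lipschitz_on {0..} (%t. LBINT x:{0<..<t}. f x)"
  proof (rule lipschitz_onI)
    show "0 <= B" using assms(2)[of 0] by simp
    fix s t :: real assume "s \<in> {0..}" "t \<in> {0..}"
    then show "dist (LBINT x:{0<..<s}. f x) (LBINT x:{0<..<t}. f x) <= B * dist s t"
      using *[of s t] *[of t s] by (cases "s <= t") (auto simp: dist_real_def abs_minus_commute)
  qed
  then show ?thesis by (rule lipschitz_on_continuous_on)
qed

lemma exp_kernel_le: "0 <= l ==> s <= t ==> \<bar>exp (- (l * (t - s))) * c\<bar> <= \<bar>c\<bar>"
  for l s t c :: real
  by (simp add: abs_mult mult_left_le_one_le)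

lemma exp_kernel_integral:
  fixes l s t :: real
  assumes "s <= t"
  shows "(LBINT r:{s<..<t}. l * exp (- (l * (r - s)))) = 1 - exp (- (l * (t - s)))"
proof -
  have "(\<integral>r. (l * exp (- (l * (r - s)))) * indicator {s..t} r \<partial>lborel)
      = - exp (- (l * (t - s))) - - exp (- (l * (s - s)))"
    by (rule integral_FTC_Icc_real[OF assms])
      (auto intro!: derivative_eq_intros continuous_intros simp: mult.commute)
  moreover have "(\<integral>r. (l * exp (- (l * (r - s)))) * indicator {s..t} r \<partial>lborel) = (LBINT r:{s<..<t}. l * exp (- (l * (r - s))))"
    by (rule integral_Icc_eq_Ioo) measurable
  ultimately show ?thesis by simp
qed

text \<open>Variation of constants: the solution of a' + l a = \<phi> with a(0) = 0, that is, one
  mode of the inhomogeneous heat equation.\<close>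

definition duhamel :: "real => (real => real) => real => real" where
  "duhamel l \<phi> t = (LBINT s:{0<..<t}. exp (- (l * (t - s))) * \<phi> s)"

lemma duhamel_factor: "duhamel l \<phi> t = exp (- (l * t)) * (LBINT s:{0<..<t}. exp (l * s) * \<phi> s)"
proof -
  have "exp (- (l * (t - s))) * \<phi> s = exp (- (l * t)) * (exp (l * s) * \<phi> s)" for s
    by (simp add: algebra_simps flip: exp_add)
  then show ?thesis unfolding duhamel_def by (simp only: set_integral_mult_right)
qed

context
  fixes l B :: real and \<phi> :: "real => real"
  assumes l: "0 <= l" and \<phi>[measurable]: "\<phi> \<in> borel_measurable borel" and B: "\<And>s. \<bar>\<phi> s\<bar> <= B"
begin

lemma B0: "0 <= B" using B[of 0] by simp

lemma continuous_on_duhamel: "continuous_on {0..T} (duhamel l \<phi>)"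
proof (cases "0 <= T")
  case True
  \<comment> \<open>Writing \<open>min s T\<close> keeps the exponential bounded on the whole line
    without changing the integrand before \<open>T\<close>.\<close>
  define \<psi> where "\<psi> s = exp (l * min s T) * \<phi> s" for s
  have "\<bar>\<psi> s\<bar> <= exp (l * T) * B" for s
    unfolding \<psi>_def abs_mult using B[of s] l True
    by (intro mult_mono) (auto intro: mult_left_mono)
  then have "continuous_on {0..} (%t. LBINT s:{0<..<t}. \<psi> s)"
    by (intro continuous_on_integral_Ioo) (auto simp: \<psi>_def)
  then have "continuous_on {0..T} (%t. exp (- (l * t)) * (LBINT s:{0<..<t}. \<psi> s))"
    by (intro continuous_intros) (auto elim: continuous_on_subset)
  moreover have "exp (- (l * t)) * (LBINT s:{0<..<t}. \<psi> s) = duhamel l \<phi> t" if "t \<in> {0..T}" for t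
    unfolding duhamel_factor \<psi>_def using that
    by (intro arg_cong2[where f = "(*)"] set_lebesgue_integral_cong) auto
  ultimately show ?thesis by (rule continuous_on_eq)
qed simp

text \<open>Fubini on the triangle s < r < t: integrating the kernel in \<open>r\<close> gives
  \<open>1 - exp (- (l * (t - s)))\<close>, whose two summands produce the source and the solution.
  The equation is kept in integrated form because \<open>\<phi>\<close> is merely
  measurable.\<close>

lemma duhamel_equation:
  assumes "0 <= t"
  shows "duhamel l \<phi> t + l * (LBINT s:{0<..<t}. duhamel l \<phi> s) = (LBINT s:{0<..<t}. \<phi> s)"
proof -
  let ?I = "{0<..<t}"
  define F where "F r s = (indicator ?I r * indicator ?I s) * (if s < r then l * exp (- (l * (r - s))) * \<phi> s else 0)" for r s
  have "integrable (lborel \<Otimes>\<^sub>M lborel) (%x. indicator (?I \<times> ?I) x *\<^sub>R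
      (case x of (r, s) => (if s < r then l * exp (- (l * (r - s))) * \<phi> s else 0)))"
  proof (rule integrableI_bounded_set_indicator[where B = "l * B"])
    show "?I \<times> ?I \<in> sets (lborel \<Otimes>\<^sub>M lborel)" by (intro pair_measureI) auto
    have "emeasure (lborel \<Otimes>\<^sub>M lborel) (?I \<times> ?I) = emeasure lborel ?I * emeasure lborel ?I"
      by (intro lborel.emeasure_pair_measure_Times) auto
    also have "\<dots> < \<infinity>" using emeasure_Ioo_finite[of 0 t] by (simp add: ennreal_mult_less_top)
    finally show "emeasure (lborel \<Otimes>\<^sub>M lborel) (?I \<times> ?I) < \<infinity>" .
    have "\<bar>if s < r then l * exp (- (l * (r - s))) * \<phi> s else 0\<bar> <= l * B" for r s
      using exp_kernel_le[OF l, of s r "\<phi> s"] B[of s] B0 l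
      by (auto simp: abs_mult mult.assoc intro!: mult_left_mono)
    then show "AE x in lborel \<Otimes>\<^sub>M lborel. x \<in> ?I \<times> ?I -->
      norm (case x of (r, s) => if s < r then l * exp (- (l * (r - s))) * \<phi> s else 0) <= l * B"
      by (intro AE_I2) auto
  qed (measurable)
  then have "integrable (lborel \<Otimes>\<^sub>M lborel) (%(r, s). F r s)"
    by (rule Bochner_Integration.integrable_cong[THEN iffD1, rotated -1])
      (auto simp: F_def indicator_def)
  then have "(\<integral>s. (\<integral>r. F r s \<partial>lborel) \<partial>lborel) = (\<integral>r. (\<integral>s. F r s \<partial>lborel) \<partial>lborel)"
    by (rule lborel_pair.Fubini_integral)
  moreover have "(\<integral>s. F r s \<partial>lborel) = indicator ?I r * (l * duhamel l \<phi> r)" for r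
  proof (cases "r \<in> ?I")
    case True
    have "(\<integral>s. F r s \<partial>lborel) = (LBINT s:{0<..<r}. l * (exp (- (l * (r - s))) * \<phi> s))"
      unfolding set_lebesgue_integral_def
      by (intro Bochner_Integration.integral_cong) (use True in \<open>auto simp: F_def indicator_def\<close>)
    then show ?thesis using True by (simp add: duhamel_def)
  qed (simp add: F_def)
  moreover have "(\<integral>r. F r s \<partial>lborel) = indicator ?I s * (\<phi> s - exp (- (l * (t - s))) * \<phi> s)" for s
  proof (cases "s \<in> ?I")
    case True
    have "(\<integral>r. F r s \<partial>lborel) = (LBINT r:{s<..<t}. l * exp (- (l * (r - s))) * \<phi> s)"
      unfolding set_lebesgue_integral_def
      by (intro Bochner_Integration.integral_cong) (use True in \<open>auto simp: F_def indicator_def\<close>)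
    also have "\<dots> = (1 - exp (- (l * (t - s)))) * \<phi> s"
      using True by (simp only: set_integral_mult_left exp_kernel_integral greaterThanLessThan_iff less_imp_le)
    finally show ?thesis using True by (simp add: algebra_simps)
  qed (simp add: F_def)
  ultimately have *: "(LBINT s:?I. \<phi> s - exp (- (l * (t - s))) * \<phi> s) = l * (LBINT r:?I. duhamel l \<phi> r)"
    by (simp add: set_lebesgue_integral_def mult.left_commute)
  have "set_integrable lborel ?I \<phi>"
    by (rule set_integrable_bounded[where B = B]) (use B in \<open>auto simp: emeasure_Ioo_finite\<close>)
  moreover have "set_integrable lborel ?I (%s. exp (- (l * (t - s))) * \<phi> s)"
    by (rule set_integrable_bounded[where B = B])
      (use order_trans[OF exp_kernel_le[OF l] B] in \<open>auto simp: emeasure_Ioo_finite\<close>)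
  ultimately show ?thesis using * by (simp add: duhamel_def set_integral_diff)
qed

text \<open>Cauchy-Schwarz with respect to the exponential kernel, whose mass \<open>m\<close>
  satisfies both \<open>m <= T\<close> and \<open>l * m <= 1\<close>. The second bound gains the
  factor \<open>l\<close>: a source that is square integrable in time yields a solution bounded in
  the form norm uniformly in time.\<close>

lemma duhamel_sq_le:
  assumes t: "0 <= t" "t <= T"
  shows "(1 + l) * (duhamel l \<phi> t)\<^sup>2 <= (1 + T) * (LBINT s:{0<..<T}. (\<phi> s)\<^sup>2)"
proof (cases "t = 0")
  case True
  then show ?thesis using t
    by (simp add: duhamel_def set_lebesgue_integral_def)
next
  case False
  let ?I = "{0<..<t}"
  define k where "k s = exp (- (l * (t - s)))" for s
  have [measurable]: "k \<in> borel_measurable borel" unfolding k_def by measurable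
  have k: "0 < k s" "s \<in> ?I ==> k s <= 1" for s using l by (auto simp: k_def)
  have B2: "\<bar>(\<phi> s)\<^sup>2\<bar> <= B\<^sup>2" for s using B[of s] by (simp add: abs_le_square_iff[symmetric] B0)
  have kint: "set_integrable lborel ?I (%s. k s * f s)"
    if "f \<in> borel_measurable borel" "\<And>s. \<bar>f s\<bar> <= C" for f C
  proof (rule set_integrable_bounded[where B = C])
    fix s assume "s \<in> ?I"
    then have "k s * \<bar>f s\<bar> <= 1 * C" using k[of s] that(2)[of s] by (intro mult_mono) auto
    then show "norm (k s * f s) <= C" using k(1)[of s] by (simp add: abs_mult)
  qed (use that(1) in \<open>auto simp: emeasure_Ioo_finite\<close>)
  have int: "set_integrable lborel ?I (%s. k s * \<phi> s)" "set_integrable lborel ?I (%s. k s * (\<phi> s)\<^sup>2)"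
    using B B2 by (auto intro!: kint)
  have int1: "set_integrable lborel ?I k" using kint[of "%_. 1" 1] by simp
  define m where "m = (LBINT s:?I. k s)"
  define a where "a = duhamel l \<phi> t"
  define b where "b = (LBINT s:?I. k s * (\<phi> s)\<^sup>2)"
  have a: "a = (LBINT s:?I. k s * \<phi> s)" by (simp add: a_def duhamel_def k_def)
  have lm: "l * m = 1 - exp (- (l * t))"
  proof -
    have "duhamel l (%_. 1) t = m" by (simp add: duhamel_def m_def k_def)
    moreover have "l * m = (LBINT s:?I. l * k s)" by (simp add: m_def)
    moreover have "(\<integral>r. (l * exp (- (l * (t - r)))) * indicator {0..t} r \<partial>lborel)
      = exp (- (l * (t - t))) - exp (- (l * (t - 0)))"
      by (rule integral_FTC_Icc_real[OF t(1)])
        (auto intro!: derivative_eq_intros continuous_intros simp: mult.commute)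
    moreover have "(\<integral>r. (l * exp (- (l * (t - r)))) * indicator {0..t} r \<partial>lborel) = (LBINT s:?I. l * k s)"
      unfolding k_def by (rule integral_Icc_eq_Ioo) measurable
    ultimately show ?thesis by (simp add: m_def)
  qed
  then have lm1: "l * m <= 1" by simp
  have "m <= (LBINT s:?I. 1)"
    unfolding m_def using int1 k
    by (intro set_integral_mono) (auto intro!: set_integrable_bounded[where B = 1] simp: emeasure_Ioo_finite)
  then have mT: "m <= T" using t by (simp add: set_integral_Ioo_const)
  have mpos: "0 < m"
  proof -
    have "(LBINT s:?I. exp (- (l * t))) <= m"
      unfolding m_def using int1 k l
      by (intro set_integral_mono)
        (auto intro!: set_integrable_bounded[where B = 1] mult_left_mono simp: emeasure_Ioo_finite k_def)
    moreover have "0 < (LBINT s:?I. exp (- (l * t)))" using t False by (simp add: set_integral_Ioo_const)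
    ultimately show ?thesis by simp
  qed
  \<comment> \<open>Cauchy-Schwarz as nonnegativity of the variance of \<open>\<phi>\<close> about
    its mean \<open>a / m\<close> for the weight \<open>k\<close>.\<close>
  have "0 <= (LBINT s:?I. k s * (\<phi> s - a / m)\<^sup>2)"
    using k(1) by (intro set_integral_nonneg) (auto simp: less_imp_le)
  also have "\<dots> = (LBINT s:?I. (k s * (\<phi> s)\<^sup>2 - (2 * (a / m)) * (k s * \<phi> s)) + (a / m)\<^sup>2 * k s)"
    by (simp add: power2_diff algebra_simps)
  also have "\<dots> = b - 2 * (a / m) * a + (a / m)\<^sup>2 * m"
    using int int1 by (simp add: set_integral_add set_integral_diff b_def a m_def)
  also have "\<dots> = b - a\<^sup>2 / m" using mpos by (simp add: field_simps power2_eq_square)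
  finally have "a\<^sup>2 <= b * m" using mpos by (simp add: field_simps)
  then have "(1 + l) * a\<^sup>2 <= (1 + l) * (b * m)" using l by (intro mult_left_mono) auto
  also have "\<dots> = (m + l * m) * b" by (simp add: algebra_simps)
  also have "\<dots> <= (1 + T) * (LBINT s:{0<..<T}. (\<phi> s)\<^sup>2)"
  proof (intro mult_mono)
    show "m + l * m <= 1 + T" using lm1 mT by simp
    have i2: "set_integrable lborel {0<..<c} (%s. (\<phi> s)\<^sup>2)" for c
      using B2 by (intro set_integrable_bounded[where B = "B\<^sup>2"]) (auto simp: emeasure_Ioo_finite)
    have "b <= (LBINT s:?I. (\<phi> s)\<^sup>2)"
      unfolding b_def using int i2 k
      by (intro set_integral_mono) (auto intro!: mult_left_le_one_le simp: less_imp_le)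
    also have "\<dots> <= (LBINT s:{0<..<T}. (\<phi> s)\<^sup>2)"
      using i2[of T] t set_integral_Ioo_split[of 0 T "%s. (\<phi> s)\<^sup>2" t]
        set_integral_nonneg[of "{t<..<T}" "%s. (\<phi> s)\<^sup>2" lborel] by simp
    finally show "b <= (LBINT s:{0<..<T}. (\<phi> s)\<^sup>2)" .
    show "0 <= 1 + T" using t by simp
    show "0 <= b" unfolding b_def using k(1) by (intro set_integral_nonneg) (auto simp: less_imp_le)
  qed
  finally show ?thesis by (simp add: a_def)
qed

text \<open>The difference \<open>b\<close> of two solutions equals -l times its own integral from
  0, so exp(l r) times that integral has zero derivative and vanishes at 0. Continuity of
  \<open>a\<close> allows differentiating the integral at every point.\<close>

lemma duhamel_unique:
  assumes a: "continuous_on {0..T} a"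
    and eq: "\<And>t. t \<in> {0..T} ==> a t + l * (LBINT s:{0<..<t}. a s) = (LBINT s:{0<..<t}. \<phi> s)"
    and t: "t \<in> {0..T}"
  shows "a t = duhamel l \<phi> t"
proof -
  define b where "b s = a s - duhamel l \<phi> s" for s
  have b: "continuous_on {0..T} b" unfolding b_def using a continuous_on_duhamel by (intro continuous_intros)
  have Ioo: "(LBINT s:{0<..<r}. f s) = integral {0..r} f" if "continuous_on {0..T} f" "r \<in> {0..T}" for f :: "real => real" and r
  proof -
    have c: "continuous_on {0..r} f" using that by (auto elim: continuous_on_subset)
    then have i: "set_integrable lborel {0..r} f" by (rule borel_integrable_atLeastAtMost')
    have "(LBINT s:{0<..<r}. f s) = (LBINT s:{0..r}. f s)"
    proof -
      have "AE x in lborel. x \<noteq> 0 \<and> x \<noteq> r" by (intro AE_conjI AE_lborel_singleton)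
      then have ae: "AE x in lborel. indicator {0<..<r} x *\<^sub>R f x = indicator {0..r} x *\<^sub>R f x"
        by eventually_elim (auto simp: indicator_def)
      have "set_integrable lborel {0<..<r} f" by (rule set_integrable_subset[OF i]) auto
      then show ?thesis using i ae unfolding set_lebesgue_integral_def set_integrable_def
        by (intro integral_cong_AE) auto
    qed
    then show ?thesis using set_borel_integral_eq_integral(2)[OF i] by simp
  qed
  have eqb: "b r = - l * integral {0..r} b" if "r \<in> {0..T}" for r
  proof -
    have "a r + l * integral {0..r} a = duhamel l \<phi> r + l * integral {0..r} (duhamel l \<phi>)"
      using eq[OF that] duhamel_equation[of r] that Ioo[OF a that] Ioo[OF continuous_on_duhamel that] by simp
    moreover have "integral {0..r} b = integral {0..r} a - integral {0..r} (duhamel l \<phi>)"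
      unfolding b_def using a continuous_on_duhamel that
      by (intro Henstock_Kurzweil_Integration.integral_diff integrable_continuous_interval)
        (auto elim: continuous_on_subset)
    moreover from this have "l * integral {0..r} b = l * integral {0..r} a - l * integral {0..r} (duhamel l \<phi>)"
      by (simp add: right_diff_distrib)
    ultimately have "a r - duhamel l \<phi> r = - l * integral {0..r} b" by linarith
    then show ?thesis by (simp add: b_def)
  qed
  have d: "((%r. integral {0..r} b) has_real_derivative b r) (at r within {0..T})" if "r \<in> {0..T}" for r
    using integral_has_real_derivative[OF b that] .
  have "((%r. exp (l * r) * integral {0..r} b) has_real_derivative 0) (at r within {0..T})" if "r \<in> {0..T}" for r
    using eqb[OF that] by (auto intro!: derivative_eq_intros d[OF that])
  then obtain c where c: "\<And>r. r \<in> {0..T} ==> exp (l * r) * integral {0..r} b = c"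
    using has_field_derivative_zero_constant[of "{0..T}" "%r. exp (l * r) * integral {0..r} b"] by blast
  have "c = 0" using c[of 0] t by auto
  then have "integral {0..t} b = 0" using c[OF t] by simp
  then show ?thesis using eqb[OF t] by (simp add: b_def)
qed

end

section \<open>The inhomogeneous equation, solved mode by mode\<close>

locale heat_source = form_spectrum V e g l
  for V :: "('h::{real_inner,banach} \<times> 'w::{real_inner,banach}) set"
    and e :: "nat => 'h" and g :: "nat => 'w" and l :: "nat => real" +
  fixes L :: "real => 'h" and B T :: real
  assumes L_meas [measurable]: "\<And>v. (%s. L s \<bullet> v) \<in> borel_measurable borel"
    and L_bd: "\<And>s. norm (L s) <= B" and T0: "0 <= T"
begin

lemma L_inner_bd: "\<bar>L s \<bullet> v\<bar> <= B * norm v"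
  using Cauchy_Schwarz_ineq2[of "L s" v] L_bd[of s] mult_right_mono[of "norm (L s)" B "norm v"] by simp

lemma L_coeff_bd: "\<bar>L s \<bullet> e k\<bar> <= B"
  using L_inner_bd[of s "e k"] norm_e_le[of k] L_bd[of s] mult_left_mono[of "norm (e k)" 1 B]
    norm_ge_zero[of "L s"] by linarith

definition coef :: "nat => real => real" where
  "coef k = duhamel (l k) (%s. L s \<bullet> e k)"

text \<open>A bound for the squared form norm of the k-th term that does not depend on time. It is
  the majorant for \<open>orthogonal_series\<close> and makes the solution continuous with values in
  \<open>V\<close>.\<close>

definition coef_bd :: "nat => real" where
  "coef_bd k = (1 + T) * (LBINT s:{0<..<T}. (L s \<bullet> e k)\<^sup>2)"

lemma coef_le: "0 <= t ==> t <= T ==> (coef k t)\<^sup>2 * (norm (e k, g k))\<^sup>2 <= coef_bd k"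
proof -
  assume t: "0 <= t" "t <= T"
  have "(1 + l k) * (coef k t)\<^sup>2 <= coef_bd k"
    unfolding coef_def coef_bd_def by (rule duhamel_sq_le) (use l0 L_coeff_bd t in auto)
  moreover have "(coef k t)\<^sup>2 * (norm (e k, g k))\<^sup>2 <= (1 + l k) * (coef k t)\<^sup>2"
  proof -
    have "(norm (e k))\<^sup>2 <= 1" using norm_e_le[of k] by (simp add: power_le_one)
    then have "((1 + l k) * (coef k t)\<^sup>2) * (norm (e k))\<^sup>2 <= (1 + l k) * (coef k t)\<^sup>2"
      using l0[of k] by (intro mult_left_le) auto
    then show ?thesis unfolding norm_z by (simp add: mult_ac)
  qed
  ultimately show ?thesis by simp
qed

text \<open>Bessel's inequality for \<open>L s\<close> at each time, integrated over the time
  interval.\<close>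

lemma coef_bd_summable: "summable coef_bd"
proof -
  have B0: "0 <= B" using L_bd[of 0] norm_ge_zero order_trans by blast
  have i: "set_integrable lborel {0<..<T} (%s. (L s \<bullet> e k)\<^sup>2)" for k
  proof (rule set_integrable_bounded[where B = "B\<^sup>2"])
    show "norm ((L s \<bullet> e k)\<^sup>2) <= B\<^sup>2" for s
      using L_coeff_bd[of s k] power_mono[of "\<bar>L s \<bullet> e k\<bar>" B 2] by simp
  qed (auto simp: emeasure_Ioo_finite)
  have "summable (%k. LBINT s:{0<..<T}. (L s \<bullet> e k)\<^sup>2)"
  proof (rule summableI_nonneg_bounded)
    fix n
    have "(\<Sum>k<n. LBINT s:{0<..<T}. (L s \<bullet> e k)\<^sup>2) = (LBINT s:{0<..<T}. (\<Sum>k<n. (L s \<bullet> e k)\<^sup>2))"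
      using i unfolding set_lebesgue_integral_def set_integrable_def scaleR_sum_right
      by (subst Bochner_Integration.integral_sum) auto
    also have "\<dots> <= (LBINT s:{0<..<T}. B\<^sup>2)"
    proof (rule set_integral_mono)
      show "set_integrable lborel {0<..<T} (%s. \<Sum>k<n. (L s \<bullet> e k)\<^sup>2)"
        using i unfolding set_integrable_def scaleR_sum_right by (intro Bochner_Integration.integrable_sum)
      show "set_integrable lborel {0<..<T} (%s. B\<^sup>2)"
        by (rule set_integrable_bounded[where B = "B\<^sup>2"]) (auto simp: emeasure_Ioo_finite)
      show "(\<Sum>k<n. (L s \<bullet> e k)\<^sup>2) <= B\<^sup>2" for s
        using bessel_finite[of "{..<n}" "L s"] L_bd[of s] power_mono[of "norm (L s)" B 2] by simp
    qed
    finally show "(\<Sum>k<n. LBINT s:{0<..<T}. (L s \<bullet> e k)\<^sup>2) <= (LBINT s:{0<..<T}. B\<^sup>2)" .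
  qed (auto intro!: set_integral_nonneg)
  then show ?thesis unfolding coef_bd_def by (rule summable_mult)
qed

lemma coef_cont: "continuous_on {0..T} (coef k)"
  unfolding coef_def by (rule continuous_on_duhamel) (use l0 L_coeff_bd in auto)

lemma coef_equation:
  assumes "0 <= t"
  shows "coef k t + l k * (LBINT s:{0<..<t}. coef k s) = (LBINT s:{0<..<t}. L s \<bullet> e k)"
  unfolding coef_def by (rule duhamel_equation) (use l0 L_coeff_bd assms in auto)

lemma coef_unique:
  assumes "continuous_on {0..T} a" "t \<in> {0..T}"
    and "\<And>t. t \<in> {0..T} ==> a t + l k * (LBINT s:{0<..<t}. a s) = (LBINT s:{0<..<t}. L s \<bullet> e k)"
  shows "a t = coef k t"
  unfolding coef_def by (rule duhamel_unique[where B = B]) (use l0 L_coeff_bd assms in auto)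

definition part :: "nat => real => 'h \<times> 'w" where
  "part n t = (\<Sum>k<n. coef k t *\<^sub>R (e k, g k))"

text \<open>The first component is the solution, the second its gradient. Convergence takes place in
  the product space, uniformly on \<open>{0..T}\<close>, so both components are continuous in
  time.\<close>

definition sol :: "real => 'h \<times> 'w" where
  "sol t = (\<Sum>k. coef k t *\<^sub>R (e k, g k))"

definition tail :: "nat => real" where "tail n = (\<Sum>k. coef_bd (k + n))"

lemma tail_lim: "tail \<longlonglongrightarrow> 0"
  unfolding tail_def by (rule suminf_exist_split2[OF coef_bd_summable])

lemma part_sol: "0 <= t ==> t <= T ==> (norm (sol t - part n t))\<^sup>2 <= tail n"
  unfolding sol_def part_def tail_def
  by (rule orthogonal_series(2)[of "%k. (e k, g k)", OF orth_z_all coef_le coef_bd_summable])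

lemma part_lim:
  assumes "0 <= t" "t <= T"
  shows "(%n. part n t) \<longlonglongrightarrow> sol t"
  unfolding part_def sol_def
  by (rule summable_LIMSEQ orthogonal_series(1)[of "%k. (e k, g k)", OF orth_z_all coef_le[OF assms] coef_bd_summable])+

lemma part_in_V: "part n t \<in> V"
  unfolding part_def by (intro subspace_sum subspace_scale subV eV)

lemma sol_in_V: "0 <= t ==> t <= T ==> sol t \<in> V"
  using part_lim part_in_V closedV by (meson closed_sequentially)

lemma part_bd: "0 <= t ==> t <= T ==> (norm (part n t))\<^sup>2 <= (\<Sum>k. coef_bd k)"
proof -
  assume t: "0 <= t" "t <= T"
  have "(norm (part n t))\<^sup>2 = (\<Sum>k<n. (coef k t)\<^sup>2 * (norm (e k, g k))\<^sup>2)"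
    unfolding part_def by (rule orthogonal_norm_sum[OF orth_z_all]) simp
  also have "\<dots> <= (\<Sum>k<n. coef_bd k)" by (intro sum_mono coef_le t)
  also have "\<dots> <= (\<Sum>k. coef_bd k)"
  proof (rule sum_le_suminf[OF coef_bd_summable])
    show "0 <= coef_bd k" for k
      using coef_le[OF t, of k] by (meson order_trans zero_le_mult_iff zero_le_power2)
  qed simp
  finally show ?thesis .
qed

lemma sol_bd: "0 <= t ==> t <= T ==> (norm (sol t))\<^sup>2 <= (\<Sum>k. coef_bd k)"
proof -
  assume t: "0 <= t" "t <= T"
  have "(%n. (norm (part n t))\<^sup>2) \<longlonglongrightarrow> (norm (sol t))\<^sup>2" by (intro tendsto_intros part_lim t)
  then show ?thesis by (rule LIMSEQ_le_const2) (use part_bd[OF t] in auto)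
qed

lemma sol_cont: "continuous_on {0..T} sol"
proof (rule uniform_limit_theorem)
  show "\<forall>\<^sub>F n in sequentially. continuous_on {0..T} (part n)"
    unfolding part_def[abs_def] by (intro always_eventually allI continuous_intros coef_cont)
  show "uniform_limit {0..T} part sol sequentially"
  proof (rule uniform_limitI)
    fix \<epsilon> :: real assume \<epsilon>: "0 < \<epsilon>"
    then have "\<forall>\<^sub>F n in sequentially. tail n < \<epsilon>\<^sup>2"
      using order_tendstoD(2)[OF tail_lim, of "\<epsilon>\<^sup>2"] by simp
    then show "\<forall>\<^sub>F n in sequentially. \<forall>t\<in>{0..T}. dist (part n t) (sol t) < \<epsilon>"
    proof eventually_elim
      case (elim n)
      show ?case
      proof
        fix t assume "t \<in> {0..T}"
        then have "(norm (sol t - part n t))\<^sup>2 < \<epsilon>\<^sup>2" using part_sol[of t n] elim by simp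
        then have "norm (sol t - part n t) < \<epsilon>" by (rule power2_less_imp_less) (use \<epsilon> in simp)
        then show "dist (part n t) (sol t) < \<epsilon>" by (simp add: dist_norm norm_minus_commute)
      qed
    qed
  qed
qed auto

lemma sol_0: "sol 0 = 0"
  by (simp add: sol_def coef_def duhamel_def set_lebesgue_integral_def flip: zero_prod_def)

lemma bounded_family_integral_lim:
  fixes f :: "nat => real => real"
  assumes t: "0 <= t" and [measurable]: "\<And>n. set_borel_measurable lborel {0<..<t} (f n)" "set_borel_measurable lborel {0<..<t} F"
    and lim: "\<And>s. s \<in> {0<..<t} ==> (%n. f n s) \<longlonglongrightarrow> F s"
    and bd: "\<And>n s. s \<in> {0<..<t} ==> \<bar>f n s\<bar> <= C"
  shows "(%n. LBINT s:{0<..<t}. f n s) \<longlonglongrightarrow> (LBINT s:{0<..<t}. F s)"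
  unfolding set_lebesgue_integral_def
proof (rule integral_dominated_convergence[where w = "%s. indicator {0<..<t} s * \<bar>C\<bar>"])
  show "integrable lborel (%s. indicator {0<..<t} s * \<bar>C\<bar>)"
    using set_integrable_bounded[of "%_. \<bar>C\<bar>" "{0<..<t}" "\<bar>C\<bar>"] by (simp add: set_integrable_def emeasure_Ioo_finite)
  show "AE s in lborel. (%n. indicator {0<..<t} s *\<^sub>R f n s) \<longlonglongrightarrow> indicator {0<..<t} s *\<^sub>R F s"
    using lim by (intro AE_I2) (auto simp: indicator_def)
  show "AE s in lborel. norm (indicator {0<..<t} s *\<^sub>R f n s) <= indicator {0<..<t} s * \<bar>C\<bar>" for n
    using order_trans[OF bd[of _ n] abs_ge_self] by (intro AE_I2) (auto simp: indicator_def)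
qed (use assms(2,3) in \<open>auto simp: set_borel_measurable_def\<close>)

text \<open>For the partial sums this is the sum over \<open>k\<close> of the equations
  \<open>coef_equation\<close> with weights \<open>v \<bullet> e k\<close>; the source is then
  tested with the partial expansion of \<open>v\<close>. Both time integrals pass to the limit by
  dominated convergence.\<close>

lemma sol_equation:
  assumes vh: "(v, h) \<in> V" and t: "0 <= t" "t <= T"
  shows "fst (sol t) \<bullet> v + (LBINT s:{0<..<t}. snd (sol s) \<bullet> h) = (LBINT s:{0<..<t}. L s \<bullet> v)"
proof -
  have ic: "set_integrable lborel {0<..<t} (coef k)" for k
  proof -
    have "continuous_on {0..t} (coef k)" using coef_cont[of k] t by (auto elim: continuous_on_subset)
    then have "set_integrable lborel {0..t} (coef k)" by (rule borel_integrable_atLeastAtMost')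
    then show ?thesis by (rule set_integrable_subset) auto
  qed
  have part_snd: "snd (part n s) \<bullet> h = (\<Sum>k<n. coef k s * (l k * (v \<bullet> e k)))" for n s
    using eig[OF vh] by (simp add: part_def snd_sum inner_sum_left inner_commute[of "g _" h])
  have part_fst: "fst (part n s) \<bullet> v = (\<Sum>k<n. coef k s * (v \<bullet> e k))" for n s
    by (simp add: part_def fst_sum inner_sum_left inner_commute[of "e _" v])
  have eq: "fst (part n t) \<bullet> v + (LBINT s:{0<..<t}. snd (part n s) \<bullet> h)
    = (LBINT s:{0<..<t}. L s \<bullet> (\<Sum>k<n. (v \<bullet> e k) *\<^sub>R e k))" for n
  proof -
    have "(LBINT s:{0<..<t}. snd (part n s) \<bullet> h) = (\<Sum>k<n. (LBINT s:{0<..<t}. coef k s) * (l k * (v \<bullet> e k)))"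
      unfolding part_snd using ic
      unfolding set_lebesgue_integral_def set_integrable_def scaleR_sum_right
      by (subst Bochner_Integration.integral_sum) (auto simp: mult.assoc[symmetric])
    moreover have "(LBINT s:{0<..<t}. L s \<bullet> (\<Sum>k<n. (v \<bullet> e k) *\<^sub>R e k))
      = (\<Sum>k<n. (LBINT s:{0<..<t}. L s \<bullet> e k) * (v \<bullet> e k))"
    proof -
      have "set_integrable lborel {0<..<t} (%s. L s \<bullet> e k)" for k
        by (rule set_integrable_bounded[where B = B]) (use L_coeff_bd in \<open>auto simp: emeasure_Ioo_finite\<close>)
      then show ?thesis
        unfolding set_lebesgue_integral_def set_integrable_def inner_sum_right scaleR_sum_right
        by (subst Bochner_Integration.integral_sum) (auto simp: mult.assoc[symmetric] mult.commute[of "v \<bullet> _"])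
    qed
    ultimately show ?thesis
      unfolding part_fst coef_equation[OF t(1), symmetric] by (simp add: algebra_simps flip: sum.distrib)
  qed
  have "(%n. fst (part n t) \<bullet> v + (LBINT s:{0<..<t}. snd (part n s) \<bullet> h))
    \<longlonglongrightarrow> fst (sol t) \<bullet> v + (LBINT s:{0<..<t}. snd (sol s) \<bullet> h)"
  proof (intro tendsto_add tendsto_inner tendsto_fst part_lim t tendsto_const)
    have m: "set_borel_measurable lborel {0<..<t} (%s. f s \<bullet> h)" if "continuous_on {0..T} f" for f :: "real => 'w"
    proof -
      have "continuous_on {0..t} (%s. f s \<bullet> h)"
        using that t by (intro continuous_intros) (auto elim: continuous_on_subset)
      then have "set_integrable lborel {0..t} (%s. f s \<bullet> h)" by (rule borel_integrable_atLeastAtMost')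
      then have "set_integrable lborel {0<..<t} (%s. f s \<bullet> h)" by (rule set_integrable_subset) auto
      then show ?thesis unfolding set_integrable_def set_borel_measurable_def by auto
    qed
    show "(%n. LBINT s:{0<..<t}. snd (part n s) \<bullet> h) \<longlonglongrightarrow> (LBINT s:{0<..<t}. snd (sol s) \<bullet> h)"
    proof (rule bounded_family_integral_lim[OF t(1), where C = "sqrt (\<Sum>k. coef_bd k) * norm h"])
      show "set_borel_measurable lborel {0<..<t} (%s. snd (part n s) \<bullet> h)" for n
        by (rule m) (auto simp: part_def intro!: continuous_intros coef_cont)
      show "set_borel_measurable lborel {0<..<t} (%s. snd (sol s) \<bullet> h)"
        by (rule m) (intro continuous_intros sol_cont)
      show "(%n. snd (part n s) \<bullet> h) \<longlonglongrightarrow> snd (sol s) \<bullet> h" if "s \<in> {0<..<t}" for s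
        using that t by (intro tendsto_inner tendsto_snd part_lim tendsto_const) auto
      show "\<bar>snd (part n s) \<bullet> h\<bar> <= sqrt (\<Sum>k. coef_bd k) * norm h" if "s \<in> {0<..<t}" for n s
      proof -
        have "norm (snd (part n s)) <= norm (part n s)" by (cases "part n s") (simp add: norm_Pair real_le_rsqrt)
        also have "\<dots> <= sqrt (\<Sum>k. coef_bd k)" using part_bd[of s n] that t by (simp add: real_le_rsqrt)
        finally show ?thesis
          using Cauchy_Schwarz_ineq2[of "snd (part n s)" h] mult_right_mono[of "norm (snd (part n s))" _ "norm h"]
          by (meson norm_ge_zero order_trans)
      qed
    qed
  qed
  moreover have "(%n. LBINT s:{0<..<t}. L s \<bullet> (\<Sum>k<n. (v \<bullet> e k) *\<^sub>R e k)) \<longlonglongrightarrow> (LBINT s:{0<..<t}. L s \<bullet> v)"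
  proof (rule bounded_family_integral_lim[OF t(1), where C = "B * norm v"])
    have mb: "set_borel_measurable lborel {0<..<t} (%s. L s \<bullet> w)" for w
      unfolding set_borel_measurable_def by measurable
    then show "set_borel_measurable lborel {0<..<t} (%s. L s \<bullet> (\<Sum>k<n. (v \<bullet> e k) *\<^sub>R e k))"
      "set_borel_measurable lborel {0<..<t} (%s. L s \<bullet> v)" for n by auto
    have "(%n. \<Sum>k<n. (v \<bullet> e k) *\<^sub>R e k) \<longlonglongrightarrow> v" using expand_V[OF vh] by (simp add: sums_def)
    then show "(%n. L s \<bullet> (\<Sum>k<n. (v \<bullet> e k) *\<^sub>R e k)) \<longlonglongrightarrow> L s \<bullet> v" for s
      by (intro tendsto_intros)
    show "\<bar>L s \<bullet> (\<Sum>k<n. (v \<bullet> e k) *\<^sub>R e k)\<bar> <= B * norm v" for n s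
    proof -
      have "(norm (\<Sum>k<n. (v \<bullet> e k) *\<^sub>R e k))\<^sup>2 <= (norm v)\<^sup>2"
        using orthogonal_norm_sum[OF orth_e_all, of "{..<n}" "%k. v \<bullet> e k"] bessel_finite[of "{..<n}" v]
        by (simp add: coeff_sq_norm_e)
      then have "norm (\<Sum>k<n. (v \<bullet> e k) *\<^sub>R e k) <= norm v" by (rule power2_le_imp_le) simp
      then have "B * norm (\<Sum>k<n. (v \<bullet> e k) *\<^sub>R e k) <= B * norm v"
        using order_trans[OF norm_ge_zero L_bd] by (intro mult_left_mono) auto
      then show ?thesis using L_inner_bd order_trans by blast
    qed
  qed
  ultimately show ?thesis unfolding eq by (rule LIMSEQ_unique)
qed

text \<open>Each coefficient at time \<open>T\<close> is an integral of the source against exp(-l (T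
  - s)). A multiplier is symmetric, so the exponential may be moved onto the coefficient of
  \<open>x\<close>, and the sum becomes the flow of \<open>x\<close> run for the remaining
  time.\<close>

lemma duality:
  "fst (sol T) \<bullet> x = (LBINT s:{0<..<T}. L s \<bullet> flow (T - s) x)"
proof -
  define y where "y n s = (\<Sum>k<n. (exp (- (l k * (T - s))) * (x \<bullet> e k)) *\<^sub>R e k)" for n s
  have "(%n. fst (part n T) \<bullet> x) \<longlonglongrightarrow> fst (sol T) \<bullet> x"
    using T0 by (intro tendsto_inner tendsto_fst part_lim tendsto_const) auto
  moreover have "fst (part n T) \<bullet> x = (LBINT s:{0<..<T}. L s \<bullet> y n s)" for n
  proof -
    have "set_integrable lborel {0<..<T} (%s. exp (- (l k * (T - s))) * (L s \<bullet> e k))" for k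
    proof (rule set_integrable_bounded[where B = B])
      show "norm (exp (- (l k * (T - s))) * (L s \<bullet> e k)) <= B" if "s \<in> {0<..<T}" for s
        using exp_kernel_le[OF l0[of k], of s T "L s \<bullet> e k"] L_coeff_bd[of s k] that
        by (simp add: abs_mult)
    qed (auto simp: emeasure_Ioo_finite)
    then have "(LBINT s:{0<..<T}. L s \<bullet> y n s) = (\<Sum>k<n. (LBINT s:{0<..<T}. exp (- (l k * (T - s))) * (L s \<bullet> e k)) * (x \<bullet> e k))"
      unfolding y_def set_lebesgue_integral_def set_integrable_def inner_sum_right scaleR_sum_right
      by (subst Bochner_Integration.integral_sum) (auto simp: mult_ac simp flip: integral_mult_left_zero)
    then show ?thesis
      by (simp add: part_def fst_sum inner_sum_left coef_def duhamel_def inner_commute[of "e _" x])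
  qed
  moreover have "(%n. LBINT s:{0<..<T}. L s \<bullet> y n s) \<longlonglongrightarrow> (LBINT s:{0<..<T}. L s \<bullet> flow (T - s) x)"
  proof -
    have lim: "(%n. L s \<bullet> y n s) \<longlonglongrightarrow> L s \<bullet> flow (T - s) x" if "s \<in> {0<..<T}" for s
      unfolding y_def flow_def mult_def using that
      by (intro tendsto_inner tendsto_const summable_LIMSEQ mult_summable[where B = 1] flow_bd) auto
    have m: "set_borel_measurable lborel {0<..<T} (%s. L s \<bullet> y n s)" for n
      unfolding y_def set_borel_measurable_def inner_sum_right inner_scaleR_right by measurable
    have m2: "set_borel_measurable lborel {0<..<T} (%s. L s \<bullet> flow (T - s) x)"
      unfolding set_borel_measurable_def
    proof (rule borel_measurable_LIMSEQ_metric)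
      show "(%s. indicator {0<..<T} s *\<^sub>R (L s \<bullet> y n s)) \<in> borel_measurable lborel" for n
        using m[of n] by (simp add: set_borel_measurable_def)
      show "(%n. indicator {0<..<T} s *\<^sub>R (L s \<bullet> y n s)) \<longlonglongrightarrow> indicator {0<..<T} s *\<^sub>R (L s \<bullet> flow (T - s) x)" for s
        using lim[of s] by (auto simp: indicator_def)
    qed
    show ?thesis
    proof (rule bounded_family_integral_lim[OF T0 m m2 lim, where C = "B * norm x"])
      fix n s assume s: "s \<in> {0<..<T}"
      have "(norm (y n s))\<^sup>2 = (\<Sum>k<n. (exp (- (l k * (T - s))) * (x \<bullet> e k))\<^sup>2 * (norm (e k))\<^sup>2)"
        unfolding y_def by (rule orthogonal_norm_sum[OF orth_e_all]) simp
      also have "\<dots> <= (\<Sum>k<n. 1\<^sup>2 * (x \<bullet> e k)\<^sup>2)"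
        using s by (intro sum_mono mult_bound_sq[of "%k. exp (- (l k * (T - s)))"] flow_bd) auto
      also have "\<dots> <= (norm x)\<^sup>2" using bessel_finite[of "{..<n}" x] by simp
      finally have "norm (y n s) <= norm x" by (rule power2_le_imp_le) simp
      then have "B * norm (y n s) <= B * norm x"
        using order_trans[OF norm_ge_zero L_bd] by (intro mult_left_mono) auto
      then show "\<bar>L s \<bullet> y n s\<bar> <= B * norm x" using L_inner_bd order_trans by blast
    qed
  qed
  ultimately show ?thesis using LIMSEQ_unique by force
qed

end

subsection \<open>The form domain of the Dirichlet Laplacian\<close>

definition restr :: "'a set => ('a => 'b::real_vector) => 'a => 'b" where
  "restr \<Omega> f = (%x. indicator \<Omega> x *\<^sub>R f x)"

lemma L2_on_iff: "L2_on \<Omega> f \<longleftrightarrow> L2_fun (restr \<Omega> f)"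
proof -
  have "(norm (indicator \<Omega> x *\<^sub>R f x))\<^sup>2 = indicator \<Omega> x *\<^sub>R (norm (f x))\<^sup>2" for x
    by (simp add: indicator_def)
  then show ?thesis
    by (simp add: L2_on_def L2_fun_def restr_def set_borel_measurable_def set_integrable_def)
qed

lemma has_derivative_imp_GDERIV_zero:
  assumes "GDERIV \<phi> x :> D" "open S" "x \<in> S" "\<And>y. y \<in> S ==> \<phi> y = 0"
  shows "D = 0"
proof -
  have "(\<phi> has_derivative (%h. 0)) (at x)"
    using has_derivative_transform_within_open[of "%_. 0" "%h. 0" x UNIV S \<phi>] assms by auto
  with assms(1) have "(%h. inner h D) = (%h. 0)"
    unfolding gderiv_def by (rule has_derivative_unique)
  then have "inner D D = 0" by metis
  then show ?thesis by simp
qed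

lemma C1_compactD:
  assumes "C1_compact \<Omega> \<phi> D"
  shows "continuous_on UNIV \<phi>" "continuous_on UNIV D"
    "\<exists>K. compact K \<and> K \<subseteq> \<Omega> \<and> (\<forall>x. x \<notin> K --> \<phi> x = 0 \<and> D x = 0)"
proof -
  from assms obtain K where g: "\<And>x. GDERIV \<phi> x :> D x" and D: "continuous_on UNIV D"
    and K: "compact K" "K \<subseteq> \<Omega>" "\<And>x. x \<notin> K ==> \<phi> x = 0"
    unfolding C1_compact_def by blast
  show "continuous_on UNIV D" by (rule D)
  show "continuous_on UNIV \<phi>"
    using g by (intro has_derivative_continuous_on) (auto simp: gderiv_def)
  have "D x = 0" if "x \<notin> K" for x
    by (rule has_derivative_imp_GDERIV_zero[OF g[of x], of "- K"]) (use K that in \<open>auto simp: compact_imp_closed\<close>)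
  then show "\<exists>K. compact K \<and> K \<subseteq> \<Omega> \<and> (\<forall>x. x \<notin> K --> \<phi> x = 0 \<and> D x = 0)"
    using K by blast
qed

lemma L2_fun_continuous_compact:
  fixes f :: "'a::euclidean_space => 'b::euclidean_space"
  assumes f: "continuous_on UNIV f" and K: "compact K" "\<And>x. x \<notin> K ==> f x = 0"
  shows "L2_fun f"
  unfolding L2_fun_def
proof
  show "f \<in> borel_measurable lborel" using f by (simp add: borel_measurable_continuous_onI)
  have "continuous_on K (%x. (norm (f x))\<^sup>2)"
    using f by (intro continuous_intros) (auto elim: continuous_on_subset)
  then have "integrable lborel (%x. indicator K x *\<^sub>R (norm (f x))\<^sup>2)"
    by (intro borel_integrable_compact K)
  moreover have "indicator K x *\<^sub>R (norm (f x))\<^sup>2 = (norm (f x))\<^sup>2" for x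
    using K(2)[of x] by (auto simp: indicator_def)
  ultimately show "integrable lborel (%x. (norm (f x))\<^sup>2)" by (simp only:)
qed

lemma C1_compact_L2_fun:
  assumes "C1_compact \<Omega> \<phi> D"
  shows "L2_fun \<phi>" "L2_fun D"
  using C1_compactD[OF assms] L2_fun_continuous_compact by metis+

lemma C1_compact_restr:
  assumes "C1_compact \<Omega> \<phi> D"
  shows "restr \<Omega> \<phi> = \<phi>" "restr \<Omega> D = D"
proof -
  from C1_compactD(3)[OF assms] obtain K where "K \<subseteq> \<Omega>" "\<And>x. x \<notin> K ==> \<phi> x = 0 \<and> D x = 0" by blast
  then show "restr \<Omega> \<phi> = \<phi>" "restr \<Omega> D = D"
    by (auto simp: restr_def fun_eq_iff indicator_def)
qed

lemma C1_compact_zero: "C1_compact \<Omega> (%x. 0) (%x. 0)"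
  unfolding C1_compact_def by (auto simp: GDERIV_const intro: exI[of _ "{}"])

lemma C1_compact_add:
  assumes "C1_compact \<Omega> \<phi> D" "C1_compact \<Omega> \<psi> E"
  shows "C1_compact \<Omega> (%x. \<phi> x + \<psi> x) (%x. D x + E x)"
proof -
  from assms obtain K L where "compact K" "K \<subseteq> \<Omega>" "\<And>x. x \<notin> K ==> \<phi> x = 0"
    "compact L" "L \<subseteq> \<Omega>" "\<And>x. x \<notin> L ==> \<psi> x = 0" unfolding C1_compact_def by blast
  then have "\<exists>K. compact K \<and> K \<subseteq> \<Omega> \<and> (\<forall>x. x \<notin> K --> \<phi> x + \<psi> x = 0)"
    by (intro exI[of _ "K \<union> L"]) auto
  then show ?thesis using assms unfolding C1_compact_def
    by (auto intro!: GDERIV_add continuous_intros)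
qed

lemma C1_compact_scaleR:
  assumes "C1_compact \<Omega> \<phi> D"
  shows "C1_compact \<Omega> (%x. c *\<^sub>R \<phi> x) (%x. c *\<^sub>R D x)"
proof -
  have "GDERIV (%x. c * \<phi> x) x :> c *\<^sub>R D x" for x
    using GDERIV_mult[OF GDERIV_const[of c x], of \<phi> "D x"] assms by (simp add: C1_compact_def)
  then show ?thesis using assms unfolding C1_compact_def
    by (auto intro!: continuous_intros)
qed

text \<open>H^1_0 as the graph of its gradient: a closed subspace of a product of Hilbert spaces,
  whose norm is the H^1 norm. This is the shape that \<open>compact_form_spectral\<close>
  expects.\<close>

definition form_dom :: "'a::euclidean_space set => (('a, real) L2 \<times> ('a, 'a) L2) set" where
  "form_dom \<Omega> = closure {(cls \<phi>, cls D) |\<phi> D. C1_compact \<Omega> \<phi> D}"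

lemma C1_in_form_dom: "C1_compact \<Omega> \<phi> D ==> (cls \<phi>, cls D) \<in> form_dom \<Omega>"
  unfolding form_dom_def by (intro closure_subset[THEN subsetD]) auto

lemma closed_form_dom: "closed (form_dom \<Omega>)"
  by (simp add: form_dom_def)

lemma subspace_closure_subspace:
  fixes S :: "'a::real_normed_vector set"
  assumes S: "subspace S"
  shows "subspace (closure S)"
  unfolding subspace_def
proof (intro conjI ballI allI)
  show "0 \<in> closure S" using subspace_0[OF S] closure_subset by blast
  fix x y assume "x \<in> closure S" "y \<in> closure S"
  then obtain f g where fg: "\<And>n::nat. f n \<in> S" "f \<longlonglongrightarrow> x" "\<And>n::nat. g n \<in> S" "g \<longlonglongrightarrow> y"
    unfolding closure_sequential by blast
  then have "(\<forall>n. f n + g n \<in> S) \<and> (%n. f n + g n) \<longlonglongrightarrow> x + y"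
    by (auto intro!: subspace_add[OF S] tendsto_intros)
  then show "x + y \<in> closure S" unfolding closure_sequential by (rule exI[of _ "%n. f n + g n"])
next
  fix c x assume "x \<in> closure S"
  then obtain f where f: "\<And>n::nat. f n \<in> S" "f \<longlonglongrightarrow> x"
    unfolding closure_sequential by blast
  then have "(\<forall>n. c *\<^sub>R f n \<in> S) \<and> (%n. c *\<^sub>R f n) \<longlonglongrightarrow> c *\<^sub>R x"
    by (auto intro!: subspace_scale[OF S] tendsto_intros)
  then show "c *\<^sub>R x \<in> closure S" unfolding closure_sequential by (rule exI[of _ "%n. c *\<^sub>R f n"])
qed

lemma subspace_form_dom: "subspace (form_dom \<Omega>)"
  unfolding form_dom_def
proof (rule subspace_closure_subspace)
  show "subspace {(cls \<phi>, cls D) |\<phi> D. C1_compact \<Omega> \<phi> D}"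
    unfolding subspace_def
  proof (intro conjI ballI allI)
    show "0 \<in> {(cls \<phi>, cls D) |\<phi> D. C1_compact \<Omega> \<phi> D}"
      using C1_compact_zero[of \<Omega>] by (auto simp: zero_prod_def cls_zero)
    fix z w assume "z \<in> {(cls \<phi>, cls D) |\<phi> D. C1_compact \<Omega> \<phi> D}" "w \<in> {(cls \<phi>, cls D) |\<phi> D. C1_compact \<Omega> \<phi> D}"
    then obtain \<phi> D \<psi> E where z: "z = (cls \<phi>, cls D)" "C1_compact \<Omega> \<phi> D"
      and w: "w = (cls \<psi>, cls E)" "C1_compact \<Omega> \<psi> E" by auto
    have "z + w = (cls (%x. \<phi> x + \<psi> x), cls (%x. D x + E x))"
      using z w by (simp add: cls_add C1_compact_L2_fun)
    then show "z + w \<in> {(cls \<phi>, cls D) |\<phi> D. C1_compact \<Omega> \<phi> D}" using C1_compact_add[OF z(2) w(2)] by blast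
  next
    fix c z assume "z \<in> {(cls \<phi>, cls D) |\<phi> D. C1_compact \<Omega> \<phi> D}"
    then obtain \<phi> D where z: "z = (cls \<phi>, cls D)" "C1_compact \<Omega> \<phi> D" by auto
    have "c *\<^sub>R z = (cls (%x. c *\<^sub>R \<phi> x), cls (%x. c *\<^sub>R D x))"
      using z by (simp add: cls_scaleR C1_compact_L2_fun)
    then show "c *\<^sub>R z \<in> {(cls \<phi>, cls D) |\<phi> D. C1_compact \<Omega> \<phi> D}" using C1_compact_scaleR[OF z(2)] by blast
  qed
qed

text \<open>Closed conditions on a function and its gradient need only be checked on test functions.
  Support, Poincare's inequality and the inequality behind compactness are all transferred in this
  way.\<close>

lemma form_dom_induct_closed:
  assumes "z \<in> form_dom \<Omega>" "closed {z. P z}" "\<And>\<phi> D. C1_compact \<Omega> \<phi> D ==> P (cls \<phi>, cls D)"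
  shows "P z"
proof -
  have "form_dom \<Omega> \<subseteq> {z. P z}" unfolding form_dom_def using assms(2,3) by (intro closure_minimal) auto
  then show ?thesis using assms(1) by auto
qed

lemma form_dom_sequence:
  assumes "z \<in> form_dom \<Omega>"
  obtains \<phi> D where "\<And>n::nat. C1_compact \<Omega> (\<phi> n) (D n)" "(%n. cls (\<phi> n)) \<longlonglongrightarrow> fst z" "(%n. cls (D n)) \<longlonglongrightarrow> snd z"
proof -
  from assms obtain y where y: "\<And>n::nat. y n \<in> {(cls \<phi>, cls D) |\<phi> D. C1_compact \<Omega> \<phi> D}" "y \<longlonglongrightarrow> z"
    unfolding form_dom_def closure_sequential by blast
  then have "\<forall>n. \<exists>\<phi> D. C1_compact \<Omega> \<phi> D \<and> y n = (cls \<phi>, cls D)" by blast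
  then obtain \<phi> D where p: "\<And>n. C1_compact \<Omega> (\<phi> n) (D n)" "\<And>n. y n = (cls (\<phi> n), cls (D n))" by metis
  show thesis
    by (rule that[OF p(1)]) (use tendsto_fst[OF y(2)] tendsto_snd[OF y(2)] in \<open>simp_all add: p(2)\<close>)
qed

lemma tendsto_cls_iff:
  assumes "\<And>n. L2_fun (f n)" "L2_fun g"
  shows "((%n. cls (f n)) \<longlongrightarrow> cls g) F \<longleftrightarrow> ((%n. LBINT x. (norm (f n x - g x))\<^sup>2) \<longlongrightarrow> 0) F"
proof -
  have "((%n. cls (f n)) \<longlongrightarrow> cls g) F \<longleftrightarrow> ((%n. norm (cls (f n) - cls g)) \<longlongrightarrow> 0) F"
    by (simp add: tendsto_norm_zero_iff LIM_zero_iff)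
  also have "\<dots> \<longleftrightarrow> ((%n. (norm (cls (f n) - cls g))\<^sup>2) \<longlongrightarrow> 0) F"
  proof
    assume "((%n. (norm (cls (f n) - cls g))\<^sup>2) \<longlongrightarrow> 0) F"
    from tendsto_real_sqrt[OF this] show "((%n. norm (cls (f n) - cls g)) \<longlongrightarrow> 0) F" by simp
  next
    assume "((%n. norm (cls (f n) - cls g)) \<longlongrightarrow> 0) F"
    from tendsto_power[OF this, of 2] show "((%n. (norm (cls (f n) - cls g))\<^sup>2) \<longlongrightarrow> 0) F" by simp
  qed
  finally show ?thesis by (simp add: norm_cls_diff assms)
qed

text \<open>Test functions and their gradients vanish outside \<open>\<Omega>\<close>, so the
  integrals over \<open>\<Omega>\<close> in the definition of \<open>H10\<close> are squared norms,
  over the whole space, of differences with the restricted functions.\<close>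

lemma H10_iff:
  assumes \<Omega>: "\<Omega> \<in> sets borel"
  shows "H10 \<Omega> v G \<longleftrightarrow> L2_on \<Omega> v \<and> L2_on \<Omega> G \<and> (cls (restr \<Omega> v), cls (restr \<Omega> G)) \<in> form_dom \<Omega>"
proof -
  have sq: "set_lebesgue_integral lborel \<Omega> (%x. (norm (f x - h x))\<^sup>2) = (LBINT x. (norm (f x - restr \<Omega> h x))\<^sup>2)"
    if "restr \<Omega> f = f" for f h :: "'a => 'b::euclidean_space"
  proof -
    have "indicator \<Omega> x *\<^sub>R (norm (f x - h x))\<^sup>2 = (norm (f x - restr \<Omega> h x))\<^sup>2" for x
      using fun_cong[OF that, of x] by (auto simp: restr_def indicator_def)
    then show ?thesis by (simp add: set_lebesgue_integral_def)
  qed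
  have conv: "((%n. LBINT x:\<Omega>. (\<phi> n x - v x)\<^sup>2) \<longlonglongrightarrow> 0 \<and> (%n. LBINT x:\<Omega>. (norm (D n x - G x))\<^sup>2) \<longlonglongrightarrow> 0)
    \<longleftrightarrow> (%n. cls (\<phi> n)) \<longlonglongrightarrow> cls (restr \<Omega> v) \<and> (%n. cls (D n)) \<longlonglongrightarrow> cls (restr \<Omega> G)"
    if C: "\<And>n::nat. C1_compact \<Omega> (\<phi> n) (D n)" and L: "L2_on \<Omega> v" "L2_on \<Omega> G" for \<phi> D
  proof -
    have "(LBINT x:\<Omega>. (\<phi> n x - v x)\<^sup>2) = (LBINT x. (norm (\<phi> n x - restr \<Omega> v x))\<^sup>2)" for n
      using sq[OF C1_compact_restr(1)[OF C[of n]], of v] by simp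
    moreover have "(LBINT x:\<Omega>. (norm (D n x - G x))\<^sup>2) = (LBINT x. (norm (D n x - restr \<Omega> G x))\<^sup>2)" for n
      using sq[OF C1_compact_restr(2)[OF C[of n]], of G] by simp
    ultimately show ?thesis
      using tendsto_cls_iff[of \<phi> "restr \<Omega> v" sequentially, OF C1_compact_L2_fun(1)[OF C]]
        tendsto_cls_iff[of D "restr \<Omega> G" sequentially, OF C1_compact_L2_fun(2)[OF C]] L
      by (simp add: L2_on_iff)
  qed
  show ?thesis
  proof
    assume H: "H10 \<Omega> v G"
    then obtain \<phi> D where L: "L2_on \<Omega> v" "L2_on \<Omega> G" and C: "\<And>n. C1_compact \<Omega> (\<phi> n) (D n)"
      and l: "(%n. LBINT x:\<Omega>. (\<phi> n x - v x)\<^sup>2) \<longlonglongrightarrow> 0" "(%n. LBINT x:\<Omega>. (norm (D n x - G x))\<^sup>2) \<longlonglongrightarrow> 0"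
      unfolding H10_def by blast
    then have "(%n. (cls (\<phi> n), cls (D n))) \<longlonglongrightarrow> (cls (restr \<Omega> v), cls (restr \<Omega> G))"
      using conv[of \<phi> D, OF C L] by (intro tendsto_Pair) auto
    then have "(cls (restr \<Omega> v), cls (restr \<Omega> G)) \<in> form_dom \<Omega>"
      by (rule closed_sequentially[OF closed_form_dom, rotated]) (rule C1_in_form_dom[OF C])
    with L show "L2_on \<Omega> v \<and> L2_on \<Omega> G \<and> (cls (restr \<Omega> v), cls (restr \<Omega> G)) \<in> form_dom \<Omega>" by simp
  next
    assume R: "L2_on \<Omega> v \<and> L2_on \<Omega> G \<and> (cls (restr \<Omega> v), cls (restr \<Omega> G)) \<in> form_dom \<Omega>"
    then obtain \<phi> D where C: "\<And>n::nat. C1_compact \<Omega> (\<phi> n) (D n)"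
      and l: "(%n. cls (\<phi> n)) \<longlonglongrightarrow> cls (restr \<Omega> v)" "(%n. cls (D n)) \<longlonglongrightarrow> cls (restr \<Omega> G)"
      by (metis form_dom_sequence fst_conv snd_conv)
    with R conv[of \<phi> D, OF C] have "(%n. LBINT x:\<Omega>. (\<phi> n x - v x)\<^sup>2) \<longlonglongrightarrow> 0 \<and> (%n. LBINT x:\<Omega>. (norm (D n x - G x))\<^sup>2) \<longlonglongrightarrow> 0"
      by blast
    with R C show "H10 \<Omega> v G" unfolding H10_def by blast
  qed
qed

text \<open>Membership in the L^2 space of the domain. The representative is arbitrary, but any
  other one differs from it on a null set only.\<close>

definition supported :: "'a set => ('a::euclidean_space, 'b::euclidean_space) L2 => bool" where
  "supported \<Omega> z \<longleftrightarrow> (AE x in lborel. x \<notin> \<Omega> --> rep_L2 z x = 0)"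

lemma supported_cls_restr:
  assumes "L2_fun (restr \<Omega> f)"
  shows "supported \<Omega> (cls (restr \<Omega> f))"
  unfolding supported_def using rep_L2_cls[OF assms] by eventually_elim (auto simp: restr_def)

lemma supported_iff:
  assumes [measurable]: "\<Omega> \<in> sets borel"
  shows "supported \<Omega> z \<longleftrightarrow> cls (restr \<Omega> (rep_L2 z)) = z" and "L2_fun (restr \<Omega> (rep_L2 z))"
proof -
  show s: "L2_fun (restr \<Omega> (rep_L2 z))"
    unfolding restr_def by (rule L2_fun_bounded_mult[where B = 1]) (auto simp: indicator_def)
  show "supported \<Omega> z \<longleftrightarrow> cls (restr \<Omega> (rep_L2 z)) = z"
  proof
    assume "supported \<Omega> z"
    then have "AE x in lborel. restr \<Omega> (rep_L2 z) x = rep_L2 z x"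
      unfolding supported_def by eventually_elim (auto simp: restr_def indicator_def)
    then have "cls (restr \<Omega> (rep_L2 z)) = cls (rep_L2 z)" using s by (subst cls_eq_iff) auto
    then show "cls (restr \<Omega> (rep_L2 z)) = z" by simp
  next
    assume "cls (restr \<Omega> (rep_L2 z)) = z"
    with supported_cls_restr[OF s] show "supported \<Omega> z" by simp
  qed
qed

text \<open>The condition says that \<open>z\<close> is a fixed point of the cut-off to
  \<open>\<Omega>\<close>, which is 1-Lipschitz.\<close>

lemma supported_closed:
  assumes [measurable]: "\<Omega> \<in> sets borel"
  shows "closed {z::('a::euclidean_space, 'b::euclidean_space) L2. supported \<Omega> z}"
proof -
  have lip: "norm (cls (restr \<Omega> (rep_L2 z)) - cls (restr \<Omega> (rep_L2 w))) <= norm (z - w)" for z w :: "('a, 'b) L2"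
  proof (rule power2_le_imp_le)
    have "(norm (cls (restr \<Omega> (rep_L2 z)) - cls (restr \<Omega> (rep_L2 w))))\<^sup>2
      = (LBINT x. (norm (restr \<Omega> (rep_L2 z) x - restr \<Omega> (rep_L2 w) x))\<^sup>2)"
      by (rule norm_cls_diff) (auto intro: supported_iff assms)
    also have "\<dots> <= (LBINT x. (norm (rep_L2 z x - rep_L2 w x))\<^sup>2)"
      using L2_fun_diff[OF supported_iff(2)[OF assms, of z] supported_iff(2)[OF assms, of w]]
        L2_fun_diff[OF L2_fun_rep_L2[of z] L2_fun_rep_L2[of w]]
      by (intro integral_mono) (auto simp: L2_fun_def restr_def indicator_def)
    also have "\<dots> = (norm (z - w))\<^sup>2" using norm_cls_diff[of "rep_L2 z" "rep_L2 w"] by simp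
    finally show "(norm (cls (restr \<Omega> (rep_L2 z)) - cls (restr \<Omega> (rep_L2 w))))\<^sup>2 <= (norm (z - w))\<^sup>2" .
  qed simp
  have "continuous_on UNIV (%z::('a, 'b) L2. cls (restr \<Omega> (rep_L2 z)))"
    using lip by (intro lipschitz_on_continuous_on[of 1] lipschitz_onI) (auto simp: dist_norm)
  then have "closed {z::('a, 'b) L2. cls (restr \<Omega> (rep_L2 z)) = z}"
    by (intro closed_Collect_eq continuous_intros)
  then show ?thesis by (simp add: supported_iff)
qed

lemma form_dom_supported:
  assumes "\<Omega> \<in> sets borel" "(v, h) \<in> form_dom \<Omega>"
  shows "supported \<Omega> v" "supported \<Omega> h"
proof -
  have "supported \<Omega> (fst z) \<and> supported \<Omega> (snd z)" if "z \<in> form_dom \<Omega>" for z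
    using that
  proof (rule form_dom_induct_closed)
    show "closed {z. supported \<Omega> (fst z) \<and> supported \<Omega> (snd z)}"
    proof -
      have "closed (fst -` {z. supported \<Omega> z} \<inter> snd -` {z. supported \<Omega> z})"
        by (intro closed_Int closed_vimage supported_closed assms(1) continuous_intros)
      then show ?thesis by (simp add: vimage_def Int_def)
    qed
    fix \<phi> D assume "C1_compact \<Omega> \<phi> D"
    then show "supported \<Omega> (fst (cls \<phi>, cls D)) \<and> supported \<Omega> (snd (cls \<phi>, cls D))"
      using supported_cls_restr[of \<Omega> \<phi>] supported_cls_restr[of \<Omega> D] C1_compact_restr C1_compact_L2_fun
      by (metis fst_conv snd_conv)
  qed
  from this[OF assms(2)] show "supported \<Omega> v" "supported \<Omega> h" by auto
qed

subsection \<open>Bump functions and density\<close>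

lemma DERIV_pos_part_square: "((%t::real. (max 0 t)\<^sup>2) has_real_derivative 2 * max 0 t) (at t)"
proof -
  have "((%t::real. (max 0 t)\<^sup>2) has_vector_derivative 2 * max 0 t) (at t)"
  proof (rule has_vector_derivative_quadratic[where \<delta> = 1 and C = 1])
    fix s :: real
    show "norm ((max 0 s)\<^sup>2 - (max 0 t)\<^sup>2 - (s - t) *\<^sub>R (2 * max 0 t)) <= 1 * (s - t)\<^sup>2"
    proof (cases "0 < t")
      case t: True
      show ?thesis
      proof (cases "0 < s")
        case True
        have "s\<^sup>2 - t\<^sup>2 - (s - t) * (2 * t) = (s - t)\<^sup>2" by (simp add: power2_eq_square algebra_simps)
        with t True show ?thesis by (simp add: max_def)
      next
        case False
        then have "s * t <= 0" using t by (simp add: mult_nonpos_nonneg)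
        moreover have "0 <= s\<^sup>2" "0 <= t\<^sup>2" by simp_all
        ultimately show ?thesis using t False
          by (simp add: max_def power2_eq_square algebra_simps abs_le_iff)
      qed
    next
      case t: False
      show ?thesis
      proof (cases "0 < s")
        case True
        with t have "s <= s - t" by simp
        then have "s\<^sup>2 <= (s - t)\<^sup>2" using True by (intro power_mono) auto
        then show ?thesis using t True by (simp add: max_def)
      qed (use t in \<open>simp add: max_def\<close>)
    qed
  qed simp
  then show ?thesis by (simp add: has_real_derivative_iff_has_vector_derivative)
qed

text \<open>The square of the positive part makes this C^1, as \<open>C1_compact\<close> demands,
  and gives |grad b|^2 <= 16 r^2 b. Such control of the gradient by the function itself is what the
  logarithmic energy estimate asks of a cut-off.\<close>

definition bump :: "'a::euclidean_space => real => 'a => real" where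
  "bump c r x = (max 0 (r\<^sup>2 - (x - c) \<bullet> (x - c)))\<^sup>2"

definition bump' :: "'a::euclidean_space => real => 'a => 'a" where
  "bump' c r x = (2 * max 0 (r\<^sup>2 - (x - c) \<bullet> (x - c))) *\<^sub>R (- (2 *\<^sub>R (x - c)))"

lemma GDERIV_bump: "GDERIV (bump c r) x :> bump' c r x"
proof -
  have "GDERIV (%x. r\<^sup>2 - (x - c) \<bullet> (x - c)) x :> - (2 *\<^sub>R (x - c))"
    unfolding gderiv_def
    by (auto intro!: derivative_eq_intros simp: inner_commute inner_diff_left inner_diff_right algebra_simps)
  from GDERIV_DERIV_compose[OF this DERIV_pos_part_square] show ?thesis
    unfolding bump_def[abs_def] bump'_def .
qed

lemma continuous_on_bump [continuous_intros]:
  "continuous_on A (bump c r)" "continuous_on A (bump' c r)"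
  unfolding bump_def[abs_def] bump'_def[abs_def] by (intro continuous_intros)+

lemma bump_nonneg: "0 <= bump c r x"
  by (simp add: bump_def)

lemma bump_pos_iff: "0 < r ==> 0 < bump c r x \<longleftrightarrow> x \<in> ball c r"
proof -
  assume r: "0 < r"
  have "x \<in> ball c r \<longleftrightarrow> (x - c) \<bullet> (x - c) < r\<^sup>2"
    using r abs_le_square_iff[of r "norm (x - c)"]
    by (auto simp: dist_norm norm_minus_commute[of c x] power2_norm_eq_inner not_less[symmetric])
  then show ?thesis by (auto simp: bump_def max_def)
qed

lemma bump_eq_0_iff: "0 < r ==> bump c r x = 0 \<longleftrightarrow> x \<notin> ball c r"
  using bump_pos_iff[of r c x] bump_nonneg[of c r x] by auto

lemma bump_outside: "0 < r ==> \<not> dist c x <= r ==> bump c r x = 0"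
  by (simp add: bump_eq_0_iff)

lemma C1_compact_compose_bump:
  assumes r: "0 < r" "cball c r \<subseteq> \<Omega>" and q: "\<And>t. DERIV q t :> q' t" "continuous_on UNIV q'" "q 0 = 0"
  shows "C1_compact \<Omega> (%x. q (bump c r x)) (%x. q' (bump c r x) *\<^sub>R bump' c r x)"
  unfolding C1_compact_def
proof (intro conjI allI)
  show "GDERIV (%x. q (bump c r x)) x :> q' (bump c r x) *\<^sub>R bump' c r x" for x
    by (rule GDERIV_DERIV_compose[OF GDERIV_bump q(1)])
  show "continuous_on UNIV (%x. q' (bump c r x) *\<^sub>R bump' c r x)"
    by (intro continuous_intros continuous_on_compose2[OF q(2)]) auto
  show "\<exists>K. compact K \<and> K \<subseteq> \<Omega> \<and> (\<forall>x. x \<notin> K --> q (bump c r x) = 0)"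
    using r q(3) by (intro exI[of _ "cball c r"]) (auto simp: bump_outside)
qed

text \<open>The positive and negative parts of \<open>w\<close> define two finite measures that
  agree on balls with closure in the domain. By Vitali's covering theorem the part of an open set
  inside the domain is a disjoint union of such balls up to a null set. So the measures agree on
  open sets, which generate the Borel sets.\<close>

lemma integral_balls_zero_imp_AE_zero:
  fixes w :: "'a::euclidean_space => real"
  assumes w: "integrable lborel w" and \<Omega>: "open \<Omega>" and w0: "\<And>x. x \<notin> \<Omega> ==> w x = 0"
    and balls: "\<And>c r. 0 < r ==> cball c r \<subseteq> \<Omega> ==> (LBINT x:ball c r. w x) = 0"
  shows "AE x in lborel. w x = 0"
proof -
  have [measurable]: "w \<in> borel_measurable borel" using w by simp
  define M where "M = density lborel (%x. ennreal (w x))"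
  define N where "N = density lborel (%x. ennreal (- w x))"
  have sets: "sets M = sets borel" "sets N = sets borel" by (simp_all add: M_def N_def)
  have val: "emeasure M A = ennreal (\<integral>x. indicator A x * max 0 (w x) \<partial>lborel)"
      "emeasure N A = ennreal (\<integral>x. indicator A x * max 0 (- w x) \<partial>lborel)" if [measurable]: "A \<in> sets borel" for A
  proof -
    have pm: "integrable lborel (%x. max 0 (w x))" "integrable lborel (%x. max 0 (- w x))"
      using w by (auto intro!: integrable_max)
    have i: "integrable lborel (%x. indicator A x * max 0 (w x))" "integrable lborel (%x. indicator A x * max 0 (- w x))"
      using integrable_mult_indicator[OF _ pm(1), of A] integrable_mult_indicator[OF _ pm(2), of A] by simp_all
    have "emeasure M A = (\<integral>\<^sup>+x. ennreal (indicator A x * max 0 (w x)) \<partial>lborel)"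
      unfolding M_def by (subst emeasure_density) (auto intro!: nn_integral_cong simp: indicator_def max_def ennreal_neg)
    then show "emeasure M A = ennreal (\<integral>x. indicator A x * max 0 (w x) \<partial>lborel)"
      using nn_integral_eq_integral[OF i(1)] by simp
    have "emeasure N A = (\<integral>\<^sup>+x. ennreal (indicator A x * max 0 (- w x)) \<partial>lborel)"
      unfolding N_def by (subst emeasure_density) (auto intro!: nn_integral_cong simp: indicator_def max_def ennreal_neg)
    then show "emeasure N A = ennreal (\<integral>x. indicator A x * max 0 (- w x) \<partial>lborel)"
      using nn_integral_eq_integral[OF i(2)] by simp
  qed
  have ball_eq: "emeasure M (ball c r) = emeasure N (ball c r)" if "cball c r \<subseteq> \<Omega>" for c r
  proof (cases "0 < r")
    case True
    have pm: "integrable lborel (%x. max 0 (w x))" "integrable lborel (%x. max 0 (- w x))"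
      using w by (auto intro!: integrable_max)
    have i: "integrable lborel (%x. indicator (ball c r) x * max 0 (w x))" "integrable lborel (%x. indicator (ball c r) x * max 0 (- w x))"
      using integrable_mult_indicator[OF _ pm(1), of "ball c r"] integrable_mult_indicator[OF _ pm(2), of "ball c r"] by simp_all
    have "indicator (ball c r) x *\<^sub>R w x = indicator (ball c r) x * max 0 (w x) - indicator (ball c r) x * max 0 (- w x)" for x
      by (simp add: max_def indicator_def)
    then have "0 = (\<integral>x. indicator (ball c r) x * max 0 (w x) - indicator (ball c r) x * max 0 (- w x) \<partial>lborel)"
      using balls[OF True that] unfolding set_lebesgue_integral_def by (simp only:)
    then show ?thesis using i by (simp add: val)
  qed (simp add: ball_empty)
  have open_eq: "emeasure M U = emeasure N U" if U: "open U" for U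
  proof -
    let ?K = "{(c, r). 0 < r \<and> cball c r \<subseteq> U \<inter> \<Omega>}"
    have UO: "open (U \<inter> \<Omega>)" using U \<Omega> by auto
    obtain C where C: "countable C" "C \<subseteq> ?K" "pairwise (%i j. disjnt (ball (fst i) (snd i)) (ball (fst j) (snd j))) C"
      "negligible (U \<inter> \<Omega> - (\<Union>i\<in>C. ball (fst i) (snd i)))"
    proof (rule Vitali_covering_theorem_balls[of "U \<inter> \<Omega>" ?K fst snd])
      fix x and d :: real assume x: "x \<in> U \<inter> \<Omega>" "0 < d"
      from UO x obtain \<epsilon> where \<epsilon>: "0 < \<epsilon>" "cball x \<epsilon> \<subseteq> U \<inter> \<Omega>" by (meson open_contains_cball)
      let ?r = "min \<epsilon> (d/2)"
      have "cball x ?r \<subseteq> cball x \<epsilon>" by (rule subset_cball) simp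
      then have "(x, ?r) \<in> ?K" "?r < d" using \<epsilon> x by auto
      then show "\<exists>i. i \<in> ?K \<and> x \<in> ball (fst i) (snd i) \<and> snd i < d"
        using \<epsilon> x by (intro exI[of _ "(x, ?r)"]) auto
    qed blast
    let ?B = "%i. ball (fst i) (snd i)"
    have sub: "(\<Union>i\<in>C. ?B i) \<subseteq> U \<inter> \<Omega>" using C(2) ball_subset_cball by fastforce
    have eqU: "emeasure L U = emeasure L (\<Union>i\<in>C. ?B i)"
      if L: "L = density lborel f" and f0: "\<And>x. x \<notin> \<Omega> ==> f x = 0" and [measurable]: "f \<in> borel_measurable borel" for L and f :: "'a => ennreal"
    proof -
      have [measurable]: "U \<in> sets borel" "(\<Union>i\<in>C. ?B i) \<in> sets borel" "\<Omega> \<in> sets borel" using U \<Omega> by (auto intro!: borel_open open_UN)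
      have "U \<inter> \<Omega> - (\<Union>i\<in>C. ?B i) \<in> null_sets lborel"
        using C(4) by (simp add: negligible_iff_null_sets null_sets_completion_iff)
      then have "AE x in lborel. x \<notin> U \<inter> \<Omega> - (\<Union>i\<in>C. ?B i)" by (rule AE_not_in)
      then have "AE x in lborel. f x * indicator U x = f x * indicator (\<Union>i\<in>C. ?B i) x"
      proof eventually_elim
        case (elim x)
        then have "x \<in> \<Omega> ==> x \<in> U \<longleftrightarrow> x \<in> (\<Union>i\<in>C. ?B i)" using sub by blast
        then show ?case using f0[of x] by (cases "x \<in> \<Omega>") (simp_all add: indicator_def)
      qed
      then show ?thesis unfolding L by (subst (1 2) emeasure_density) (auto intro!: nn_integral_cong_AE)
    qed
    have dis: "disjoint_family_on ?B C" using C(3) by (auto simp: disjoint_family_on_def pairwise_def disjnt_def)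
    have "emeasure M (\<Union>i\<in>C. ?B i) = (\<integral>\<^sup>+i. emeasure M (?B i) \<partial>count_space C)"
      by (rule emeasure_UN_countable) (use C dis sets in auto)
    also have "\<dots> = (\<integral>\<^sup>+i. emeasure N (?B i) \<partial>count_space C)"
      using C(2) by (intro nn_integral_cong ball_eq) fastforce
    also have "\<dots> = emeasure N (\<Union>i\<in>C. ?B i)"
      by (rule emeasure_UN_countable[symmetric]) (use C dis sets in auto)
    finally show ?thesis using eqU[OF M_def] eqU[OF N_def] w0 by simp
  qed
  have "M = N"
  proof (rule measure_eqI_generator_eq[where E = "{S. open S}" and \<Omega> = UNIV and A = "%_. UNIV"])
    show "Int_stable {S::'a set. open S}" by (auto simp: Int_stable_def)
    show "sets M = sigma_sets UNIV {S. open S}" "sets N = sigma_sets UNIV {S. open S}"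
      by (simp_all add: sets borel_def)
    show "emeasure M X = emeasure N X" if "X \<in> {S. open S}" for X using open_eq that by simp
    show "emeasure M UNIV \<noteq> \<infinity>" for i :: nat using val(1)[of UNIV] by simp
  qed auto
  then have "emeasure M {x. 0 < w x} = emeasure N {x. 0 < w x}" "emeasure M {x. w x < 0} = emeasure N {x. w x < 0}" by simp_all
  moreover have "emeasure N {x. 0 < w x} = 0" "emeasure M {x. w x < 0} = 0"
    unfolding M_def N_def
    by (subst emeasure_density; force simp: indicator_def ennreal_neg nn_integral_0_iff_AE)+
  ultimately have "emeasure M {x. 0 < w x} = 0" "emeasure N {x. w x < 0} = 0" by simp_all
  then have "AE x in lborel. ennreal (w x) * indicator {x. 0 < w x} x = 0" "AE x in lborel. ennreal (- w x) * indicator {x. w x < 0} x = 0"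
    unfolding M_def N_def by (auto simp: emeasure_density nn_integral_0_iff_AE)
  then show ?thesis
  proof eventually_elim
    case (elim x)
    then show ?case by (cases "w x" "0::real" rule: linorder_cases) (auto simp: indicator_def)
  qed
qed

text \<open>The test functions 1 - exp(-n b), with b the bump of a ball, increase to the indicator
  of that ball. So \<open>w\<close> has integral 0 over every ball whose closure lies in the
  domain.\<close>

lemma orthogonal_to_C1_compact_imp_zero:
  fixes w :: "('a::euclidean_space, real) L2"
  assumes \<Omega>: "open \<Omega>" "bounded \<Omega>" and w: "supported \<Omega> w" and orth: "\<And>\<phi> D. C1_compact \<Omega> \<phi> D ==> w \<bullet> cls \<phi> = 0"
  shows "w = 0"
proof -
  have [measurable]: "\<Omega> \<in> sets borel" using \<Omega> by auto
  let ?w = "restr \<Omega> (rep_L2 w)"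
  have sq: "L2_fun ?w" by (rule supported_iff) simp
  have weq: "cls ?w = w" using w by (simp add: supported_iff)
  have sq1: "L2_fun (%x. indicator \<Omega> x :: real)"
  proof -
    have "(norm (indicator \<Omega> x :: real))\<^sup>2 = indicator \<Omega> x" for x by (simp add: indicator_def)
    then show ?thesis using \<Omega> emeasure_bounded_finite[of \<Omega>]
      by (simp add: L2_fun_def less_top)
  qed
  have wi: "integrable lborel ?w"
  proof -
    have "integrable lborel (%x. ?w x \<bullet> indicator \<Omega> x)" by (rule L2_fun_inner[OF sq sq1])
    moreover have "?w x \<bullet> indicator \<Omega> x = ?w x" for x by (simp add: restr_def indicator_def)
    ultimately show ?thesis by (simp only:)
  qed
  have "AE x in lborel. ?w x = 0"
  proof (rule integral_balls_zero_imp_AE_zero[OF wi \<Omega>(1)])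
    show "?w x = 0" if "x \<notin> \<Omega>" for x using that by (simp add: restr_def)
    fix c :: 'a and r :: real assume r: "0 < r" "cball c r \<subseteq> \<Omega>"
    define \<phi> where "\<phi> n x = 1 - exp (- (real n * bump c r x))" for n x
    have C: "C1_compact \<Omega> (\<phi> n) (%x. (real n * exp (- (real n * bump c r x))) *\<^sub>R bump' c r x)" for n
      unfolding \<phi>_def
      by (rule C1_compact_compose_bump[OF r, of "%t. 1 - exp (- (real n * t))" "%t. real n * exp (- (real n * t))"])
        (auto intro!: derivative_eq_intros continuous_intros)
    have "(LBINT x. ?w x * \<phi> n x) = 0" for n
      using orth[OF C[of n]] inner_cls[OF sq C1_compact_L2_fun(1)[OF C[of n]]] weq by simp
    moreover have "(%n. LBINT x. ?w x * \<phi> n x) \<longlonglongrightarrow> (LBINT x. ?w x * indicator (ball c r) x)"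
    proof (rule integral_dominated_convergence[where w = "%x. \<bar>?w x\<bar>"])
      show "AE x in lborel. (%n. ?w x * \<phi> n x) \<longlonglongrightarrow> ?w x * indicator (ball c r) x"
      proof (intro AE_I2 tendsto_mult tendsto_const)
        fix x
        show "(%n. \<phi> n x) \<longlonglongrightarrow> indicator (ball c r) x"
        proof (cases "x \<in> ball c r")
          case True
          then have b: "0 < bump c r x" using r by (simp add: bump_pos_iff)
          then have "exp (- bump c r x) < 1" by simp
          then have "(%n. exp (- bump c r x) ^ n) \<longlonglongrightarrow> 0" by (intro LIMSEQ_power_zero) simp
          then have "(%n. 1 - exp (- (real n * bump c r x))) \<longlonglongrightarrow> 1 - 0"
            by (intro tendsto_intros) (simp add: exp_of_nat_mult[symmetric])
          then show ?thesis using True by (simp add: \<phi>_def)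
        next
          case False
          then have "bump c r x = 0" using r by (simp add: bump_eq_0_iff)
          then show ?thesis using False by (simp add: \<phi>_def)
        qed
      qed
      show "AE x in lborel. norm (?w x * \<phi> n x) <= \<bar>?w x\<bar>" for n
        using bump_nonneg[of c r] by (intro AE_I2) (auto simp: \<phi>_def abs_mult intro!: mult_left_le)
      show "(%x. ?w x * \<phi> n x) \<in> borel_measurable lborel" for n
        using wi C1_compact_L2_fun(1)[OF C[of n]] by (auto simp: L2_fun_def)
      have [measurable]: "?w \<in> borel_measurable lborel" using wi by simp
      show "(%x. ?w x * indicator (ball c r) x) \<in> borel_measurable lborel"
        by (intro borel_measurable_times borel_measurable_indicator) auto
    qed (use wi in auto)
    ultimately have "(LBINT x. ?w x * indicator (ball c r) x) = 0"
      using LIMSEQ_unique[OF _ tendsto_const] by simp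
    then show "(LBINT x:ball c r. ?w x) = 0" by (simp add: set_lebesgue_integral_def mult.commute)
  qed
  then have "cls ?w = cls (%x. 0)" using sq L2_fun_zero by (subst cls_eq_iff) auto
  then show ?thesis by (simp add: weq cls_zero)
qed

subsection \<open>Poincare's inequality on convex sets and Rellich's theorem\<close>

lemma nn_integral_affine:
  fixes h :: "'a::euclidean_space => ennreal"
  assumes [measurable]: "h \<in> borel_measurable borel" and c: "0 < c"
  shows "(\<integral>\<^sup>+x. h (t + c *\<^sub>R x) \<partial>lborel) = ennreal ((1 / c) ^ DIM('a)) * (\<integral>\<^sup>+x. h x \<partial>lborel)"
proof -
  have "(\<integral>\<^sup>+x. h x \<partial>lborel) = (\<integral>\<^sup>+x. h x \<partial>density (distr lborel borel (%x. t + c *\<^sub>R x)) (%_. ennreal (\<bar>c\<bar> ^ DIM('a))))"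
    using lborel_affine[of c t] c by simp
  also have "\<dots> = ennreal (c ^ DIM('a)) * (\<integral>\<^sup>+x. h (t + c *\<^sub>R x) \<partial>lborel)"
    using c by (simp add: nn_integral_density nn_integral_distr nn_integral_cmult)
  finally have *: "(\<integral>\<^sup>+x. h x \<partial>lborel) = ennreal (c ^ DIM('a)) * (\<integral>\<^sup>+x. h (t + c *\<^sub>R x) \<partial>lborel)" .
  have "ennreal ((1 / c) ^ DIM('a)) * ennreal (c ^ DIM('a)) = 1"
    using c by (simp add: power_divide flip: ennreal_mult)
  then show ?thesis unfolding * mult.assoc[symmetric] by simp
qed

lemma square_integral_le:
  fixes f :: "real => real"
  assumes f: "continuous_on {0..1} f"
  shows "(integral {0..1} f)\<^sup>2 <= integral {0..1} (%t. (f t)\<^sup>2)"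
proof -
  let ?m = "integral {0..1} f"
  have i: "f integrable_on {0..1}" "(%t. (f t)\<^sup>2) integrable_on {0..1}"
    using f by (auto intro!: integrable_continuous_interval continuous_intros)
  have "0 <= integral {0..1} (%t. (f t - ?m)\<^sup>2)"
    using f by (intro Henstock_Kurzweil_Integration.integral_nonneg integrable_continuous_interval continuous_intros) auto
  also have "(%t. (f t - ?m)\<^sup>2) = (%t. ((f t)\<^sup>2 - (2 * ?m) * f t) + ?m\<^sup>2)"
    by (auto simp: power2_eq_square algebra_simps)
  also have "integral {0..1} \<dots> = integral {0..1} (%t. (f t)\<^sup>2) - (2 * ?m) * ?m + ?m\<^sup>2"
  proof -
    have "((%t. ((f t)\<^sup>2 - (2 * ?m) * f t) + ?m\<^sup>2) has_integral
        (integral {0..1} (%t. (f t)\<^sup>2) - (2 * ?m) * ?m) + (1 - 0) *\<^sub>R ?m\<^sup>2) {0..1}"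
      using has_integral_const_real[of "?m\<^sup>2" 0 1] i
      by (intro has_integral_add has_integral_diff has_integral_mult_right integrable_integral) auto
    then show ?thesis by (simp add: integral_unique)
  qed
  finally show ?thesis by (simp add: power2_eq_square)
qed

text \<open>The fundamental theorem of calculus along the segment, then Jensen's inequality. The
  extended nonnegative form prepares for exchanging this integral with those over both
  endpoints.\<close>

lemma C1_segment_bound:
  assumes g: "\<And>x. GDERIV \<phi> x :> D x" and D: "continuous_on UNIV D"
  shows "ennreal ((\<phi> x - \<phi> y)\<^sup>2) <= ennreal ((norm (x - y))\<^sup>2) *
    (\<integral>\<^sup>+t. ennreal ((norm (D ((1 - t) *\<^sub>R y + t *\<^sub>R x)))\<^sup>2) * indicator {0..1} t \<partial>lborel)"
proof -
  define p where "p t = (1 - t) *\<^sub>R y + t *\<^sub>R x" for t :: real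
  have p': "(p has_vector_derivative (x - y)) (at t within S)" for t S
    unfolding p_def by (auto intro!: derivative_eq_intros simp: algebra_simps)
  have pc: "continuous_on S p" for S unfolding p_def by (intro continuous_intros)
  have Dp: "continuous_on S (%t. D (p t))" for S
    by (rule continuous_on_compose2[OF D pc]) auto
  have "((%t. (x - y) \<bullet> D (p t)) has_integral (\<phi> (p 1) - \<phi> (p 0))) {0..1}"
  proof (rule fundamental_theorem_of_calculus)
    fix t :: real
    have "((\<phi> \<circ> p) has_derivative (%h. h \<bullet> D (p t)) \<circ> (%h. h *\<^sub>R (x - y))) (at t within {0..1})"
      using p'[of t "{0..1}"] g[of "p t"] unfolding gderiv_def has_vector_derivative_def
      by (intro diff_chain_within) (auto intro: has_derivative_at_withinI)
    then show "((%t. \<phi> (p t)) has_vector_derivative (x - y) \<bullet> D (p t)) (at t within {0..1})"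
      by (simp add: has_vector_derivative_def comp_def)
  qed simp
  then have "\<phi> x - \<phi> y = integral {0..1} (%t. (x - y) \<bullet> D (p t))"
    by (simp add: p_def integral_unique)
  then have "(\<phi> x - \<phi> y)\<^sup>2 <= integral {0..1} (%t. ((x - y) \<bullet> D (p t))\<^sup>2)"
    using Dp by (auto intro!: square_integral_le continuous_intros)
  also have "\<dots> <= integral {0..1} (%t. (norm (x - y))\<^sup>2 * (norm (D (p t)))\<^sup>2)"
  proof (rule Henstock_Kurzweil_Integration.integral_le)
    show "((x - y) \<bullet> D (p t))\<^sup>2 <= (norm (x - y))\<^sup>2 * (norm (D (p t)))\<^sup>2" for t
      using Cauchy_Schwarz_ineq[of "x - y" "D (p t)"] by (simp add: power2_norm_eq_inner)
  qed (use Dp in \<open>auto intro!: integrable_continuous_interval continuous_intros\<close>)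
  finally have le: "(\<phi> x - \<phi> y)\<^sup>2 <= integral {0..1} (%t. (norm (x - y))\<^sup>2 * (norm (D (p t)))\<^sup>2)" .
  have [measurable]: "(%t. D (p t)) \<in> borel_measurable borel"
    using Dp[of UNIV] by (rule borel_measurable_continuous_onI)
  have "((%t. (norm (x - y))\<^sup>2 * (norm (D (p t)))\<^sup>2) has_integral
      integral {0..1} (%t. (norm (x - y))\<^sup>2 * (norm (D (p t)))\<^sup>2)) {0..1}"
    using Dp by (intro integrable_integral integrable_continuous_interval continuous_intros)
  then have "integral\<^sup>N lborel (%t. ennreal (indicator {0..1} t * ((norm (x - y))\<^sup>2 * (norm (D (p t)))\<^sup>2)))
      = ennreal (integral {0..1} (%t. (norm (x - y))\<^sup>2 * (norm (D (p t)))\<^sup>2))"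
    by (intro nn_integral_has_integral_lebesgue) auto
  also have "(%t. ennreal (indicator {0..1} t * ((norm (x - y))\<^sup>2 * (norm (D (p t)))\<^sup>2)))
      = (%t. ennreal ((norm (x - y))\<^sup>2) * (ennreal ((norm (D (p t)))\<^sup>2) * indicator {0..1} t))"
    by (auto simp: fun_eq_iff indicator_def ennreal_mult)
  finally show ?thesis using ennreal_leI[OF le] by (simp add: p_def[symmetric] nn_integral_cmult)
qed

text \<open>The substitution z = (1 - t) y + t x in the inner integral has Jacobian t^d, whose
  inverse is at most 2^d when t >= 1/2. This is the origin of the dimensional constant.\<close>

lemma convex_translate_integral_le:
  fixes h :: "'a::euclidean_space => ennreal" and K :: "'a set"
  assumes [measurable]: "h \<in> borel_measurable borel" "K \<in> sets borel" and t: "1/2 <= t"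
  shows "(\<integral>\<^sup>+y. \<integral>\<^sup>+x. h ((1 - t) *\<^sub>R y + t *\<^sub>R x) * indicator K x * indicator K y \<partial>lborel \<partial>lborel)
    <= ennreal (2 ^ DIM('a)) * emeasure lborel K * (\<integral>\<^sup>+z. h z \<partial>lborel)"
proof -
  have "(\<integral>\<^sup>+y. \<integral>\<^sup>+x. h ((1 - t) *\<^sub>R y + t *\<^sub>R x) * indicator K x * indicator K y \<partial>lborel \<partial>lborel)
    <= (\<integral>\<^sup>+y. (\<integral>\<^sup>+x. h ((1 - t) *\<^sub>R y + t *\<^sub>R x) \<partial>lborel) * indicator K y \<partial>lborel)"
    by (intro nn_integral_mono) (auto simp: indicator_def intro: nn_integral_mono)
  also have "\<dots> <= (\<integral>\<^sup>+y. (ennreal (2 ^ DIM('a)) * (\<integral>\<^sup>+z. h z \<partial>lborel)) * indicator K y \<partial>lborel)"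
  proof (intro nn_integral_mono mult_right_mono)
    fix y
    have "(1 / t) ^ DIM('a) <= 2 ^ DIM('a)"
      using t by (intro power_mono) (auto simp: field_simps)
    then show "(\<integral>\<^sup>+x. h ((1 - t) *\<^sub>R y + t *\<^sub>R x) \<partial>lborel) <= ennreal (2 ^ DIM('a)) * (\<integral>\<^sup>+z. h z \<partial>lborel)"
      using t by (subst nn_integral_affine) (auto intro!: mult_right_mono ennreal_leI)
  qed simp
  also have "\<dots> = ennreal (2 ^ DIM('a)) * emeasure lborel K * (\<integral>\<^sup>+z. h z \<partial>lborel)"
    by (subst nn_integral_cmult_indicator) (simp_all add: mult_ac)
  finally show ?thesis .
qed

text \<open>Segments between points of \<open>K\<close> stay in \<open>K\<close>. Splitting at t =
  1/2 and exchanging the roles of the endpoints in the lower half keeps the Jacobian away from 0, so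
  no singular kernel appears.\<close>

lemma poincare_convex_nn:
  fixes K :: "'a::euclidean_space set"
  assumes g: "\<And>x. GDERIV \<phi> x :> D x" and D: "continuous_on UNIV D"
    and K [measurable]: "K \<in> sets borel" and conv: "convex K" and diam: "\<And>x y. x \<in> K ==> y \<in> K ==> norm (x - y) <= \<delta>"
  shows "(\<integral>\<^sup>+y. \<integral>\<^sup>+x. ennreal ((\<phi> x - \<phi> y)\<^sup>2) * indicator K x * indicator K y \<partial>lborel \<partial>lborel)
    <= ennreal (\<delta>\<^sup>2) * (ennreal (2 ^ DIM('a)) * emeasure lborel K * (\<integral>\<^sup>+z. ennreal ((norm (D z))\<^sup>2) * indicator K z \<partial>lborel))"
proof -
  have [measurable]: "D \<in> borel_measurable borel" using D by (rule borel_measurable_continuous_onI)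
  have [measurable]: "\<phi> \<in> borel_measurable borel"
    using g by (intro borel_measurable_continuous_onI has_derivative_continuous_on) (auto simp: gderiv_def)
  define h where "h z = ennreal ((norm (D z))\<^sup>2) * indicator K z" for z
  have [measurable]: "h \<in> borel_measurable borel" unfolding h_def by measurable
  define J where "J t = (\<integral>\<^sup>+y. \<integral>\<^sup>+x. h ((1 - t) *\<^sub>R y + t *\<^sub>R x) * indicator K x * indicator K y \<partial>lborel \<partial>lborel)" for t :: real
  let ?I = "ennreal (2 ^ DIM('a)) * emeasure lborel K * (\<integral>\<^sup>+z. h z \<partial>lborel)"
  have J: "J t <= ?I" if "t \<in> {0..1}" for t
  proof (cases "1/2 <= t")
    case True
    then show ?thesis unfolding J_def by (intro convex_translate_integral_le) auto
  next
    case False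
    have "J t = (\<integral>\<^sup>+x. \<integral>\<^sup>+y. h ((1 - t) *\<^sub>R y + t *\<^sub>R x) * indicator K x * indicator K y \<partial>lborel \<partial>lborel)"
      unfolding J_def by (rule lborel_pair.Fubini') measurable
    also have "\<dots> = (\<integral>\<^sup>+x. \<integral>\<^sup>+y. h ((1 - (1 - t)) *\<^sub>R x + (1 - t) *\<^sub>R y) * indicator K y * indicator K x \<partial>lborel \<partial>lborel)"
      by (simp add: add.commute mult_ac)
    also have "\<dots> <= ?I" using False by (intro convex_translate_integral_le) auto
    finally show ?thesis .
  qed
  have "(\<integral>\<^sup>+y. \<integral>\<^sup>+x. ennreal ((\<phi> x - \<phi> y)\<^sup>2) * indicator K x * indicator K y \<partial>lborel \<partial>lborel)
    <= (\<integral>\<^sup>+y. \<integral>\<^sup>+x. \<integral>\<^sup>+t. ennreal (\<delta>\<^sup>2) * (h ((1 - t) *\<^sub>R y + t *\<^sub>R x) * indicator K x * indicator K y * indicator {0..1} t) \<partial>lborel \<partial>lborel \<partial>lborel)"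
  proof (intro nn_integral_mono)
    fix y x
    show "ennreal ((\<phi> x - \<phi> y)\<^sup>2) * indicator K x * indicator K y
      <= (\<integral>\<^sup>+t. ennreal (\<delta>\<^sup>2) * (h ((1 - t) *\<^sub>R y + t *\<^sub>R x) * indicator K x * indicator K y * indicator {0..1} t) \<partial>lborel)"
    proof (cases "x \<in> K \<and> y \<in> K")
      case True
      have hK: "ennreal ((norm (D ((1 - t) *\<^sub>R y + t *\<^sub>R x)))\<^sup>2) * indicator {0..1} t = h ((1 - t) *\<^sub>R y + t *\<^sub>R x) * indicator {0..1} t" for t
      proof (cases "t \<in> {0..1}")
        case t: True
        then have "(1 - t) *\<^sub>R y + t *\<^sub>R x \<in> K" using True conv by (intro convexD) auto
        then show ?thesis by (simp add: h_def)
      qed simp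
      have "ennreal ((\<phi> x - \<phi> y)\<^sup>2) <= ennreal ((norm (x - y))\<^sup>2) * (\<integral>\<^sup>+t. h ((1 - t) *\<^sub>R y + t *\<^sub>R x) * indicator {0..1} t \<partial>lborel)"
        using C1_segment_bound[OF g D, of x y] by (simp add: hK)
      also have "\<dots> <= ennreal (\<delta>\<^sup>2) * (\<integral>\<^sup>+t. h ((1 - t) *\<^sub>R y + t *\<^sub>R x) * indicator {0..1} t \<partial>lborel)"
        using True diam[of x y] by (intro mult_right_mono ennreal_leI power_mono) auto
      finally show ?thesis using True by (simp add: nn_integral_cmult)
    qed (auto simp: indicator_def)
  qed
  also have "\<dots> = (\<integral>\<^sup>+y. \<integral>\<^sup>+t. \<integral>\<^sup>+x. ennreal (\<delta>\<^sup>2) * (h ((1 - t) *\<^sub>R y + t *\<^sub>R x) * indicator K x * indicator K y * indicator {0..1} t) \<partial>lborel \<partial>lborel \<partial>lborel)"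
    by (intro nn_integral_cong lborel_pair.Fubini') measurable
  also have "\<dots> = (\<integral>\<^sup>+t. \<integral>\<^sup>+y. \<integral>\<^sup>+x. ennreal (\<delta>\<^sup>2) * (h ((1 - t) *\<^sub>R y + t *\<^sub>R x) * indicator K x * indicator K y * indicator {0..1} t) \<partial>lborel \<partial>lborel \<partial>lborel)"
    by (rule lborel_pair.Fubini') measurable
  also have "\<dots> = (\<integral>\<^sup>+t. ennreal (\<delta>\<^sup>2) * (J t * indicator {0..1} t) \<partial>lborel)"
    unfolding J_def by (simp add: nn_integral_cmult nn_integral_multc)
  also have "\<dots> <= (\<integral>\<^sup>+t. (ennreal (\<delta>\<^sup>2) * ?I) * indicator {0..1::real} t \<partial>lborel)"
    using J by (intro nn_integral_mono) (auto simp: indicator_def intro: mult_left_mono)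
  also have "\<dots> = ennreal (\<delta>\<^sup>2) * ?I" by (simp add: nn_integral_cmult_indicator)
  finally show ?thesis unfolding h_def .
qed

lemma integral_le_nn_integral:
  fixes f :: "'a => real"
  assumes f: "integrable M f"
  shows "ennreal (LINT x|M. f x) <= (\<integral>\<^sup>+x. ennreal (f x) \<partial>M)"
proof -
  have i: "integrable M (%x. max 0 (f x))" using f by (intro integrable_max) auto
  have "ennreal (LINT x|M. f x) <= ennreal (LINT x|M. max 0 (f x))"
    using f i by (intro ennreal_leI integral_mono) auto
  also have "\<dots> = (\<integral>\<^sup>+x. ennreal (max 0 (f x)) \<partial>M)" by (rule nn_integral_eq_integral[OF i, symmetric]) auto
  also have "\<dots> = (\<integral>\<^sup>+x. ennreal (f x) \<partial>M)" by (intro nn_integral_cong) (auto simp: max_def ennreal_neg)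
  finally show ?thesis .
qed

text \<open>Over all pairs of points of \<open>K\<close>, the squared difference of the values
  integrates to 2 |K| times the integral of \<phi>^2 minus twice the square of the integral of
  \<phi>. Nothing is divided by |K|, so the inequality also covers null sets.\<close>

lemma poincare_convex:
  fixes K :: "'a::euclidean_space set"
  assumes C: "C1_compact \<Omega> \<phi> D"
    and K [measurable]: "K \<in> sets borel" and conv: "convex K" and diam: "\<And>x y. x \<in> K ==> y \<in> K ==> norm (x - y) <= \<delta>"
    and fin: "emeasure lborel K < top"
  shows "measure lborel K * (LBINT x:K. (\<phi> x)\<^sup>2)
    <= (LBINT x:K. \<phi> x)\<^sup>2 + (\<delta>\<^sup>2 * 2 ^ DIM('a)) * measure lborel K * (LBINT x:K. (norm (D x))\<^sup>2)"
proof -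
  have g: "\<And>x. GDERIV \<phi> x :> D x" and D: "continuous_on UNIV D" using C by (auto simp: C1_compact_def)
  have sq: "L2_fun \<phi>" "L2_fun D" using C1_compact_L2_fun[OF C] by auto
  have [measurable]: "\<phi> \<in> borel_measurable borel" "D \<in> borel_measurable borel" using sq by (auto simp: L2_fun_def)
  have si: "integrable lborel (%x. indicator K x * (\<phi> x)\<^sup>2)" "integrable lborel (%x. indicator K x * (norm (D x))\<^sup>2)"
    using sq integrable_mult_indicator[of K lborel "%x. (\<phi> x)\<^sup>2"] integrable_mult_indicator[of K lborel "%x. (norm (D x))\<^sup>2"]
    by (auto simp: L2_fun_def)
  have i1: "integrable lborel (%x. indicator K x :: real)" using fin by (simp add: less_top)
  have i\<phi>: "integrable lborel (%x. indicator K x * \<phi> x)"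
  proof (rule Bochner_Integration.integrable_bound)
    show "integrable lborel (%x. indicator K x * (\<phi> x)\<^sup>2 + indicator K x)" using si i1 by simp
    have "\<bar>a\<bar> <= a\<^sup>2 + 1" for a :: real
      using sum_squares_bound[of "\<bar>a\<bar>" 1] by simp
    then show "AE x in lborel. norm (indicator K x * \<phi> x) <= norm (indicator K x * (\<phi> x)\<^sup>2 + indicator K x)"
      by (intro AE_I2) (auto simp: indicator_def)
  qed measurable
  define A where "A = (LBINT x:K. (\<phi> x)\<^sup>2)"
  define B where "B = (LBINT x:K. \<phi> x)"
  define m where "m = measure lborel K"
  define G where "G = (LBINT x:K. (norm (D x))\<^sup>2)"
  have A: "A = (\<integral>x. indicator K x * (\<phi> x)\<^sup>2 \<partial>lborel)" and B: "B = (\<integral>x. indicator K x * \<phi> x \<partial>lborel)"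
    and G: "G = (\<integral>x. indicator K x * (norm (D x))\<^sup>2 \<partial>lborel)"
    and m: "m = (\<integral>x. indicator K x \<partial>lborel)"
    by (simp_all add: A_def B_def G_def m_def set_lebesgue_integral_def)
  have inner: "(\<integral>\<^sup>+x. ennreal ((\<phi> x - \<phi> y)\<^sup>2) * indicator K x * indicator K y \<partial>lborel) = ennreal (indicator K y * A - (2 * B) * (indicator K y * \<phi> y) + m * (indicator K y * (\<phi> y)\<^sup>2))" for y
  proof -
    have i: "integrable lborel (%x. indicator K y * (indicator K x * (\<phi> x)\<^sup>2) - (2 * (indicator K y * \<phi> y)) * (indicator K x * \<phi> x) + (indicator K y * (\<phi> y)\<^sup>2) * indicator K x)"
      using si i1 i\<phi> by (intro Bochner_Integration.integrable_add Bochner_Integration.integrable_diff integrable_mult_right)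
    have "(\<integral>\<^sup>+x. ennreal ((\<phi> x - \<phi> y)\<^sup>2) * indicator K x * indicator K y \<partial>lborel)
      = (\<integral>\<^sup>+x. ennreal (indicator K y * (indicator K x * (\<phi> x)\<^sup>2) - (2 * (indicator K y * \<phi> y)) * (indicator K x * \<phi> x) + (indicator K y * (\<phi> y)\<^sup>2) * indicator K x) \<partial>lborel)"
      by (intro nn_integral_cong) (auto simp: indicator_def power2_eq_square algebra_simps)
    also have "\<dots> = ennreal (\<integral>x. indicator K y * (indicator K x * (\<phi> x)\<^sup>2) - (2 * (indicator K y * \<phi> y)) * (indicator K x * \<phi> x) + (indicator K y * (\<phi> y)\<^sup>2) * indicator K x \<partial>lborel)"
    proof (rule nn_integral_eq_integral[OF i], intro AE_I2)
      fix x
      have "indicator K y * (indicator K x * (\<phi> x)\<^sup>2) - (2 * (indicator K y * \<phi> y)) * (indicator K x * \<phi> x) + (indicator K y * (\<phi> y)\<^sup>2) * indicator K x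
        = indicator K y * indicator K x * (\<phi> x - \<phi> y)\<^sup>2" by (simp add: power2_eq_square algebra_simps)
      then show "0 <= indicator K y * (indicator K x * (\<phi> x)\<^sup>2) - (2 * (indicator K y * \<phi> y)) * (indicator K x * \<phi> x) + (indicator K y * (\<phi> y)\<^sup>2) * indicator K x"
        by simp
    qed
    also have "(\<integral>x. indicator K y * (indicator K x * (\<phi> x)\<^sup>2) - (2 * (indicator K y * \<phi> y)) * (indicator K x * \<phi> x) + (indicator K y * (\<phi> y)\<^sup>2) * indicator K x \<partial>lborel)
        = indicator K y * A - (2 * B) * (indicator K y * \<phi> y) + m * (indicator K y * (\<phi> y)\<^sup>2)"
      using si i1 i\<phi> by (simp add: A B m)
    finally show ?thesis .
  qed
  have i2: "integrable lborel (%y. indicator K y * A - (2 * B) * (indicator K y * \<phi> y) + m * (indicator K y * (\<phi> y)\<^sup>2))"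
    using si i1 i\<phi> by (intro Bochner_Integration.integrable_add Bochner_Integration.integrable_diff integrable_mult_right integrable_mult_left)
  have "(\<integral>y. indicator K y * A - (2 * B) * (indicator K y * \<phi> y) + m * (indicator K y * (\<phi> y)\<^sup>2) \<partial>lborel) = m * A - (2 * B) * B + m * A"
    using si i1 i\<phi> by (simp add: A[symmetric] B[symmetric] m_def[symmetric])
  then have "ennreal (m * A - (2 * B) * B + m * A) = ennreal (\<integral>y. indicator K y * A - (2 * B) * (indicator K y * \<phi> y) + m * (indicator K y * (\<phi> y)\<^sup>2) \<partial>lborel)"
    by (simp only:)
  also have "\<dots> <= (\<integral>\<^sup>+y. ennreal (indicator K y * A - (2 * B) * (indicator K y * \<phi> y) + m * (indicator K y * (\<phi> y)\<^sup>2)) \<partial>lborel)"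
    by (rule integral_le_nn_integral[OF i2])
  also have "\<dots> <= ennreal (\<delta>\<^sup>2) * (ennreal (2 ^ DIM('a)) * emeasure lborel K * (\<integral>\<^sup>+z. ennreal ((norm (D z))\<^sup>2) * indicator K z \<partial>lborel))"
    unfolding inner[symmetric] by (rule poincare_convex_nn[OF g D K conv diam])
  also have "(\<integral>\<^sup>+z. ennreal ((norm (D z))\<^sup>2) * indicator K z \<partial>lborel) = (\<integral>\<^sup>+z. ennreal (indicator K z * (norm (D z))\<^sup>2) \<partial>lborel)"
    by (intro nn_integral_cong) (auto simp: indicator_def)
  also have "\<dots> = ennreal G" unfolding G by (rule nn_integral_eq_integral[OF si(2)]) auto
  also have "emeasure lborel K = ennreal m" using fin by (simp add: m_def emeasure_eq_ennreal_measure)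
  also have "ennreal (\<delta>\<^sup>2) * (ennreal (2 ^ DIM('a)) * ennreal m * ennreal G) = ennreal (\<delta>\<^sup>2 * (2 ^ DIM('a) * m * G))"
    by (simp add: ennreal_mult m_def G_def set_integral_nonneg)
  finally have "m * A - (2 * B) * B + m * A <= \<delta>\<^sup>2 * (2 ^ DIM('a) * m * G)"
    by (subst (asm) ennreal_le_iff) (auto simp: m_def G_def set_integral_nonneg)
  \<comment> \<open>The computation gives the claim with half of the stated constant; the other
    half, which is nonnegative, is added for a simpler form.\<close>
  moreover have "0 <= \<delta>\<^sup>2 * (2 ^ DIM('a) * m * G)" by (auto simp: m_def G_def intro!: set_integral_nonneg mult_nonneg_nonneg)
  ultimately show ?thesis unfolding A_def[symmetric] B_def[symmetric] m_def[symmetric] G_def[symmetric]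
    by (simp add: power2_eq_square mult_ac)
qed

section \<open>Grid cubes and compactness of the embedding\<close>

definition cell :: "nat => ('a::euclidean_space => int) => 'a set" where
  "cell m a = {x. \<forall>i\<in>Basis. \<lfloor>real m * (x \<bullet> i)\<rfloor> = a i}"

text \<open>Indices enough for all cells that meet the ball of radius \<open>R\<close>. Extensional
  functions are used so that no cell is listed under two indices and each point of the ball is
  counted exactly once.\<close>

definition cell_index :: "nat => real => ('a::euclidean_space => int) set" where
  "cell_index m R = Basis \<rightarrow>\<^sub>E {- \<lceil>real m * R\<rceil> - 1..\<lceil>real m * R\<rceil> + 1}"

lemma finite_cell_index: "finite (cell_index m R)"
  unfolding cell_index_def by (intro finite_PiE) auto

lemma cell_facts:
  fixes a :: "'a::euclidean_space => int"
  assumes m: "0 < m"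
  shows "cell m a \<in> sets borel" "convex (cell m a)" "emeasure lborel (cell m a) < top"
    "\<And>x y. x \<in> cell m a ==> y \<in> cell m a ==> norm (x - y) <= DIM('a) / m"
proof -
  have iff: "x \<in> cell m a \<longleftrightarrow> (\<forall>i\<in>Basis. of_int (a i) / m <= x \<bullet> i \<and> x \<bullet> i < (of_int (a i) + 1) / m)" for x
    using m by (simp add: cell_def floor_eq_iff field_simps)
  then have eq: "cell m a = (\<Inter>i\<in>Basis. {x. of_int (a i) / m <= i \<bullet> x} \<inter> {x. i \<bullet> x < (of_int (a i) + 1) / m})"
    by (auto simp: inner_commute)
  show "cell m a \<in> sets borel"
    unfolding eq by (intro sets.finite_INT) (auto intro!: borel_closed borel_open closed_halfspace_ge open_halfspace_lt)
  show "convex (cell m a)"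
    unfolding eq by (intro convex_INT convex_Int convex_halfspace_ge convex_halfspace_lt)
  have sub: "cell m a \<subseteq> cbox (\<Sum>i\<in>Basis. (of_int (a i) / m) *\<^sub>R i) (\<Sum>i\<in>Basis. ((of_int (a i) + 1) / m) *\<^sub>R i)"
    by (auto simp: mem_box iff less_imp_le)
  then have "bounded (cell m a)" using bounded_cbox bounded_subset by blast
  then show "emeasure lborel (cell m a) < top" using emeasure_bounded_finite by auto
  fix x y assume xy: "x \<in> cell m a" "y \<in> cell m a"
  have "norm (x - y) <= (\<Sum>i\<in>Basis. \<bar>(x - y) \<bullet> i\<bar>)" by (rule norm_le_l1)
  also have "\<dots> <= (\<Sum>i\<in>(Basis::'a set). 1 / m)"
  proof (rule sum_mono)
    fix i :: 'a assume "i \<in> Basis"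
    then have "of_int (a i) / m <= x \<bullet> i \<and> x \<bullet> i < (of_int (a i) + 1) / m"
      "of_int (a i) / m <= y \<bullet> i \<and> y \<bullet> i < (of_int (a i) + 1) / m"
      using xy by (auto simp: iff)
    then show "\<bar>(x - y) \<bullet> i\<bar> <= 1 / m" unfolding inner_diff_left add_divide_distrib by linarith
  qed
  finally show "norm (x - y) <= DIM('a) / m" by simp
qed

lemma sum_cell_indicator:
  fixes x :: "'a::euclidean_space"
  assumes x: "norm x <= R"
  shows "(\<Sum>a\<in>cell_index m R. indicator (cell m a) x) = (1::real)"
proof -
  let ?b = "restrict (%i. \<lfloor>real m * (x \<bullet> i)\<rfloor>) Basis"
  have b: "?b \<in> cell_index m R"
    unfolding cell_index_def
  proof (rule restrict_PiE_iff[THEN iffD2], intro ballI)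
    fix i :: 'a assume "i \<in> Basis"
    then have "\<bar>x \<bullet> i\<bar> <= R" using x Basis_le_norm order_trans by blast
    then have "\<bar>real m * (x \<bullet> i)\<bar> <= real m * R" by (simp add: abs_mult mult_left_mono)
    then have "- (real m * R) <= real m * (x \<bullet> i)" "real m * (x \<bullet> i) <= real m * R" by linarith+
    then show "\<lfloor>real m * (x \<bullet> i)\<rfloor> \<in> {- \<lceil>real m * R\<rceil> - 1..\<lceil>real m * R\<rceil> + 1}" by (auto; linarith)
  qed
  have "indicator (cell m a) x = (if a = ?b then 1 else 0 :: real)" if a: "a \<in> cell_index m R" for a
  proof -
    have "a \<in> extensional Basis" using a by (simp add: cell_index_def PiE_iff)
    then have "x \<in> cell m a \<longleftrightarrow> a = ?b"
      by (auto simp: cell_def extensional_def fun_eq_iff)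
    then show ?thesis by (simp add: indicator_def)
  qed
  then have "(\<Sum>a\<in>cell_index m R. indicator (cell m a) x) = (\<Sum>a\<in>cell_index m R. if a = ?b then 1 else 0 :: real)"
    by (rule sum.cong[OF refl])
  also have "\<dots> = 1" using b sum.delta[OF finite_cell_index[of m R], of ?b "%_. 1::real"] by simp
  finally show ?thesis .
qed

definition cell_fun :: "nat => ('a::euclidean_space => int) => ('a, real) L2" where
  "cell_fun m a = cls (indicator (cell m a))"

lemma L2_fun_indicator:
  assumes "A \<in> sets borel" "emeasure lborel A < top"
  shows "L2_fun (%x. indicator A x :: real)"
proof -
  have "(norm (indicator A x :: real))\<^sup>2 = indicator A x" for x by (simp add: indicator_def)
  then show ?thesis using assms by (simp add: L2_fun_def less_top)
qed

text \<open>Poincare's inequality summed over the cells of side 1/m. Up to finitely many linear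
  functionals the L^2 norm is controlled by the gradient with a constant of order 1/m^2, which is
  compactness in quantitative form.\<close>

lemma rellich_inequality:
  assumes m: "0 < m" and z: "z \<in> form_dom \<Omega>" and \<Omega>: "\<Omega> \<subseteq> cball (0::'a::euclidean_space) R"
  shows "(norm (fst z))\<^sup>2 <= (\<Sum>a\<in>cell_index m R. inverse (measure lborel (cell m a)) * (fst z \<bullet> cell_fun m a)\<^sup>2)
    + ((DIM('a) / m)\<^sup>2 * 2 ^ DIM('a)) * (norm (snd z))\<^sup>2"
proof (rule form_dom_induct_closed[OF z, of "%z. (norm (fst z))\<^sup>2 <= (\<Sum>a\<in>cell_index m R. inverse (measure lborel (cell m a)) * (fst z \<bullet> cell_fun m a)\<^sup>2)
    + ((DIM('a) / m)\<^sup>2 * 2 ^ DIM('a)) * (norm (snd z))\<^sup>2"])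
  show "closed {z :: ('a, real) L2 \<times> ('a, 'a) L2. (norm (fst z))\<^sup>2 <= (\<Sum>a\<in>cell_index m R. inverse (measure lborel (cell m a)) * (fst z \<bullet> cell_fun m a)\<^sup>2)
    + ((DIM('a) / m)\<^sup>2 * 2 ^ DIM('a)) * (norm (snd z))\<^sup>2}"
    by (intro closed_Collect_le continuous_intros)
  fix \<phi> D assume C: "C1_compact \<Omega> \<phi> D"
  have sq: "L2_fun \<phi>" "L2_fun D" using C1_compact_L2_fun[OF C] by auto
  have split: "(LBINT x. f x) = (\<Sum>a\<in>cell_index m R. LBINT x:cell m a. f x)"
    if f: "integrable lborel f" and f0: "\<And>x. x \<notin> \<Omega> ==> f x = 0" for f :: "'a => real"
  proof -
    have "f x = (\<Sum>a\<in>cell_index m R. indicator (cell m a) x *\<^sub>R f x)" for x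
    proof (cases "x \<in> \<Omega>")
      case True
      then have "norm x <= R" using \<Omega> by auto
      then show ?thesis using sum_cell_indicator[of x R m] by (simp flip: sum_distrib_right)
    qed (simp add: f0)
    then have "(LBINT x. f x) = (LBINT x. (\<Sum>a\<in>cell_index m R. indicator (cell m a) x *\<^sub>R f x))" by (rule Bochner_Integration.integral_cong[OF refl])
    also have "\<dots> = (\<Sum>a\<in>cell_index m R. LBINT x. indicator (cell m a) x *\<^sub>R f x)"
      by (rule Bochner_Integration.integral_sum) (intro integrable_mult_indicator f, use cell_facts(1)[OF m] in simp)
    finally show ?thesis by (simp add: set_lebesgue_integral_def)
  qed
  have out: "\<phi> x = 0" "D x = 0" if "x \<notin> \<Omega>" for x
    using fun_cong[OF C1_compact_restr(1)[OF C], of x] fun_cong[OF C1_compact_restr(2)[OF C], of x] that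
    by (simp_all add: restr_def)
  have bound: "(LBINT x:cell m a. (\<phi> x)\<^sup>2) <= inverse (measure lborel (cell m a)) * (cls \<phi> \<bullet> cell_fun m a)\<^sup>2
      + ((DIM('a) / m)\<^sup>2 * 2 ^ DIM('a)) * (LBINT x:cell m a. (norm (D x))\<^sup>2)" for a
  proof -
    note cf = cell_facts[OF m, where a = a]
    have ip: "cls \<phi> \<bullet> cell_fun m a = (LBINT x:cell m a. \<phi> x)"
      unfolding cell_fun_def using inner_cls[OF sq(1) L2_fun_indicator[OF cf(1,3)]]
      by (simp add: set_lebesgue_integral_def mult.commute)
    show ?thesis
    proof (cases "measure lborel (cell m a) = 0")
      \<comment> \<open>The measure of a cell is not computed; were it 0, the left side would
        vanish, and the right side is nonnegative.\<close>
      case True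
      then have "emeasure lborel (cell m a) = 0" using cf(3) by (simp add: emeasure_eq_ennreal_measure)
      then have "cell m a \<in> null_sets lborel" using cf(1) by auto
      then have "AE x in lborel. x \<notin> cell m a" by (rule AE_not_in)
      then have "AE x in lborel. indicator (cell m a) x *\<^sub>R (\<phi> x)\<^sup>2 = 0" by eventually_elim simp
      then have "(LBINT x:cell m a. (\<phi> x)\<^sup>2) = 0"
        unfolding set_lebesgue_integral_def by (rule integral_eq_zero_AE)
      then show ?thesis by (auto intro!: add_nonneg_nonneg mult_nonneg_nonneg set_integral_nonneg)
    next
      case False
      then have pos: "0 < measure lborel (cell m a)" by (simp add: zero_less_measure_iff)
      have alg: "A <= inverse M * X + c * G" if "M * A <= X + c * M * G" "0 < M" for M A X c G :: real
        using that by (simp add: field_simps)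
      show ?thesis
        unfolding ip by (rule alg[OF poincare_convex[OF C cf(1,2,4,3)] pos])
    qed
  qed
  have "(norm (cls \<phi>))\<^sup>2 = (\<Sum>a\<in>cell_index m R. LBINT x:cell m a. (\<phi> x)\<^sup>2)"
    using norm_cls[OF sq(1)] split[of "%x. (\<phi> x)\<^sup>2"] sq(1) out by (simp add: L2_fun_def)
  also have "\<dots> <= (\<Sum>a\<in>cell_index m R. inverse (measure lborel (cell m a)) * (cls \<phi> \<bullet> cell_fun m a)\<^sup>2
      + ((DIM('a) / m)\<^sup>2 * 2 ^ DIM('a)) * (LBINT x:cell m a. (norm (D x))\<^sup>2))"
    by (intro sum_mono bound)
  also have "\<dots> = (\<Sum>a\<in>cell_index m R. inverse (measure lborel (cell m a)) * (cls \<phi> \<bullet> cell_fun m a)\<^sup>2)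
    + ((DIM('a) / m)\<^sup>2 * 2 ^ DIM('a)) * (norm (cls D))\<^sup>2"
    using norm_cls[OF sq(2)] split[of "%x. (norm (D x))\<^sup>2"] sq(2) out
    by (simp add: L2_fun_def sum.distrib sum_distrib_left)
  finally show "(norm (fst (cls \<phi>, cls D)))\<^sup>2 <= (\<Sum>a\<in>cell_index m R. inverse (measure lborel (cell m a)) * (fst (cls \<phi>, cls D) \<bullet> cell_fun m a)\<^sup>2)
    + ((DIM('a) / m)\<^sup>2 * 2 ^ DIM('a)) * (norm (snd (cls \<phi>, cls D)))\<^sup>2" by simp
qed

lemma bounded_finite_family_subseq:
  fixes f :: "'i => nat => real"
  assumes "finite A" "\<And>a n. \<bar>f a n\<bar> <= B a"
  shows "\<exists>r. strict_mono (r::nat => nat) \<and> (\<forall>a\<in>A. convergent (%n. f a (r n)))"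
  using assms(1)
proof induction
  case empty
  then show ?case by (auto intro: exI[of _ id] simp: strict_mono_def)
next
  case (insert b A)
  then obtain r where r: "strict_mono (r::nat => nat)" "\<forall>a\<in>A. convergent (%n. f a (r n))" by blast
  have "bounded (range (%n. f b (r n)))" unfolding bounded_iff using assms(2) by auto
  then obtain l s where s: "strict_mono (s::nat => nat)" "((%n. f b (r n)) \<circ> s) \<longlonglongrightarrow> l"
    using bounded_imp_convergent_subsequence by blast
  have "convergent (%n. f a (r (s n)))" if "a \<in> A" for a
    using convergent_subseq_convergent[of "%n. f a (r n)" s] r(2) that s(1) by (simp add: comp_def)
  moreover have "convergent (%n. f b (r (s n)))" using s(2) by (auto simp: convergent_def comp_def)
  ultimately show ?case using strict_mono_o[OF r(1) s(1)] by (intro exI[of _ "r \<circ> s"]) (auto simp: comp_def)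
qed

text \<open>A diagonal subsequence makes the cell functionals of all grids converge. First a grid
  fine enough for the gradient term, then indices large enough for its finitely many functionals,
  give the Cauchy property.\<close>

theorem rellich:
  fixes z :: "nat => ('a::euclidean_space, real) L2 \<times> ('a, 'a) L2"
  assumes \<Omega>: "\<Omega> \<subseteq> cball 0 R" and z: "\<And>n. z n \<in> form_dom \<Omega> \<and> norm (z n) <= 1"
  shows "\<exists>r. strict_mono (r::nat => nat) \<and> convergent (%n. fst (z (r n)))"
proof -
  let ?P = "%m s. \<forall>a\<in>cell_index m R. convergent (%n. fst (z (s n)) \<bullet> cell_fun m a)"
  have fz: "norm (fst (z n)) <= 1" "norm (snd (z n)) <= 1" for n
  proof -
    have "norm (fst (z n)) <= norm (z n)" "norm (snd (z n)) <= norm (z n)"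
      by (cases "z n"; simp add: norm_Pair real_le_rsqrt)+
    then show "norm (fst (z n)) <= 1" "norm (snd (z n)) <= 1" using z[of n] by auto
  qed
  have bd: "\<bar>fst (z n) \<bullet> w\<bar> <= norm w" for n w
    using Cauchy_Schwarz_ineq2[of "fst (z n)" w] mult_right_mono[OF fz(1)[of n] norm_ge_zero[of w]] by simp
  interpret subseqs ?P
  proof
    fix m and s :: "nat => nat" assume "strict_mono s"
    show "\<exists>r'. strict_mono r' \<and> ?P m (s \<circ> r')"
    proof -
      have b: "\<bar>fst (z (s n)) \<bullet> cell_fun m a\<bar> <= norm (cell_fun m a)" for a n by (rule bd)
      from bounded_finite_family_subseq[of "cell_index m R" "%a n. fst (z (s n)) \<bullet> cell_fun m a" "%a. norm (cell_fun m a)", OF finite_cell_index b]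
      show ?thesis unfolding comp_def .
    qed
  qed
  define r where "r = diagseq"
  have r: "strict_mono r" unfolding r_def by (rule subseq_diagseq)
  have conv: "convergent (%n. fst (z (r n)) \<bullet> cell_fun m a)" if a: "a \<in> cell_index m R" for m a
  proof -
    have "?P m (diagseq \<circ> ((+) (Suc m)))"
    proof (rule diagseq_holds)
      fix q s :: "nat => nat" and n assume "strict_mono q" "?P n s"
      then show "?P n (s \<circ> q)"
        using convergent_subseq_convergent[of "%k. fst (z (s k)) \<bullet> cell_fun n a" q for a] by (auto simp: comp_def)
    qed
    then have "convergent (%n. fst (z (r (n + Suc m))) \<bullet> cell_fun m a)" using a by (auto simp: r_def comp_def add.commute)
    then show ?thesis by (simp only: convergent_ignore_initial_segment[of "%n. fst (z (r n)) \<bullet> cell_fun m a"])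
  qed
  have "Cauchy (%n. fst (z (r n)))"
  proof (rule CauchyI)
    fix \<epsilon> :: real assume \<epsilon>: "0 < \<epsilon>"
    define d where "d = real DIM('a)"
    \<comment> \<open>The 4 bounds the squared norm of a difference of two gradients, each of norm
      at most 1.\<close>
    define Q where "Q = d\<^sup>2 * 2 ^ DIM('a) * 4"
    obtain m :: nat where m': "max 1 (Q / (\<epsilon>\<^sup>2 / 2)) < m" using reals_Archimedean2 by blast
    then have m: "0 < m" "Q / (\<epsilon>\<^sup>2 / 2) < m" by (auto intro: gr0I)
    have Q: "(d / m)\<^sup>2 * 2 ^ DIM('a) * 4 < \<epsilon>\<^sup>2 / 2"
    proof -
      have "0 <= Q" by (simp add: Q_def)
      then have "(d / m)\<^sup>2 * 2 ^ DIM('a) * 4 = Q / m / m" by (simp add: Q_def power2_eq_square)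
      also have "\<dots> <= Q / m" using m \<open>0 <= Q\<close> divide_left_mono[of 1 "real m" "Q / m"] by simp
      also have "\<dots> < \<epsilon>\<^sup>2 / 2" using m \<epsilon> by (simp add: field_simps)
      finally show ?thesis .
    qed
    let ?N = "%k n. \<Sum>a\<in>cell_index m R. inverse (measure lborel (cell m a)) * ((fst (z (r k)) - fst (z (r n))) \<bullet> cell_fun m a)\<^sup>2"
    have "\<exists>M. \<forall>k\<ge>M. \<forall>n\<ge>M. ?N k n < \<epsilon>\<^sup>2 / 2"
    proof -
      define L where "L a = lim (%n. fst (z (r n)) \<bullet> cell_fun m a)" for a
      have L: "(%n. fst (z (r n)) \<bullet> cell_fun m a) \<longlonglongrightarrow> L a" if "a \<in> cell_index m R" for a
        using conv[OF that] by (simp add: L_def convergent_LIMSEQ_iff)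
      have "((%(k, n). \<Sum>a\<in>cell_index m R. inverse (measure lborel (cell m a)) * (fst (z (r k)) \<bullet> cell_fun m a - fst (z (r n)) \<bullet> cell_fun m a)\<^sup>2)
        \<longlongrightarrow> (\<Sum>a\<in>cell_index m R. inverse (measure lborel (cell m a)) * (L a - L a)\<^sup>2)) (sequentially \<times>\<^sub>F sequentially)"
        unfolding case_prod_beta
        by (intro tendsto_intros filterlim_compose[OF L filterlim_fst] filterlim_compose[OF L filterlim_snd])
      then have "\<forall>\<^sub>F p in sequentially \<times>\<^sub>F sequentially. (case p of (k, n) => ?N k n) < \<epsilon>\<^sup>2 / 2"
        using \<epsilon> by (intro order_tendstoD(2)[of _ "\<Sum>a\<in>cell_index m R. inverse (measure lborel (cell m a)) * (L a - L a)\<^sup>2"]) (simp_all add: inner_diff_left case_prod_unfold)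
      then show ?thesis
        unfolding eventually_prod_sequentially by auto
    qed
    then obtain M where M: "\<And>k n. k \<ge> M ==> n \<ge> M ==> ?N k n < \<epsilon>\<^sup>2 / 2" by blast
    show "\<exists>M. \<forall>k\<ge>M. \<forall>n\<ge>M. norm (fst (z (r k)) - fst (z (r n))) < \<epsilon>"
    proof (intro exI[of _ M] allI impI)
      fix k n assume kn: "k \<ge> M" "n \<ge> M"
      have zz: "z (r k) - z (r n) \<in> form_dom \<Omega>" using z by (intro subspace_diff subspace_form_dom) auto
      have "norm (snd (z (r k)) - snd (z (r n))) <= 2"
        using norm_triangle_ineq4[of "snd (z (r k))" "snd (z (r n))"] fz(2)[of "r k"] fz(2)[of "r n"] by linarith
      then have "(norm (snd (z (r k)) - snd (z (r n))))\<^sup>2 <= 4" using power_mono[of _ 2 2] by fastforce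
      then have "(d / m)\<^sup>2 * 2 ^ DIM('a) * (norm (snd (z (r k)) - snd (z (r n))))\<^sup>2 <= (d / m)\<^sup>2 * 2 ^ DIM('a) * 4"
        by (intro mult_left_mono) auto
      moreover have "(norm (fst (z (r k)) - fst (z (r n))))\<^sup>2 <= ?N k n + (d / m)\<^sup>2 * 2 ^ DIM('a) * (norm (snd (z (r k)) - snd (z (r n))))\<^sup>2"
        using rellich_inequality[OF m(1) zz \<Omega>] by (simp add: d_def)
      ultimately have "(norm (fst (z (r k)) - fst (z (r n))))\<^sup>2 < \<epsilon>\<^sup>2" using M[OF kn] Q by linarith
      then show "norm (fst (z (r k)) - fst (z (r n))) < \<epsilon>" by (rule power2_less_imp_less) (use \<epsilon> in simp)
    qed
  qed
  then have "convergent (%n. fst (z (r n)))" by (simp add: Cauchy_convergent_iff)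
  with r show ?thesis by blast
qed

subsection \<open>Chain and product rules in the form domain\<close>

text \<open>For the chain rule: a continuous function of the approximants converges where the
  approximants do, and norm convergence alone gives no such points.\<close>

lemma L2_tendsto_subseq_AE:
  fixes f :: "nat => 'a::euclidean_space => 'b::euclidean_space"
  assumes f: "\<And>n. L2_fun (f n)" and lim: "(%n. cls (f n)) \<longlonglongrightarrow> z"
  obtains r :: "nat => nat" where "strict_mono r" "AE x in lborel. (%n. f (r n) x) \<longlonglongrightarrow> rep_L2 z x"
proof -
  have "Cauchy (%n. cls (f n))" using lim by (rule LIMSEQ_imp_Cauchy)
  then obtain r where r: "strict_mono (r::nat => nat)" "\<And>n. norm (cls (f (r (Suc n))) - cls (f (r n))) < (1/4) ^ n"
    using Cauchy_fast_subseq[of "%n. cls (f n)" "%n. (1/4) ^ n"] by auto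
  have fast: "(norm (cls (f (r (Suc n))) - cls (f (r n))))\<^sup>2 <= (1/16) ^ n" for n
  proof -
    have "(norm (cls (f (r (Suc n))) - cls (f (r n))))\<^sup>2 <= ((1/4) ^ n)\<^sup>2"
      using r(2)[of n] by (intro power_mono) auto
    also have "\<dots> = (1/16) ^ n" by (simp add: power2_eq_square flip: power_mult_distrib)
    finally show ?thesis .
  qed
  note c = fast_L2_convergence[of "%n. f (r n)", OF f fast]
  have "(%n. cls (f (r n))) \<longlonglongrightarrow> z"
    using LIMSEQ_subseq_LIMSEQ[OF lim r(1)] by (simp add: comp_def)
  with c(2) have "cls (%x. lim (%n. f (r n) x)) = z" by (rule LIMSEQ_unique)
  with rep_L2_cls[OF c(1)] have "AE x in lborel. rep_L2 z x = lim (%n. f (r n) x)" by simp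
  with c(3) have "AE x in lborel. (%n. f (r n) x) \<longlonglongrightarrow> rep_L2 z x"
    by eventually_elim simp
  with r(1) show thesis by (rule that)
qed

lemma L2_tendsto_lipschitz:
  fixes f :: "nat => 'a::euclidean_space => 'b::euclidean_space" and h :: "nat => 'a => 'c::euclidean_space"
  assumes f: "\<And>n. L2_fun (f n)" "L2_fun f0" "(%n. cls (f n)) \<longlonglongrightarrow> cls f0"
    and h: "\<And>n. L2_fun (h n)" "L2_fun h0"
    and le: "\<And>n. AE x in lborel. norm (h n x - h0 x) <= B * norm (f n x - f0 x)"
  shows "(%n. cls (h n)) \<longlonglongrightarrow> cls h0"
proof -
  have "(LBINT x. (norm (h n x - h0 x))\<^sup>2) <= B\<^sup>2 * (LBINT x. (norm (f n x - f0 x))\<^sup>2)" for n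
  proof -
    have "(LBINT x. (norm (h n x - h0 x))\<^sup>2) <= (LBINT x. B\<^sup>2 * (norm (f n x - f0 x))\<^sup>2)"
    proof (rule integral_mono_AE)
      show "integrable lborel (%x. (norm (h n x - h0 x))\<^sup>2)"
        using L2_fun_diff[OF h(1) h(2)] by (simp add: L2_fun_def)
      show "integrable lborel (%x. B\<^sup>2 * (norm (f n x - f0 x))\<^sup>2)"
        using L2_fun_diff[OF f(1) f(2)] by (simp add: L2_fun_def)
      show "AE x in lborel. (norm (h n x - h0 x))\<^sup>2 <= B\<^sup>2 * (norm (f n x - f0 x))\<^sup>2"
        using le[of n]
      proof eventually_elim
        case (elim x)
        then have "(norm (h n x - h0 x))\<^sup>2 <= (B * norm (f n x - f0 x))\<^sup>2" by (rule power_mono) simp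
        then show ?case by (simp add: power_mult_distrib)
      qed
    qed
    then show ?thesis by simp
  qed
  moreover have "(%n. B\<^sup>2 * (LBINT x. (norm (f n x - f0 x))\<^sup>2)) \<longlonglongrightarrow> B\<^sup>2 * 0"
    using f(3) unfolding tendsto_cls_iff[of f f0 sequentially, OF f(1,2)] by (intro tendsto_intros)
  ultimately have "(%n. LBINT x. (norm (h n x - h0 x))\<^sup>2) \<longlonglongrightarrow> 0"
    by (intro tendsto_sandwich[of "%_. 0" "%n. LBINT x. (norm (h n x - h0 x))\<^sup>2" sequentially]) auto
  then show ?thesis unfolding tendsto_cls_iff[of h h0 sequentially, OF h] .
qed

lemma lipschitz_of_deriv:
  fixes q :: "real => real"
  assumes "\<And>t. DERIV q t :> q' t" "\<And>t. \<bar>q' t\<bar> <= C"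
  shows "\<bar>q a - q b\<bar> <= C * \<bar>a - b\<bar>"
proof -
  have "norm (q a - q b) <= C * norm (a - b)"
    by (rule field_differentiable_bound[of UNIV q q']) (use assms in \<open>auto intro: has_field_derivative_at_within\<close>)
  then show ?thesis by simp
qed

lemma L2_fun_lipschitz:
  fixes f :: "'a::euclidean_space => real"
  assumes "L2_fun f" "q \<in> borel_measurable borel" "\<And>t. \<bar>q t\<bar> <= C * \<bar>t\<bar>"
  shows "L2_fun (%x. q (f x))"
proof (rule L2_fun_bound[OF L2_fun_scaleR[OF assms(1), of C]])
  have "f \<in> borel_measurable borel" using assms(1) by (simp add: L2_fun_def)
  then show "(%x. q (f x)) \<in> borel_measurable lborel" using assms(2) by simp
  show "AE x in lborel. norm (q (f x)) <= norm (C *\<^sub>R f x)"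
    using order_trans[OF assms(3) abs_ge_self] by (intro AE_I2) (simp add: abs_mult)
qed

text \<open>\<open>q 0 = 0\<close> keeps the composition with a test function compactly supported.
  The gradient of the composition is split as q'(\<phi>_n) (D_n - \<gamma>) + q'(\<phi>_n) \<gamma>:
  the first part is small because q' is bounded, the second converges by dominated convergence along
  an almost everywhere convergent subsequence, because q' is continuous.\<close>

lemma form_dom_chain:
  assumes wg: "(w, \<gamma>) \<in> form_dom \<Omega>"
    and q: "\<And>t. DERIV q t :> q' t" "continuous_on UNIV q'" "\<And>t. \<bar>q' t\<bar> <= C" "q 0 = 0"
  shows "(cls (%x. q (rep_L2 w x)), cls (%x. q' (rep_L2 w x) *\<^sub>R rep_L2 \<gamma> x)) \<in> form_dom \<Omega>"
proof -
  obtain \<phi>0 D0 where s0: "\<And>n::nat. C1_compact \<Omega> (\<phi>0 n) (D0 n)" "(%n. cls (\<phi>0 n)) \<longlonglongrightarrow> w" "(%n. cls (D0 n)) \<longlonglongrightarrow> \<gamma>"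
    using form_dom_sequence[OF wg] by (metis fst_conv snd_conv)
  obtain r where r: "strict_mono (r::nat => nat)" and ae: "AE x in lborel. (%n. \<phi>0 (r n) x) \<longlonglongrightarrow> rep_L2 w x"
    using L2_tendsto_subseq_AE[OF C1_compact_L2_fun(1)[OF s0(1)] s0(2)] by blast
  define \<phi> where "\<phi> n = \<phi>0 (r n)" for n
  define D where "D n = D0 (r n)" for n
  have C1: "C1_compact \<Omega> (\<phi> n) (D n)" for n using s0 by (simp add: \<phi>_def D_def)
  have sq: "L2_fun (\<phi> n)" "L2_fun (D n)" for n using C1_compact_L2_fun[OF C1] .
  have lim: "(%n. cls (\<phi> n)) \<longlonglongrightarrow> w" "(%n. cls (D n)) \<longlonglongrightarrow> \<gamma>"
    using LIMSEQ_subseq_LIMSEQ[OF s0(2) r] LIMSEQ_subseq_LIMSEQ[OF s0(3) r] by (auto simp: comp_def \<phi>_def D_def)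
  have ae: "AE x in lborel. (%n. \<phi> n x) \<longlonglongrightarrow> rep_L2 w x" using ae by (simp add: \<phi>_def)
  have C0: "0 <= C" using q(3)[of 0] by simp
  have qm [measurable]: "q \<in> borel_measurable borel"
    using q(1) by (intro borel_measurable_continuous_onI DERIV_continuous_on) (auto intro: has_field_derivative_at_within)
  have q'm [measurable]: "q' \<in> borel_measurable borel" using q(2) by (rule borel_measurable_continuous_onI)
  have lip: "\<bar>q a - q b\<bar> <= C * \<bar>a - b\<bar>" for a b by (rule lipschitz_of_deriv[OF q(1,3)])
  have qle: "\<bar>q t\<bar> <= C * \<bar>t\<bar>" for t using lip[of t 0] q(4) by simp
  have [measurable]: "\<phi> n \<in> borel_measurable borel" "D n \<in> borel_measurable borel" for n
    using sq by (auto simp: L2_fun_def)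
  have C1q: "C1_compact \<Omega> (%x. q (\<phi> n x)) (%x. q' (\<phi> n x) *\<^sub>R D n x)" for n
    unfolding C1_compact_def
  proof (intro conjI allI)
    show "GDERIV (%x. q (\<phi> n x)) x :> q' (\<phi> n x) *\<^sub>R D n x" for x
      using C1[of n] q(1) by (intro GDERIV_DERIV_compose) (auto simp: C1_compact_def)
    show "continuous_on UNIV (%x. q' (\<phi> n x) *\<^sub>R D n x)"
      using C1_compactD(1,2)[OF C1[of n]] by (intro continuous_intros continuous_on_compose2[OF q(2)]) auto
    from C1[of n] obtain K where "compact K" "K \<subseteq> \<Omega>" "\<forall>x. x \<notin> K --> \<phi> n x = 0" unfolding C1_compact_def by blast
    then show "\<exists>K. compact K \<and> K \<subseteq> \<Omega> \<and> (\<forall>x. x \<notin> K --> q (\<phi> n x) = 0)" using q(4) by auto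
  qed
  have sw: "L2_fun (%x. q (rep_L2 w x))"
    by (rule L2_fun_lipschitz[OF L2_fun_rep_L2 qm qle])
  have s\<gamma>: "L2_fun (%x. q' (rep_L2 w x) *\<^sub>R rep_L2 \<gamma> x)"
    by (rule L2_fun_bounded_mult[where B = C]) (use q(3) in auto)
  have L1: "(%n. cls (%x. q (\<phi> n x))) \<longlonglongrightarrow> cls (%x. q (rep_L2 w x))"
    by (rule L2_tendsto_lipschitz[OF sq(1) L2_fun_rep_L2[of w] _ C1_compact_L2_fun(1)[OF C1q] sw, where B = C])
      (use lim lip in auto)
  have mid: "L2_fun (%x. q' (\<phi> n x) *\<^sub>R rep_L2 \<gamma> x)" for n
    by (rule L2_fun_bounded_mult[where B = C]) (use q(3) in auto)
  have L2a: "(%n. cls (%x. q' (\<phi> n x) *\<^sub>R (D n x - rep_L2 \<gamma> x))) \<longlonglongrightarrow> cls (%x. 0)"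
  proof (rule L2_tendsto_lipschitz[OF sq(2) L2_fun_rep_L2[of \<gamma>], where B = C])
    show "L2_fun (%x. q' (\<phi> n x) *\<^sub>R (D n x - rep_L2 \<gamma> x))" for n
      using L2_fun_diff[OF sq(2)[of n] L2_fun_rep_L2[of \<gamma>]]
      by (rule L2_fun_bounded_mult[where B = C]) (use q(3) in auto)
    show "AE x in lborel. norm (q' (\<phi> n x) *\<^sub>R (D n x - rep_L2 \<gamma> x) - 0) <= C * norm (D n x - rep_L2 \<gamma> x)" for n
      using q(3) by (intro AE_I2) (auto intro: mult_right_mono)
  qed (use lim L2_fun_zero in auto)
  have "(%n. LBINT x. (norm (q' (\<phi> n x) *\<^sub>R rep_L2 \<gamma> x - q' (rep_L2 w x) *\<^sub>R rep_L2 \<gamma> x))\<^sup>2) \<longlonglongrightarrow> (LINT x|(lborel::'a measure). (0::real))"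
  proof (rule integral_dominated_convergence[where f = "%x. 0" and w = "%x. (2 * C)\<^sup>2 * (norm (rep_L2 \<gamma> x))\<^sup>2"])
    show "integrable lborel (%x. (2 * C)\<^sup>2 * (norm (rep_L2 \<gamma> x))\<^sup>2)"
      using L2_fun_rep_L2[of \<gamma>] by (simp add: L2_fun_def)
    show "AE x in lborel. (%n. (norm (q' (\<phi> n x) *\<^sub>R rep_L2 \<gamma> x - q' (rep_L2 w x) *\<^sub>R rep_L2 \<gamma> x))\<^sup>2) \<longlonglongrightarrow> 0"
      using ae
    proof eventually_elim
      case (elim x)
      have "isCont q' (rep_L2 w x)" using q(2) by (simp add: continuous_on_eq_continuous_at)
      then have "(%n. q' (\<phi> n x)) \<longlonglongrightarrow> q' (rep_L2 w x)" using elim by (rule isCont_tendsto_compose)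
      then have "(%n. (norm (q' (\<phi> n x) *\<^sub>R rep_L2 \<gamma> x - q' (rep_L2 w x) *\<^sub>R rep_L2 \<gamma> x))\<^sup>2)
        \<longlonglongrightarrow> (norm (q' (rep_L2 w x) *\<^sub>R rep_L2 \<gamma> x - q' (rep_L2 w x) *\<^sub>R rep_L2 \<gamma> x))\<^sup>2" by (intro tendsto_intros)
      then show ?case by simp
    qed
    show "AE x in lborel. norm ((norm (q' (\<phi> n x) *\<^sub>R rep_L2 \<gamma> x - q' (rep_L2 w x) *\<^sub>R rep_L2 \<gamma> x))\<^sup>2) <= (2 * C)\<^sup>2 * (norm (rep_L2 \<gamma> x))\<^sup>2" for n
    proof (intro AE_I2)
      fix x
      have "\<bar>q' (\<phi> n x) - q' (rep_L2 w x)\<bar> <= 2 * C" using q(3)[of "\<phi> n x"] q(3)[of "rep_L2 w x"] by linarith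
      then have "norm ((q' (\<phi> n x) - q' (rep_L2 w x)) *\<^sub>R rep_L2 \<gamma> x) <= 2 * C * norm (rep_L2 \<gamma> x)"
        by (simp add: mult_right_mono)
      then have "(norm ((q' (\<phi> n x) - q' (rep_L2 w x)) *\<^sub>R rep_L2 \<gamma> x))\<^sup>2 <= (2 * C * norm (rep_L2 \<gamma> x))\<^sup>2"
        by (rule power_mono) simp
      then show "norm ((norm (q' (\<phi> n x) *\<^sub>R rep_L2 \<gamma> x - q' (rep_L2 w x) *\<^sub>R rep_L2 \<gamma> x))\<^sup>2) <= (2 * C)\<^sup>2 * (norm (rep_L2 \<gamma> x))\<^sup>2"
        by (simp add: scaleR_left_diff_distrib power_mult_distrib)
    qed
  qed measurable
  then have L2b: "(%n. cls (%x. q' (\<phi> n x) *\<^sub>R rep_L2 \<gamma> x)) \<longlonglongrightarrow> cls (%x. q' (rep_L2 w x) *\<^sub>R rep_L2 \<gamma> x)"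
    unfolding tendsto_cls_iff[of "%n x. q' (\<phi> n x) *\<^sub>R rep_L2 \<gamma> x", OF mid s\<gamma>] by simp
  have "cls (%x. q' (\<phi> n x) *\<^sub>R D n x) = cls (%x. q' (\<phi> n x) *\<^sub>R (D n x - rep_L2 \<gamma> x)) + cls (%x. q' (\<phi> n x) *\<^sub>R rep_L2 \<gamma> x)" for n
  proof -
    have "L2_fun (%x. q' (\<phi> n x) *\<^sub>R (D n x - rep_L2 \<gamma> x))"
      using L2_fun_diff[OF sq(2)[of n] L2_fun_rep_L2[of \<gamma>]]
      by (rule L2_fun_bounded_mult[where B = C]) (use q(3) in auto)
    then show ?thesis using mid[of n] by (simp add: cls_add algebra_simps)
  qed
  then have "(%n. cls (%x. q' (\<phi> n x) *\<^sub>R D n x)) \<longlonglongrightarrow> cls (%x. q' (rep_L2 w x) *\<^sub>R rep_L2 \<gamma> x)"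
    using tendsto_add[OF L2a L2b] by (simp flip: cls_zero)
  with L1 have "(%n. (cls (%x. q (\<phi> n x)), cls (%x. q' (\<phi> n x) *\<^sub>R D n x))) \<longlonglongrightarrow>
     (cls (%x. q (rep_L2 w x)), cls (%x. q' (rep_L2 w x) *\<^sub>R rep_L2 \<gamma> x))" by (rule tendsto_Pair)
  then show ?thesis
    by (rule closed_sequentially[OF closed_form_dom, rotated]) (rule C1_in_form_dom[OF C1q])
qed

text \<open>Value and gradient of the product depend on the pair only through multiplication by
  bounded functions, so approximation by test functions survives term by term.\<close>

lemma form_dom_product:
  assumes vg: "(v, \<gamma>) \<in> form_dom \<Omega>"
    and \<eta>: "\<And>x. GDERIV \<eta> x :> X x" "continuous_on UNIV X" "\<And>x. \<bar>\<eta> x\<bar> <= B" "\<And>x. norm (X x) <= B"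
  shows "(cls (%x. \<eta> x * rep_L2 v x), cls (%x. rep_L2 v x *\<^sub>R X x + \<eta> x *\<^sub>R rep_L2 \<gamma> x)) \<in> form_dom \<Omega>"
proof -
  obtain \<phi> D where C1: "\<And>n::nat. C1_compact \<Omega> (\<phi> n) (D n)" and lim: "(%n. cls (\<phi> n)) \<longlonglongrightarrow> v" "(%n. cls (D n)) \<longlonglongrightarrow> \<gamma>"
    using form_dom_sequence[OF vg] by (metis fst_conv snd_conv)
  have sq: "L2_fun (\<phi> n)" "L2_fun (D n)" for n using C1_compact_L2_fun[OF C1] .
  have \<eta>c: "continuous_on UNIV \<eta>" using \<eta>(1) by (intro has_derivative_continuous_on) (auto simp: gderiv_def)
  have [measurable]: "\<eta> \<in> borel_measurable borel" "X \<in> borel_measurable borel"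
    using \<eta>c \<eta>(2) by (auto intro: borel_measurable_continuous_onI)
  have mul: "L2_fun (%x. \<eta> x *\<^sub>R f x)" if "L2_fun f" for f :: "'a => 'b::euclidean_space"
    by (rule L2_fun_bounded_mult[OF that, where B = B]) (use \<eta> in auto)
  have mulX: "L2_fun (%x. f x *\<^sub>R X x)" if "L2_fun f" for f :: "'a => real"
  proof (rule L2_fun_bound[OF L2_fun_scaleR[OF that, of B]])
    have [measurable]: "f \<in> borel_measurable borel" using that by (simp add: L2_fun_def)
    show "(%x. f x *\<^sub>R X x) \<in> borel_measurable lborel" by measurable
    show "AE x in lborel. norm (f x *\<^sub>R X x) <= norm (B *\<^sub>R f x)"
    proof (intro AE_I2)
      fix x
      have "\<bar>f x\<bar> * norm (X x) <= \<bar>f x\<bar> * \<bar>B\<bar>"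
        using order_trans[OF \<eta>(4) abs_ge_self] by (intro mult_left_mono) auto
      then show "norm (f x *\<^sub>R X x) <= norm (B *\<^sub>R f x)" by (simp add: mult.commute)
    qed
  qed
  have C1p: "C1_compact \<Omega> (%x. \<eta> x * \<phi> n x) (%x. \<phi> n x *\<^sub>R X x + \<eta> x *\<^sub>R D n x)" for n
    unfolding C1_compact_def
  proof (intro conjI allI)
    show "GDERIV (%x. \<eta> x * \<phi> n x) x :> \<phi> n x *\<^sub>R X x + \<eta> x *\<^sub>R D n x" for x
      using GDERIV_mult[OF \<eta>(1), of "\<phi> n" x "D n x"] C1[of n] by (simp add: C1_compact_def add.commute)
    show "continuous_on UNIV (%x. \<phi> n x *\<^sub>R X x + \<eta> x *\<^sub>R D n x)"
      using C1_compactD(1,2)[OF C1[of n]] \<eta>c \<eta>(2) by (intro continuous_intros)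
    from C1[of n] obtain K where "compact K" "K \<subseteq> \<Omega>" "\<forall>x. x \<notin> K --> \<phi> n x = 0" unfolding C1_compact_def by blast
    then show "\<exists>K. compact K \<and> K \<subseteq> \<Omega> \<and> (\<forall>x. x \<notin> K --> \<eta> x * \<phi> n x = 0)" by auto
  qed
  have lim': "(%n. cls (\<phi> n)) \<longlonglongrightarrow> cls (rep_L2 v)" "(%n. cls (D n)) \<longlonglongrightarrow> cls (rep_L2 \<gamma>)" using lim by simp_all
  have L1: "(%n. cls (%x. \<eta> x * \<phi> n x)) \<longlonglongrightarrow> cls (%x. \<eta> x * rep_L2 v x)"
  proof (rule L2_tendsto_lipschitz[OF sq(1) L2_fun_rep_L2 lim'(1), where B = B])
    have "norm (\<eta> x * \<phi> n x - \<eta> x * rep_L2 v x) = \<bar>\<eta> x\<bar> * norm (\<phi> n x - rep_L2 v x)" for n x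
      by (simp add: abs_mult flip: right_diff_distrib)
    then show "AE x in lborel. norm (\<eta> x * \<phi> n x - \<eta> x * rep_L2 v x) <= B * norm (\<phi> n x - rep_L2 v x)" for n
      using \<eta>(3) by (intro AE_I2) (simp add: mult_right_mono)
  qed (use mul[OF sq(1)] mul[of "rep_L2 v"] in auto)
  have L2: "(%n. cls (%x. \<phi> n x *\<^sub>R X x)) \<longlonglongrightarrow> cls (%x. rep_L2 v x *\<^sub>R X x)"
  proof (rule L2_tendsto_lipschitz[OF sq(1) L2_fun_rep_L2 lim'(1), where B = B])
    have "norm (\<phi> n x *\<^sub>R X x - rep_L2 v x *\<^sub>R X x) = norm (X x) * norm (\<phi> n x - rep_L2 v x)" for n x
      by (simp flip: scaleR_left_diff_distrib)
    then show "AE x in lborel. norm (\<phi> n x *\<^sub>R X x - rep_L2 v x *\<^sub>R X x) <= B * norm (\<phi> n x - rep_L2 v x)" for n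
      using \<eta>(4) by (intro AE_I2) (simp add: mult_right_mono)
  qed (use mulX[OF sq(1)] mulX[of "rep_L2 v"] in auto)
  have L3: "(%n. cls (%x. \<eta> x *\<^sub>R D n x)) \<longlonglongrightarrow> cls (%x. \<eta> x *\<^sub>R rep_L2 \<gamma> x)"
  proof (rule L2_tendsto_lipschitz[OF sq(2) L2_fun_rep_L2 lim'(2), where B = B])
    have "norm (\<eta> x *\<^sub>R D n x - \<eta> x *\<^sub>R rep_L2 \<gamma> x) = \<bar>\<eta> x\<bar> * norm (D n x - rep_L2 \<gamma> x)" for n x
      by (simp flip: scaleR_right_diff_distrib)
    then show "AE x in lborel. norm (\<eta> x *\<^sub>R D n x - \<eta> x *\<^sub>R rep_L2 \<gamma> x) <= B * norm (D n x - rep_L2 \<gamma> x)" for n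
      using \<eta>(3) by (intro AE_I2) (simp add: mult_right_mono)
  qed (use mul[OF sq(2)] mul[of "rep_L2 \<gamma>"] in auto)
  have "(%n. (cls (%x. \<eta> x * \<phi> n x), cls (%x. \<phi> n x *\<^sub>R X x + \<eta> x *\<^sub>R D n x))) \<longlonglongrightarrow>
    (cls (%x. \<eta> x * rep_L2 v x), cls (%x. rep_L2 v x *\<^sub>R X x + \<eta> x *\<^sub>R rep_L2 \<gamma> x))"
    using tendsto_Pair[OF L1 tendsto_add[OF L2 L3]]
    by (simp add: cls_add mul mulX sq)
  then show ?thesis
    by (rule closed_sequentially[OF closed_form_dom, rotated]) (rule C1_in_form_dom[OF C1p])
qed

subsection \<open>The heat flow on the ball\<close>

lemma supported_diff: "supported \<Omega> z ==> supported \<Omega> w ==> supported \<Omega> (z - w)"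
  unfolding supported_def using rep_L2_diff[of z w]
proof -
  assume a: "AE x in lborel. x \<notin> \<Omega> --> rep_L2 z x = 0" "AE x in lborel. x \<notin> \<Omega> --> rep_L2 w x = 0"
  from a rep_L2_diff[of z w] show "AE x in lborel. x \<notin> \<Omega> --> rep_L2 (z - w) x = 0"
    by eventually_elim auto
qed

lemma supported_zero: "supported \<Omega> 0"
  unfolding supported_def cls_zero using rep_L2_cls[OF L2_fun_zero] by eventually_elim auto

lemma supported_scaleR: "supported \<Omega> z ==> supported \<Omega> (c *\<^sub>R z)"
  unfolding supported_def
proof -
  assume a: "AE x in lborel. x \<notin> \<Omega> --> rep_L2 z x = 0"
  from a rep_L2_scaleR[of c z] show "AE x in lborel. x \<notin> \<Omega> --> rep_L2 (c *\<^sub>R z) x = 0"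
    by eventually_elim auto
qed

lemma supported_sum:
  assumes "finite A" "\<And>a. a \<in> A ==> supported \<Omega> (f a)"
  shows "supported \<Omega> (\<Sum>a\<in>A. f a)"
  using assms
proof (induction A)
  case (insert a A)
  have "f a + (\<Sum>a\<in>A. f a) = f a - (-1) *\<^sub>R (\<Sum>a\<in>A. f a)" by simp
  then show ?case using insert supported_diff supported_scaleR by (metis insertCI sum.insert)
qed (simp add: supported_zero)

locale ball_heat = form_spectrum "form_dom (ball 0 R)" e g l
  for R :: real and e :: "nat => ('a::euclidean_space, real) L2" and g :: "nat => ('a, 'a) L2" and l :: "nat => real" +
  assumes R: "0 < R"

theorem ball_heat_exists:
  assumes "0 < R"
  obtains e g l where "ball_heat R (e :: nat => ('a::euclidean_space, real) L2) g l"
proof -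
  have sub: "ball (0::'a) R \<subseteq> cball 0 R" by auto
  have cpt: "\<exists>r. strict_mono (r::nat => nat) \<and> convergent (%n. fst (z (r n)))"
    if "\<And>n. z n \<in> form_dom (ball (0::'a) R) \<and> norm (z n) <= 1" for z
    using rellich[OF sub that] .
  show thesis
  proof (rule compact_form_spectral[OF subspace_form_dom closed_form_dom cpt])
    fix e :: "nat => ('a, real) L2" and g l
    assume "\<And>k::nat. (e k, g k) \<in> form_dom (ball 0 R)" "\<And>k. 0 <= l k"
      "\<And>k v h. (v, h) \<in> form_dom (ball 0 R) ==> h \<bullet> g k = l k * (v \<bullet> e k)"
      "\<And>j k. j \<noteq> k ==> e j \<bullet> e k = 0"
      "\<And>k. norm (e k) = 0 \<or> norm (e k) = 1"
      "\<And>v h. (v, h) \<in> form_dom (ball 0 R) ==> (%k. (v \<bullet> e k) *\<^sub>R e k) sums v"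
    note H = this
    have "ball_heat R e g l"
      by unfold_locales (fact H subspace_form_dom closed_form_dom assms)+
    then show thesis by (rule that)
  qed
qed

context ball_heat
begin

abbreviation "\<Omega> \<equiv> ball (0::'a) R"

lemma supported_mult:
  assumes "\<And>k. \<bar>m k\<bar> <= B"
  shows "supported \<Omega> (mult m w)"
proof -
  have lim: "(%n. \<Sum>k<n. (m k * (w \<bullet> e k)) *\<^sub>R e k) \<longlonglongrightarrow> mult m w"
    unfolding mult_def by (rule summable_LIMSEQ[OF mult_summable[of m B, OF assms]])
  have "supported \<Omega> (\<Sum>k<n. (m k * (w \<bullet> e k)) *\<^sub>R e k)" for n
    using form_dom_supported(1)[OF _ eV] by (intro supported_sum supported_scaleR) auto
  then have "mult m w \<in> {z. supported \<Omega> z}"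
    by (intro closed_sequentially[OF supported_closed[of \<Omega>] _ lim]) auto
  then show ?thesis by simp
qed

lemma supported_flow: "0 <= s ==> supported \<Omega> (flow s w)"
  unfolding flow_def by (rule supported_mult[of _ 1]) (rule flow_bd)

text \<open>The difference of \<open>w\<close> and its eigenfunction series is orthogonal to every
  \<open>e k\<close>, hence to every test function, since test functions expand in the
  \<open>e k\<close>. A class supported in the ball and orthogonal to all test functions is
  0.\<close>

lemma expand:
  assumes w: "supported \<Omega> w"
  shows "(%k. (w \<bullet> e k) *\<^sub>R e k) sums w"
proof -
  define u where "u = mult (%_. 1) w"
  have su: "(%k. (w \<bullet> e k) *\<^sub>R e k) sums u"
    using summable_sums[OF mult_summable[of "%_. 1" 1 w]] by (simp add: u_def mult_def)
  have ue: "u \<bullet> e j = w \<bullet> e j" for j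
  proof -
    have "(%k. ((w \<bullet> e k) *\<^sub>R e k) \<bullet> e j) sums (u \<bullet> e j)"
      using su by (rule bounded_linear.sums[OF bounded_linear_inner_left])
    moreover have "(%k. ((w \<bullet> e k) *\<^sub>R e k) \<bullet> e j) = (%k. if k = j then w \<bullet> e j else 0)"
      using orth_e coeff_norm_e[of w j] by (auto simp: fun_eq_iff)
    moreover have "(%k. if k = j then w \<bullet> e j else 0) sums (w \<bullet> e j)" by (rule sums_single)
    ultimately show ?thesis using sums_unique2 by metis
  qed
  have "w - u = 0"
  proof (rule orthogonal_to_C1_compact_imp_zero[of \<Omega>])
    show "supported \<Omega> (w - u)" unfolding u_def by (intro supported_diff w supported_mult[of _ 1]) auto
    fix \<phi> D assume "C1_compact \<Omega> \<phi> D"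
    then have "(%k. (cls \<phi> \<bullet> e k) *\<^sub>R e k) sums cls \<phi>" by (intro expand_V[OF C1_in_form_dom])
    then have "(%k. (w - u) \<bullet> ((cls \<phi> \<bullet> e k) *\<^sub>R e k)) sums ((w - u) \<bullet> cls \<phi>)"
      by (rule bounded_linear.sums[OF bounded_linear_inner_right])
    then have "(%k. 0) sums ((w - u) \<bullet> cls \<phi>)" using ue by (simp only: inner_scaleR_right inner_diff_left diff_self mult_zero_right)
    then show "(w - u) \<bullet> cls \<phi> = 0" using sums_unique2[OF sums_zero] by metis
  qed auto
  then show ?thesis using su by simp
qed

lemma flow_0_supported: "supported \<Omega> w ==> flow 0 w = w"
  by (rule flow_0[OF expand])

end

subsection \<open>Weak maximum principle\<close>

lemma integral_norm_bound_AE: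
  fixes f :: "'a => real"
  assumes "integrable M f" "integrable M h" "AE x in M. norm (f x) <= h x"
  shows "norm (LINT x|M. f x) <= (LINT x|M. h x)"
proof -
  have "norm (LINT x|M. f x) <= (LINT x|M. norm (f x))" by (rule integral_norm_bound)
  also have "\<dots> <= (LINT x|M. h x)" using assms by (intro integral_mono_AE) auto
  finally show ?thesis .
qed

text \<open>
  Differentiation of \<open>s \<mapsto> \<integral> \<eta> F(W(s))\<close> along a differentiable curve in \<open>L2\<close>; the quadratic
  Taylor bound is only needed on the set \<open>S\<close> of values taken.
\<close>

lemma L2_functional_derivative:
  fixes W :: "real => ('a::euclidean_space, real) L2"
  assumes W: "(W has_vector_derivative W') (at s)" and "0 < \<delta>"
    and S: "\<And>t. \<bar>t - s\<bar> < \<delta> ==> AE x in lborel. rep_L2 (W t) x \<in> S"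
    and F: "\<And>a b. a \<in> S ==> b \<in> S ==> \<bar>F b - F a - q a * (b - a)\<bar> <= C * (b - a)\<^sup>2"
    and \<eta>: "\<And>x. \<bar>\<eta> x\<bar> <= B"
    and int: "\<And>t. \<bar>t - s\<bar> < \<delta> ==> integrable lborel (%x. \<eta> x * F (rep_L2 (W t) x))"
    and sq: "L2_fun (%x. \<eta> x * q (rep_L2 (W s) x))"
  shows "((%t. LBINT x. \<eta> x * F (rep_L2 (W t) x)) has_real_derivative
    (W' \<bullet> cls (%x. \<eta> x * q (rep_L2 (W s) x)))) (at s)"
proof -
  let ?q = "cls (%x. \<eta> x * q (rep_L2 (W s) x))"
  define Y where "Y t = (LBINT x. \<eta> x * F (rep_L2 (W t) x))" for t
  define rem where "rem t = Y t - Y s - (W t - W s) \<bullet> ?q" for t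
  have B0: "0 <= B" using order_trans[OF abs_ge_zero \<eta>] .
  have rem: "\<bar>rem t\<bar> <= B * C * (norm (W t - W s))\<^sup>2" if t: "\<bar>t - s\<bar> < \<delta>" for t
  proof -
    have s0: "\<bar>s - s\<bar> < \<delta>" using \<open>0 < \<delta>\<close> by simp
    let ?w = "%t. rep_L2 (W t)"
    have d: "L2_fun (%x. ?w t x - ?w s x)" by (intro L2_fun_diff) auto
    have i3: "integrable lborel (%x. (?w t x - ?w s x) \<bullet> (\<eta> x * q (?w s x)))"
      by (rule L2_fun_inner[OF d sq])
    have "(W t - W s) \<bullet> ?q = (LBINT x. (?w t x - ?w s x) \<bullet> (\<eta> x * q (?w s x)))"
      using inner_cls[OF d sq] cls_diff[of "?w t" "?w s"] by simp
    then have "rem t = (LBINT x. (\<eta> x * F (?w t x) - \<eta> x * F (?w s x)) - (?w t x - ?w s x) \<bullet> (\<eta> x * q (?w s x)))"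
      unfolding rem_def Y_def using int[OF t] int[OF s0] i3 by simp
    also have "norm \<dots> <= (LBINT x. B * C * (norm (?w t x - ?w s x))\<^sup>2)"
    proof (rule integral_norm_bound_AE)
      show "integrable lborel (%x. (\<eta> x * F (?w t x) - \<eta> x * F (?w s x)) - (?w t x - ?w s x) \<bullet> (\<eta> x * q (?w s x)))"
        using int[OF t] int[OF s0] i3 by (intro Bochner_Integration.integrable_diff)
      show "integrable lborel (%x. B * C * (norm (?w t x - ?w s x))\<^sup>2)"
        using d by (simp add: L2_fun_def)
      have "AE x in lborel. norm ((\<eta> x * F (?w t x) - \<eta> x * F (?w s x)) - (?w t x - ?w s x) \<bullet> (\<eta> x * q (?w s x)))
        <= B * C * (norm (?w t x - ?w s x))\<^sup>2"
        using S[OF t] S[OF s0]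
      proof eventually_elim
        case (elim x)
        have "(\<eta> x * F (?w t x) - \<eta> x * F (?w s x)) - (?w t x - ?w s x) \<bullet> (\<eta> x * q (?w s x))
          = \<eta> x * (F (?w t x) - F (?w s x) - q (?w s x) * (?w t x - ?w s x))" by (simp add: algebra_simps)
        also have "norm \<dots> = \<bar>\<eta> x\<bar> * \<bar>F (?w t x) - F (?w s x) - q (?w s x) * (?w t x - ?w s x)\<bar>"
          by (simp add: abs_mult)
        also have "\<dots> <= B * (C * (?w t x - ?w s x)\<^sup>2)"
          using F[OF elim(2,1)] \<eta>[of x] B0 by (intro mult_mono) auto
        finally show ?case by (simp add: mult.assoc)
      qed
      then show "AE x in lborel. norm ((\<eta> x * F (?w t x) - \<eta> x * F (?w s x)) - (?w t x - ?w s x) \<bullet> (\<eta> x * q (?w s x)))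
        <= B * C * (norm (?w t x - ?w s x))\<^sup>2" .
    qed
    also have "\<dots> = B * C * (norm (W t - W s))\<^sup>2"
      using norm_cls_diff[of "?w t" "?w s"] by simp
    finally show ?thesis by simp
  qed
  \<comment> \<open>The remainder is quadratic in \<open>W t - W s\<close>, and the difference
    quotient of \<open>W\<close> stays bounded; after division by \<open>t - s\<close> there is
    still one factor that tends to 0.\<close>
  have rem0: "(rem has_real_derivative 0) (at s)"
    unfolding has_field_derivative_def
  proof (rule has_derivativeI_sandwich[OF \<open>0 < \<delta>\<close>, where H = "%t. (norm (W t - W s - (t - s) *\<^sub>R W') / norm (t - s) + norm W') * (\<bar>B * C\<bar> * norm (W t - W s))"])
    show "bounded_linear (%h::real. 0 * h)" by simp
    show "norm (rem t - rem s - 0 * (t - s)) / norm (t - s) <= (norm (W t - W s - (t - s) *\<^sub>R W') / norm (t - s) + norm W') * (\<bar>B * C\<bar> * norm (W t - W s))"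
      if "t \<in> UNIV" "t \<noteq> s" "dist t s < \<delta>" for t
    proof -
      have "norm (W t - W s) <= norm (W t - W s - (t - s) *\<^sub>R W') + norm ((t - s) *\<^sub>R W')"
        using norm_triangle_ineq[of "W t - W s - (t - s) *\<^sub>R W'" "(t - s) *\<^sub>R W'"] by simp
      then have "norm (W t - W s) <= norm (W t - W s - (t - s) *\<^sub>R W') + \<bar>t - s\<bar> * norm W'"
        by (simp only: norm_scaleR)
      from divide_right_mono[OF this, of "\<bar>t - s\<bar>"]
      have n: "norm (W t - W s) / \<bar>t - s\<bar> <= norm (W t - W s - (t - s) *\<^sub>R W') / norm (t - s) + norm W'"
        using that by (simp add: add_divide_distrib)
      have "rem s = 0" by (simp add: rem_def)
      then have "norm (rem t - rem s - 0 * (t - s)) / norm (t - s) <= \<bar>rem t\<bar> / \<bar>t - s\<bar>" by simp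
      also have "\<dots> <= (\<bar>B * C\<bar> * (norm (W t - W s))\<^sup>2) / \<bar>t - s\<bar>"
        using order_trans[OF rem[of t] mult_right_mono[OF abs_ge_self]] that by (intro divide_right_mono) (auto simp: dist_real_def)
      also have "\<dots> = (norm (W t - W s) / \<bar>t - s\<bar>) * (\<bar>B * C\<bar> * norm (W t - W s))" by (simp add: power2_eq_square)
      also have "\<dots> <= (norm (W t - W s - (t - s) *\<^sub>R W') / norm (t - s) + norm W') * (\<bar>B * C\<bar> * norm (W t - W s))"
        by (rule mult_right_mono[OF n]) simp
      finally show ?thesis .
    qed
    have 1: "((%t. norm (W t - W s - (t - s) *\<^sub>R W') / norm (t - s)) \<longlongrightarrow> 0) (at s)"
      using W by (simp add: has_vector_derivative_def has_derivative_iff_norm)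
    have 2: "(W \<longlongrightarrow> W s) (at s)" using has_vector_derivative_continuous[OF W] by (simp add: isCont_def)
    have "((%t. (norm (W t - W s - (t - s) *\<^sub>R W') / norm (t - s) + norm W') * (\<bar>B * C\<bar> * norm (W t - W s))) \<longlongrightarrow> (0 + norm W') * (\<bar>B * C\<bar> * norm (W s - W s))) (at s)"
      by (intro tendsto_intros 1 2)
    then show "((%t. (norm (W t - W s - (t - s) *\<^sub>R W') / norm (t - s) + norm W') * (\<bar>B * C\<bar> * norm (W t - W s))) \<longlongrightarrow> 0) (at s within UNIV)" by simp
  qed
  have "((%t. (W t - W s) \<bullet> ?q) has_vector_derivative (W' - 0) \<bullet> ?q) (at s)"
    by (rule bounded_linear.has_vector_derivative[OF bounded_linear_inner_left])
      (intro has_vector_derivative_diff W has_vector_derivative_const)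
  then have "((%t. (W t - W s) \<bullet> ?q) has_real_derivative W' \<bullet> ?q) (at s)"
    by (simp add: has_real_derivative_iff_has_vector_derivative)
  then have "((%t. rem t + (W t - W s) \<bullet> ?q + Y s) has_real_derivative 0 + W' \<bullet> ?q + 0) (at s)"
    by (intro DERIV_add rem0 DERIV_const)
  then show ?thesis by (simp add: rem_def Y_def)
qed

lemma DERIV_borel_measurable:
  fixes q :: "real => real"
  assumes "\<And>t. DERIV q t :> q' t"
  shows "q \<in> borel_measurable borel"
  by (rule borel_measurable_continuous_onI[OF DERIV_continuous_on[of _ q q']])
    (rule has_field_derivative_at_within[OF assms])

lemma taylor_quadratic:
  fixes F q :: "real => real"
  assumes "\<And>t. DERIV F t :> q t" and lip: "\<And>a b. \<bar>q a - q b\<bar> <= C * \<bar>a - b\<bar>"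
  shows "\<bar>F b - F a - q a * (b - a)\<bar> <= C * (b - a)\<^sup>2"
proof -
  have C0: "0 <= C" using order_trans[OF abs_ge_zero lip[of 1 0]] by simp
  have "\<bar>(F b - q a * b) - (F a - q a * a)\<bar> <= (C * \<bar>b - a\<bar>) * \<bar>b - a\<bar>"
  proof -
    let ?S = "closed_segment a b"
    have "norm ((F b - q a * b) - (F a - q a * a)) <= (C * \<bar>b - a\<bar>) * norm (b - a)"
    proof (rule field_differentiable_bound[of ?S "%t. F t - q a * t" "%t. q t - q a"])
      show "((%t. F t - q a * t) has_field_derivative q t - q a) (at t within ?S)" for t
        by (rule has_field_derivative_at_within) (auto intro!: derivative_eq_intros assms(1))
      fix t assume "t \<in> ?S"
      then have "\<bar>t - a\<bar> <= \<bar>b - a\<bar>" by (auto simp: closed_segment_eq_real_ivl split: if_splits)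
      then show "norm (q t - q a) <= C * \<bar>b - a\<bar>"
        using lip[of t a] C0 mult_left_mono[of "\<bar>t - a\<bar>" "\<bar>b - a\<bar>" C] by simp
    qed auto
    then show ?thesis by simp
  qed
  then show ?thesis by (simp add: algebra_simps power2_eq_square)
qed

text \<open>The composed function is constant on the other half-line; \<open>f' 0 = 0\<close> makes
  the two pieces match to first order at 0.\<close>

lemma DERIV_neg_part_compose:
  fixes f :: "real => real"
  assumes f: "\<And>m. 0 <= m ==> DERIV f m :> f' m" and "f' 0 = 0"
  shows "DERIV (%t. f (max 0 (- t))) t :> - f' (max 0 (- t))"
proof (cases t "0::real" rule: linorder_cases)
  case less
  have "DERIV (%t. f (- t)) t :> - f' (- t)"
  proof -
    have "(uminus has_real_derivative - 1) (at t)" by (auto intro!: derivative_eq_intros)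
    from DERIV_chain2[OF f this] show ?thesis using less by simp
  qed
  then have "DERIV (%t. f (max 0 (- t))) t :> - f' (- t)"
    by (rule has_field_derivative_transform_within_open[of _ _ _ "{..<0}"]) (use less in \<open>auto simp: max_def\<close>)
  then show ?thesis using less by (simp add: max_def)
next
  case greater
  have "DERIV (%t. f 0) t :> 0" by simp
  then have "DERIV (%t. f (max 0 (- t))) t :> 0"
    by (rule has_field_derivative_transform_within_open[of _ _ _ "{0<..}"]) (use greater in \<open>auto simp: max_def\<close>)
  then show ?thesis using greater assms(2) by (simp add: max_def)
next
  case equal
  have "((%h. (f h - f 0) / h) \<longlongrightarrow> 0) (at 0)"
    using f[of 0] assms(2) by (simp add: has_field_derivative_iff)
  then have 0: "((%h. \<bar>(f h - f 0) / h\<bar>) \<longlongrightarrow> 0) (at 0)" using tendsto_rabs_zero by blast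
  have "filterlim uminus (at 0) (at (0::real))"
    by (auto simp: filterlim_at eventually_at_filter intro!: tendsto_eq_intros)
  from filterlim_compose[OF 0 this] have 1: "((%h. \<bar>(f (- h) - f 0) / (- h)\<bar>) \<longlongrightarrow> 0) (at (0::real))" .
  have "((%h. (f (max 0 (- h)) - f 0) / h) \<longlongrightarrow> 0) (at 0)"
  proof (rule Lim_null_comparison[OF _ 1], rule always_eventually, rule allI)
    show "norm ((f (max 0 (- h)) - f 0) / h) <= \<bar>(f (- h) - f 0) / (- h)\<bar>" for h
      by (cases "0 <= h") (auto simp: max_def abs_divide)
  qed
  then show ?thesis using equal assms(2) by (simp add: has_field_derivative_iff)
qed

text \<open>A penalty on the negative part m. Its derivative is to be inserted as a test function,
  and \<open>form_dom_chain\<close> then wants a continuous bounded second derivative, which the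
  plain square of m does not have. The function m - arctan m behaves like m^3 / 3 near 0, is convex,
  and has bounded first and second derivatives.\<close>

definition pen :: "real => real" where "pen t = max 0 (- t) - arctan (max 0 (- t))"
definition pen' :: "real => real" where "pen' t = - ((max 0 (- t))\<^sup>2 / (1 + (max 0 (- t))\<^sup>2))"
definition pen'' :: "real => real" where "pen'' t = 2 * max 0 (- t) / (1 + (max 0 (- t))\<^sup>2)\<^sup>2"

lemma one_plus_sq_pos: "0 < 1 + (m::real)\<^sup>2"
  by (rule add_pos_nonneg) auto

lemma DERIV_pen: "DERIV pen t :> pen' t"
proof -
  have "DERIV (%m. m - arctan m) m :> m\<^sup>2 / (1 + m\<^sup>2)" for m :: real
    using one_plus_sq_pos[of m] by (auto intro!: derivative_eq_intros simp: field_simps)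
  from DERIV_neg_part_compose[OF this] show ?thesis unfolding pen_def[abs_def] pen'_def by simp
qed

lemma DERIV_pen': "DERIV pen' t :> pen'' t"
proof -
  have "DERIV (%m. - (m\<^sup>2 / (1 + m\<^sup>2))) m :> - (2 * m / (1 + m\<^sup>2)\<^sup>2)" for m :: real
    using one_plus_sq_pos[of m]
    by (auto intro!: derivative_eq_intros simp: power2_eq_square) (simp add: field_simps)
  from DERIV_neg_part_compose[OF this] show ?thesis unfolding pen'_def[abs_def] pen''_def by simp
qed

lemma pen''_bounds: "0 <= pen'' t" "\<bar>pen'' t\<bar> <= 1"
proof -
  define m where "m = max 0 (- t)"
  have m: "0 <= m" by (simp add: m_def)
  show 0: "0 <= pen'' t" by (simp add: pen''_def)
  have "2 * m <= 1 + m\<^sup>2" using sum_squares_bound[of 1 m] by simp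
  also have "\<dots> <= (1 + m\<^sup>2)\<^sup>2" using self_le_power[of "1 + m\<^sup>2" 2] by simp
  finally have "2 * m / (1 + m\<^sup>2)\<^sup>2 <= 1" using one_plus_sq_pos[of m] by (simp add: divide_le_eq)
  then show "\<bar>pen'' t\<bar> <= 1" using 0 by (simp add: pen''_def m_def)
qed

lemma pen_facts: "pen 0 = 0" "pen' 0 = 0" "0 <= pen t" "pen t = 0 ==> 0 <= t" "0 <= t ==> pen t = 0"
proof -
  show "pen 0 = 0" "pen' 0 = 0" "0 <= t ==> pen t = 0" by (auto simp: pen_def pen'_def)
  have a: "arctan m < m" if "0 < m" for m :: real
  proof -
    have "0 - arctan 0 < m - arctan m"
    proof (rule DERIV_pos_imp_increasing_open[OF that])
      show "\<exists>y. DERIV (%m. m - arctan m) x :> y \<and> 0 < y" if "0 < x" for x :: real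
        using that one_plus_sq_pos[of x]
        by (intro exI[of _ "x\<^sup>2 / (1 + x\<^sup>2)"]) (auto intro!: derivative_eq_intros simp: field_simps)
    qed (intro continuous_intros)
    then show ?thesis by simp
  qed
  show "0 <= pen t" "pen t = 0 ==> 0 <= t"
    using a[of "- t"] by (cases "t < 0"; force simp: pen_def max_def)+
qed

lemma continuous_on_pen'': "continuous_on UNIV pen''"
  unfolding pen''_def[abs_def]
  by (intro continuous_intros) (use one_plus_sq_pos in \<open>auto simp: less_imp_neq[symmetric]\<close>)

context ball_heat
begin

text \<open>The integral of \<open>pen\<close> over the flow has derivative minus the integral of
  pen'' |grad u|^2, hence does not increase at positive times, and it tends to 0 with the time
  because \<open>w\<close> is nonnegative. The flow is known to be differentiable at positive times
  only, so the initial time is reached by a limit.\<close>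

lemma flow_nonneg:
  assumes w: "supported \<Omega> w" "AE x in lborel. 0 <= rep_L2 w x" and s: "0 <= s"
  shows "AE x in lborel. 0 <= rep_L2 (flow s w) x"
proof -
  define Y where "Y t = (LBINT x. pen (rep_L2 (flow t w) x))" for t
  have pm [measurable]: "pen \<in> borel_measurable borel" "pen' \<in> borel_measurable borel"
    by (rule DERIV_borel_measurable, rule DERIV_pen DERIV_pen')+
  have tay: "\<bar>pen b - pen a - pen' a * (b - a)\<bar> <= 1 * (b - a)\<^sup>2" for a b
    by (rule taylor_quadratic[OF DERIV_pen lipschitz_of_deriv[OF DERIV_pen' pen''_bounds(2)]])
  have pen_le: "\<bar>pen b\<bar> <= b\<^sup>2" for b using tay[of b 0] pen_facts(1,2) by simp
  have pen'_le: "\<bar>pen' b\<bar> <= 1 * \<bar>b\<bar>" for b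
    using lipschitz_of_deriv[OF DERIV_pen' pen''_bounds(2), of b 0] pen_facts(2) by simp
  have pint: "integrable lborel (%x. pen (rep_L2 z x))" for z :: "('a, real) L2"
  proof (rule Bochner_Integration.integrable_bound)
    show "integrable lborel (%x. (norm (rep_L2 z x))\<^sup>2)" using L2_fun_rep_L2[of z] by (simp add: L2_fun_def)
    show "AE x in lborel. norm (pen (rep_L2 z x)) <= norm ((norm (rep_L2 z x))\<^sup>2)" using pen_le by (intro AE_I2) simp
  qed measurable
  have psq: "L2_fun (%x. pen' (rep_L2 z x))" for z :: "('a, real) L2"
    by (rule L2_fun_lipschitz[OF L2_fun_rep_L2 pm(2) pen'_le])
  have deriv: "(Y has_real_derivative (flow' t w \<bullet> cls (%x. 1 * pen' (rep_L2 (flow t w) x)))) (at t)" if "0 < t" for t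
  proof -
    have "((%t. LBINT x. 1 * pen (rep_L2 (flow t w) x)) has_real_derivative
       (flow' t w \<bullet> cls (%x. 1 * pen' (rep_L2 (flow t w) x)))) (at t)"
      by (rule L2_functional_derivative[where S = UNIV and \<delta> = 1 and B = 1 and C = 1, OF flow_has_derivative[OF that]])
        (use tay pint psq in auto)
    then show ?thesis by (simp add: Y_def[abs_def])
  qed
  have neg: "flow' t w \<bullet> cls (%x. 1 * pen' (rep_L2 (flow t w) x)) <= 0" if t: "0 < t" for t
  proof -
    let ?G = "grad_flow t w"
    have V: "(cls (%x. pen' (rep_L2 (flow t w) x)), cls (%x. pen'' (rep_L2 (flow t w) x) *\<^sub>R rep_L2 ?G x)) \<in> form_dom \<Omega>"
      by (rule form_dom_chain[OF flow_in_V[OF t] DERIV_pen' continuous_on_pen'' pen''_bounds(2) pen_facts(2)])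
    have sq: "L2_fun (%x. pen'' (rep_L2 (flow t w) x) *\<^sub>R rep_L2 ?G x)"
      using borel_measurable_continuous_onI[OF continuous_on_pen'']
      by (intro L2_fun_bounded_mult[where B = 1]) (auto intro: pen''_bounds)
    have "?G \<bullet> cls (%x. pen'' (rep_L2 (flow t w) x) *\<^sub>R rep_L2 ?G x)
      = (LBINT x. rep_L2 ?G x \<bullet> (pen'' (rep_L2 (flow t w) x) *\<^sub>R rep_L2 ?G x))"
      using inner_cls[OF L2_fun_rep_L2 sq] by simp
    also have "\<dots> \<ge> 0" by (intro integral_nonneg_AE AE_I2) (simp add: pen''_bounds)
    finally show ?thesis using flow'_inner[OF t V, of w] by simp
  qed
  have mono: "Y t <= Y r" if "0 < r" "r <= t" for r t
  proof (rule DERIV_nonpos_imp_nonincreasing[OF that(2)])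
    fix x assume "r <= x" "x <= t"
    then have "0 < x" using that by simp
    then show "\<exists>y. (Y has_real_derivative y) (at x) \<and> y <= 0" using deriv neg by blast
  qed
  \<comment> \<open>Expanding \<open>pen\<close> about the initial datum, where its integral is 0,
    bounds \<open>Y t\<close> by the distance from \<open>w\<close>; this is how continuity at time
    0 enters.\<close>
  have close: "\<bar>Y t\<bar> <= (norm w + 1) * norm (flow t w - w) + (norm (flow t w - w))\<^sup>2" if "0 <= t" for t
  proof -
    let ?a = "rep_L2 w" and ?b = "rep_L2 (flow t w)"
    have "(LBINT x. pen (?a x)) = 0"
      by (rule integral_eq_zero_AE) (use w(2) in eventually_elim, simp add: pen_facts)
    then have "Y t = (LBINT x. pen (?b x) - pen (?a x))" using pint by (simp add: Y_def)
    also have "norm \<dots> <= (LBINT x. \<bar>pen' (?a x)\<bar> * \<bar>?b x - ?a x\<bar> + (norm (?b x - ?a x))\<^sup>2)"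
    proof (rule integral_norm_bound_AE)
      have d: "L2_fun (%x. ?b x - ?a x)" by (intro L2_fun_diff) auto
      have "integrable lborel (%x. pen' (?a x) \<bullet> (?b x - ?a x))" by (rule L2_fun_inner[OF psq d])
      then have "integrable lborel (%x. \<bar>pen' (?a x) \<bullet> (?b x - ?a x)\<bar>)" by (rule integrable_abs)
      then show "integrable lborel (%x. \<bar>pen' (?a x)\<bar> * \<bar>?b x - ?a x\<bar> + (norm (?b x - ?a x))\<^sup>2)"
        using d by (simp add: L2_fun_def abs_mult)
      show "integrable lborel (%x. pen (?b x) - pen (?a x))" using pint by simp
      show "AE x in lborel. norm (pen (?b x) - pen (?a x)) <= \<bar>pen' (?a x)\<bar> * \<bar>?b x - ?a x\<bar> + (norm (?b x - ?a x))\<^sup>2"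
      proof (intro AE_I2)
        fix x
        have "\<bar>pen (?b x) - pen (?a x)\<bar> <= \<bar>pen' (?a x) * (?b x - ?a x)\<bar> + (?b x - ?a x)\<^sup>2"
          using tay[of "?b x" "?a x"] by linarith
        then show "norm (pen (?b x) - pen (?a x)) <= \<bar>pen' (?a x)\<bar> * \<bar>?b x - ?a x\<bar> + (norm (?b x - ?a x))\<^sup>2"
          by (simp add: abs_mult)
      qed
    qed
    also have "\<dots> = cls (%x. \<bar>pen' (?a x)\<bar>) \<bullet> cls (%x. \<bar>?b x - ?a x\<bar>) + (norm (flow t w - w))\<^sup>2"
    proof -
      have d: "L2_fun (%x. ?b x - ?a x)" by (intro L2_fun_diff) auto
      have a1: "L2_fun (%x. \<bar>?b x - ?a x\<bar>)" by (rule L2_fun_bound[OF d]) (use d in \<open>auto simp: L2_fun_def\<close>)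
      have a2: "L2_fun (%x. \<bar>pen' (?a x)\<bar>)" by (rule L2_fun_bound[OF psq]) (use psq in \<open>auto simp: L2_fun_def\<close>)
      have i: "integrable lborel (%x. \<bar>pen' (?a x)\<bar> * \<bar>?b x - ?a x\<bar>)" using L2_fun_inner[OF a2 a1] by simp
      show ?thesis using inner_cls[OF a2 a1] norm_cls_diff[OF L2_fun_rep_L2[of "flow t w"] L2_fun_rep_L2[of w]] i d by (simp add: L2_fun_def)
    qed
    also have "\<dots> <= norm w * norm (flow t w - w) + (norm (flow t w - w))\<^sup>2"
    proof -
      have d: "L2_fun (%x. ?b x - ?a x)" by (intro L2_fun_diff) auto
      have a1: "L2_fun (%x. \<bar>?b x - ?a x\<bar>)" by (rule L2_fun_bound[OF d]) (use d in \<open>auto simp: L2_fun_def\<close>)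
      have a2: "L2_fun (%x. \<bar>pen' (?a x)\<bar>)" by (rule L2_fun_bound[OF psq]) (use psq in \<open>auto simp: L2_fun_def\<close>)
      have "(norm (cls (%x. \<bar>?b x - ?a x\<bar>)))\<^sup>2 = (norm (flow t w - w))\<^sup>2"
        using norm_cls[OF a1] norm_cls_diff[OF L2_fun_rep_L2[of "flow t w"] L2_fun_rep_L2[of w]] by simp
      then have n1: "norm (cls (%x. \<bar>?b x - ?a x\<bar>)) = norm (flow t w - w)" by simp
      have "(norm (cls (%x. \<bar>pen' (?a x)\<bar>)))\<^sup>2 <= (norm (cls ?a))\<^sup>2"
        unfolding norm_cls[OF a2] norm_cls[OF L2_fun_rep_L2]
      proof (rule integral_mono)
        show "(norm \<bar>pen' (?a x)\<bar>)\<^sup>2 <= (norm (?a x))\<^sup>2" for x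
          using pen'_le[of "?a x"] by (intro power_mono) auto
      qed (use a2 L2_fun_rep_L2[of w] in \<open>simp_all add: L2_fun_def\<close>)
      then have "norm (cls (%x. \<bar>pen' (?a x)\<bar>)) <= norm (cls ?a)" by (rule power2_le_imp_le) simp
      then have n2: "norm (cls (%x. \<bar>pen' (?a x)\<bar>)) <= norm w" by simp
      have "cls (%x. \<bar>pen' (?a x)\<bar>) \<bullet> cls (%x. \<bar>?b x - ?a x\<bar>) <= norm (cls (%x. \<bar>pen' (?a x)\<bar>)) * norm (cls (%x. \<bar>?b x - ?a x\<bar>))"
        by (rule norm_cauchy_schwarz)
      also have "\<dots> <= norm w * norm (flow t w - w)" unfolding n1 by (rule mult_right_mono[OF n2]) simp
      finally show ?thesis by simp
    qed
    finally have "\<bar>Y t\<bar> <= norm w * norm (flow t w - w) + (norm (flow t w - w))\<^sup>2" by simp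
    then show ?thesis using norm_ge_zero[of "flow t w - w"] unfolding distrib_right by linarith
  qed
  show ?thesis
  proof (cases "s = 0")
    case True
    then show ?thesis using w by (simp add: flow_0_supported)
  next
    case False
    then have s0: "0 < s" using s by simp
    have lim: "((%t. flow t w) \<longlongrightarrow> w) (at_right 0)"
    proof -
      have "((%t. flow t w) \<longlongrightarrow> flow 0 w) (at 0 within {0..})"
        using continuous_on_flow[of w] by (auto simp: continuous_on)
      then have "((%t. flow t w) \<longlongrightarrow> flow 0 w) (at_right 0)" by (rule tendsto_within_subset) auto
      then show ?thesis using w(1) by (simp add: flow_0_supported)
    qed
    have "((%t. (norm w + 1) * norm (flow t w - w) + (norm (flow t w - w))\<^sup>2) \<longlongrightarrow> (norm w + 1) * norm (w - w) + (norm (w - w))\<^sup>2) (at_right 0)"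
      by (intro tendsto_intros lim)
    then have z: "((%t. (norm w + 1) * norm (flow t w - w) + (norm (flow t w - w))\<^sup>2) \<longlongrightarrow> 0) (at_right 0)" by simp
    have "Y s <= 0"
    proof (rule tendsto_lowerbound[OF z])
      have "\<forall>\<^sub>F t in at_right 0. t \<in> {0<..<s}" using s0 by (rule eventually_at_right_real)
      then show "\<forall>\<^sub>F t in at_right 0. Y s <= (norm w + 1) * norm (flow t w - w) + (norm (flow t w - w))\<^sup>2"
      proof eventually_elim
        case (elim t)
        then show ?case using mono[of t s] close[of t] by auto
      qed
    qed simp
    then have "(LBINT x. pen (rep_L2 (flow s w) x)) = 0"
      unfolding Y_def by (intro antisym integral_nonneg_AE AE_I2 pen_facts(3))
    then have "AE x in lborel. pen (rep_L2 (flow s w) x) = 0"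
      using integral_nonneg_eq_0_iff_AE[OF pint] pen_facts(3) by auto
    then show ?thesis by eventually_elim (rule pen_facts(4))
  qed
qed

end

subsection \<open>Strict positivity of the heat flow\<close>

lemma DERIV_pos_part_compose:
  fixes f :: "real => real"
  assumes f: "\<And>m. 0 <= m ==> DERIV f m :> f' m" and "f' 0 = 0"
  shows "DERIV (%t. f (max 0 t)) t :> f' (max 0 t)"
proof -
  have "DERIV (%t. f (max 0 (- t))) (- t) :> - f' (max 0 (- (- t)))"
    by (rule DERIV_neg_part_compose) (use assms in auto)
  moreover have "DERIV uminus t :> (- 1 :: real)" by (auto intro!: derivative_eq_intros)
  ultimately have "DERIV (%t. f (max 0 (- (- t)))) t :> - f' (max 0 (- (- t))) * - 1"
    by (rule DERIV_chain2)
  then show ?thesis by simp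
qed

text \<open>
  \<open>C1\<close> extensions to the negative axis of \<open>ln (t + \<epsilon>) - ln \<epsilon>\<close> and of its derivative \<open>1 / (t + \<epsilon>)\<close>.
\<close>

definition lg :: "real => real => real" where
  "lg \<epsilon> t = (ln (max 0 t + \<epsilon>) - ln \<epsilon> - max 0 t / \<epsilon>) + t / \<epsilon>"
definition lg' :: "real => real => real" where
  "lg' \<epsilon> t = 1 / (max 0 t + \<epsilon>)"
definition rc :: "real => real => real" where
  "rc \<epsilon> t = (1 / (max 0 t + \<epsilon>) - 1 / \<epsilon> + max 0 t / \<epsilon>\<^sup>2) - t / \<epsilon>\<^sup>2"
definition rc' :: "real => real => real" where
  "rc' \<epsilon> t = - (1 / (max 0 t + \<epsilon>)\<^sup>2)"

lemma DERIV_lg: "0 < \<epsilon> ==> DERIV (lg \<epsilon>) t :> lg' \<epsilon> t"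
proof -
  assume \<epsilon>: "0 < \<epsilon>"
  have "DERIV (%m. ln (m + \<epsilon>) - ln \<epsilon> - m / \<epsilon>) m :> 1 / (m + \<epsilon>) - 1 / \<epsilon>" if "0 <= m" for m
    using that \<epsilon> by (auto intro!: derivative_eq_intros)
  from DERIV_pos_part_compose[OF this, of t]
  have "DERIV (%t. ln (max 0 t + \<epsilon>) - ln \<epsilon> - max 0 t / \<epsilon>) t :> 1 / (max 0 t + \<epsilon>) - 1 / \<epsilon>" by simp
  moreover have "DERIV (%t. t / \<epsilon>) t :> 1 / \<epsilon>" using \<epsilon> by (auto intro!: derivative_eq_intros)
  ultimately have "DERIV (%t. (ln (max 0 t + \<epsilon>) - ln \<epsilon> - max 0 t / \<epsilon>) + t / \<epsilon>) t :> (1 / (max 0 t + \<epsilon>) - 1 / \<epsilon>) + 1 / \<epsilon>"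
    by (rule DERIV_add)
  then show ?thesis by (simp add: lg_def[abs_def] lg'_def)
qed

lemma DERIV_rc: "0 < \<epsilon> ==> DERIV (rc \<epsilon>) t :> rc' \<epsilon> t"
proof -
  assume \<epsilon>: "0 < \<epsilon>"
  have "DERIV (%m. 1 / (m + \<epsilon>) - 1 / \<epsilon> + m / \<epsilon>\<^sup>2) m :> - (1 / (m + \<epsilon>)\<^sup>2) + 1 / \<epsilon>\<^sup>2" if "0 <= m" for m
    using that \<epsilon> by (auto intro!: derivative_eq_intros simp: power2_eq_square)
  from DERIV_pos_part_compose[OF this, of t]
  have "DERIV (%t. 1 / (max 0 t + \<epsilon>) - 1 / \<epsilon> + max 0 t / \<epsilon>\<^sup>2) t :> - (1 / (max 0 t + \<epsilon>)\<^sup>2) + 1 / \<epsilon>\<^sup>2" by simp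
  moreover have "DERIV (%t. t / \<epsilon>\<^sup>2) t :> 1 / \<epsilon>\<^sup>2" by (rule DERIV_cdivide[OF DERIV_ident])
  ultimately have "DERIV (%t. (1 / (max 0 t + \<epsilon>) - 1 / \<epsilon> + max 0 t / \<epsilon>\<^sup>2) - t / \<epsilon>\<^sup>2) t :> (- (1 / (max 0 t + \<epsilon>)\<^sup>2) + 1 / \<epsilon>\<^sup>2) - 1 / \<epsilon>\<^sup>2"
    by (rule DERIV_diff)
  then show ?thesis by (simp add: rc_def[abs_def] rc'_def)
qed

lemma lg_facts:
  assumes \<epsilon>: "0 < \<epsilon>"
  shows "lg \<epsilon> 0 = 0" "rc \<epsilon> 0 = 0" "0 < lg' \<epsilon> t" "\<bar>lg' \<epsilon> t\<bar> <= 1 / \<epsilon>" "\<bar>rc' \<epsilon> t\<bar> <= 1 / \<epsilon>\<^sup>2"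
    "continuous_on UNIV (lg' \<epsilon>)" "continuous_on UNIV (rc' \<epsilon>)"
    "0 <= t ==> lg \<epsilon> t = ln (t + \<epsilon>) - ln \<epsilon>" "0 <= t ==> rc \<epsilon> t + 1 / \<epsilon> = lg' \<epsilon> t" "rc' \<epsilon> t = - (lg' \<epsilon> t)\<^sup>2"
proof -
  have p: "\<epsilon> <= max 0 t + \<epsilon>" "0 < max 0 t + \<epsilon>" for t using \<epsilon> by auto
  show "0 < lg' \<epsilon> t" using p by (simp add: lg'_def)
  show "\<bar>lg' \<epsilon> t\<bar> <= 1 / \<epsilon>" using p(1)[of t] \<epsilon> by (simp add: lg'_def frac_le)
  have "1 / (max 0 t + \<epsilon>)\<^sup>2 <= 1 / \<epsilon>\<^sup>2" using p(1)[of t] \<epsilon> by (intro frac_le power_mono) auto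
  then show "\<bar>rc' \<epsilon> t\<bar> <= 1 / \<epsilon>\<^sup>2" by (simp add: rc'_def)
  show "continuous_on UNIV (lg' \<epsilon>)" "continuous_on UNIV (rc' \<epsilon>)"
    unfolding lg'_def[abs_def] rc'_def[abs_def]
    by (intro continuous_intros; use p(2) in \<open>metis less_irrefl power_not_zero\<close>)+
  show "rc' \<epsilon> t = - (lg' \<epsilon> t)\<^sup>2" by (simp add: rc'_def lg'_def power_divide)
qed (use \<epsilon> in \<open>auto simp: lg_def rc_def lg'_def max_def\<close>)

lemma lg'_lipschitz:
  assumes \<epsilon>: "0 < \<epsilon>"
  shows "\<bar>lg' \<epsilon> a - lg' \<epsilon> b\<bar> <= 1 / \<epsilon>\<^sup>2 * \<bar>a - b\<bar>"
proof -
  let ?a = "max 0 a" and ?b = "max 0 b"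
  have p: "0 < ?a + \<epsilon>" "0 < ?b + \<epsilon>" using \<epsilon> by auto
  have "lg' \<epsilon> a - lg' \<epsilon> b = (?b - ?a) / ((?a + \<epsilon>) * (?b + \<epsilon>))"
    using p by (simp add: lg'_def field_simps)
  also have "\<bar>\<dots>\<bar> = \<bar>?b - ?a\<bar> / ((?a + \<epsilon>) * (?b + \<epsilon>))"
    using p by (simp add: abs_mult)
  also have "\<dots> <= \<bar>a - b\<bar> / (\<epsilon> * \<epsilon>)"
    using \<epsilon> by (intro frac_le mult_mono) auto
  finally show ?thesis by (simp add: power2_eq_square)
qed

text \<open>With m the positive part, the bump is m^2 and its gradient has norm 4 m |x - c|, where
  |x - c| <= r unless m = 0. So the squared gradient is at most 16 r^2 times the bump.\<close>

lemma bump_bounds: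
  assumes "0 < r"
  shows "bump c r x <= r ^ 4" "(norm (bump' c r x))\<^sup>2 <= 16 * r\<^sup>2 * bump c r x" "norm (bump' c r x) <= 4 * r ^ 3"
proof -
  define m where "m = max 0 (r\<^sup>2 - (x - c) \<bullet> (x - c))"
  have m: "0 <= m" "m <= r\<^sup>2" by (auto simp: m_def)
  have b: "bump c r x = m\<^sup>2" by (simp add: bump_def m_def)
  have "m\<^sup>2 <= (r\<^sup>2)\<^sup>2" using m by (intro power_mono) auto
  then show b4: "bump c r x <= r ^ 4" by (simp add: b flip: power_mult)
  have "m\<^sup>2 * (norm (x - c))\<^sup>2 <= m\<^sup>2 * r\<^sup>2"
  proof (cases "m = 0")
    case False
    then have "(norm (x - c))\<^sup>2 <= r\<^sup>2" by (auto simp: m_def max_def power2_norm_eq_inner split: if_splits)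
    then show ?thesis by (intro mult_left_mono) auto
  qed simp
  moreover have "(norm (bump' c r x))\<^sup>2 = 16 * (m\<^sup>2 * (norm (x - c))\<^sup>2)"
    using m by (simp add: bump'_def m_def[symmetric] power_mult_distrib)
  ultimately show s: "(norm (bump' c r x))\<^sup>2 <= 16 * r\<^sup>2 * bump c r x" by (simp add: b mult.commute)
  also have "\<dots> <= 16 * r\<^sup>2 * r ^ 4" using b4 by (intro mult_left_mono) auto
  also have "\<dots> = (4 * r ^ 3)\<^sup>2" by (simp add: power_mult_distrib flip: power_mult power_add)
  finally show "norm (bump' c r x) <= 4 * r ^ 3" by (rule power2_le_imp_le) (use assms in simp)
qed

lemma C1_compact_bump: "0 < r ==> cball c r \<subseteq> \<Omega> ==> C1_compact \<Omega> (bump c r) (bump' c r)"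
  using C1_compact_compose_bump[of r c \<Omega> "%t. t" "%_. 1"] by simp

text \<open>The absorption of the cross term in the energy estimate for the logarithm.\<close>

lemma log_energy_pointwise:
  fixes G X :: "'a::real_inner"
  assumes X: "(norm X)\<^sup>2 <= 16 * r\<^sup>2 * b" and "0 <= b" "0 < r" "0 <= k"
  shows "1/2 * (b * (k * norm G)\<^sup>2) - 8 * r\<^sup>2 <= b * (k * norm G)\<^sup>2 - k * (G \<bullet> X)"
proof -
  let ?p = "k * norm G"
  have "k * (G \<bullet> X) <= ?p * norm X"
    using norm_cauchy_schwarz[of G X] assms(4) by (simp add: mult.assoc mult_left_mono)
  also have "norm X <= sqrt (16 * r\<^sup>2 * b)" using X by (rule real_le_rsqrt)
  also have "sqrt (16 * r\<^sup>2 * b) = 4 * r * sqrt b" using assms by (simp add: real_sqrt_mult)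
  also have "?p * (4 * r * sqrt b) <= 1/2 * (b * ?p\<^sup>2) + 8 * r\<^sup>2"
  proof -
    have "0 <= (sqrt b * ?p - 4 * r)\<^sup>2" by simp
    also have "\<dots> = b * ?p\<^sup>2 - 2 * (?p * (4 * r * sqrt b)) + 16 * r\<^sup>2"
      using \<open>0 <= b\<close> by (simp add: power2_diff power_mult_distrib algebra_simps)
    finally show ?thesis by simp
  qed
  finally show ?thesis using assms(4) by (simp add: mult_left_mono)
qed

lemma continuous_on_cut:
  fixes K :: "'a::euclidean_space set"
  assumes K: "K \<in> sets borel"
  shows "continuous_on UNIV (%z::('a, 'b::euclidean_space) L2. cls (restr K (rep_L2 z)))"
proof (intro lipschitz_on_continuous_on[of 1] lipschitz_onI)
  fix z y :: "('a, 'b) L2"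
  note s = supported_iff(2)[OF K]
  have "(norm (cls (restr K (rep_L2 z)) - cls (restr K (rep_L2 y))))\<^sup>2
    = (LBINT x. (norm (restr K (rep_L2 z) x - restr K (rep_L2 y) x))\<^sup>2)"
    by (rule norm_cls_diff[OF s s])
  also have "\<dots> <= (LBINT x. (norm (rep_L2 z x - rep_L2 y x))\<^sup>2)"
    using L2_fun_diff[OF s[of z] s[of y]]
      L2_fun_diff[OF L2_fun_rep_L2[of z] L2_fun_rep_L2[of y]]
    by (intro integral_mono) (auto simp: L2_fun_def restr_def indicator_def)
  also have "\<dots> = (norm (z - y))\<^sup>2"
    using norm_cls_diff[OF L2_fun_rep_L2[of z] L2_fun_rep_L2[of y]] by simp
  finally have "norm (cls (restr K (rep_L2 z)) - cls (restr K (rep_L2 y))) <= norm (z - y)"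
    by (rule power2_le_imp_le) simp
  then show "dist (cls (restr K (rep_L2 z))) (cls (restr K (rep_L2 y))) <= 1 * dist z y"
    by (simp add: dist_norm)
qed simp

lemma norm_cut:
  fixes z :: "('a::euclidean_space, 'b::euclidean_space) L2"
  assumes K: "K \<in> sets borel"
  shows "(norm (cls (restr K (rep_L2 z))))\<^sup>2 = (LBINT x:K. (norm (rep_L2 z x))\<^sup>2)"
proof -
  have "(norm (restr K (rep_L2 z) x))\<^sup>2 = indicator K x *\<^sub>R (norm (rep_L2 z x))\<^sup>2" for x
    by (simp add: restr_def indicator_def)
  then show ?thesis unfolding norm_cls[OF supported_iff(2)[OF K]] by (simp add: set_lebesgue_integral_def)
qed

text \<open>Passed from test functions to the form domain by density; the integrals over
  \<open>K\<close> are written as norms of cut-offs because these are continuous in the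
  pair.\<close>

lemma poincare_form_dom:
  fixes K :: "'a::euclidean_space set"
  assumes z: "(v, h) \<in> form_dom \<Omega>"
    and K: "K \<in> sets borel" "convex K" "emeasure lborel K < top"
    and diam: "\<And>x y. x \<in> K ==> y \<in> K ==> norm (x - y) <= \<delta>"
  shows "measure lborel K * (LBINT x:K. (norm (rep_L2 v x))\<^sup>2)
    <= (v \<bullet> cls (indicator K))\<^sup>2 + (\<delta>\<^sup>2 * 2 ^ DIM('a)) * measure lborel K * (LBINT x:K. (norm (rep_L2 h x))\<^sup>2)"
proof -
  let ?P = "%z::('a, real) L2 \<times> ('a, 'a) L2. measure lborel K * (norm (cls (restr K (rep_L2 (fst z)))))\<^sup>2
    <= (fst z \<bullet> cls (indicator K))\<^sup>2 + (\<delta>\<^sup>2 * 2 ^ DIM('a)) * measure lborel K * (norm (cls (restr K (rep_L2 (snd z)))))\<^sup>2"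
  have "?P (v, h)"
  proof (rule form_dom_induct_closed[OF z, of ?P])
    have "continuous_on UNIV (%z::('a, real) L2 \<times> ('a, 'a) L2. cls (restr K (rep_L2 (fst z))))"
      "continuous_on UNIV (%z::('a, real) L2 \<times> ('a, 'a) L2. cls (restr K (rep_L2 (snd z))))"
      by (rule continuous_on_compose2[OF continuous_on_cut[OF K(1)]]; auto intro: continuous_intros)+
    then show "closed {z. ?P z}" by (intro closed_Collect_le continuous_intros)
    fix \<phi> D assume C: "C1_compact \<Omega> \<phi> D"
    note sq = C1_compact_L2_fun[OF C]
    have c: "(norm (cls (restr K (rep_L2 (cls f)))))\<^sup>2 = (LBINT x:K. (norm (f x))\<^sup>2)" if f: "L2_fun f" for f :: "'a => 'b::euclidean_space"
    proof -
      have fm: "f \<in> borel_measurable borel" using f by (simp add: L2_fun_def)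
      have "AE x in lborel. indicator K x *\<^sub>R (norm (rep_L2 (cls f) x))\<^sup>2 = indicator K x *\<^sub>R (norm (f x))\<^sup>2"
        using rep_L2_cls[OF f] by eventually_elim simp
      then show ?thesis unfolding norm_cut[OF K(1)] set_lebesgue_integral_def
        using K(1) fm by (intro integral_cong_AE) auto
    qed
    have i: "cls \<phi> \<bullet> cls (indicator K) = (LBINT x:K. \<phi> x)"
      using inner_cls[OF sq(1) L2_fun_indicator[OF K(1,3)]] by (simp add: set_lebesgue_integral_def mult.commute)
    show "?P (cls \<phi>, cls D)"
      using poincare_convex[OF C K(1,2) diam K(3)] by (simp add: c[OF sq(1)] c[OF sq(2)] i)
  qed
  then show ?thesis by (simp add: norm_cut K(1))
qed

lemma lim_const_over_n_plus_2: "(%m. c / (real m + 2)) \<longlonglongrightarrow> 0"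
  using LIMSEQ_ignore_initial_segment[OF lim_const_over_n[of c], of 2] by (simp add: add.commute)

lemma eventually_in_smaller_ball:
  fixes x :: "'a::real_normed_vector"
  assumes "x \<in> ball 0 R"
  shows "\<forall>\<^sub>F m in sequentially. x \<in> ball 0 (R * (1 - 1 / (real m + 2)))"
proof -
  have "(%m. R * (1 - 1 / (real m + 2))) \<longlonglongrightarrow> R * (1 - 0)" by (intro tendsto_intros lim_const_over_n_plus_2)
  then have "\<forall>\<^sub>F m in sequentially. norm x < R * (1 - 1 / (real m + 2))"
    using assms by (intro order_tendstoD(1)) auto
  then show ?thesis by simp
qed

lemma smaller_radius: "0 < R ==> 0 < R * (1 - 1 / (real m + 2)) \<and> R * (1 - 1 / (real m + 2)) < R"
  using mult_strict_left_mono[of "1 - 1 / (real m + 2)" 1 R] by simp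

context ball_heat
begin

section \<open>The logarithmic energy of the flow, with a cut-off on a smaller ball\<close>

context
  fixes \<rho> :: real and w :: "('a, real) L2"
  assumes \<rho>: "0 < \<rho>" "\<rho> < R" and w: "supported \<Omega> w" "AE x in lborel. 0 <= rep_L2 w x"
begin

abbreviation (input) bmp :: "'a => real" where "bmp \<equiv> bump 0 \<rho>"

definition energy :: "real => real => real" where
  "energy \<epsilon> s = (LBINT x. bump 0 \<rho> x * lg \<epsilon> (rep_L2 (flow s w) x))"
definition energy' :: "real => real => real" where
  "energy' \<epsilon> s = flow' s w \<bullet> cls (%x. bump 0 \<rho> x * lg' \<epsilon> (rep_L2 (flow s w) x))"
text \<open>What the gradient of the cut-off costs: the term \<open>8 * r\<^sup>2\<close> of
  \<open>log_energy_pointwise\<close> at radius \<open>\<rho>\<close>, integrated over the ball. It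
  does not depend on \<epsilon>, which is decisive once everything is divided by ln
  (1/\<epsilon>).\<close>

definition offset :: real where "offset = 8 * \<rho>\<^sup>2 * measure lborel (ball (0::'a) \<rho>)"
text \<open>Where u is nonnegative, this is the cut-off times |grad ln (u + \<epsilon>)|^2.\<close>

definition dissip :: "real => real => 'a => real" where
  "dissip \<epsilon> s x = bump 0 \<rho> x * (lg' \<epsilon> (rep_L2 (flow s w) x) * norm (rep_L2 (grad_flow s w) x))\<^sup>2"

lemma bump_C1: "C1_compact \<Omega> (bump 0 \<rho>) (bump' 0 \<rho>)"
  by (rule C1_compact_bump) (use \<rho> in auto)

lemma bump_abs: "\<bar>bmp x\<bar> <= \<rho> ^ 4"
  using bump_bounds(1)[OF \<rho>(1), of 0 x] bump_nonneg[of 0 \<rho> x] by simp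

lemma bump_measurable [measurable]: "bmp \<in> borel_measurable borel" "bump' (0::'a) \<rho> \<in> borel_measurable borel"
  by (intro borel_measurable_continuous_onI continuous_on_bump)+

lemma bump_sq: "L2_fun (bmp)" "L2_fun (bump' (0::'a) \<rho>)"
  using C1_compact_L2_fun[OF bump_C1] .

lemma lg_measurable:
  assumes "0 < \<epsilon>"
  shows "lg \<epsilon> \<in> borel_measurable borel" "lg' \<epsilon> \<in> borel_measurable borel" "rc \<epsilon> \<in> borel_measurable borel" "rc' \<epsilon> \<in> borel_measurable borel"
  using lg_facts(6,7)[OF assms] DERIV_borel_measurable[OF DERIV_lg[OF assms]] DERIV_borel_measurable[OF DERIV_rc[OF assms]]
  by (auto intro: borel_measurable_continuous_onI)

lemma lg_abs_le: "0 < \<epsilon> ==> \<bar>lg \<epsilon> t\<bar> <= 1 / \<epsilon> * \<bar>t\<bar>"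
proof -
  assume \<epsilon>: "0 < \<epsilon>"
  show ?thesis using lipschitz_of_deriv[OF DERIV_lg[OF \<epsilon>] lg_facts(4)[OF \<epsilon>], of t 0] lg_facts(1)[OF \<epsilon>] by simp
qed

lemma bump_lg_sq:
  assumes \<epsilon>: "0 < \<epsilon>"
  shows "L2_fun (%x. lg \<epsilon> (rep_L2 (z::('a, real) L2) x))"
    "L2_fun (%x. bmp x * lg' \<epsilon> (rep_L2 z x))"
    "integrable lborel (%x. bmp x * lg \<epsilon> (rep_L2 z x))"
proof -
  note [measurable] = lg_measurable[OF \<epsilon>]
  show l: "L2_fun (%x. lg \<epsilon> (rep_L2 z x))"
    by (rule L2_fun_lipschitz[OF L2_fun_rep_L2 lg_measurable(1)[OF \<epsilon>] lg_abs_le[OF \<epsilon>]])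
  show "L2_fun (%x. bmp x * lg' \<epsilon> (rep_L2 z x))"
    using L2_fun_bounded_mult[OF bump_sq(1), of "%x. lg' \<epsilon> (rep_L2 z x)" "1 / \<epsilon>"] lg_facts(4)[OF \<epsilon>]
    by (simp add: mult.commute)
  show "integrable lborel (%x. bmp x * lg \<epsilon> (rep_L2 z x))"
    using L2_fun_inner[OF bump_sq(1) l] by simp
qed

lemma flow_nn: "0 <= s ==> AE x in lborel. 0 <= rep_L2 (flow s w) x"
  by (rule flow_nonneg[OF w])

lemma energy_deriv:
  assumes \<epsilon>: "0 < \<epsilon>" and s: "0 < s"
  shows "(energy \<epsilon> has_real_derivative energy' \<epsilon> s) (at s)"
  unfolding energy_def[abs_def] energy'_def
proof (rule L2_functional_derivative[where S = UNIV and \<delta> = 1 and B = "\<rho> ^ 4" and C = "1 / \<epsilon>\<^sup>2", OF flow_has_derivative[OF s]])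
  show "\<bar>lg \<epsilon> b - lg \<epsilon> a - lg' \<epsilon> a * (b - a)\<bar> <= 1 / \<epsilon>\<^sup>2 * (b - a)\<^sup>2" for a b
    by (rule taylor_quadratic[OF DERIV_lg[OF \<epsilon>] lg'_lipschitz[OF \<epsilon>]])
qed (use bump_abs bump_lg_sq[OF \<epsilon>] in auto)

text \<open>The flow equation tested with b / (u + \<epsilon>), b being the bump, gives minus a
  product of gradients: the full dissipation and a cross term with grad b.
  \<open>log_energy_pointwise\<close> absorbs the cross term into half of the dissipation and a
  constant.\<close>

lemma dissip_bound:
  assumes \<epsilon>: "0 < \<epsilon>" and s: "0 < s"
  shows "integrable lborel (dissip \<epsilon> s)" "1/2 * (LBINT x. dissip \<epsilon> s x) <= energy' \<epsilon> s + offset"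
proof -
  let ?W = "rep_L2 (flow s w)" and ?G = "rep_L2 (grad_flow s w)"
  let ?b = "bmp" and ?X = "bump' (0::'a) \<rho>"
  note [measurable] = lg_measurable[OF \<epsilon>]
  have ch: "(cls (%x. rc \<epsilon> (?W x)), cls (%x. rc' \<epsilon> (?W x) *\<^sub>R ?G x)) \<in> form_dom \<Omega>"
    by (rule form_dom_chain[OF flow_in_V[OF s] DERIV_rc[OF \<epsilon>] lg_facts(7)[OF \<epsilon>] lg_facts(5)[OF \<epsilon>] lg_facts(2)[OF \<epsilon>]])
  define v where "v = cls (%x. rc \<epsilon> (?W x))"
  define \<gamma> where "\<gamma> = cls (%x. rc' \<epsilon> (?W x) *\<^sub>R ?G x)"
  have rcle: "\<bar>rc \<epsilon> t\<bar> <= 1 / \<epsilon>\<^sup>2 * \<bar>t\<bar>" for t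
    using lipschitz_of_deriv[OF DERIV_rc[OF \<epsilon>] lg_facts(5)[OF \<epsilon>], of t 0] lg_facts(2)[OF \<epsilon>] by simp
  have sqv: "L2_fun (%x. rc \<epsilon> (?W x))"
    by (rule L2_fun_lipschitz[OF L2_fun_rep_L2 lg_measurable(3)[OF \<epsilon>] rcle])
  have sq\<gamma>: "L2_fun (%x. rc' \<epsilon> (?W x) *\<^sub>R ?G x)"
    by (rule L2_fun_bounded_mult[where B = "1 / \<epsilon>\<^sup>2"]) (use lg_facts(5)[OF \<epsilon>] in auto)
  have av: "AE x in lborel. rep_L2 v x = rc \<epsilon> (?W x)" unfolding v_def by (rule rep_L2_cls[OF sqv])
  have a\<gamma>: "AE x in lborel. rep_L2 \<gamma> x = rc' \<epsilon> (?W x) *\<^sub>R ?G x" unfolding \<gamma>_def by (rule rep_L2_cls[OF sq\<gamma>])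
  define Bd where "Bd = max (\<rho> ^ 4) (4 * \<rho> ^ 3)"
  have pr: "(cls (%x. ?b x * rep_L2 v x), cls (%x. rep_L2 v x *\<^sub>R ?X x + ?b x *\<^sub>R rep_L2 \<gamma> x)) \<in> form_dom \<Omega>"
  proof (rule form_dom_product[where B = Bd])
    show "(v, \<gamma>) \<in> form_dom \<Omega>" using ch by (simp add: v_def \<gamma>_def)
    show "norm (?X x) <= Bd" for x using bump_bounds(3)[OF \<rho>(1), of 0 x] by (simp add: Bd_def)
    show "\<bar>?b x\<bar> <= Bd" for x using bump_abs[of x] by (simp add: Bd_def)
  qed (use GDERIV_bump continuous_on_bump in auto)
  have cb: "(cls (%x. (1/\<epsilon>) *\<^sub>R ?b x), cls (%x. (1/\<epsilon>) *\<^sub>R ?X x)) \<in> form_dom \<Omega>"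
    by (rule C1_in_form_dom[OF C1_compact_scaleR[OF bump_C1]])
  have s1: "L2_fun (%x. ?b x * rep_L2 v x)"
    using L2_fun_bounded_mult[OF L2_fun_rep_L2[of v], of ?b "\<rho>^4"] bump_abs by simp
  have s2: "L2_fun (%x. rep_L2 v x *\<^sub>R ?X x)"
  proof (rule L2_fun_bound[OF L2_fun_scaleR[OF L2_fun_rep_L2[of v], of Bd]])
    show "AE x in lborel. norm (rep_L2 v x *\<^sub>R ?X x) <= norm (Bd *\<^sub>R rep_L2 v x)"
    proof (intro AE_I2)
      fix x
      have "\<bar>rep_L2 v x\<bar> * norm (?X x) <= \<bar>rep_L2 v x\<bar> * \<bar>Bd\<bar>"
        using bump_bounds(3)[OF \<rho>(1), of 0 x] by (intro mult_left_mono) (auto simp: Bd_def)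
      then show "norm (rep_L2 v x *\<^sub>R ?X x) <= norm (Bd *\<^sub>R rep_L2 v x)" by (simp add: mult.commute)
    qed
  qed measurable
  have s3: "L2_fun (%x. ?b x *\<^sub>R rep_L2 \<gamma> x)"
    using L2_fun_bounded_mult[OF L2_fun_rep_L2[of \<gamma>], of ?b "\<rho>^4"] bump_abs by simp
  have s4: "L2_fun (%x. (1/\<epsilon>) *\<^sub>R ?b x)" "L2_fun (%x. (1/\<epsilon>) *\<^sub>R ?X x)"
    by (intro L2_fun_scaleR bump_sq)+
  define T where "T x = (rep_L2 v x *\<^sub>R ?X x + ?b x *\<^sub>R rep_L2 \<gamma> x) + (1/\<epsilon>) *\<^sub>R ?X x" for x
  have sT: "L2_fun T" unfolding T_def by (intro L2_fun_add s2 s3 s4)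
  \<comment> \<open>1 / (u + \<epsilon>) does not vanish where u does, so the chain rule does not
    apply to it directly. It is written as \<open>rc \<epsilon>\<close> of u plus
    \<open>1 / \<epsilon>\<close>: the product rule handles the first summand times the bump, and
    the bump itself, a test function, takes care of the second.\<close>
  have test: "(cls (%x. ?b x * lg' \<epsilon> (?W x)), cls T) \<in> form_dom \<Omega>"
  proof -
    have "(cls (%x. ?b x * rep_L2 v x), cls (%x. rep_L2 v x *\<^sub>R ?X x + ?b x *\<^sub>R rep_L2 \<gamma> x)) + (cls (%x. (1/\<epsilon>) *\<^sub>R ?b x), cls (%x. (1/\<epsilon>) *\<^sub>R ?X x)) \<in> form_dom \<Omega>"
      by (rule subspace_add[OF subV pr cb])
    then have "(cls (%x. ?b x * rep_L2 v x + (1/\<epsilon>) *\<^sub>R ?b x), cls T) \<in> form_dom \<Omega>"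
      using cls_add[OF s1 s4(1)] cls_add[OF L2_fun_add[OF s2 s3] s4(2)] by (simp add: T_def[abs_def])
    moreover have "cls (%x. ?b x * rep_L2 v x + (1/\<epsilon>) *\<^sub>R ?b x) = cls (%x. ?b x * lg' \<epsilon> (?W x))"
    proof (subst cls_eq_iff[OF L2_fun_add[OF s1 s4(1)] bump_lg_sq(2)[OF \<epsilon>]])
      show "AE x in lborel. ?b x * rep_L2 v x + (1/\<epsilon>) *\<^sub>R ?b x = ?b x * lg' \<epsilon> (?W x)"
        using av flow_nn[OF less_imp_le[OF s]]
      proof eventually_elim
        case (elim x)
        have "?b x * rep_L2 v x + (1/\<epsilon>) *\<^sub>R ?b x = ?b x * (rc \<epsilon> (?W x) + 1/\<epsilon>)"
          by (simp add: elim(1) distrib_left)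
        then show ?case unfolding lg_facts(9)[OF \<epsilon> elim(2)] .
      qed
    qed
    ultimately show ?thesis by simp
  qed
  have "energy' \<epsilon> s = - (LBINT x. ?G x \<bullet> T x)"
    unfolding energy'_def using flow'_inner[OF s test, of w] inner_cls[OF L2_fun_rep_L2 sT, of "grad_flow s w"] by simp
  have iGT: "integrable lborel (%x. ?G x \<bullet> T x)" by (rule L2_fun_inner[OF L2_fun_rep_L2 sT])
  show idis: "integrable lborel (dissip \<epsilon> s)"
  proof (rule Bochner_Integration.integrable_bound)
    show "integrable lborel (%x. (\<rho>^4 * (1/\<epsilon>)\<^sup>2) * (norm (?G x))\<^sup>2)"
      using L2_fun_rep_L2[of "grad_flow s w"] by (simp add: L2_fun_def)
    show "dissip \<epsilon> s \<in> borel_measurable lborel" unfolding dissip_def[abs_def] by measurable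
    show "AE x in lborel. norm (dissip \<epsilon> s x) <= norm ((\<rho>^4 * (1/\<epsilon>)\<^sup>2) * (norm (?G x))\<^sup>2)"
    proof (intro AE_I2)
      fix x
      have "(lg' \<epsilon> (?W x))\<^sup>2 <= (1/\<epsilon>)\<^sup>2" using lg_facts(3,4)[OF \<epsilon>, of "?W x"] by (intro power_mono) auto
      then have "?b x * ((lg' \<epsilon> (?W x))\<^sup>2 * (norm (?G x))\<^sup>2) <= \<rho>^4 * ((1/\<epsilon>)\<^sup>2 * (norm (?G x))\<^sup>2)"
        using bump_abs[of x] bump_nonneg[of 0 \<rho> x] by (intro mult_mono) auto
      then show "norm (dissip \<epsilon> s x) <= norm ((\<rho>^4 * (1/\<epsilon>)\<^sup>2) * (norm (?G x))\<^sup>2)"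
        using bump_nonneg[of 0 \<rho> x] by (simp add: dissip_def power_mult_distrib mult.assoc)
    qed
  qed
  have i8: "integrable lborel (%x. 8 * \<rho>\<^sup>2 * indicator (ball (0::'a) \<rho>) x)"
    using emeasure_bounded_finite[of "ball (0::'a) \<rho>"] by (simp add: less_top)
  have pw: "AE x in lborel. 1/2 * dissip \<epsilon> s x - 8 * \<rho>\<^sup>2 * indicator (ball (0::'a) \<rho>) x <= - (?G x \<bullet> T x)"
    using av a\<gamma> flow_nn[OF less_imp_le[OF s]]
  proof eventually_elim
    case (elim x)
    have T: "?G x \<bullet> T x = lg' \<epsilon> (?W x) * (?G x \<bullet> ?X x) - ?b x * (lg' \<epsilon> (?W x) * norm (?G x))\<^sup>2"
    proof -
      have "T x = (rc \<epsilon> (?W x) + 1/\<epsilon>) *\<^sub>R ?X x + (?b x * rc' \<epsilon> (?W x)) *\<^sub>R ?G x"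
        by (simp add: T_def elim algebra_simps)
      also have "\<dots> = lg' \<epsilon> (?W x) *\<^sub>R ?X x + (?b x * - (lg' \<epsilon> (?W x))\<^sup>2) *\<^sub>R ?G x"
        using lg_facts(9,10)[OF \<epsilon>] elim by simp
      finally show ?thesis
        by (simp add: inner_add_right inner_diff_right power_mult_distrib power2_norm_eq_inner)
    qed
    show ?case
    proof (cases "x \<in> ball 0 \<rho>")
      case True
      have "1/2 * (?b x * (lg' \<epsilon> (?W x) * norm (?G x))\<^sup>2) - 8 * \<rho>\<^sup>2 <= ?b x * (lg' \<epsilon> (?W x) * norm (?G x))\<^sup>2 - lg' \<epsilon> (?W x) * (?G x \<bullet> ?X x)"
        by (rule log_energy_pointwise[OF bump_bounds(2)[OF \<rho>(1)] bump_nonneg \<rho>(1)]) (use lg_facts(3)[OF \<epsilon>] in \<open>simp add: less_imp_le\<close>)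
      then show ?thesis using True by (simp add: T dissip_def)
    next
      case False
      then have b0: "?b x = 0" using \<rho> by (simp add: bump_eq_0_iff)
      then have "?X x = 0" using bump_bounds(2)[OF \<rho>(1), of 0 x] by simp
      then show ?thesis using False by (simp add: T dissip_def b0)
    qed
  qed
  have "(LBINT x. 1/2 * dissip \<epsilon> s x - 8 * \<rho>\<^sup>2 * indicator (ball (0::'a) \<rho>) x) <= (LBINT x. - (?G x \<bullet> T x))"
    using idis i8 iGT pw by (intro integral_mono_AE) auto
  also have "\<dots> = energy' \<epsilon> s" using \<open>energy' \<epsilon> s = _\<close> by simp
  finally have *: "(LBINT x. 1/2 * dissip \<epsilon> s x - 8 * \<rho>\<^sup>2 * indicator (ball (0::'a) \<rho>) x) <= energy' \<epsilon> s" .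
  have "(LBINT x. 1/2 * dissip \<epsilon> s x - 8 * \<rho>\<^sup>2 * indicator (ball (0::'a) \<rho>) x)
    = 1/2 * (LBINT x. dissip \<epsilon> s x) - offset"
    using idis i8 by (simp add: offset_def)
  with * show "1/2 * (LBINT x. dissip \<epsilon> s x) <= energy' \<epsilon> s + offset" by simp
qed

lemma dissip_nonneg: "0 <= dissip \<epsilon> s x"
  by (simp add: dissip_def bump_nonneg)

lemma energy'_nonneg: "0 < \<epsilon> ==> 0 < s ==> 0 <= energy' \<epsilon> s + offset"
  using dissip_bound(2)[of \<epsilon> s] integral_nonneg_AE[where M = lborel and f = "dissip \<epsilon> s"] dissip_nonneg[of \<epsilon> s] by fastforce

lemma energy_mono:
  assumes \<epsilon>: "0 < \<epsilon>" and "0 < s" "s <= t"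
  shows "energy \<epsilon> s + offset * s <= energy \<epsilon> t + offset * t"
proof (rule DERIV_nonneg_imp_nondecreasing[OF assms(3)])
  fix x assume "s <= x" "x <= t"
  then have x: "0 < x" using assms by simp
  have "((%x. energy \<epsilon> x + offset * x) has_real_derivative energy' \<epsilon> x + offset * 1) (at x)"
    by (intro DERIV_add energy_deriv[OF \<epsilon> x] DERIV_cmult DERIV_ident)
  then show "\<exists>y. ((%a. energy \<epsilon> a + offset * a) has_real_derivative y) (at x) \<and> 0 <= y"
    using energy'_nonneg[OF \<epsilon> x] by auto
qed

text \<open>Where u > 0, ln (u + \<epsilon>) - ln \<epsilon> is at most ln (1/\<epsilon>) + u, and
  where u = 0 it is 0. So up to a term independent of \<epsilon> the energy is at most ln
  (1/\<epsilon>) times the bump mass of the positivity set.\<close>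

lemma energy_bounds:
  assumes \<epsilon>: "0 < \<epsilon>" "\<epsilon> <= 1" and s: "0 <= s"
  shows "0 <= energy \<epsilon> s" "energy \<epsilon> s <= ln (1 / \<epsilon>) * (LBINT x. bmp x * indicator {x. 0 < rep_L2 (flow s w) x} x)
      + norm (cls (bmp)) * norm w"
proof -
  let ?W = "rep_L2 (flow s w)"
  have lgb: "0 <= lg \<epsilon> t" "lg \<epsilon> t <= ln (1/\<epsilon>) * indicator {x. 0 < x} t + t" if "0 <= t" for t
  proof -
    show "0 <= lg \<epsilon> t" using lg_facts(8)[OF \<epsilon>(1) that] that \<epsilon> by simp
    have "ln (t + \<epsilon>) <= (t + \<epsilon>) - 1" using that \<epsilon> by (intro ln_le_minus_one) auto
    then have "lg \<epsilon> t <= ln (1/\<epsilon>) + t" using lg_facts(8)[OF \<epsilon>(1) that] \<epsilon> by (simp add: ln_div)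
    then show "lg \<epsilon> t <= ln (1/\<epsilon>) * indicator {x. 0 < x} t + t"
      using that lg_facts(1)[OF \<epsilon>(1)] by (cases "t = 0") auto
  qed
  show "0 <= energy \<epsilon> s" unfolding energy_def
    by (rule integral_nonneg_AE) (use flow_nn[OF s] in eventually_elim, simp add: lgb(1) bump_nonneg)
  have ibw: "integrable lborel (%x. bmp x * ?W x)"
    using L2_fun_inner[OF bump_sq(1) L2_fun_rep_L2[of "flow s w"]] by simp
  have ib: "integrable lborel (bmp)"
  proof -
    have "integrable lborel (%x. bmp x \<bullet> indicator (ball 0 \<rho>) x)"
      using emeasure_bounded_finite[of "ball (0::'a) \<rho>"]
      by (intro L2_fun_inner bump_sq L2_fun_indicator) auto
    moreover have "bmp x \<bullet> indicator (ball 0 \<rho>) x = bump 0 \<rho> x" for x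
      using bump_eq_0_iff[OF \<rho>(1), of 0 x] by (auto simp: indicator_def)
    ultimately show ?thesis by (simp only:)
  qed
  have ibi: "integrable lborel (%x. bmp x * indicator {x. 0 < ?W x} x)"
    using integrable_mult_indicator[OF _ ib, of "{x. 0 < ?W x}"] by (simp add: mult.commute)
  have "energy \<epsilon> s <= (LBINT x. ln (1/\<epsilon>) * (bmp x * indicator {x. 0 < ?W x} x) + bmp x * ?W x)"
    unfolding energy_def
  proof (rule integral_mono_AE)
    show "AE x in lborel. bump 0 \<rho> x * lg \<epsilon> (?W x) <= ln (1/\<epsilon>) * (bmp x * indicator {x. 0 < ?W x} x) + bmp x * ?W x"
      using flow_nn[OF s]
    proof eventually_elim
      case (elim x)
      have "bump 0 \<rho> x * lg \<epsilon> (?W x) <= bump 0 \<rho> x * (ln (1/\<epsilon>) * indicator {x. 0 < x} (?W x) + ?W x)"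
        by (intro mult_left_mono lgb elim bump_nonneg)
      then show ?case by (simp add: indicator_def algebra_simps)
    qed
  qed (use ibi ibw bump_lg_sq(3)[OF \<epsilon>(1)] in auto)
  also have "\<dots> = ln (1/\<epsilon>) * (LBINT x. bmp x * indicator {x. 0 < ?W x} x) + cls (bmp) \<bullet> flow s w"
    using ibi ibw inner_cls[OF bump_sq(1) L2_fun_rep_L2[of "flow s w"]] by simp
  also have "cls (bmp) \<bullet> flow s w <= norm (cls (bmp)) * norm w"
    using norm_cauchy_schwarz[of "cls (bmp)" "flow s w"] mult_left_mono[OF norm_flow_le[OF s, of w] norm_ge_zero[of "cls (bmp)"]] by linarith
  finally show "energy \<epsilon> s <= ln (1 / \<epsilon>) * (LBINT x. bmp x * indicator {x. 0 < ?W x} x) + norm (cls (bmp)) * norm w"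
    by simp
qed

text \<open>Allows integrating the derivative of the energy over a time interval, so that the total
  dissipation is read off from the increment.\<close>

lemma continuous_on_energy':
  assumes \<epsilon>: "0 < \<epsilon>" and a: "0 < a"
  shows "continuous_on {a..b} (energy' \<epsilon>)"
  unfolding energy'_def[abs_def]
proof (rule continuous_on_inner)
  show "continuous_on {a..b} (%s. flow' s w)"
    using continuous_on_flow'[OF a] by (rule continuous_on_subset) auto
  let ?T = "%z::('a, real) L2. cls (%x. bmp x * lg' \<epsilon> (rep_L2 z x))"
  have "norm (?T z - ?T y) <= (\<rho>^4 / \<epsilon>\<^sup>2) * norm (z - y)" for z y
  proof (rule power2_le_imp_le)
    note d = L2_fun_diff[OF L2_fun_rep_L2[of z] L2_fun_rep_L2[of y]]
    have "(norm (?T z - ?T y))\<^sup>2 = (LBINT x. (norm (bmp x * lg' \<epsilon> (rep_L2 z x) - bmp x * lg' \<epsilon> (rep_L2 y x)))\<^sup>2)"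
      by (rule norm_cls_diff[OF bump_lg_sq(2)[OF \<epsilon>] bump_lg_sq(2)[OF \<epsilon>]])
    also have "\<dots> <= (LBINT x. (\<rho>^4 / \<epsilon>\<^sup>2)\<^sup>2 * (norm (rep_L2 z x - rep_L2 y x))\<^sup>2)"
    proof (rule integral_mono)
      show "integrable lborel (%x. (norm (bmp x * lg' \<epsilon> (rep_L2 z x) - bmp x * lg' \<epsilon> (rep_L2 y x)))\<^sup>2)"
        using L2_fun_diff[OF bump_lg_sq(2)[OF \<epsilon>, of z] bump_lg_sq(2)[OF \<epsilon>, of y]] by (simp add: L2_fun_def)
      show "integrable lborel (%x. (\<rho>^4 / \<epsilon>\<^sup>2)\<^sup>2 * (norm (rep_L2 z x - rep_L2 y x))\<^sup>2)"
        using d by (simp add: L2_fun_def)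
      fix x
      have "\<bar>bmp x\<bar> * \<bar>lg' \<epsilon> (rep_L2 z x) - lg' \<epsilon> (rep_L2 y x)\<bar> <= \<rho>^4 * (1 / \<epsilon>\<^sup>2 * \<bar>rep_L2 z x - rep_L2 y x\<bar>)"
        using bump_abs[of x] lg'_lipschitz[OF \<epsilon>] by (intro mult_mono) auto
      then have "norm (bmp x * lg' \<epsilon> (rep_L2 z x) - bmp x * lg' \<epsilon> (rep_L2 y x)) <= (\<rho>^4 / \<epsilon>\<^sup>2) * norm (rep_L2 z x - rep_L2 y x)"
        by (simp add: abs_mult flip: right_diff_distrib)
      then have "(norm (bmp x * lg' \<epsilon> (rep_L2 z x) - bmp x * lg' \<epsilon> (rep_L2 y x)))\<^sup>2 <= ((\<rho>^4 / \<epsilon>\<^sup>2) * norm (rep_L2 z x - rep_L2 y x))\<^sup>2"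
        by (rule power_mono) simp
      then show "(norm (bmp x * lg' \<epsilon> (rep_L2 z x) - bmp x * lg' \<epsilon> (rep_L2 y x)))\<^sup>2 <= (\<rho>^4 / \<epsilon>\<^sup>2)\<^sup>2 * (norm (rep_L2 z x - rep_L2 y x))\<^sup>2"
        by (simp only: power_mult_distrib)
    qed
    also have "\<dots> = ((\<rho>^4 / \<epsilon>\<^sup>2) * norm (z - y))\<^sup>2"
      unfolding power_mult_distrib
      using norm_cls_diff[OF L2_fun_rep_L2[of z] L2_fun_rep_L2[of y]] by simp
    finally show "(norm (?T z - ?T y))\<^sup>2 <= ((\<rho>^4 / \<epsilon>\<^sup>2) * norm (z - y))\<^sup>2" .
  qed (use \<rho> in simp)
  then have "continuous_on UNIV ?T"
    using \<rho> by (intro lipschitz_on_continuous_on[of "\<rho>^4 / \<epsilon>\<^sup>2"] lipschitz_onI) (auto simp: dist_norm)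
  then show "continuous_on {a..b} (%s. ?T (flow s w))"
    by (rule continuous_on_compose2[where t = UNIV]) (use continuous_on_subset[OF continuous_on_flow[of w], of "{a..b}"] a in auto)
qed

text \<open>Chosen so that \<open>ln (1 / eps n)\<close> is \<open>2 ^ n\<close>: the dissipation
  divided by the square of this number has a time integral of order \<open>(1/2) ^ n\<close>, which
  is summable.\<close>

definition eps :: "nat => real" where "eps n = exp (- (2 ^ n))"

lemma eps: "0 < eps n" "eps n <= 1" "ln (1 / eps n) = 2 ^ n"
  by (simp_all add: eps_def ln_div)

lemma integrable_bump: "integrable lborel (bmp)"
proof -
  have "integrable lborel (%x. bmp x \<bullet> indicator (ball 0 \<rho>) x)"
    using emeasure_bounded_finite[of "ball (0::'a) \<rho>"]
    by (intro L2_fun_inner bump_sq L2_fun_indicator) auto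
  moreover have "bmp x \<bullet> indicator (ball 0 \<rho>) x = bump 0 \<rho> x" for x
    using bump_eq_0_iff[OF \<rho>(1), of 0 x] by (auto simp: indicator_def)
  ultimately show ?thesis by (simp only:)
qed

text \<open>
  The dissipation of the logarithmic energy over a time interval is only of the order of
  \<open>ln (1 / \<epsilon>)\<close>, hence negligible after division by its square.
\<close>

lemma good_time:
  assumes s: "0 < s1" "s1 < s2"
  obtains s where "s1 < s" "s < s2" "(%n. (energy' (eps n) s + offset) / (2 ^ n)\<^sup>2) \<longlonglongrightarrow> 0"
proof -
  define C where "C = (LBINT x. bmp x) + norm (cls (bmp)) * norm w + offset * (s2 - s1)"
  define D where "D n s = (energy' (eps n) s + offset) / (2 ^ n)\<^sup>2" for n s
  have off: "0 <= offset" by (simp add: offset_def)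
  have cont: "continuous_on {s1..s2} (D n)" for n
    unfolding D_def[abs_def] by (intro continuous_intros continuous_on_energy' eps s) simp
  have D0: "0 <= D n s" if "s1 <= s" for n s
    using energy'_nonneg[OF eps(1), of s n] that s by (simp add: D_def)
  have bound: "(\<integral>\<^sup>+s. ennreal (indicator {s1..s2} s * D n s) \<partial>lborel) <= ennreal (C * (1/2) ^ n)" for n
  proof -
    let ?F = "%s. (energy (eps n) s + offset * s) / (2 ^ n)\<^sup>2"
    have hi: "has_bochner_integral lborel (%s. indicator {s1..s2} s *\<^sub>R D n s) (?F s2 - ?F s1)"
    proof (rule has_bochner_integral_FTC_Icc)
      fix x assume "s1 <= x" "x <= s2"
      then have "0 < x" using s by simp
      then have "(?F has_real_derivative (energy' (eps n) x + offset * 1) / (2 ^ n)\<^sup>2) (at x)"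
        by (intro DERIV_cdivide DERIV_add energy_deriv eps DERIV_cmult DERIV_ident)
      then show "(?F has_vector_derivative D n x) (at x within {s1..s2})"
        by (simp add: D_def has_real_derivative_iff_has_vector_derivative has_vector_derivative_at_within)
    qed (use cont s in auto)
    have "(\<integral>\<^sup>+s. ennreal (indicator {s1..s2} s * D n s) \<partial>lborel) = ennreal (LBINT s. indicator {s1..s2} s *\<^sub>R D n s)"
      using nn_integral_eq_integral[of lborel "%s. indicator {s1..s2} s *\<^sub>R D n s"] hi D0
      by (auto simp: has_bochner_integral_iff indicator_def)
    also have "\<dots> = ennreal (?F s2 - ?F s1)" using hi by (simp add: has_bochner_integral_iff)
    also have "\<dots> <= ennreal (C * (1/2) ^ n)"
    proof (rule ennreal_leI)
      have "(LBINT x. bmp x * indicator {x. 0 < rep_L2 (flow s2 w) x} x) <= (LBINT x. bmp x)"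
        using integrable_mult_indicator[OF _ integrable_bump, of "{x. 0 < rep_L2 (flow s2 w) x}"] integrable_bump
        by (intro integral_mono) (auto simp: indicator_def bump_nonneg mult.commute)
      then have "2 ^ n * (LBINT x. bmp x * indicator {x. 0 < rep_L2 (flow s2 w) x} x) <= 2 ^ n * (LBINT x. bmp x)"
        by (rule mult_left_mono) simp
      then have e2: "energy (eps n) s2 <= 2 ^ n * (LBINT x. bmp x) + norm (cls (bmp)) * norm w"
        using energy_bounds(2)[OF eps(1,2), of s2 n] s unfolding eps(3) by linarith
      have e1: "0 <= energy (eps n) s1" using energy_bounds(1)[OF eps(1,2), of s1 n] s by simp
      define N where "N = norm (cls (bmp)) * norm w + offset * (s2 - s1)"
      have "0 <= N" using off s by (simp add: N_def)
      then have "1 * N <= 2 ^ n * N" by (intro mult_right_mono) auto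
      moreover have "2 ^ n * C = 2 ^ n * (LBINT x. bmp x) + 2 ^ n * N"
        by (simp add: C_def N_def distrib_left)
      moreover have "offset * (s2 - s1) = offset * s2 - offset * s1" by (rule right_diff_distrib)
      ultimately have "energy (eps n) s2 + offset * s2 - (energy (eps n) s1 + offset * s1) <= 2 ^ n * C"
        using e1 e2 N_def by linarith
      then have "(energy (eps n) s2 + offset * s2 - (energy (eps n) s1 + offset * s1)) / (2 ^ n)\<^sup>2 <= (2 ^ n * C) / (2 ^ n)\<^sup>2"
        by (rule divide_right_mono) simp
      then show "?F s2 - ?F s1 <= C * (1/2) ^ n"
        unfolding diff_divide_distrib by (simp add: power2_eq_square power_one_over)
    qed
    finally show ?thesis .
  qed
  have C0: "0 <= C" unfolding C_def using off s
    by (intro add_nonneg_nonneg integral_nonneg_AE AE_I2) (auto simp: bump_nonneg)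
  have meas [measurable]: "(%s. indicator {s1..s2} s * D n s) \<in> borel_measurable borel" for n
    using borel_measurable_continuous_on_indicator[OF _ cont[of n]] by simp
  have "(\<integral>\<^sup>+s. (\<Sum>n. ennreal (indicator {s1..s2} s * D n s)) \<partial>lborel) = (\<Sum>n. \<integral>\<^sup>+s. ennreal (indicator {s1..s2} s * D n s) \<partial>lborel)"
    by (rule nn_integral_suminf) measurable
  also have "\<dots> <= (\<Sum>n. ennreal (C * (1/2) ^ n))" by (intro suminf_le bound) auto
  also have "\<dots> = ennreal (\<Sum>n. C * (1/2) ^ n)"
    using C0 by (intro suminf_ennreal2) (auto intro!: summable_mult summable_geometric)
  also have "\<dots> < \<infinity>" by simp
  finally have "AE s in lborel. (\<Sum>n. ennreal (indicator {s1..s2} s * D n s)) \<noteq> \<infinity>"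
    by (intro nn_integral_PInf_AE) auto
  then have "\<exists>s\<in>{s1<..<s2}. (\<Sum>n. ennreal (indicator {s1..s2} s * D n s)) \<noteq> \<infinity>"
  proof (rule contrapos_pp)
    assume "\<not> (\<exists>s\<in>{s1<..<s2}. (\<Sum>n. ennreal (indicator {s1..s2} s * D n s)) \<noteq> \<infinity>)"
    show "\<not> (AE s in lborel. (\<Sum>n. ennreal (indicator {s1..s2} s * D n s)) \<noteq> \<infinity>)"
    proof
      assume "AE s in lborel. (\<Sum>n. ennreal (indicator {s1..s2} s * D n s)) \<noteq> \<infinity>"
      then have "AE s in lborel. s \<notin> {s1<..<s2}"
        by eventually_elim (use \<open>\<not> (\<exists>s\<in>{s1<..<s2}. _ s)\<close> in auto)
      then have "emeasure lborel {s1<..<s2} = 0"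
        by (subst (asm) AE_iff_measurable[of "{s1<..<s2}"]) auto
      then show False using s by simp
    qed
  qed
  \<comment> \<open>The whole series is finite at some interior time, so one and the same time
    serves all \<open>n\<close>, and the terms tend to 0 there.\<close>
  then obtain s where s': "s1 < s" "s < s2" "(\<Sum>n. ennreal (D n s)) \<noteq> \<infinity>" by auto
  have "summable (%n. D n s)"
    using s' D0[of s] by (intro summable_suminf_not_top) auto
  then have "(%n. D n s) \<longlonglongrightarrow> 0" by (rule summable_LIMSEQ_zero)
  then show thesis using s' by (intro that[of s]) (auto simp: D_def)
qed

lemma lg_upper: "0 <= t ==> lg (eps n) t <= 2 ^ n + t" and lg_nonneg: "0 <= t ==> 0 <= lg (eps n) t"
proof -
  assume t: "0 <= t"
  have "ln (t + eps n) <= (t + eps n) - 1" using t eps(1)[of n] by (intro ln_le_minus_one) auto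
  moreover have "ln (eps n) = - (2 ^ n)" by (simp add: eps_def)
  ultimately show "lg (eps n) t <= 2 ^ n + t" using lg_facts(8)[OF eps(1) t, of n] eps(2)[of n] by simp
  show "0 <= lg (eps n) t" using lg_facts(8)[OF eps(1) t, of n] t eps(1)[of n] by simp
qed

text \<open>For positive \<open>t\<close>, \<open>ln (t + eps n)\<close> stays bounded while
  \<open>- ln (eps n)\<close> is exactly \<open>2 ^ n\<close>.\<close>

lemma lg_scaled_lim:
  assumes t: "0 <= t"
  shows "(%n. lg (eps n) t / 2 ^ n) \<longlonglongrightarrow> indicator {x. 0 < x} t"
proof (cases "t = 0")
  case True
  then show ?thesis using lg_facts(1)[OF eps(1)] by simp
next
  case False
  have p: "(%n. (1/2) ^ n) \<longlonglongrightarrow> (0::real)" by (rule LIMSEQ_power_zero) simp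
  have e0: "eps \<longlonglongrightarrow> 0"
  proof (rule tendsto_sandwich[OF _ _ tendsto_const p])
    have "eps n <= (1/2) ^ n" for n
    proof -
      have "2 ^ n <= exp ((2::real) ^ n)" using exp_ge_add_one_self[of "(2::real) ^ n"] by linarith
      then show ?thesis by (simp add: eps_def exp_minus power_one_over inverse_eq_divide frac_le)
    qed
    then show "\<forall>\<^sub>F n in sequentially. eps n <= (1/2) ^ n" by simp
    show "\<forall>\<^sub>F n in sequentially. 0 <= eps n" using eps(1) by (simp add: less_imp_le)
  qed
  have "(%n. ln (t + eps n) * (1/2) ^ n + 1) \<longlonglongrightarrow> ln (t + 0) * 0 + 1"
    by (intro tendsto_intros e0 p) (use t False in auto)
  moreover have "lg (eps n) t / 2 ^ n = ln (t + eps n) * (1/2) ^ n + 1" for n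
    using lg_facts(8)[OF eps(1) t, of n] by (simp add: eps_def power_one_over add_divide_distrib)
  ultimately show ?thesis using t False by simp
qed

text \<open>The functions ln (1 + u/\<epsilon>) / ln (1/\<epsilon>) converge on \<open>K\<close> to
  the indicator of {u > 0}, and at a good time their gradients tend to 0 there in L^2. Poincare's
  inequality becomes |K| |P| <= |P|^2 in the limit: \<open>P\<close> is null or has full
  measure.\<close>

lemma zero_or_full:
  assumes s: "0 < s" and good: "(%n. (energy' (eps n) s + offset) / (2 ^ n)\<^sup>2) \<longlonglongrightarrow> 0"
    and r: "0 < r" "r < \<rho>"
  defines "K \<equiv> ball (0::'a) r"
  defines "P \<equiv> {x \<in> K. 0 < rep_L2 (flow s w) x}"
  shows "measure lborel K * measure lborel P <= (measure lborel P)\<^sup>2"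
proof -
  let ?W = "rep_L2 (flow s w)" and ?G = "rep_L2 (grad_flow s w)"
  have K: "K \<in> sets borel" "convex K" "emeasure lborel K < top"
    unfolding K_def using emeasure_bounded_finite[of "ball (0::'a) r"] by auto
  have Pm [measurable]: "P \<in> sets borel" unfolding P_def using K(1) by measurable
  have diam: "norm (x - y) <= 2 * r" if "x \<in> K" "y \<in> K" for x y
    using that norm_triangle_ineq4[of x y] by (simp add: K_def)
  define c where "c = (2 * r)\<^sup>2 * 2 ^ DIM('a)"
  \<comment> \<open>The bump is at least \<open>c0\<close> on \<open>K\<close>. Here
    \<open>r < \<rho>\<close> matters, because the dissipation carries the bump as a weight.\<close>
  define c0 where "c0 = (\<rho>\<^sup>2 - r\<^sup>2)\<^sup>2"
  have r2: "r\<^sup>2 < \<rho>\<^sup>2" using r by (intro power_strict_mono) auto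
  then have c0: "0 < c0" by (simp add: c0_def)
  have bK: "c0 <= bump 0 \<rho> x" if "x \<in> K" for x
  proof -
    have "x \<bullet> x <= r\<^sup>2" using that r by (simp add: K_def power2_norm_eq_inner[symmetric] power_mono)
    then have "\<rho>\<^sup>2 - r\<^sup>2 <= max 0 (\<rho>\<^sup>2 - (x - 0) \<bullet> (x - 0))" by simp
    then show ?thesis unfolding c0_def bump_def using r2 by (intro power_mono) auto
  qed
  define A where "A n = (LBINT x:K. (lg (eps n) (?W x) / 2 ^ n)\<^sup>2)" for n
  define B where "B n = (LBINT x:K. lg (eps n) (?W x) / 2 ^ n)" for n
  have ineq: "measure lborel K * A n <= (B n)\<^sup>2 + c * measure lborel K * ((2 / c0) * ((energy' (eps n) s + offset) / (2 ^ n)\<^sup>2))" for n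
  proof -
    note e = eps(1)[of n]
    note [measurable] = lg_measurable[OF e]
    let ?D = "%x. lg' (eps n) (?W x) *\<^sub>R ?G x"
    have ch: "(cls (%x. lg (eps n) (?W x)), cls ?D) \<in> form_dom \<Omega>"
      by (rule form_dom_chain[OF flow_in_V[OF s] DERIV_lg[OF e] lg_facts(6)[OF e] lg_facts(4)[OF e] lg_facts(1)[OF e]])
    have sq: "L2_fun (%x. lg (eps n) (?W x))" by (rule bump_lg_sq(1)[OF e])
    have sqD: "L2_fun ?D"
      by (rule L2_fun_bounded_mult[where B = "1 / eps n"]) (use lg_facts(4)[OF e] in auto)
    have cK: "(LBINT x:K. (norm (rep_L2 (cls f) x))\<^sup>2) = (LBINT x:K. (norm (f x))\<^sup>2)" if f: "L2_fun f" for f :: "'a => 'b::euclidean_space"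
    proof -
      have fm: "f \<in> borel_measurable borel" using f by (simp add: L2_fun_def)
      have "AE x in lborel. indicator K x *\<^sub>R (norm (rep_L2 (cls f) x))\<^sup>2 = indicator K x *\<^sub>R (norm (f x))\<^sup>2"
        using rep_L2_cls[OF f] by eventually_elim simp
      then show ?thesis unfolding set_lebesgue_integral_def
        using K(1) fm by (intro integral_cong_AE) auto
    qed
    have iK: "cls (%x. lg (eps n) (?W x)) \<bullet> cls (indicator K) = (LBINT x:K. lg (eps n) (?W x))"
      using inner_cls[OF sq L2_fun_indicator[OF K(1,3)]] by (simp add: set_lebesgue_integral_def mult.commute)
    have G: "(LBINT x:K. (norm (?D x))\<^sup>2) <= (2 / c0) * (energy' (eps n) s + offset)"
    proof -
      have "(LBINT x:K. (norm (?D x))\<^sup>2) <= (LBINT x. (1 / c0) * dissip (eps n) s x)"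
        unfolding set_lebesgue_integral_def
      proof (rule integral_mono)
        show "integrable lborel (%x. indicator K x *\<^sub>R (norm (?D x))\<^sup>2)"
          using sqD K(1) by (intro integrable_mult_indicator) (auto simp: L2_fun_def)
        show "integrable lborel (%x. (1 / c0) * dissip (eps n) s x)" using dissip_bound(1)[OF e s] by simp
        fix x
        show "indicator K x *\<^sub>R (norm (?D x))\<^sup>2 <= (1 / c0) * dissip (eps n) s x"
        proof (cases "x \<in> K")
          case True
          have "c0 * (norm (?D x))\<^sup>2 <= bump 0 \<rho> x * (norm (?D x))\<^sup>2" by (rule mult_right_mono[OF bK[OF True]]) simp
          also have "\<dots> = dissip (eps n) s x" by (simp add: dissip_def power_mult_distrib)
          finally show ?thesis using True c0 by (simp add: field_simps)
        qed (use c0 dissip_nonneg in simp)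
      qed
      also have "\<dots> <= (1 / c0) * (2 * (energy' (eps n) s + offset))"
        using dissip_bound[OF e s] c0 by (simp add: divide_right_mono)
      finally show ?thesis by simp
    qed
    have "measure lborel K * (LBINT x:K. (norm (lg (eps n) (?W x)))\<^sup>2)
      <= (LBINT x:K. lg (eps n) (?W x))\<^sup>2 + c * measure lborel K * (LBINT x:K. (norm (?D x))\<^sup>2)"
      using poincare_form_dom[OF ch K diam] unfolding cK[OF sq] cK[OF sqD] iK c_def .
    also have "\<dots> <= (LBINT x:K. lg (eps n) (?W x))\<^sup>2 + c * measure lborel K * ((2 / c0) * (energy' (eps n) s + offset))"
      by (intro add_left_mono mult_left_mono[OF G]) (simp add: c_def)
    finally have "(measure lborel K * (LBINT x:K. (norm (lg (eps n) (?W x)))\<^sup>2)) / (2 ^ n)\<^sup>2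
      <= ((LBINT x:K. lg (eps n) (?W x))\<^sup>2 + c * measure lborel K * ((2 / c0) * (energy' (eps n) s + offset))) / (2 ^ n)\<^sup>2"
      by (rule divide_right_mono) simp
    moreover have "A n = (LBINT x:K. (norm (lg (eps n) (?W x)))\<^sup>2) / (2 ^ n)\<^sup>2"
      unfolding A_def by (simp add: power_divide)
    moreover have "B n = (LBINT x:K. lg (eps n) (?W x)) / 2 ^ n" unfolding B_def by simp
    moreover have "(X\<^sup>2 + a * ((2 / c0) * E)) / y\<^sup>2 = (X / y)\<^sup>2 + a * ((2 / c0) * (E / y\<^sup>2))" for X a E y :: real
      by (simp only: add_divide_distrib power_divide times_divide_eq_right)
    ultimately show ?thesis by (simp only: times_divide_eq_right)
  qed
  have iKW: "integrable lborel (%x. indicator K x * (2 + 2 * (?W x)\<^sup>2))"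
  proof -
    have "integrable lborel (%x. indicator K x * (?W x)\<^sup>2)"
      using integrable_mult_indicator[OF _ , of K lborel "%x. (?W x)\<^sup>2"] K(1) L2_fun_rep_L2[of "flow s w"]
      by (simp add: L2_fun_def)
    moreover have "integrable lborel (%x. indicator K x :: real)" using K by (simp add: less_top)
    ultimately have "integrable lborel (%x. 2 * (indicator K x * (?W x)\<^sup>2) + 2 * indicator K x)" by simp
    then show ?thesis by (simp add: algebra_simps)
  qed
  have lgm: "(%x. lg (eps n) (?W x)) \<in> borel_measurable borel" for n
    using measurable_compose[OF measurable_rep_L2 lg_measurable(1)[OF eps(1)]] .
  have sc: "0 <= lg (eps n) t / 2 ^ n" "lg (eps n) t / 2 ^ n <= 1 + t" if "0 <= t" for n t
  proof -
    show "0 <= lg (eps n) t / 2 ^ n" using lg_nonneg[OF that] by simp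
    have "lg (eps n) t / 2 ^ n <= (2 ^ n + t) / 2 ^ n" using lg_upper[OF that] by (rule divide_right_mono) simp
    also have "\<dots> <= 1 + t" using that by (simp add: add_divide_distrib divide_le_eq mult_le_cancel_left1)
    finally show "lg (eps n) t / 2 ^ n <= 1 + t" .
  qed
  have sq_le: "(1 + t)\<^sup>2 <= 2 + 2 * t\<^sup>2" "1 + t <= 2 + 2 * t\<^sup>2" for t :: real
  proof -
    have "0 <= (1 - t)\<^sup>2" "0 <= (1 - 2 * t)\<^sup>2" by simp_all
    then have a: "2 * t <= 1 + t\<^sup>2" "4 * t <= 1 + 4 * t\<^sup>2" by (simp_all add: power2_diff power_mult_distrib)
    show "(1 + t)\<^sup>2 <= 2 + 2 * t\<^sup>2" using a by (simp add: power2_sum)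
    show "1 + t <= 2 + 2 * t\<^sup>2" using a zero_le_power2[of t] by linarith
  qed
  have indP: "indicator K x * indicator {x. 0 < x} (?W x) = (indicator P x :: real)" for x
    by (simp add: P_def indicator_def)
  have Plim: "(LBINT x. indicator P x) = measure lborel P" using Pm by simp
  have Alim: "A \<longlonglongrightarrow> measure lborel P"
    unfolding A_def[abs_def] set_lebesgue_integral_def Plim[symmetric]
  proof (rule integral_dominated_convergence[OF _ _ iKW])
    show "AE x in lborel. (%n. indicator K x *\<^sub>R (lg (eps n) (?W x) / 2 ^ n)\<^sup>2) \<longlonglongrightarrow> indicator P x"
      using flow_nn[OF less_imp_le[OF s]]
    proof eventually_elim
      case (elim x)
      have "(%n. indicator K x *\<^sub>R (lg (eps n) (?W x) / 2 ^ n)\<^sup>2) \<longlonglongrightarrow> indicator K x *\<^sub>R (indicator {x. 0 < x} (?W x))\<^sup>2"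
        by (intro tendsto_intros lg_scaled_lim elim)
      moreover have "indicator K x *\<^sub>R (indicator {x. 0 < x} (?W x))\<^sup>2 = (indicator P x :: real)"
        by (simp add: P_def indicator_def)
      ultimately show ?case by simp
    qed
    show "AE x in lborel. norm (indicator K x *\<^sub>R (lg (eps n) (?W x) / 2 ^ n)\<^sup>2) <= indicator K x * (2 + 2 * (?W x)\<^sup>2)" for n
      using flow_nn[OF less_imp_le[OF s]]
    proof eventually_elim
      case (elim x)
      have "(lg (eps n) (?W x) / 2 ^ n)\<^sup>2 <= (1 + ?W x)\<^sup>2" by (intro power_mono sc elim)
      also have "\<dots> <= 2 + 2 * (?W x)\<^sup>2" by (rule sq_le)
      finally show ?case by (simp add: indicator_def)
    qed
    show "(%x. indicator K x *\<^sub>R (lg (eps n) (?W x) / 2 ^ n)\<^sup>2) \<in> borel_measurable lborel" for n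
      using K(1) lgm[of n] by measurable
  qed measurable
  have Blim: "B \<longlonglongrightarrow> measure lborel P"
    unfolding B_def[abs_def] set_lebesgue_integral_def Plim[symmetric]
  proof (rule integral_dominated_convergence[OF _ _ iKW])
    show "AE x in lborel. (%n. indicator K x *\<^sub>R (lg (eps n) (?W x) / 2 ^ n)) \<longlonglongrightarrow> indicator P x"
      using flow_nn[OF less_imp_le[OF s]]
    proof eventually_elim
      case (elim x)
      have "(%n. indicator K x *\<^sub>R (lg (eps n) (?W x) / 2 ^ n)) \<longlonglongrightarrow> indicator K x *\<^sub>R (indicator {x. 0 < x} (?W x))"
        by (intro tendsto_intros lg_scaled_lim elim)
      then show ?case by (simp add: indP)
    qed
    show "AE x in lborel. norm (indicator K x *\<^sub>R (lg (eps n) (?W x) / 2 ^ n)) <= indicator K x * (2 + 2 * (?W x)\<^sup>2)" for n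
      using flow_nn[OF less_imp_le[OF s]]
    proof eventually_elim
      case (elim x)
      then show ?case using order_trans[OF sc(2)[OF elim] sq_le(2)] sc(1)[OF elim]
        by (auto simp: indicator_def simp del: abs_divide)
    qed
    show "(%x. indicator K x *\<^sub>R (lg (eps n) (?W x) / 2 ^ n)) \<in> borel_measurable lborel" for n
      using K(1) lgm[of n] by measurable
  qed measurable
  have "measure lborel K * measure lborel P <= (measure lborel P)\<^sup>2 + c * measure lborel K * ((2 / c0) * 0)"
  proof (rule LIMSEQ_le)
    show "(%n. measure lborel K * A n) \<longlonglongrightarrow> measure lborel K * measure lborel P" by (intro tendsto_intros Alim)
    show "(%n. (B n)\<^sup>2 + c * measure lborel K * ((2 / c0) * ((energy' (eps n) s + offset) / (2 ^ n)\<^sup>2)))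
      \<longlonglongrightarrow> (measure lborel P)\<^sup>2 + c * measure lborel K * ((2 / c0) * 0)"
      by (intro tendsto_intros Blim good)
  qed (use ineq in auto)
  then show ?thesis by simp
qed

text \<open>The limit of the energies divided by ln (1/\<epsilon>): it measures the positivity set,
  with the bump as density.\<close>

definition pos_mass :: "real => real" where
  "pos_mass s = (LBINT x. bmp x * indicator {x. 0 < rep_L2 (flow s w) x} x)"

text \<open>Between the two times the energy loses at most \<open>offset * (t - s)\<close>. After
  division by \<open>2 ^ n\<close> the loss disappears in the limit; the energy tends to the mass at
  \<open>s\<close>, and by \<open>energy_bounds\<close> that at \<open>t\<close> exceeds the mass at
  \<open>t\<close> only by a vanishing term.\<close>

lemma pos_mass_mono:
  assumes s: "0 < s" "s <= t"
  shows "pos_mass s <= pos_mass t"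
proof -
  let ?W = "rep_L2 (flow s w)"
  define M where "M = norm (cls (bmp)) * norm w + offset * (t - s)"
  have "(%n. energy (eps n) s / 2 ^ n) \<longlonglongrightarrow> pos_mass s"
  proof -
    have iw: "integrable lborel (%x. bmp x * (1 + ?W x))"
      using integrable_bump L2_fun_inner[OF bump_sq(1) L2_fun_rep_L2[of "flow s w"]] by (simp add: distrib_left)
    have "(%n. LBINT x. bmp x * (lg (eps n) (?W x) / 2 ^ n)) \<longlonglongrightarrow> (LBINT x. bmp x * indicator {x. 0 < ?W x} x)"
    proof (rule integral_dominated_convergence[OF _ _ iw])
      show "AE x in lborel. (%n. bmp x * (lg (eps n) (?W x) / 2 ^ n)) \<longlonglongrightarrow> bmp x * indicator {x. 0 < ?W x} x"
        using flow_nn[OF less_imp_le[OF s(1)]]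
      proof eventually_elim
        case (elim x)
        have "(%n. bmp x * (lg (eps n) (?W x) / 2 ^ n)) \<longlonglongrightarrow> bmp x * indicator {x. 0 < x} (?W x)"
          by (intro tendsto_intros lg_scaled_lim elim)
        then show ?case by (simp add: indicator_def)
      qed
      show "AE x in lborel. norm (bmp x * (lg (eps n) (?W x) / 2 ^ n)) <= bmp x * (1 + ?W x)" for n
        using flow_nn[OF less_imp_le[OF s(1)]]
      proof eventually_elim
        case (elim x)
        have "lg (eps n) (?W x) / 2 ^ n <= 1 + ?W x"
        proof -
          have "lg (eps n) (?W x) <= 2 ^ n + ?W x" by (rule lg_upper[OF elim])
          also have "\<dots> <= 2 ^ n * (1 + ?W x)"
            using mult_right_mono[of 1 "2 ^ n" "?W x"] elim by (simp add: distrib_left)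
          finally show ?thesis by (simp add: divide_le_eq mult.commute)
        qed
        then have "bmp x * (lg (eps n) (?W x) / 2 ^ n) <= bmp x * (1 + ?W x)"
          by (rule mult_left_mono[OF _ bump_nonneg])
        moreover have "0 <= bmp x * (lg (eps n) (?W x) / 2 ^ n)"
          using bump_nonneg[of 0 \<rho> x] lg_nonneg[OF elim, of n] by simp
        ultimately show ?case by simp
      qed
      show "(%x. bmp x * (lg (eps n) (?W x) / 2 ^ n)) \<in> borel_measurable lborel" for n
        using measurable_compose[OF measurable_rep_L2 lg_measurable(1)[OF eps(1)[of n]], of "flow s w"] by measurable
    qed measurable
    then show ?thesis by (simp add: energy_def pos_mass_def)
  qed
  moreover have "(%n. pos_mass t + M * (1/2) ^ n) \<longlonglongrightarrow> pos_mass t + M * 0"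
    by (intro tendsto_intros LIMSEQ_power_zero) simp
  ultimately have "pos_mass s <= pos_mass t + M * 0"
  proof (rule LIMSEQ_le, intro exI allI impI)
    fix n :: nat
    have "energy (eps n) s <= 2 ^ n * pos_mass t + M"
      using energy_mono[OF eps(1) s, of n] energy_bounds(2)[OF eps(1,2), of t n] s
      unfolding eps(3) pos_mass_def M_def right_diff_distrib by linarith
    then have "energy (eps n) s / 2 ^ n <= (2 ^ n * pos_mass t + M) / 2 ^ n" by (rule divide_right_mono) simp
    then show "energy (eps n) s / 2 ^ n <= pos_mass t + M * (1/2) ^ n"
      by (simp add: add_divide_distrib power_one_over)
  qed
  then show ?thesis by simp
qed

lemma pos_mass_lt:
  assumes "emeasure lborel {x \<in> ball 0 \<rho>. rep_L2 (flow S w) x <= 0} \<noteq> 0"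
  shows "pos_mass S < (LBINT x. bmp x)"
proof (rule ccontr)
  let ?W = "rep_L2 (flow S w)"
  assume less: "\<not> pos_mass S < (LBINT x. bmp x)"
  have i1: "integrable lborel (%x. bmp x * indicator {x. 0 < ?W x} x)"
    using integrable_mult_indicator[OF _ integrable_bump, of "{x. 0 < ?W x}"] by (simp add: mult.commute)
  have i2: "integrable lborel (%x. bmp x * (1 - indicator {x. 0 < ?W x} x))"
    using Bochner_Integration.integrable_diff[OF integrable_bump i1] by (simp add: right_diff_distrib)
  have nn: "0 <= bmp x * (1 - indicator {x. 0 < ?W x} x)" for x
    using bump_nonneg[of 0 \<rho> x] by (simp add: indicator_def)
  have "(LBINT x. bmp x * (1 - indicator {x. 0 < ?W x} x)) = (LBINT x. bmp x) - pos_mass S"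
    unfolding right_diff_distrib pos_mass_def mult_1_right by (rule Bochner_Integration.integral_diff[OF integrable_bump i1])
  then have "(LBINT x. bmp x * (1 - indicator {x. 0 < ?W x} x)) = 0"
    using less Bochner_Integration.integral_nonneg[of lborel "%x. bmp x * (1 - indicator {x. 0 < ?W x} x)", OF nn] by linarith
  then have "AE x in lborel. bmp x * (1 - indicator {x. 0 < ?W x} x) = 0"
    using integral_nonneg_eq_0_iff_AE[OF i2] nn by simp
  then have "AE x in lborel. x \<notin> {x \<in> ball 0 \<rho>. ?W x <= 0}"
  proof eventually_elim
    case (elim x)
    show ?case
    proof
      assume "x \<in> {x \<in> ball 0 \<rho>. ?W x <= 0}"
      then have "bump 0 \<rho> x \<noteq> 0" "indicator {x. 0 < ?W x} x = (0::real)"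
        using bump_eq_0_iff[OF \<rho>(1), of 0 x] by auto
      then show False using elim by simp
    qed
  qed
  moreover have "{x \<in> ball 0 \<rho>. ?W x <= 0} \<in> sets lborel" by measurable
  ultimately have "emeasure lborel {x \<in> ball 0 \<rho>. ?W x <= 0} = 0"
    using AE_iff_measurable[of "{x \<in> ball 0 \<rho>. ?W x <= 0}" lborel "%x. x \<notin> {x \<in> ball 0 \<rho>. ?W x <= 0}"] by auto
  then show False using assms by simp
qed

text \<open>
  Since \<open>pos_mass\<close> is nondecreasing, at all good times the positivity set misses almost all of \<open>K\<close>;
  good times accumulate at \<open>0\<close>.
\<close>

lemma initial_zero_on_smaller_ball:
  assumes S: "0 < S" and r: "0 < r" "r < \<rho>"
    and big: "pos_mass S < (LBINT x. bmp x * indicator (ball 0 r) x)"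
  shows "AE x in lborel. x \<in> ball 0 r --> rep_L2 w x = 0"
proof -
  let ?K = "ball (0::'a) r"
  let ?c = "%z::('a, real) L2. cls (restr ?K (rep_L2 z))"
  have K: "?K \<in> sets borel" "emeasure lborel ?K < top" using emeasure_bounded_finite[of ?K] by auto
  have zero: "?c (flow s w) = 0" if s: "0 < s" "s < S" "(%n. (energy' (eps n) s + offset) / (2 ^ n)\<^sup>2) \<longlonglongrightarrow> 0" for s
  proof -
    let ?W = "rep_L2 (flow s w)"
    let ?P = "{x \<in> ?K. 0 < ?W x}"
    have Pm: "?P \<in> sets lborel" by measurable
    have PK: "?P \<subseteq> ?K" by auto
    have Pf: "emeasure lborel ?P \<noteq> \<infinity>" using emeasure_mono[OF PK, of lborel] K by (auto simp: top_unique)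
    have le: "measure lborel ?K * measure lborel ?P <= (measure lborel ?P)\<^sup>2" by (rule zero_or_full[OF s(1,3) r])
    have "measure lborel ?P < measure lborel ?K"
    proof (rule ccontr)
      assume "\<not> measure lborel ?P < measure lborel ?K"
      then have "measure lborel (?K - ?P) = 0"
        using measure_Diff[of lborel ?K ?P] K Pm PK measure_nonneg[of lborel "?K - ?P"] by (simp add: less_top)
      then have "emeasure lborel (?K - ?P) = 0"
        using emeasure_eq_ennreal_measure[of lborel "?K - ?P"] emeasure_mono[of "?K - ?P" ?K lborel] K by (auto simp: top_unique)
      moreover have "?K - ?P \<in> sets lborel" using Pm K by auto
      ultimately have "AE x in lborel. x \<notin> ?K - ?P" by (intro AE_not_in) (simp add: null_sets_def)
      then have "AE x in lborel. bmp x * indicator ?K x <= bmp x * indicator {x. 0 < ?W x} x"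
        by eventually_elim (use bump_nonneg in \<open>auto simp: indicator_def\<close>)
      then have "(LBINT x. bmp x * indicator ?K x) <= pos_mass s" unfolding pos_mass_def
      proof (rule integral_mono_AE[rotated 2])
        show "integrable lborel (%x. bmp x * indicator ?K x)"
          using integrable_mult_indicator[OF _ integrable_bump, of ?K] by (simp add: mult.commute)
        show "integrable lborel (%x. bmp x * indicator {x. 0 < ?W x} x)"
          using integrable_mult_indicator[OF _ integrable_bump, of "{x. 0 < ?W x}"] by (simp add: mult.commute)
      qed
      then show False using big pos_mass_mono[OF s(1) less_imp_le[OF s(2)]] by simp
    qed
    then have "measure lborel ?P = 0" using le by (cases "measure lborel ?P = 0") (auto simp: power2_eq_square zero_less_measure_iff)
    then have "emeasure lborel ?P = 0" using emeasure_eq_ennreal_measure[of lborel ?P] Pf by simp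
    then have "AE x in lborel. x \<notin> ?P" using Pm by (intro AE_not_in) (simp add: null_sets_def)
    then have "AE x in lborel. restr ?K ?W x = 0"
      using flow_nn[OF less_imp_le[OF s(1)]] by eventually_elim (auto simp: restr_def)
    then have "cls (restr ?K ?W) = cls (%_. 0)"
      by (subst cls_eq_iff[OF supported_iff(2)[OF K(1)] L2_fun_zero])
    then show ?thesis by (simp add: cls_zero)
  qed
  \<comment> \<open>One time in each of a sequence of intervals shrinking to 0; the shift by 2 keeps
    all of them below \<open>S\<close>, so that monotonicity of \<open>pos_mass\<close>
    applies.\<close>
  define good where "good j s \<longleftrightarrow> S / (real j + 3) < s \<and> s < S / (real j + 2)
    \<and> (%n. (energy' (eps n) s + offset) / (2 ^ n)\<^sup>2) \<longlonglongrightarrow> 0" for j s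
  have "\<forall>j. \<exists>s. good j s"
  proof
    fix j
    have "0 < S / (real j + 3)" "S / (real j + 3) < S / (real j + 2)" using S by (simp_all add: divide_strict_left_mono)
    then obtain s where "S / (real j + 3) < s" "s < S / (real j + 2)"
      "(%n. (energy' (eps n) s + offset) / (2 ^ n)\<^sup>2) \<longlonglongrightarrow> 0" by (rule good_time)
    then show "\<exists>s. good j s" unfolding good_def by blast
  qed
  then obtain s where "\<forall>j. good j (s j)" using choice by blast
  then have s: "\<And>j. S / (real j + 3) < s j" "\<And>j. s j < S / (real j + 2)"
    "\<And>j. (%n. (energy' (eps n) (s j) + offset) / (2 ^ n)\<^sup>2) \<longlonglongrightarrow> 0"
    unfolding good_def by blast+
  have s0: "0 < s j" for j using less_trans[OF _ s(1)[of j], of 0] S by simp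
  have sS: "s j < S" for j using less_le_trans[OF s(2)[of j], of S] S by (simp add: divide_le_eq)
  have "s \<longlonglongrightarrow> 0"
  proof (rule tendsto_sandwich[OF _ _ tendsto_const])
    show "(%j. S / (real j + 2)) \<longlonglongrightarrow> 0" by (rule lim_const_over_n_plus_2)
    show "\<forall>\<^sub>F j in sequentially. 0 <= s j" "\<forall>\<^sub>F j in sequentially. s j <= S / (real j + 2)"
      using s0 s(2) by (simp_all add: less_imp_le)
  qed
  then have "(%j. flow (s j) w) \<longlonglongrightarrow> flow 0 w"
    by (intro continuous_on_tendsto_compose[OF continuous_on_flow]) (use s0 in \<open>auto intro!: always_eventually less_imp_le\<close>)
  then have "(%j. ?c (flow (s j) w)) \<longlonglongrightarrow> ?c (flow 0 w)"
    by (intro continuous_on_tendsto_compose[OF continuous_on_cut[OF K(1)]]) auto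
  then have "?c w = 0"
    using zero[OF s0 sS s(3)] flow_0_supported[OF w(1)] by (simp add: LIMSEQ_const_iff)
  then have "cls (restr ?K (rep_L2 w)) = cls (%_. 0)" by (simp add: cls_zero)
  then have "AE x in lborel. restr ?K (rep_L2 w) x = 0"
    by (subst (asm) cls_eq_iff[OF supported_iff(2)[OF K(1)] L2_fun_zero])
  then show ?thesis by eventually_elim (auto simp: restr_def)
qed

text \<open>The alternative of \<open>zero_or_full\<close> is available on balls strictly inside the
  support of the bump. As these exhaust it, the bump mass inside them tends to the total mass, which
  exceeds \<open>pos_mass S\<close> once positivity fails on a set of positive measure.\<close>

lemma initial_zero_on_ball:
  assumes S: "0 < S" and ne: "emeasure lborel {x \<in> ball 0 \<rho>. rep_L2 (flow S w) x <= 0} \<noteq> 0"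
  shows "AE x in lborel. x \<in> ball 0 \<rho> --> rep_L2 w x = 0"
proof -
  define r where "r m = \<rho> * (1 - 1 / (real m + 2))" for m
  have "(%m. LBINT x. bmp x * indicator (ball 0 (r m)) x) \<longlonglongrightarrow> (LBINT x. bmp x)"
  proof (rule integral_dominated_convergence[OF _ _ integrable_bump])
    show "AE x in lborel. (%m. bmp x * indicator (ball 0 (r m)) x) \<longlonglongrightarrow> bump 0 \<rho> x"
    proof (intro AE_I2 tendsto_eventually)
      fix x :: 'a
      show "\<forall>\<^sub>F m in sequentially. bmp x * indicator (ball 0 (r m)) x = bump 0 \<rho> x"
      proof (cases "x \<in> ball 0 \<rho>")
        case True
        show ?thesis using eventually_in_smaller_ball[OF True] by eventually_elim (auto simp: r_def)
      next
        case False
        then show ?thesis using bump_eq_0_iff[OF \<rho>(1), of 0 x] by simp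
      qed
    qed
  qed (use bump_nonneg in \<open>auto simp: indicator_def\<close>)
  then have "\<forall>\<^sub>F m in sequentially. pos_mass S < (LBINT x. bmp x * indicator (ball 0 (r m)) x)"
    using pos_mass_lt[OF ne] by (rule order_tendstoD(1))
  then obtain m0 where m0: "\<And>m. m0 <= m ==> pos_mass S < (LBINT x. bmp x * indicator (ball 0 (r m)) x)"
    by (auto simp: eventually_sequentially)
  have "AE x in lborel. \<forall>m. m0 <= m --> x \<in> ball 0 (r m) --> rep_L2 w x = 0"
  proof (intro AE_all_countable[THEN iffD2] allI)
    fix m
    show "AE x in lborel. m0 <= m --> x \<in> ball 0 (r m) --> rep_L2 w x = 0"
    proof (cases "m0 <= m")
      case True
      show ?thesis using initial_zero_on_smaller_ball[OF S _ _ m0[OF True]] smaller_radius[OF \<rho>(1), of m]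
        by (simp add: r_def)
    qed simp
  qed
  then show ?thesis
  proof eventually_elim
    case (elim x)
    show ?case
    proof
      assume "x \<in> ball 0 \<rho>"
      then have "\<forall>\<^sub>F m in sequentially. m0 <= m \<and> x \<in> ball 0 (r m)"
        unfolding r_def by (intro eventually_conj eventually_ge_at_top eventually_in_smaller_ball)
      then obtain m where "m0 <= m" "x \<in> ball 0 (r m)" using eventually_happens'[OF sequentially_bot] by blast
      then show "rep_L2 w x = 0" using elim by blast
    qed
  qed
qed

end

text \<open>By contraposition: failure of positivity on a set of positive measure in a ball at time
  \<open>s\<close> would force the initial datum to vanish almost everywhere on that ball. This is
  impossible for balls large enough to meet the set where \<open>w\<close> is nonzero, and these
  exhaust the domain.\<close>

theorem flow_pos:
  assumes w: "supported \<Omega> w" "AE x in lborel. 0 <= rep_L2 w x" "w \<noteq> 0" and s: "0 < s"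
  shows "AE x in lborel. x \<in> \<Omega> --> 0 < rep_L2 (flow s w) x"
proof -
  let ?W = "rep_L2 (flow s w)"
  define r where "r m = R * (1 - 1 / (real m + 2))" for m
  have r: "0 < r m" "r m < R" for m using smaller_radius[OF R] by (simp_all add: r_def)
  define N where "N m \<longleftrightarrow> (AE x in lborel. x \<in> ball 0 (r m) --> rep_L2 w x = 0)" for m
  have "\<not> (\<forall>m. N m)"
  proof
    assume "\<forall>m. N m"
    then have "AE x in lborel. \<forall>m. x \<in> ball 0 (r m) --> rep_L2 w x = 0"
      unfolding N_def by (subst AE_all_countable)
    moreover have "AE x in lborel. x \<notin> \<Omega> --> rep_L2 w x = 0" using w(1) by (simp add: supported_def)
    ultimately have "AE x in lborel. rep_L2 w x = 0"
    proof eventually_elim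
      case (elim x)
      show ?case
      proof (cases "x \<in> \<Omega>")
        case True
        then obtain m where "x \<in> ball 0 (r m)"
          using eventually_happens'[OF sequentially_bot eventually_in_smaller_ball[OF True]] unfolding r_def by blast
        then show ?thesis using elim by blast
      qed (use elim in blast)
    qed
    then have "cls (rep_L2 w) = cls (%_. 0)"
      by (subst cls_eq_iff[OF L2_fun_rep_L2 L2_fun_zero])
    then show False using w(3) by (simp add: cls_rep_L2 cls_zero)
  qed
  then obtain m0 where "\<not> N m0" by blast
  have nN: "\<not> N m" if "m0 <= m" for m
  proof
    assume "N m"
    have "r m0 <= r m" unfolding r_def using that R by (intro mult_left_mono diff_left_mono divide_left_mono) auto
    then have "ball (0::'a) (r m0) \<subseteq> ball 0 (r m)" by (rule subset_ball)
    with \<open>N m\<close> have "N m0" unfolding N_def by (auto elim!: eventually_mono simp del: mem_ball)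
    then show False using \<open>\<not> N m0\<close> by simp
  qed
  have pos: "AE x in lborel. m0 <= m --> x \<in> ball 0 (r m) --> 0 < ?W x" for m
  proof (cases "m0 <= m")
    case True
    have "emeasure lborel {x \<in> ball 0 (r m). ?W x <= 0} = 0"
      using initial_zero_on_ball[OF r w(1,2) s] nN[OF True] unfolding N_def by blast
    moreover have "{x \<in> ball 0 (r m). ?W x <= 0} \<in> sets lborel" by measurable
    ultimately have "AE x in lborel. x \<notin> {x \<in> ball 0 (r m). ?W x <= 0}" by (intro AE_not_in) (simp add: null_sets_def)
    then show ?thesis by eventually_elim auto
  qed simp
  then have "AE x in lborel. \<forall>m. m0 <= m --> x \<in> ball 0 (r m) --> 0 < ?W x" by (subst AE_all_countable) blast
  then show ?thesis
  proof eventually_elim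
    case (elim x)
    show ?case
    proof
      assume "x \<in> \<Omega>"
      then have "\<forall>\<^sub>F m in sequentially. m0 <= m \<and> x \<in> ball 0 (r m)"
        unfolding r_def by (intro eventually_conj eventually_ge_at_top eventually_in_smaller_ball)
      then obtain m where "m0 <= m" "x \<in> ball 0 (r m)" using eventually_happens'[OF sequentially_bot] by blast
      then show "0 < ?W x" using elim by blast
    qed
  qed
qed

end

subsection \<open>Schwarz rearrangement\<close>

lemma measure_ball_0:
  "0 <= r ==> measure lborel (ball (0::'a::euclidean_space) r) = unit_ball_vol (real DIM('a)) * r ^ DIM('a)"
  "0 <= r ==> measure lborel (cball (0::'a::euclidean_space) r) = unit_ball_vol (real DIM('a)) * r ^ DIM('a)"
  using content_ball[of r "0::'a"] content_cball[of r "0::'a"] by auto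

lemma measure_ball_le_iff:
  assumes "0 <= r" "0 <= r'"
  shows "measure lborel (ball (0::'a::euclidean_space) r) <= measure lborel (ball (0::'a) r') \<longleftrightarrow> r <= r'"
  using assms unit_ball_vol_pos[of "real DIM('a)"] by (simp add: measure_ball_0 power_mono_iff)

lemma ball_of_measure:
  assumes v: "0 <= v" "v <= measure lborel (ball (0::'a::euclidean_space) R)" and R: "0 < R"
  obtains r where "0 <= r" "r <= R" "measure lborel (ball (0::'a) r) = v"
proof -
  let ?c = "unit_ball_vol (real DIM('a))"
  have c: "0 < ?c" by simp
  define r where "r = root DIM('a) (v / ?c)"
  have r0: "0 <= r" using v c by (simp add: r_def)
  have "r ^ DIM('a) = v / ?c" unfolding r_def using v c by (intro real_root_pow_pos2) auto
  then have m: "measure lborel (ball (0::'a) r) = v" using measure_ball_0(1)[OF r0, where 'a = 'a] c by simp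
  then have "r <= R" using v(2) R r0 measure_ball_le_iff[OF r0, of R, where 'a = 'a] by simp
  then show thesis using that r0 m by blast
qed

text \<open>A nonnegative value is the length of the interval of levels \<open>s\<close> with
  \<open>0 < s\<close> and \<open>s <= g x\<close>; then Fubini. Restricting to positive levels
  makes negative values count as 0, as \<open>ennreal\<close> does.\<close>

lemma nn_layer_cake:
  fixes g :: "'a::euclidean_space => real"
  assumes [measurable]: "g \<in> borel_measurable borel" "E \<in> sets borel"
  shows "(\<integral>\<^sup>+x. ennreal (g x) * indicator E x \<partial>lborel)
    = (\<integral>\<^sup>+s. emeasure lborel (E \<inter> {x. s <= g x}) * indicator {0<..} s \<partial>lborel)"
proof -
  have "(\<integral>\<^sup>+x. ennreal (g x) * indicator E x \<partial>lborel)
    = (\<integral>\<^sup>+x. (\<integral>\<^sup>+s. indicator E x * indicator {0<..} s * indicator {s. s <= g x} s \<partial>lborel) \<partial>lborel)"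
  proof (intro nn_integral_cong)
    fix x
    have "ennreal (g x) = emeasure lborel {0<..g x}" by (cases "0 <= g x") (auto simp: ennreal_neg)
    also have "\<dots> = (\<integral>\<^sup>+s. indicator {0<..g x} s \<partial>lborel)" by simp
    finally have "ennreal (g x) * indicator E x = (\<integral>\<^sup>+s. indicator E x * indicator {0<..g x} s \<partial>lborel)"
      by (simp add: nn_integral_cmult mult.commute)
    also have "\<dots> = (\<integral>\<^sup>+s. indicator E x * indicator {0<..} s * indicator {s. s <= g x} s \<partial>lborel)"
      by (intro nn_integral_cong) (auto simp: indicator_def)
    finally show "ennreal (g x) * indicator E x = \<dots>" .
  qed
  also have "\<dots> = (\<integral>\<^sup>+s. (\<integral>\<^sup>+x. indicator E x * indicator {0<..} s * indicator {s. s <= g x} s \<partial>lborel) \<partial>lborel)"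
    by (rule lborel_pair.Fubini'[symmetric]) measurable
  also have "\<dots> = (\<integral>\<^sup>+s. emeasure lborel (E \<inter> {x. s <= g x}) * indicator {0<..} s \<partial>lborel)"
  proof (intro nn_integral_cong)
    fix s :: real
    have "(\<integral>\<^sup>+x. indicator E x * indicator {0<..} s * indicator {s. s <= g x} s \<partial>lborel)
      = (\<integral>\<^sup>+x. indicator {0<..} s * indicator (E \<inter> {x. s <= g x}) x \<partial>lborel)"
      by (intro nn_integral_cong) (auto simp: indicator_def)
    also have "\<dots> = emeasure lborel (E \<inter> {x. s <= g x}) * indicator {0<..} s"
      by (simp add: nn_integral_cmult mult.commute)
    finally show "(\<integral>\<^sup>+x. indicator E x * indicator {0<..} s * indicator {s. s <= g x} s \<partial>lborel) = \<dots>" .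
  qed
  finally show ?thesis .
qed

lemma is_schwarz_cong:
  assumes "\<And>x. x \<in> ball 0 R ==> g x = g' x"
  shows "schwarz_rearrangement R g = schwarz_rearrangement R g'"
proof -
  have "{x \<in> ball 0 R. g x \<ge> s} = {x \<in> ball 0 R. g' x \<ge> s}" for s using assms by auto
  then show ?thesis by (simp add: schwarz_rearrangement_def is_schwarz_rearrangement_def)
qed

text \<open>Of two sets nested up to a point, the intersection is the smaller one up to a null set.
  The point \<open>z\<close> stands for the origin, where monotonicity of a rearrangement is not
  imposed.\<close>

lemma measure_down_set:
  fixes E :: "'a::euclidean_space set"
  assumes "E \<in> sets borel" "S \<in> sets borel" "E \<subseteq> ball 0 R" "S \<subseteq> ball 0 R" "E \<subseteq> insert z S \<or> S \<subseteq> insert z E"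
  shows "emeasure lborel (E \<inter> S) = ennreal (min (measure lborel E) (measure lborel S))"
proof -
  have fin: "emeasure lborel A \<noteq> \<infinity>" if "A \<subseteq> ball 0 R" for A :: "'a set"
    using emeasure_bounded_finite[OF bounded_subset[OF bounded_ball that]] by simp
  have sub: "emeasure lborel (A \<inter> B) = ennreal (min (measure lborel A) (measure lborel B))"
    if A: "A \<in> sets borel" "A \<subseteq> ball 0 R" and B: "B \<in> sets borel" "B \<subseteq> ball 0 R" and AB: "A \<subseteq> insert z B" for A B :: "'a set"
  proof -
    have "emeasure lborel A <= emeasure lborel ((A \<inter> B) \<union> {z})" using AB A B by (intro emeasure_mono) auto
    also have "\<dots> = emeasure lborel (A \<inter> B)" using A B by (intro emeasure_Un_null_set) auto
    finally have "emeasure lborel A <= emeasure lborel (A \<inter> B)" .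
    moreover have "emeasure lborel (A \<inter> B) <= emeasure lborel A" using A by (intro emeasure_mono) auto
    ultimately have e: "emeasure lborel (A \<inter> B) = emeasure lborel A" by (rule antisym[rotated])
    moreover have "emeasure lborel (A \<inter> B) <= emeasure lborel B" using B by (intro emeasure_mono) auto
    ultimately have "measure lborel A <= measure lborel B"
      using fin[OF B(2)] by (simp add: measure_def enn2real_mono less_top)
    then show ?thesis using e emeasure_eq_ennreal_measure[OF fin[OF A(2), simplified]] by simp
  qed
  show ?thesis using assms sub[of E S] sub[of S E] by (auto simp: Int_commute min.commute)
qed

section \<open>Distribution function, quantile and rearrangement on the ball\<close>

context
  fixes R :: real and g :: "'a::euclidean_space => real"
  assumes R: "0 < R" and g [measurable]: "g \<in> borel_measurable borel"
    and g_int: "set_integrable lborel (ball 0 R) g" and g0: "AE x in lborel. x \<in> ball 0 R --> 0 <= g x"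
begin

definition dfun :: "real => real" where "dfun s = measure lborel {x \<in> ball 0 R. s <= g x}"

lemma finite_sub: "A \<subseteq> ball 0 R ==> emeasure lborel A \<noteq> \<infinity>" for A :: "'a set"
proof -
  assume "A \<subseteq> ball 0 R"
  from emeasure_bounded_finite[OF bounded_subset[OF bounded_ball this]] show ?thesis by simp
qed

lemma finite_level: "emeasure lborel {x \<in> ball (0::'a) R. P x} \<noteq> \<infinity>"
  by (rule finite_sub) auto

lemma measure_sub_mono: "A \<subseteq> B ==> B \<subseteq> ball 0 R ==> A \<in> sets borel ==> B \<in> sets borel ==> measure lborel A <= measure lborel B" for A B :: "'a set"
  using finite_sub[of B] by (intro measure_mono_fmeasurable) (auto simp: fmeasurable_def less_top)

lemma dfun_antimono: "s <= t ==> dfun t <= dfun s"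
  unfolding dfun_def by (rule measure_sub_mono) auto

lemma dfun_0: "dfun 0 = measure lborel (ball (0::'a) R)"
  unfolding dfun_def using g0 by (intro measure_eq_AE) auto

text \<open>The superlevel sets for \<open>s - 1 / (n + 2)\<close> decrease to the one for
  \<open>s\<close>, because it is defined by a weak inequality, and all of them have finite
  measure.\<close>

lemma dfun_left_continuous:
  assumes "\<And>n. v <= dfun (s - 1 / (real n + 2))"
  shows "v <= dfun s"
proof (rule LIMSEQ_le_const)
  let ?A = "%n. {x \<in> ball 0 R. s - 1 / (real n + 2) <= g x}"
  have "(%n. measure lborel (?A n)) \<longlonglongrightarrow> measure lborel (\<Inter>n. ?A n)"
  proof (rule Lim_measure_decseq)
    show "range ?A \<subseteq> sets lborel" by auto
    have "s - 1 / (real m + 2) <= s - 1 / (real n + 2)" if "m <= n" for m n using that by (simp add: frac_le)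
    then show "decseq ?A" unfolding decseq_def by (blast intro: order_trans)
    show "emeasure lborel (?A n) \<noteq> \<infinity>" for n by (rule finite_level)
  qed
  also have "(\<Inter>n. ?A n) = {x \<in> ball 0 R. s <= g x}"
  proof (intro set_eqI iffI)
    fix x assume x: "x \<in> (\<Inter>n. ?A n)"
    have "(%n. s - 1 / (real n + 2)) \<longlonglongrightarrow> s - 0" by (intro tendsto_intros lim_const_over_n_plus_2)
    then have "s - 0 <= g x" by (rule LIMSEQ_le_const2) (use x in auto)
    then show "x \<in> {x \<in> ball 0 R. s <= g x}" using x by auto
  next
    fix x assume "x \<in> {x \<in> ball 0 R. s <= g x}"
    moreover have "0 <= 1 / (real n + 2)" for n by simp
    then have "s - 1 / (real n + 2) <= s" for n by (metis diff_ge_0_iff_ge diff_diff_eq2 add_diff_cancel_left')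
    ultimately show "x \<in> (\<Inter>n. ?A n)" by (blast intro: order_trans)
  qed
  finally show "(%n. dfun (s - 1 / (real n + 2))) \<longlonglongrightarrow> dfun s" by (simp only: dfun_def)
qed (use assms in auto)

lemma dfun_small:
  assumes "0 < v"
  obtains b where "\<And>s. v <= dfun s ==> s < b"
proof -
  let ?A = "%n. {x \<in> ball 0 R. real n <= g x}"
  have "(%n. measure lborel (?A n)) \<longlonglongrightarrow> measure lborel (\<Inter>n. ?A n)"
  proof (rule Lim_measure_decseq)
    show "range ?A \<subseteq> sets lborel" "decseq ?A" by (auto simp: decseq_def)
    show "emeasure lborel (?A n) \<noteq> \<infinity>" for n by (rule finite_level)
  qed
  moreover have "(\<Inter>n. ?A n) = {}"
  proof -
    have "\<exists>n. \<not> real n <= g x" for x using reals_Archimedean2[of "g x"] by (simp add: not_le)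
    then show ?thesis by blast
  qed
  ultimately have "(%n. dfun (real n)) \<longlonglongrightarrow> 0" by (simp add: dfun_def)
  then have "\<forall>\<^sub>F n in sequentially. dfun (real n) < v" using assms by (rule order_tendstoD(2))
  then obtain n where "dfun (real n) < v" using eventually_happens'[OF sequentially_bot] by blast
  then have "s < real n" if "v <= dfun s" for s using that dfun_antimono[of "real n" s] by linarith
  then show thesis by (rule that)
qed

definition quant :: "real => real" where "quant v = Sup {s. 0 <= s \<and> v <= dfun s}"

text \<open>Left continuity of \<open>dfun\<close> makes the supremum attained, so
  \<open>quant\<close> is a generalised inverse in the exact form of a Galois connection. Superlevel
  sets of the rearrangement can then be read off.\<close>

lemma quant:
  assumes v: "0 < v" "v <= measure lborel (ball (0::'a) R)"
  shows "0 <= quant v" "0 <= s ==> s <= quant v \<longleftrightarrow> v <= dfun s"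
proof -
  let ?S = "{s. 0 <= s \<and> v <= dfun s}"
  obtain b where b: "\<And>s. v <= dfun s ==> s < b" using dfun_small[OF v(1)] by blast
  have bdd: "bdd_above ?S" using b by (auto intro!: bdd_aboveI[of _ b] less_imp_le)
  have z: "0 \<in> ?S" using v dfun_0 by simp
  show q0: "0 <= quant v" unfolding quant_def using cSup_upper[OF z bdd] .
  have at: "v <= dfun (quant v)"
  proof (rule dfun_left_continuous)
    fix n
    obtain s where "s \<in> ?S" "quant v - 1 / (real n + 2) < s"
      using less_cSup_iff[OF _ bdd, of "quant v - 1 / (real n + 2)"] z unfolding quant_def[symmetric] by fastforce
    then show "v <= dfun (quant v - 1 / (real n + 2))" using dfun_antimono[of "quant v - 1 / (real n + 2)" s] by auto
  qed
  show "s <= quant v \<longleftrightarrow> v <= dfun s" if "0 <= s"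
  proof
    show "s <= quant v ==> v <= dfun s" using at dfun_antimono[of s "quant v"] by simp
    show "v <= dfun s ==> s <= quant v" unfolding quant_def using that by (intro cSup_upper bdd) auto
  qed
qed

lemma is_schwarz: "is_schwarz_rearrangement R g (schwarz_rearrangement R g)"
proof -
  let ?V = "%x::'a. measure lborel (ball (0::'a) (norm x))"
  \<comment> \<open>The quantile of the volume of the centred ball reaching to \<open>x\<close>. At
    the origin that volume is 0, every level qualifies, and the supremum would be over an unbounded
    set; the value 0 is put instead.\<close>
  define h where "h x = (if x = 0 then 0 else quant (?V x))" for x :: 'a
  have V: "0 < ?V x" "?V x <= measure lborel (ball (0::'a) R)" if "x \<in> ball 0 R - {0}" for x :: 'a
    using that R by (auto simp: measure_ball_le_iff)
  have h: "0 <= h x" "0 <= s ==> s <= h x \<longleftrightarrow> ?V x <= dfun s" if "x \<in> ball 0 R - {0}" for x s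
    using quant(1)[OF V[OF that]] quant(2)[OF V[OF that], of s] that by (auto simp: h_def)
  have "is_schwarz_rearrangement R g h" unfolding is_schwarz_rearrangement_def
  proof (intro conjI ballI allI impI)
    fix x :: 'a assume "x \<in> ball 0 R"
    then show "0 <= h x" using h(1)[of x] by (cases "x = 0") (auto simp: h_def)
  next
    fix x y :: 'a assume xy: "x \<in> ball 0 R - {0}" "y \<in> ball 0 R - {0}" "norm x <= norm y"
    have "?V y <= dfun (h y)" using h(2)[OF xy(2), of "h y"] h(1)[OF xy(2)] by simp
    moreover have "?V x <= ?V y" using xy(3) by (simp add: measure_ball_le_iff)
    ultimately show "h y <= h x" using h(2)[OF xy(1), of "h y"] h(1)[OF xy(2)] by simp
  next
    fix s :: real assume s: "0 <= s"
    obtain r where r: "0 <= r" "r <= R" "measure lborel (ball (0::'a) r) = dfun s"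
      by (rule ball_of_measure[of "dfun s" R]) (use R dfun_antimono[OF s] dfun_0 in \<open>auto simp: dfun_def\<close>)
    have iff: "s <= h x \<longleftrightarrow> norm x <= r" if "x \<in> ball 0 R - {0}" for x
      using h(2)[OF that s] r(1) unfolding r(3)[symmetric] by (simp add: measure_ball_le_iff)
    define Z where "Z = cball (0::'a) r \<inter> ball 0 R"
    have sub: "{x \<in> ball 0 R. s <= h x} - {0} = Z - {0}" using iff by (auto simp: Z_def)
    have Zm: "measure lborel Z = dfun s"
    proof (rule antisym)
      have "measure lborel Z <= measure lborel (cball (0::'a) r)"
        using emeasure_bounded_finite[of "cball (0::'a) r"] by (intro measure_mono_fmeasurable) (auto simp: Z_def fmeasurable_def)
      then show "measure lborel Z <= dfun s" using r(3) measure_ball_0[OF r(1), where 'a = 'a] by simp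
      show "dfun s <= measure lborel Z" unfolding r(3)[symmetric] using r(2) by (intro measure_sub_mono) (auto simp: Z_def)
    qed
    have Zs: "Z \<in> sets borel" by (simp add: Z_def)
    have "{x \<in> ball 0 R. s <= h x} = Z - {0} \<or> {x \<in> ball 0 R. s <= h x} = insert 0 (Z - {0})" using sub by auto
    moreover have "Z - {0} \<in> sets borel" "insert 0 (Z - {0}) \<in> sets borel" using Zs by auto
    ultimately have hs: "{x \<in> ball 0 R. s <= h x} \<in> sets borel" by metis
    have "measure lborel {x \<in> ball 0 R. s <= h x} = measure lborel Z"
    proof (rule measure_eq_AE)
      show "AE x in lborel. x \<in> {x \<in> ball 0 R. s <= h x} \<longleftrightarrow> x \<in> Z"
        using AE_lborel_singleton[of "0::'a"] by eventually_elim (use sub in blast)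
    qed (use hs Zs in simp_all)
    then show "measure lborel {x \<in> ball 0 R. s <= g x} = measure lborel {x \<in> ball 0 R. s <= h x}"
      using Zm by (simp add: dfun_def)
  qed
  then show ?thesis unfolding schwarz_rearrangement_def by (rule someI[of "is_schwarz_rearrangement R g" h])
qed

text \<open>Take all points above the quantile \<open>s0\<close>, and as much of the level set {g =
  s0} as lies in a centred ball of radius \<open>t\<close>. The volume is continuous in
  \<open>t\<close>, so the intermediate value theorem meets the prescribed one even if the level set
  has positive measure. Such a set is comparable with every superlevel set.\<close>

lemma optimal_set:
  assumes r: "0 < r" "r < R"
  obtains E where "E \<in> sets borel" "E \<subseteq> ball 0 R" "measure lborel E = measure lborel (ball (0::'a) r)"
    "\<And>s. E \<subseteq> {x \<in> ball 0 R. s <= g x} \<or> {x \<in> ball 0 R. s <= g x} \<subseteq> E"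
proof -
  let ?V = "measure lborel (ball (0::'a) r)"
  define s0 where "s0 = quant ?V"
  have V: "0 < ?V" "?V <= measure lborel (ball (0::'a) R)" using r by (auto simp: measure_ball_le_iff)
  note q = quant[OF V, folded s0_def]
  define G where "G = {x \<in> ball 0 R. s0 < g x}"
  define E where "E t = G \<union> ({x \<in> ball 0 R. g x = s0} \<inter> cball 0 t)" for t
  have Es [measurable]: "E t \<in> sets borel" for t unfolding E_def G_def by measurable
  have EB: "E t \<subseteq> ball 0 R" for t by (auto simp: E_def G_def)
  let ?A = "%n. {x \<in> ball 0 R. s0 + 1 / (real n + 2) <= g x}"
  have "(%n. measure lborel (?A n)) \<longlonglongrightarrow> measure lborel (\<Union>n. ?A n)"
  proof (rule Lim_measure_incseq)
    have "s0 + 1 / (real n + 2) <= s0 + 1 / (real m + 2)" if "m <= n" for m n using that by (simp add: frac_le)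
    then show "incseq ?A" unfolding incseq_def by (blast intro: order_trans)
    show "range ?A \<subseteq> sets lborel" by auto
    show "emeasure lborel (\<Union>n. ?A n) \<noteq> \<infinity>" by (rule finite_sub) auto
  qed
  also have "(\<Union>n. ?A n) = G"
  proof (intro set_eqI iffI)
    fix x assume "x \<in> (\<Union>n. ?A n)"
    then obtain n where n: "x \<in> ball 0 R" "s0 + 1 / (real n + 2) <= g x" by blast
    have "s0 < s0 + 1 / (real n + 2)" by simp
    then have "s0 < g x" using n(2) by (rule less_le_trans)
    then show "x \<in> G" using n(1) by (simp add: G_def)
  next
    fix x assume x: "x \<in> G"
    have "(%n. s0 + 1 / (real n + 2)) \<longlonglongrightarrow> s0 + 0" by (intro tendsto_intros lim_const_over_n_plus_2)
    then have "\<forall>\<^sub>F n in sequentially. s0 + 1 / (real n + 2) < g x" by (rule order_tendstoD(2)) (use x in \<open>simp add: G_def\<close>)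
    then obtain n where "s0 + 1 / (real n + 2) < g x" using eventually_happens'[OF sequentially_bot] by blast
    then show "x \<in> (\<Union>n. ?A n)" using x by (auto simp: G_def intro!: less_imp_le)
  qed
  finally have "measure lborel G <= ?V"
  proof (rule LIMSEQ_le_const2, intro exI allI impI)
    fix n
    have "0 <= s0 + 1 / (real n + 2)" "\<not> s0 + 1 / (real n + 2) <= s0" using q(1) by auto
    then show "measure lborel (?A n) <= ?V" using q(2)[of "s0 + 1 / (real n + 2)"] unfolding dfun_def by linarith
  qed
  moreover have "measure lborel (E 0) <= measure lborel G"
  proof -
    have "measure lborel (E 0) = measure lborel G"
      using AE_lborel_singleton[of "0::'a"] Es[of 0] by (intro measure_eq_AE) (auto simp: E_def G_def elim!: eventually_mono)
    then show ?thesis by simp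
  qed
  ultimately have low: "measure lborel (E 0) <= ?V" by simp
  have "E R = {x \<in> ball 0 R. s0 <= g x}" by (auto simp: E_def G_def)
  then have high: "?V <= measure lborel (E R)" using q(1) q(2)[of s0] by (simp add: dfun_def)
  have "continuous_on {0..R} (%t. measure lborel (E t))"
  proof -
    let ?c = "%t. measure lborel (cball (0::'a) t)"
    have "continuous_on {0..R} (%t. unit_ball_vol (real DIM('a)) * t ^ DIM('a))" by (intro continuous_intros)
    then have cc: "continuous_on {0..R} ?c" by (rule continuous_on_eq) (simp add: measure_ball_0)
    have inc: "\<bar>measure lborel (E t) - measure lborel (E u)\<bar> <= \<bar>?c t - ?c u\<bar>" if tu: "u <= t" "t \<in> {0..R}" "u \<in> {0..R}" for t u
    proof -
      have fc: "cball (0::'a) t \<in> fmeasurable lborel" "cball (0::'a) u \<in> fmeasurable lborel" by (auto intro: fmeasurable_compact)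
      have sub: "E u \<subseteq> E t" using tu by (auto simp: E_def)
      have fE: "E t \<in> fmeasurable lborel" "E u \<in> fmeasurable lborel"
        using finite_sub[OF EB] by (auto simp: fmeasurable_def less_top)
      have "measure lborel (E t) - measure lborel (E u) = measure lborel (E t - E u)"
        using sub fE by (simp add: measurable_measure_Diff fmeasurableD)
      also have "\<dots> <= measure lborel (cball (0::'a) t - cball 0 u)"
        using fc by (intro measure_mono_fmeasurable) (auto simp: E_def G_def fmeasurable_Diff)
      also have "\<dots> = ?c t - ?c u" using tu fc by (intro measurable_measure_Diff) auto
      finally show ?thesis using measure_sub_mono[OF sub EB] Es by simp
    qed
    show ?thesis unfolding continuous_on_iff
    proof (intro ballI allI impI)
      fix t \<epsilon> :: real assume t: "t \<in> {0..R}" "0 < \<epsilon>"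
      then obtain d where d: "0 < d" "\<And>u. u \<in> {0..R} ==> dist u t < d ==> dist (?c u) (?c t) < \<epsilon>"
        using cc unfolding continuous_on_iff by blast
      have "dist (measure lborel (E u)) (measure lborel (E t)) < \<epsilon>" if u: "u \<in> {0..R}" "dist u t < d" for u
        using d(2)[OF u] inc[of u t] inc[of t u] u t by (cases "u <= t") (auto simp: dist_real_def abs_minus_commute)
      then show "\<exists>d>0. \<forall>u\<in>{0..R}. dist u t < d --> dist (measure lborel (E u)) (measure lborel (E t)) < \<epsilon>"
        using d(1) by blast
    qed
  qed
  from IVT'[OF low high less_imp_le[OF R] this] obtain t where t: "measure lborel (E t) = ?V" by blast
  have "E t \<subseteq> {x \<in> ball 0 R. s <= g x} \<or> {x \<in> ball 0 R. s <= g x} \<subseteq> E t" for s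
    by (cases "s <= s0") (auto simp: E_def G_def)
  with that Es EB t show thesis by blast
qed

text \<open>This holds for whatever rearrangement \<open>SOME\<close> returns. Radial monotonicity
  makes its superlevel sets comparable with \<open>ball 0 r\<close> up to the origin, so each layer
  contributes a minimum of two volumes and only \<open>dfun\<close> remains.\<close>

lemma schwarz_layers:
  assumes r: "0 < r" "r < R"
  shows "(%x. indicator (ball 0 r) x * schwarz_rearrangement R g x) \<in> borel_measurable borel"
    "(\<integral>\<^sup>+x. ennreal (schwarz_rearrangement R g x) * indicator (ball 0 r) x \<partial>lborel)
      = (\<integral>\<^sup>+s. ennreal (min (measure lborel (ball (0::'a) r)) (dfun s)) * indicator {0<..} s \<partial>lborel)"
proof -
  let ?h = "schwarz_rearrangement R g"
  have S: "x \<in> ball 0 R ==> 0 <= ?h x"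
    "x \<in> ball 0 R - {0} ==> y \<in> ball 0 R - {0} ==> norm x <= norm y ==> ?h y <= ?h x"
    "0 <= s ==> dfun s = measure lborel {x \<in> ball 0 R. s <= ?h x}" for x y s
    using is_schwarz unfolding is_schwarz_rearrangement_def dfun_def by blast+
  \<comment> \<open>Measurability is obtained from the radial profile along a fixed unit vector,
    which is monotone on the open interval; the origin is added as a single point.\<close>
  obtain b :: 'a where "b \<in> Basis" using nonempty_Basis by blast
  then have nb: "norm b = 1" "b \<noteq> 0" by auto
  define H where "H t = ?h (t *\<^sub>R b)" for t
  have hH: "?h x = H (norm x)" if "x \<in> ball 0 R - {0}" for x
  proof -
    have "norm x *\<^sub>R b \<in> ball 0 R - {0}" using that nb by simp
    then show ?thesis unfolding H_def using that nb by (intro antisym S(2)) simp_all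
  qed
  have "mono_on {0<..<R} (%t. - H t)"
  proof (rule mono_onI)
    fix t u assume "t \<in> {0<..<R}" "u \<in> {0<..<R}" "t <= u"
    then show "- H t <= - H u" using S(2)[of "t *\<^sub>R b" "u *\<^sub>R b"] nb by (simp add: H_def)
  qed
  from borel_measurable_uminus[OF borel_measurable_mono_on_fnc[OF this]]
  have "H \<in> borel_measurable (restrict_space borel {0<..<R})" by simp
  then have "(%t. indicator {0<..<R} t *\<^sub>R H t) \<in> borel_measurable borel"
    by (subst (asm) borel_measurable_restrict_space_iff) auto
  then have "(%x::'a. indicator {0<..<R} (norm x) *\<^sub>R H (norm x)) \<in> borel_measurable borel"
    by (rule measurable_compose[rotated]) measurable
  then have "(%x::'a. indicator (ball 0 R - {0}) x * (indicator {0<..<R} (norm x) *\<^sub>R H (norm x)) + indicator {0} x * ?h 0) \<in> borel_measurable borel"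
    by (intro borel_measurable_add borel_measurable_times borel_measurable_indicator borel_measurable_const) auto
  also have "(%x::'a. indicator (ball 0 R - {0}) x * (indicator {0<..<R} (norm x) *\<^sub>R H (norm x)) + indicator {0} x * ?h 0)
    = (%x. indicator (ball 0 R) x * ?h x)"
    using hH R by (auto simp: fun_eq_iff indicator_def)
  finally have hm: "(%x. indicator (ball 0 R) x * ?h x) \<in> borel_measurable borel" .
  have rR: "ball (0::'a) r \<subseteq> ball 0 R" using r by (intro subset_ball) auto
  have "(%x. indicator (ball 0 r) x * (indicator (ball 0 R) x * ?h x)) = (%x. indicator (ball 0 r) x * ?h x)"
    using rR by (auto simp: indicator_def fun_eq_iff simp del: mem_ball)
  moreover have "(%x. indicator (ball 0 r) x * (indicator (ball 0 R) x * ?h x)) \<in> borel_measurable borel"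
    by (intro borel_measurable_times borel_measurable_indicator hm) auto
  ultimately show "(%x. indicator (ball 0 r) x * ?h x) \<in> borel_measurable borel" by simp
  have "(\<integral>\<^sup>+x. ennreal (?h x) * indicator (ball 0 r) x \<partial>lborel)
    = (\<integral>\<^sup>+x. ennreal (indicator (ball 0 R) x * ?h x) * indicator (ball 0 r) x \<partial>lborel)"
    using rR by (intro nn_integral_cong) (auto simp: indicator_def simp del: mem_ball)
  also have "\<dots> = (\<integral>\<^sup>+s. emeasure lborel (ball 0 r \<inter> {x. s <= indicator (ball 0 R) x * ?h x}) * indicator {0<..} s \<partial>lborel)"
    by (rule nn_layer_cake[OF hm]) auto
  also have "\<dots> = (\<integral>\<^sup>+s. ennreal (min (measure lborel (ball (0::'a) r)) (dfun s)) * indicator {0<..} s \<partial>lborel)"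
  proof (intro nn_integral_cong)
    fix s :: real
    show "emeasure lborel (ball 0 r \<inter> {x. s <= indicator (ball 0 R) x * ?h x}) * indicator {0<..} s
      = ennreal (min (measure lborel (ball (0::'a) r)) (dfun s)) * indicator {0<..} s"
    proof (cases "0 < s")
      case True
      let ?S = "{x \<in> ball 0 R. s <= ?h x}"
      have e: "{x. s <= indicator (ball 0 R) x * ?h x} = ?S" using True by (auto simp: indicator_def)
      have "{x. s <= indicator (ball 0 R) x * ?h x} \<in> sets borel" using hm unfolding borel_measurable_iff_ge by simp
      then have Sm: "?S \<in> sets borel" by (simp only: e)
      have nest: "ball 0 r \<subseteq> insert 0 ?S \<or> ?S \<subseteq> insert 0 (ball 0 r)"
      proof (cases "\<exists>x\<in>?S. r <= norm x")
        case True
        then obtain x where x: "x \<in> ?S" "r <= norm x" by blast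
        have "y \<in> insert 0 ?S" if "y \<in> ball 0 r" for y
        proof (cases "y = 0")
          case False
          have "y \<in> ball 0 R - {0}" "x \<in> ball 0 R - {0}" using x that rR False r by auto
          moreover have "norm y <= norm x" using x(2) that by simp
          ultimately have "?h x <= ?h y" by (rule S(2))
          then show ?thesis using x(1) \<open>y \<in> ball 0 R - {0}\<close> by simp
        qed simp
        then show ?thesis by blast
      next
        case False
        then show ?thesis by (auto simp: not_le)
      qed
      have "emeasure lborel (ball 0 r \<inter> ?S) = ennreal (min (measure lborel (ball (0::'a) r)) (measure lborel ?S))"
        by (rule measure_down_set[OF _ Sm rR _ nest]) auto
      moreover have "measure lborel ?S = dfun s" using S(3)[of s] True by simp
      ultimately show ?thesis by (simp only: e)
    qed simp
  qed
  finally show "(\<integral>\<^sup>+x. ennreal (?h x) * indicator (ball 0 r) x \<partial>lborel)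
    = (\<integral>\<^sup>+s. ennreal (min (measure lborel (ball (0::'a) r)) (dfun s)) * indicator {0<..} s \<partial>lborel)" .
qed

lemma set_layers:
  assumes E: "E \<in> sets borel" "E \<subseteq> ball 0 R"
  shows "(\<integral>\<^sup>+x. ennreal (g x) * indicator E x \<partial>lborel)
    = (\<integral>\<^sup>+s. emeasure lborel (E \<inter> {x \<in> ball 0 R. s <= g x}) * indicator {0<..} s \<partial>lborel)"
proof -
  have "E \<inter> {x. s <= g x} = E \<inter> {x \<in> ball 0 R. s <= g x}" for s using E by auto
  then show ?thesis using nn_layer_cake[OF g E(1)] by simp
qed

lemma set_integral_nn:
  assumes E: "E \<in> sets borel" "E \<subseteq> ball 0 R"
  shows "ennreal (LBINT x:E. g x) = (\<integral>\<^sup>+x. ennreal (g x) * indicator E x \<partial>lborel)"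
proof -
  have "set_integrable lborel E g" by (rule set_integrable_subset[OF g_int]) (use E in auto)
  then have "ennreal (LBINT x:E. g x) = (\<integral>\<^sup>+x. ennreal (indicator E x *\<^sub>R g x) \<partial>lborel)"
    unfolding set_integrable_def set_lebesgue_integral_def
    using g0 E(2) by (intro nn_integral_eq_integral[symmetric]) (auto elim!: eventually_mono simp: indicator_def)
  also have "\<dots> = (\<integral>\<^sup>+x. ennreal (g x) * indicator E x \<partial>lborel)"
    by (intro nn_integral_cong) (auto simp: indicator_def)
  finally show ?thesis .
qed

text \<open>Layer by layer, the part of \<open>E'\<close> above level \<open>s\<close> has measure
  at most the minimum of the measure of \<open>E'\<close> and \<open>dfun s\<close>, with equality
  for the set of \<open>optimal_set\<close>. The supremum in the second description of the ordering
  is thus attained, which permits testing on one fixed set.\<close>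

lemma schwarz_attained:
  assumes r: "0 < r" "r < R"
  obtains E where "E \<in> sets borel" "E \<subseteq> ball 0 R" "measure lborel E = measure lborel (ball (0::'a) r)"
    "(LBINT x:E. g x) = (LBINT x:ball 0 r. schwarz_rearrangement R g x)"
    "\<And>E'. E' \<in> sets borel ==> E' \<subseteq> ball 0 R ==> measure lborel E' = measure lborel (ball (0::'a) r) ==>
      (LBINT x:E'. g x) <= (LBINT x:ball 0 r. schwarz_rearrangement R g x)"
proof -
  let ?h = "schwarz_rearrangement R g"
  obtain E where E: "E \<in> sets borel" "E \<subseteq> ball 0 R" "measure lborel E = measure lborel (ball (0::'a) r)"
    "\<And>s. E \<subseteq> {x \<in> ball 0 R. s <= g x} \<or> {x \<in> ball 0 R. s <= g x} \<subseteq> E" using optimal_set[OF r] by blast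
  have lvl: "{x \<in> ball 0 R. s <= g x} \<in> sets borel" for s by measurable
  have nn: "0 <= (LBINT x:E'. g x)" if "E' \<subseteq> ball 0 R" for E'
    unfolding set_lebesgue_integral_def using g0 that
    by (intro integral_nonneg_AE) (auto elim!: eventually_mono simp: indicator_def)
  have "emeasure lborel (E \<inter> {x \<in> ball 0 R. s <= g x}) = ennreal (min (measure lborel (ball (0::'a) r)) (dfun s))" for s
  proof -
    have sub: "{x \<in> ball 0 R. s <= g x} \<subseteq> ball 0 R" by auto
    have nest: "E \<subseteq> insert 0 {x \<in> ball 0 R. s <= g x} \<or> {x \<in> ball 0 R. s <= g x} \<subseteq> insert 0 E"
      using E(4)[of s] by blast
    show ?thesis by (simp only: measure_down_set[OF E(1) lvl E(2) sub nest] E(3) dfun_def)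
  qed
  then have eq: "ennreal (LBINT x:E. g x) = (\<integral>\<^sup>+x. ennreal (?h x) * indicator (ball 0 r) x \<partial>lborel)"
    using set_integral_nn[OF E(1,2)] set_layers[OF E(1,2)] schwarz_layers(2)[OF r] by simp
  have hnn: "0 <= indicator (ball 0 r) x * ?h x" for x
    using is_schwarz r unfolding is_schwarz_rearrangement_def by (auto simp: indicator_def)
  have "(LBINT x:ball 0 r. ?h x) = enn2real (\<integral>\<^sup>+x. ennreal (indicator (ball 0 r) x * ?h x) \<partial>lborel)"
    unfolding set_lebesgue_integral_def real_scaleR_def using schwarz_layers(1)[OF r] hnn by (intro integral_eq_nn_integral) auto
  also have "(\<integral>\<^sup>+x. ennreal (indicator (ball 0 r) x * ?h x) \<partial>lborel) = (\<integral>\<^sup>+x. ennreal (?h x) * indicator (ball 0 r) x \<partial>lborel)"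
    by (intro nn_integral_cong) (auto simp: indicator_def)
  also have "enn2real \<dots> = (LBINT x:E. g x)" unfolding eq[symmetric] using nn[OF E(2)] by simp
  finally have att: "(LBINT x:E. g x) = (LBINT x:ball 0 r. ?h x)" by simp
  show thesis
  proof (rule that[OF E(1-3) att])
    fix E' :: "'a set" assume E': "E' \<in> sets borel" "E' \<subseteq> ball 0 R" "measure lborel E' = measure lborel (ball (0::'a) r)"
    have "emeasure lborel (E' \<inter> {x \<in> ball 0 R. s <= g x}) <= ennreal (min (measure lborel (ball (0::'a) r)) (dfun s))" for s
    proof -
      have "E' \<inter> {x \<in> ball 0 R. s <= g x} \<subseteq> ball 0 R" by auto
      then have "emeasure lborel (E' \<inter> {x \<in> ball 0 R. s <= g x}) = ennreal (measure lborel (E' \<inter> {x \<in> ball 0 R. s <= g x}))"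
        using finite_sub by (intro emeasure_eq_ennreal_measure) auto
      also have "\<dots> <= ennreal (min (measure lborel E') (dfun s))" unfolding dfun_def
        using E' lvl by (intro ennreal_leI min.boundedI measure_sub_mono) auto
      finally show ?thesis by (simp add: E'(3))
    qed
    then have "ennreal (LBINT x:E'. g x) <= ennreal (LBINT x:E. g x)"
      unfolding set_integral_nn[OF E'(1,2)] set_layers[OF E'(1,2)] eq schwarz_layers(2)[OF r]
      by (intro nn_integral_mono mult_right_mono) auto
    then show "(LBINT x:E'. g x) <= (LBINT x:ball 0 r. ?h x)" using nn[OF E(2)] att by simp
  qed
qed

end

subsection \<open>Weak solutions on the ball\<close>

lemma L2_on_cong: "(\<And>x. x \<in> S ==> f x = g x) ==> L2_on S f \<longleftrightarrow> L2_on S g"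
proof -
  assume "\<And>x. x \<in> S ==> f x = g x"
  then have "restr S f = restr S g" by (auto simp: restr_def indicator_def fun_eq_iff)
  then show ?thesis by (simp add: L2_on_iff)
qed

lemma integral_inner_cls:
  assumes "L2_on \<Omega> w" "L2_on \<Omega> h"
  shows "(LBINT x:\<Omega>. w x \<bullet> h x) = cls (restr \<Omega> w) \<bullet> cls (restr \<Omega> h)"
proof -
  have "indicator \<Omega> x *\<^sub>R (w x \<bullet> h x) = restr \<Omega> w x \<bullet> restr \<Omega> h x" for x
    by (simp add: restr_def indicator_def)
  then show ?thesis using assms by (simp add: L2_on_iff inner_cls set_lebesgue_integral_def)
qed

lemma section_measurable:
  fixes w :: "real => 'a::euclidean_space => 'b::euclidean_space"
  assumes "(%(t, x). w t x) \<in> borel_measurable borel"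
  shows "w t \<in> borel_measurable borel"
proof -
  have "(%(t, x). w t x) \<in> borel_measurable (borel \<Otimes>\<^sub>M borel)" using assms by (simp only: borel_prod)
  from measurable_compose[OF measurable_Pair1' this, of t] show ?thesis by simp
qed

lemma L2_on_slab:
  fixes w :: "real => 'a::euclidean_space => 'b::euclidean_space"
  assumes w: "(%(t, x). w t x) \<in> borel_measurable borel" and \<Omega> [measurable]: "\<Omega> \<in> sets borel"
    and sq: "\<And>t. t \<in> {0<..<T} ==> L2_on \<Omega> (w t)"
    and bd: "\<And>t. t \<in> {0<..<T} ==> (norm (cls (restr \<Omega> (w t))))\<^sup>2 <= C"
  shows "L2_on ({0<..<T} \<times> \<Omega>) (%(t, x). w t x)"
proof -
  let ?r = "restr ({0<..<T} \<times> \<Omega>) (%(t, x). w t x)"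
  have Q: "{0<..<T} \<times> \<Omega> \<in> sets borel" using \<Omega> by (intro borel_Times) auto
  have rm: "?r \<in> borel_measurable borel" unfolding restr_def using w Q by measurable
  then have rm': "?r \<in> borel_measurable (lborel \<Otimes>\<^sub>M lborel)" by (simp add: lborel_prod)
  have "(\<integral>\<^sup>+z. ennreal ((norm (?r z))\<^sup>2) \<partial>lborel) = (\<integral>\<^sup>+t. (\<integral>\<^sup>+x. ennreal ((norm (?r (t, x)))\<^sup>2) \<partial>lborel) \<partial>lborel)"
    unfolding lborel_prod[symmetric] by (rule lborel.nn_integral_fst[symmetric]) (use rm' in measurable)
  also have "\<dots> <= (\<integral>\<^sup>+t. ennreal C * indicator {0<..<T} t \<partial>lborel)"
  proof (intro nn_integral_mono)
    fix t
    show "(\<integral>\<^sup>+x. ennreal ((norm (?r (t, x)))\<^sup>2) \<partial>lborel) <= ennreal C * indicator {0<..<T} t"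
    proof (cases "t \<in> {0<..<T}")
      case True
      then have "?r (t, x) = restr \<Omega> (w t) x" for x by (simp add: restr_def indicator_def)
      moreover have "(\<integral>\<^sup>+x. ennreal ((norm (restr \<Omega> (w t) x))\<^sup>2) \<partial>lborel) = ennreal ((norm (cls (restr \<Omega> (w t))))\<^sup>2)"
        using sq[OF True] by (simp add: L2_on_iff norm_cls) (simp add: nn_integral_eq_integral L2_fun_def)
      ultimately show ?thesis using bd[OF True] True by (simp add: ennreal_leI)
    next
      case False
      then have "?r (t, x) = 0" for x by (auto simp: restr_def indicator_def)
      then show ?thesis by simp
    qed
  qed
  also have "\<dots> = ennreal C * emeasure lborel {0<..<T}" by (simp add: nn_integral_cmult_indicator)
  also have "\<dots> < \<infinity>" using emeasure_Ioo_finite by (simp add: ennreal_mult_less_top)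
  finally have "integrable lborel (%z. (norm (?r z))\<^sup>2)" using rm by (intro integrableI_nonneg) auto
  then show ?thesis using rm by (simp add: L2_on_iff L2_fun_def)
qed

lemma L2_on_slab_const:
  fixes v :: "'a::euclidean_space => 'b::euclidean_space"
  assumes v: "L2_on \<Omega> v" and \<Omega>: "\<Omega> \<in> sets borel"
  shows "L2_on ({0<..<T} \<times> \<Omega>) (%(t::real, x). v x)"
proof -
  have rr: "restr \<Omega> (restr \<Omega> v) = restr \<Omega> v" by (auto simp: restr_def indicator_def)
  have "restr \<Omega> v \<in> borel_measurable borel" using v by (simp add: L2_on_iff L2_fun_def)
  then have "(%(t::real, x). restr \<Omega> v x) \<in> borel_measurable (borel \<Otimes>\<^sub>M borel)" by measurable
  then have "L2_on ({0<..<T} \<times> \<Omega>) (%(t::real, x). restr \<Omega> v x)"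
    using v rr by (intro L2_on_slab[where C = "(norm (cls (restr \<Omega> v)))\<^sup>2"] \<Omega>) (auto simp: borel_prod L2_on_iff)
  then show ?thesis by (rule L2_on_cong[THEN iffD1, rotated]) (auto simp: restr_def)
qed

lemma slab_fubini:
  fixes w h :: "real => 'a::euclidean_space => 'b::euclidean_space"
  assumes w: "L2_on ({0<..<T} \<times> \<Omega>) (%(t, x). w t x)" and h: "L2_on ({0<..<T} \<times> \<Omega>) (%(t, x). h t x)"
  shows "set_integrable lborel {0<..<T} (%s. LBINT x:\<Omega>. w s x \<bullet> h s x)"
    and "(LBINT (s, x):{0<..<T} \<times> \<Omega>. w s x \<bullet> h s x) = (LBINT s:{0<..<T}. (LBINT x:\<Omega>. w s x \<bullet> h s x))"
    and "set_integrable lborel ({0<..<T} \<times> \<Omega>) (%(s, x). w s x \<bullet> h s x)"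
proof -
  let ?Q = "{0<..<T} \<times> \<Omega>"
  let ?f = "%z. indicator ?Q z *\<^sub>R (case z of (s, x) => w s x \<bullet> h s x)"
  have "?f = (%z. restr ?Q (%(t, x). w t x) z \<bullet> restr ?Q (%(t, x). h t x) z)"
    by (auto simp: restr_def indicator_def fun_eq_iff)
  then have i: "integrable lborel ?f" using L2_fun_inner w h by (simp add: L2_on_iff)
  then show "set_integrable lborel ?Q (%(s, x). w s x \<bullet> h s x)" by (simp add: set_integrable_def)
  have i': "integrable (lborel \<Otimes>\<^sub>M lborel) ?f" using i by (simp only: lborel_prod)
  have f: "(LBINT x. ?f (s, x)) = indicator {0<..<T} s *\<^sub>R (LBINT x:\<Omega>. w s x \<bullet> h s x)" for s
    by (simp add: set_lebesgue_integral_def indicator_times mult.assoc)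
  show "set_integrable lborel {0<..<T} (%s. LBINT x:\<Omega>. w s x \<bullet> h s x)"
    using lborel_pair.integrable_fst'[OF i'] unfolding f by (simp only: set_integrable_def)
  show "(LBINT (s, x):?Q. w s x \<bullet> h s x) = (LBINT s:{0<..<T}. (LBINT x:\<Omega>. w s x \<bullet> h s x))"
    using lborel_pair.integral_fst'[OF i'] unfolding f by (simp only: set_lebesgue_integral_def lborel_prod)
qed

lemma cls_restr_supported:
  assumes \<Omega>: "\<Omega> \<in> sets borel" and f: "L2_fun f" and s: "supported \<Omega> (cls f)"
  shows "L2_fun (restr \<Omega> f)" "cls (restr \<Omega> f) = cls f"
proof -
  show r: "L2_fun (restr \<Omega> f)"
    unfolding restr_def by (rule L2_fun_bounded_mult[where B = 1, OF f]) (use \<Omega> in \<open>auto simp: indicator_def\<close>)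
  have "AE x in lborel. restr \<Omega> f x = f x"
    using rep_L2_cls[OF f] s[unfolded supported_def] by eventually_elim (auto simp: restr_def indicator_def)
  then show "cls (restr \<Omega> f) = cls f" by (subst cls_eq_iff[OF r f])
qed

lemma cls_sum_rep:
  "L2_fun (%x. \<Sum>k<n. a k *\<^sub>R rep_L2 (b k) x)"
  "cls (%x. \<Sum>k<n. a k *\<^sub>R rep_L2 (b k) x) = (\<Sum>k<(n::nat). a k *\<^sub>R b k)"
proof (induction n)
  case (Suc n)
  { case 1 then show ?case by (simp add: L2_fun_add L2_fun_scaleR Suc) }
  { case 2 then show ?case
      by (simp add: cls_add[symmetric] L2_fun_scaleR Suc cls_scaleR[symmetric]) }
qed (simp_all add: L2_fun_zero cls_zero)

text \<open>A curve in \<open>L2\<close> is a family of classes, while integrals over the slab call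
  for one jointly measurable function representing it at every time. The partial sums are such
  functions. As \<open>\<delta>\<close> does not depend on \<open>t\<close>, a single subsequence
  converges fast at all times simultaneously, and its pointwise \<open>lim\<close> is the
  representative.\<close>

lemma spectral_representative:
  fixes b :: "nat => ('a::euclidean_space, 'b::euclidean_space) L2"
  assumes \<Omega>: "\<Omega> \<in> sets borel"
    and c: "\<And>k. (%t. indicator A t * c k t) \<in> borel_measurable borel"
    and bd: "\<And>t n. t \<in> A ==> (norm (X t - (\<Sum>k<n. c k t *\<^sub>R b k)))\<^sup>2 <= \<delta> n" and \<delta>: "\<delta> \<longlonglongrightarrow> 0"
    and supp: "\<And>t. t \<in> A ==> supported \<Omega> (X t)"
  obtains w where "(%(t::real, x). w t x) \<in> borel_measurable borel"
    "\<And>t. t \<in> A ==> L2_on \<Omega> (w t)" "\<And>t. t \<in> A ==> cls (restr \<Omega> (w t)) = X t"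
proof -
  define W where "W n t x = (\<Sum>k<n. (indicator A t * c k t) *\<^sub>R rep_L2 (b k) x)" for n t x
  have sq: "L2_fun (W n t)" for n t unfolding W_def[abs_def] by (rule cls_sum_rep)
  have cl: "cls (W n t) = (\<Sum>k<n. c k t *\<^sub>R b k)" if "t \<in> A" for n t
    unfolding W_def[abs_def] cls_sum_rep(2) using that by simp
  \<comment> \<open>One quarter, because the squared distance of consecutive terms is at most twice
    the sum of their squared distances from the limit, and \<open>fast_L2_convergence\<close> asks
    for \<open>(1/16) ^ n\<close>.\<close>
  have "\<forall>n. \<exists>m. \<delta> m < (1/4) * (1/16) ^ n"
  proof
    fix n
    have "\<forall>\<^sub>F m in sequentially. \<delta> m < (1/4) * (1/16) ^ n" by (rule order_tendstoD(2)[OF \<delta>]) simp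
    then show "\<exists>m. \<delta> m < (1/4) * (1/16) ^ n" using eventually_happens'[OF sequentially_bot] by blast
  qed
  from choice[OF this] obtain r where "\<forall>n. \<delta> (r n) < (1/4) * (1/16) ^ n" by blast
  then have r: "\<delta> (r n) <= (1/4) * (1/16) ^ n" for n by (simp add: less_imp_le)
  have near: "(norm (cls (W (r n) t) - X t))\<^sup>2 <= (1/4) * (1/16) ^ n" if "t \<in> A" for n t
    using bd[OF that, of "r n"] r[of n] by (simp add: cl[OF that] norm_minus_commute)
  have fast: "(norm (cls (W (r (Suc n)) t) - cls (W (r n) t)))\<^sup>2 <= (1/16) ^ n" if t: "t \<in> A" for n t
  proof -
    let ?p = "norm (cls (W (r (Suc n)) t) - X t)" and ?q = "norm (cls (W (r n) t) - X t)"
    have "(norm (cls (W (r (Suc n)) t) - cls (W (r n) t)))\<^sup>2 <= (?p + ?q)\<^sup>2"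
      using norm_triangle_ineq4[of "cls (W (r (Suc n)) t) - X t" "cls (W (r n) t) - X t"] by (intro power_mono) auto
    also have "\<dots> <= 2 * ?p\<^sup>2 + 2 * ?q\<^sup>2" using sum_squares_bound[of ?p ?q] by (simp add: power2_sum)
    also have "\<dots> <= 2 * ((1/4) * (1/16) ^ n) + 2 * ((1/4) * (1/16) ^ n)"
    proof (intro add_mono mult_left_mono)
      have "(1/4) * (1/16) ^ Suc n <= (1/4) * (1/16::real) ^ n" by simp
      with near[OF t, of "Suc n"] show "?p\<^sup>2 <= (1/4) * (1/16) ^ n" by (rule order_trans)
    qed (use near[OF t, of n] in simp_all)
    finally show ?thesis by simp
  qed
  define w where "w t x = lim (%n. W (r n) t x)" for t x
  have wX: "L2_fun (w t)" "cls (w t) = X t" if t: "t \<in> A" for t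
  proof -
    note F = fast_L2_convergence[of "%n. W (r n) t", OF sq fast[OF t]]
    show "L2_fun (w t)" unfolding w_def[abs_def] by (rule F(1))
    have "(%n. (norm (cls (W (r n) t) - X t))\<^sup>2) \<longlonglongrightarrow> 0"
    proof (rule tendsto_sandwich[OF _ _ tendsto_const])
      have "(%n. (1/4) * (1/16) ^ n) \<longlonglongrightarrow> (1/4) * (0::real)" by (intro tendsto_intros LIMSEQ_power_zero) simp
      then show "(%n. (1/4) * (1/16) ^ n) \<longlonglongrightarrow> (0::real)" by simp
    qed (use near[OF t] in auto)
    then have "(%n. sqrt ((norm (cls (W (r n) t) - X t))\<^sup>2)) \<longlonglongrightarrow> sqrt 0" by (intro tendsto_intros)
    then have "(%n. cls (W (r n) t)) \<longlonglongrightarrow> X t" by (simp add: tendsto_norm_zero_iff LIM_zero_iff)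
    from LIMSEQ_unique[OF F(2) this] show "cls (w t) = X t" unfolding w_def[abs_def] .
  qed
  have wm: "(%(t, x). w t x) \<in> borel_measurable (borel \<Otimes>\<^sub>M borel)"
  proof -
    have "(%z. W n (fst z) (snd z)) \<in> borel_measurable (borel \<Otimes>\<^sub>M borel)" for n
      unfolding W_def
    proof (intro borel_measurable_sum borel_measurable_scaleR)
      show "(%z. indicator A (fst z) * c k (fst z)) \<in> borel_measurable (borel \<Otimes>\<^sub>M borel)" for k
        by (rule measurable_compose[OF measurable_fst c])
      show "(%z. rep_L2 (b k) (snd z)) \<in> borel_measurable (borel \<Otimes>\<^sub>M borel)" for k
        by (rule measurable_compose[OF measurable_snd measurable_rep_L2])
    qed
    from borel_measurable_lim_metric[of "%n z. W (r n) (fst z) (snd z)", OF this] show ?thesis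
      unfolding w_def by (simp add: case_prod_beta')
  qed
  show thesis
  proof (rule that[of w])
    show "(%(t, x). w t x) \<in> borel_measurable borel" using wm by (simp only: borel_prod)
    fix t assume t: "t \<in> A"
    note cr = cls_restr_supported[OF \<Omega> wX(1)[OF t], unfolded wX(2)[OF t], OF supp[OF t]]
    show "L2_on \<Omega> (w t)" "cls (restr \<Omega> (w t)) = X t" using cr by (simp_all add: L2_on_iff)
  qed
qed

section \<open>Existence of the weak solution and its uniqueness at the final time\<close>

locale ball_source = ball_heat R e g l
  for R :: real and e :: "nat => ('a::euclidean_space, real) L2" and g :: "nat => ('a, 'a) L2" and l :: "nat => real" +
  fixes T :: real and f :: "real \<times> 'a => real"
  assumes T: "0 < T" and f_meas: "set_borel_measurable lborel ({0<..<T} \<times> ball 0 R) f"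
    and f_bd: "AE z\<in>{0<..<T} \<times> ball 0 R in lborel. 0 <= f z \<and> f z <= 1"
begin

text \<open>Truncation makes \<open>f\<close> Borel and bounded everywhere, so that all its time sections are usable.\<close>

definition F :: "real => 'a => real" where
  "F s x = indicator ({0<..<T} \<times> \<Omega>) (s, x) * max 0 (min 1 (indicator ({0<..<T} \<times> \<Omega>) (s, x) *\<^sub>R f (s, x)))"

definition L :: "real => ('a, real) L2" where "L s = cls (F s)"

lemma \<Omega>_fin: "emeasure lborel \<Omega> < top" using emeasure_bounded_finite[of \<Omega>] by simp

lemma Q_sets: "{0<..<t::real} \<times> \<Omega> \<in> sets borel" by (intro borel_Times) auto

lemma F_meas: "(%(s, x). F s x) \<in> borel_measurable borel"
proof -
  have [measurable]: "(%z. indicator ({0<..<T} \<times> \<Omega>) z *\<^sub>R f z) \<in> borel_measurable borel"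
    using f_meas by (simp add: set_borel_measurable_def)
  have [measurable]: "{0<..<T} \<times> \<Omega> \<in> sets borel" by (rule Q_sets)
  have "(%z. indicator ({0<..<T} \<times> \<Omega>) z * max 0 (min 1 (indicator ({0<..<T} \<times> \<Omega>) z *\<^sub>R f z))) \<in> borel_measurable borel"
    by measurable
  then show ?thesis by (simp add: F_def case_prod_beta')
qed

lemma F_bd: "0 <= F s x" "F s x <= indicator \<Omega> x" by (auto simp: F_def indicator_def)

lemma F_AE: "AE z\<in>{0<..<T} \<times> \<Omega> in lborel. F (fst z) (snd z) = f z"
  using f_bd by eventually_elim (auto simp: F_def)

lemma F_sq: "L2_fun (F s)" "restr \<Omega> (F s) = F s" "L2_on \<Omega> (F s)" "(norm (L s))\<^sup>2 <= measure lborel \<Omega>"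
proof -
  have m: "F s \<in> borel_measurable borel" by (rule section_measurable[OF F_meas])
  have i: "L2_fun (indicator \<Omega> :: 'a => real)" using \<Omega>_fin by (intro L2_fun_indicator) auto
  show sq: "L2_fun (F s)" by (rule L2_fun_bound[OF i]) (use m F_bd in auto)
  show r: "restr \<Omega> (F s) = F s" by (auto simp: restr_def F_def fun_eq_iff indicator_def)
  show "L2_on \<Omega> (F s)" using sq r by (simp add: L2_on_iff)
  have "(norm (L s))\<^sup>2 = (LBINT x. (norm (F s x))\<^sup>2)" unfolding L_def by (rule norm_cls[OF sq])
  also have "\<dots> <= (LBINT x. indicator \<Omega> x)"
  proof (rule integral_mono)
    show "integrable lborel (%x. (norm (F s x))\<^sup>2)" using sq by (simp add: L2_fun_def)
    show "integrable lborel (indicator \<Omega> :: 'a => real)" using \<Omega>_fin by (simp add: less_top)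
    show "(norm (F s x))\<^sup>2 <= indicator \<Omega> x" for x
      using F_bd[of s x] by (cases "x \<in> \<Omega>") (auto simp: abs_square_le_1 indicator_def)
  qed
  finally show "(norm (L s))\<^sup>2 <= measure lborel \<Omega>" by simp
qed

sublocale heat_source "form_dom (ball 0 R)" e g l L "sqrt (measure lborel \<Omega>)" T
proof
  show "(%s. L s \<bullet> v) \<in> borel_measurable borel" for v
  proof -
    have "L s \<bullet> v = (LBINT x. F s x * rep_L2 v x)" for s
      using inner_cls[OF F_sq(1) L2_fun_rep_L2[of v], of s] by (simp add: L_def)
    moreover have "(%s. LBINT x. F s x * rep_L2 v x) \<in> borel_measurable borel"
    proof (rule lborel.borel_measurable_lebesgue_integral)
      have "(%(s, x). F s x) \<in> borel_measurable (borel \<Otimes>\<^sub>M lborel)"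
        using F_meas by (simp add: borel_prod[symmetric] measurable_cong_sets[OF sets_pair_measure_cong[OF refl sets_lborel] refl])
      moreover have "(%z. rep_L2 v (snd z)) \<in> borel_measurable (borel \<Otimes>\<^sub>M lborel)"
        by (rule measurable_compose[OF measurable_snd]) simp
      ultimately have "(%z. (%(s, x). F s x) z * rep_L2 v (snd z)) \<in> borel_measurable (borel \<Otimes>\<^sub>M lborel)"
        by (rule borel_measurable_times)
      then show "(%(s, x). F s x * rep_L2 v x) \<in> borel_measurable (borel \<Otimes>\<^sub>M lborel)" by (simp add: case_prod_beta')
    qed
    ultimately show ?thesis by simp
  qed
  show "norm (L s) <= sqrt (measure lborel \<Omega>)" for s using F_sq(4) by (rule real_le_rsqrt)
qed (use T in simp)

lemma F_slab: "t <= T ==> L2_on ({0<..<t} \<times> \<Omega>) (%(s, x). F s x)"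
  by (rule L2_on_slab[OF F_meas, where C = "measure lborel \<Omega>"]) (use F_sq in \<open>auto simp: L_def\<close>)

text \<open>The bounds on \<open>f\<close> hold almost everywhere on the slab, which says nothing
  about a given time section. So \<open>f\<close> is exchanged for its truncation before Fubini is
  applied.\<close>

lemma source_integral:
  assumes h: "L2_on ({0<..<t} \<times> \<Omega>) (%(s, x). h s x)" and t: "t <= T"
  shows "(LBINT (s, x):{0<..<t} \<times> \<Omega>. f (s, x) * h s x) = (LBINT s:{0<..<t}. (LBINT x:\<Omega>. F s x \<bullet> h s x))"
proof -
  let ?Q = "{0<..<t} \<times> \<Omega>"
  have hm: "restr ?Q (%(s, x). h s x) \<in> borel_measurable borel" using h by (simp add: L2_on_iff L2_fun_def)
  have fm: "(%z. indicator ({0<..<T} \<times> \<Omega>) z *\<^sub>R f z) \<in> borel_measurable borel"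
    using f_meas by (simp add: set_borel_measurable_def)
  have m1: "(%z. indicator ?Q z *\<^sub>R (case z of (s, x) => f (s, x) * h s x)) \<in> borel_measurable lborel"
  proof -
    have "(%z. indicator ?Q z *\<^sub>R (case z of (s, x) => f (s, x) * h s x))
      = (%z. (indicator ({0<..<T} \<times> \<Omega>) z *\<^sub>R f z) * restr ?Q (%(s, x). h s x) z)"
      using t by (auto simp: restr_def indicator_def fun_eq_iff)
    then show ?thesis using borel_measurable_times[OF fm hm] by simp
  qed
  have m2: "(%z. indicator ?Q z *\<^sub>R (case z of (s, x) => F s x \<bullet> h s x)) \<in> borel_measurable lborel"
    using slab_fubini(3)[OF F_slab[OF t] h] by (auto simp: set_integrable_def dest: borel_measurable_integrable)
  have "AE z in lborel. indicator ?Q z *\<^sub>R (case z of (s, x) => f (s, x) * h s x) = indicator ?Q z *\<^sub>R (case z of (s, x) => F s x \<bullet> h s x)"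
    using F_AE by eventually_elim (use t in \<open>auto simp: indicator_def\<close>)
  from integral_cong_AE[OF m1 m2 this] show ?thesis
    using slab_fubini(2)[OF F_slab[OF t] h] by (simp only: set_lebesgue_integral_def)
qed

lemma source_pairing:
  assumes v: "L2_on \<Omega> v" and t: "t <= T"
  shows "(LBINT (s, x):{0<..<t} \<times> \<Omega>. f (s, x) * v x) = (LBINT s:{0<..<t}. L s \<bullet> cls (restr \<Omega> v))"
  using source_integral[OF L2_on_slab_const[OF v] t] integral_inner_cls[OF F_sq(3) v] by (simp add: F_sq(2) L_def)

text \<open>Jointly measurable representatives of the two components of \<open>sol\<close> serve as
  solution and gradient. Fubini turns the integrals over the slab into time integrals of inner
  products, for which \<open>sol_equation\<close> holds.\<close>

lemma heat_solution_exists: "\<exists>u. is_heat_solution \<Omega> T f u"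
proof -
  have \<Omega>: "\<Omega> \<in> sets borel" by simp
  have cm: "(%t. indicator {0..T} t * coef k t) \<in> borel_measurable borel" for k
    using borel_measurable_continuous_on_indicator[OF _ coef_cont[of k]] by simp
  have inV: "(fst (sol t), snd (sol t)) \<in> form_dom \<Omega>" if "t \<in> {0..T}" for t using sol_in_V that by simp
  have d: "(norm (fst (sol t) - (\<Sum>k<n. coef k t *\<^sub>R e k)))\<^sup>2 <= tail n"
    "(norm (snd (sol t) - (\<Sum>k<n. coef k t *\<^sub>R g k)))\<^sup>2 <= tail n" if t: "t \<in> {0..T}" for t n
  proof -
    have p: "fst (part n t) = (\<Sum>k<n. coef k t *\<^sub>R e k)" "snd (part n t) = (\<Sum>k<n. coef k t *\<^sub>R g k)"
      by (simp_all add: part_def fst_sum snd_sum)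
    have q: "(norm (sol t - part n t))\<^sup>2 <= tail n" using part_sol t by simp
    have "norm (fst z) <= norm z" "norm (snd z) <= norm z" for z :: "('a, real) L2 \<times> ('a, 'a) L2"
      by (cases z, simp add: norm_fst_le norm_snd_le)+
    from this[of "sol t - part n t"] have "norm (fst (sol t - part n t)) <= norm (sol t - part n t)"
      "norm (snd (sol t - part n t)) <= norm (sol t - part n t)" .
    then show "(norm (fst (sol t) - (\<Sum>k<n. coef k t *\<^sub>R e k)))\<^sup>2 <= tail n"
      "(norm (snd (sol t) - (\<Sum>k<n. coef k t *\<^sub>R g k)))\<^sup>2 <= tail n"
      using q order_trans[OF power_mono[of _ _ 2] q] by (simp_all add: p)
  qed
  obtain u where u: "(%(t, x). u t x) \<in> borel_measurable borel"
    "\<And>t. t \<in> {0..T} ==> L2_on \<Omega> (u t)" "\<And>t. t \<in> {0..T} ==> cls (restr \<Omega> (u t)) = fst (sol t)"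
    using spectral_representative[of \<Omega> "{0..T}" coef "%t. fst (sol t)" e tail, OF \<Omega> cm d(1) tail_lim
      form_dom_supported(1)[OF \<Omega> inV]] by blast
  obtain G where G: "(%(t, x). G t x) \<in> borel_measurable borel"
    "\<And>t. t \<in> {0..T} ==> L2_on \<Omega> (G t)" "\<And>t. t \<in> {0..T} ==> cls (restr \<Omega> (G t)) = snd (sol t)"
    using spectral_representative[of \<Omega> "{0..T}" coef "%t. snd (sol t)" g tail, OF \<Omega> cm d(2) tail_lim
      form_dom_supported(2)[OF \<Omega> inV]] by blast
  have bd: "(norm (fst (sol t)))\<^sup>2 <= (\<Sum>k. coef_bd k)" "(norm (snd (sol t)))\<^sup>2 <= (\<Sum>k. coef_bd k)" if "t \<in> {0..T}" for t
  proof -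
    have "(norm (fst (sol t)))\<^sup>2 + (norm (snd (sol t)))\<^sup>2 <= (\<Sum>k. coef_bd k)"
      using sol_bd[of t] that by (simp add: norm_prod_def)
    then show "(norm (fst (sol t)))\<^sup>2 <= (\<Sum>k. coef_bd k)" "(norm (snd (sol t)))\<^sup>2 <= (\<Sum>k. coef_bd k)"
      using zero_le_power2[of "norm (fst (sol t))"] zero_le_power2[of "norm (snd (sol t))"] by linarith+
  qed
  have slab: "L2_on ({0<..<t} \<times> \<Omega>) (%(t, x). u t x)" "L2_on ({0<..<t} \<times> \<Omega>) (%(t, x). G t x)" if "t <= T" for t
    using u G bd that by (auto intro!: L2_on_slab[where C = "\<Sum>k. coef_bd k"])
  have diff: "(LBINT x:\<Omega>. (u s x - u t x)\<^sup>2) = (norm (fst (sol s) - fst (sol t)))\<^sup>2" if "s \<in> {0..T}" "t \<in> {0..T}" for s t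
  proof -
    have "indicator \<Omega> x *\<^sub>R (u s x - u t x)\<^sup>2 = (norm (restr \<Omega> (u s) x - restr \<Omega> (u t) x))\<^sup>2" for x
      by (simp add: restr_def indicator_def)
    then show ?thesis using norm_cls_diff[of "restr \<Omega> (u s)" "restr \<Omega> (u t)"] u that
      by (simp add: set_lebesgue_integral_def L2_on_iff)
  qed
  have "is_heat_solution \<Omega> T f u" unfolding is_heat_solution_def
  proof (intro conjI ballI exI[of _ G] allI impI)
    show "((%s. LBINT x:\<Omega>. (u s x - u t x)\<^sup>2) \<longlongrightarrow> 0) (at t within {0..T})" if t: "t \<in> {0..T}" for t
    proof (rule Lim_transform_eventually)
      have "(sol \<longlongrightarrow> sol t) (at t within {0..T})" using sol_cont t by (simp add: continuous_on_def)
      then have "((%s. (norm (fst (sol s) - fst (sol t)))\<^sup>2) \<longlongrightarrow> (norm (fst (sol t) - fst (sol t)))\<^sup>2) (at t within {0..T})"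
        by (intro tendsto_intros)
      then show "((%s. (norm (fst (sol s) - fst (sol t)))\<^sup>2) \<longlongrightarrow> 0) (at t within {0..T})" by simp
      show "\<forall>\<^sub>F s in at t within {0..T}. (norm (fst (sol s) - fst (sol t)))\<^sup>2 = (LBINT x:\<Omega>. (u s x - u t x)\<^sup>2)"
        unfolding eventually_at_filter by (rule always_eventually) (use diff t in simp)
    qed
    have "cls (restr \<Omega> (u 0)) = cls (%_. 0)" using u(3)[of 0] T by (simp add: sol_0 cls_zero)
    moreover have "L2_fun (restr \<Omega> (u 0))" using u(2)[of 0] T by (simp add: L2_on_iff)
    ultimately have "AE x in lborel. restr \<Omega> (u 0) x = 0"
      using cls_eq_iff[OF _ L2_fun_zero] by blast
    then show "AE x\<in>\<Omega> in lborel. u 0 x = 0" by eventually_elim (auto simp: restr_def indicator_def split: if_splits)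
    show "AE t\<in>{0<..<T} in lborel. H10 \<Omega> (u t) (G t)"
      by (rule AE_I2) (use u G inV in \<open>simp add: H10_iff\<close>)
    fix v H t assume H: "H10 \<Omega> v H" and t: "t \<in> {0..T}"
    then have vH: "L2_on \<Omega> v" "L2_on \<Omega> H" "(cls (restr \<Omega> v), cls (restr \<Omega> H)) \<in> form_dom \<Omega>"
      by (simp_all add: H10_iff)
    have "(LBINT x:\<Omega>. u t x * v x) = fst (sol t) \<bullet> cls (restr \<Omega> v)"
      using integral_inner_cls[OF u(2)[OF t] vH(1)] u(3)[OF t] by simp
    moreover have "(LBINT (s, x):{0<..<t} \<times> \<Omega>. G s x \<bullet> H x) = (LBINT s:{0<..<t}. snd (sol s) \<bullet> cls (restr \<Omega> H))"
    proof -
      have "(LBINT x:\<Omega>. G s x \<bullet> H x) = snd (sol s) \<bullet> cls (restr \<Omega> H)" if "s \<in> {0<..<t}" for s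
        using integral_inner_cls[OF G(2) vH(2), of s] G(3)[of s] that t by simp
      then have "(LBINT s:{0<..<t}. (LBINT x:\<Omega>. G s x \<bullet> H x)) = (LBINT s:{0<..<t}. snd (sol s) \<bullet> cls (restr \<Omega> H))"
        by (intro set_lebesgue_integral_cong) auto
      then show ?thesis using slab_fubini(2)[OF slab(2) L2_on_slab_const[OF vH(2) \<Omega>], of t] t by simp
    qed
    ultimately show "(LBINT x:\<Omega>. u t x * v x) + (LBINT (s, x):{0<..<t} \<times> \<Omega>. G s x \<bullet> H x)
      = (LBINT (s, x):{0<..<t} \<times> \<Omega>. f (s, x) * v x)"
      using sol_equation[OF vH(3), of t] source_pairing[OF vH(1), of t] t by simp
  qed (use u slab in auto)
  then show ?thesis by blast
qed

text \<open>Tested with the eigenfunctions, the weak equation becomes the scalar integral equation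
  of each coefficient: the solution and its gradient form a pair in the form domain for almost every
  time, and \<open>eig\<close> converts the gradient term. Scalar uniqueness fixes all coefficients,
  and \<open>expand\<close> recovers the function.\<close>

lemma heat_solution_unique:
  assumes u: "is_heat_solution \<Omega> T f u"
  shows "L2_on \<Omega> (u T)" "cls (restr \<Omega> (u T)) = fst (sol T)"
proof -
  have \<Omega>: "\<Omega> \<in> sets borel" by simp
  have uL: "\<And>t. t \<in> {0..T} ==> L2_on \<Omega> (u t)"
    and uc: "\<And>t. t \<in> {0..T} ==> ((%s. LBINT x:\<Omega>. (u s x - u t x)\<^sup>2) \<longlongrightarrow> 0) (at t within {0..T})"
    using u by (auto simp: is_heat_solution_def)
  obtain G where GQ: "L2_on ({0<..<T} \<times> \<Omega>) (%(t, x). G t x)" and GH: "AE t\<in>{0<..<T} in lborel. H10 \<Omega> (u t) (G t)"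
    and eq: "\<And>v H t. H10 \<Omega> v H ==> t \<in> {0..T} ==> (LBINT x:\<Omega>. u t x * v x) + (LBINT (s, x):{0<..<t} \<times> \<Omega>. G s x \<bullet> H x)
      = (LBINT (s, x):{0<..<t} \<times> \<Omega>. f (s, x) * v x)"
    using u unfolding is_heat_solution_def by blast
  define z where "z t = cls (restr \<Omega> (u t))" for t
  have zc: "continuous_on {0..T} z" unfolding continuous_on_def
  proof
    fix t assume t: "t \<in> {0..T}"
    have d: "(LBINT x:\<Omega>. (u s x - u t x)\<^sup>2) = (norm (z s - z t))\<^sup>2" if "s \<in> {0..T}" for s
    proof -
      have "indicator \<Omega> x *\<^sub>R (u s x - u t x)\<^sup>2 = (norm (restr \<Omega> (u s) x - restr \<Omega> (u t) x))\<^sup>2" for x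
        by (simp add: restr_def indicator_def)
      then show ?thesis using norm_cls_diff[of "restr \<Omega> (u s)" "restr \<Omega> (u t)"] uL that t
        by (simp add: set_lebesgue_integral_def L2_on_iff z_def)
    qed
    have "((%s. (norm (z s - z t))\<^sup>2) \<longlongrightarrow> 0) (at t within {0..T})"
      by (rule Lim_transform_eventually[OF uc[OF t]]) (auto simp: eventually_at_filter d intro!: always_eventually)
    then have "((%s. sqrt ((norm (z s - z t))\<^sup>2)) \<longlongrightarrow> sqrt 0) (at t within {0..T})" by (intro tendsto_intros)
    then show "(z \<longlongrightarrow> z t) (at t within {0..T})" by (simp add: tendsto_norm_zero_iff LIM_zero_iff)
  qed
  have zk: "z t \<bullet> e k = coef k t" if t: "t \<in> {0..T}" for k t
  proof (rule coef_unique[where a = "%t. z t \<bullet> e k", OF _ t])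
    show "continuous_on {0..T} (%t. z t \<bullet> e k)" by (intro continuous_intros zc)
    fix t assume t: "t \<in> {0..T}"
    note sup = form_dom_supported[OF \<Omega> eV[of k]]
    have re: "cls (restr \<Omega> (rep_L2 (e k))) = e k" "cls (restr \<Omega> (rep_L2 (g k))) = g k"
      using sup by (simp_all add: supported_iff(1)[OF \<Omega>, symmetric])
    have L2: "L2_on \<Omega> (rep_L2 (e k))" "L2_on \<Omega> (rep_L2 (g k))" by (simp_all add: L2_on_iff supported_iff(2)[OF \<Omega>])
    have H: "H10 \<Omega> (rep_L2 (e k)) (rep_L2 (g k))" using L2 re eV[of k] by (simp add: H10_iff)
    have Gt: "L2_on ({0<..<t} \<times> \<Omega>) (%(t, x). G t x)"
    proof -
      have "restr ({0<..<t} \<times> \<Omega>) (%(t, x). G t x) = (%w. indicator ({0<..<t} \<times> \<Omega>) w *\<^sub>R restr ({0<..<T} \<times> \<Omega>) (%(t, x). G t x) w)"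
        using t by (auto simp: restr_def indicator_def fun_eq_iff)
      then show ?thesis using GQ Q_sets[of t] unfolding L2_on_iff
        by (auto intro!: L2_fun_bounded_mult[where B = 1] simp: indicator_def)
    qed
    note fub = slab_fubini[OF Gt L2_on_slab_const[OF L2(2) \<Omega>]]
    have "(LBINT x:\<Omega>. u t x * rep_L2 (e k) x) = z t \<bullet> e k"
      using integral_inner_cls[OF uL[OF t] L2(1)] re by (simp add: z_def)
    moreover have "(LBINT (s, x):{0<..<t} \<times> \<Omega>. f (s, x) * rep_L2 (e k) x) = (LBINT s:{0<..<t}. L s \<bullet> e k)"
      using source_pairing[OF L2(1), of t] t re by simp
    moreover have "(LBINT (s, x):{0<..<t} \<times> \<Omega>. G s x \<bullet> rep_L2 (g k) x) = l k * (LBINT s:{0<..<t}. z s \<bullet> e k)"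
    proof -
      have "(LBINT s:{0<..<t}. (LBINT x:\<Omega>. G s x \<bullet> rep_L2 (g k) x)) = (LBINT s:{0<..<t}. l k * (z s \<bullet> e k))"
        unfolding set_lebesgue_integral_def
      proof (rule integral_cong_AE)
        show "(%s. indicator {0<..<t} s *\<^sub>R (LBINT x. indicator \<Omega> x *\<^sub>R (G s x \<bullet> rep_L2 (g k) x))) \<in> borel_measurable lborel"
          using fub(1) by (simp add: set_integrable_def set_lebesgue_integral_def borel_measurable_integrable)
        have "continuous_on {0<..<t} (%s. l k * (z s \<bullet> e k))"
          using t by (intro continuous_intros continuous_on_subset[OF zc]) auto
        then show "(%s. indicator {0<..<t} s *\<^sub>R (l k * (z s \<bullet> e k))) \<in> borel_measurable lborel"
          using borel_measurable_continuous_on_indicator[of "{0<..<t}", OF _ \<open>continuous_on {0<..<t} (%s. l k * (z s \<bullet> e k))\<close>] by simp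
        show "AE s in lborel. indicator {0<..<t} s *\<^sub>R (LBINT x. indicator \<Omega> x *\<^sub>R (G s x \<bullet> rep_L2 (g k) x))
          = indicator {0<..<t} s *\<^sub>R (l k * (z s \<bullet> e k))"
          using GH
        proof eventually_elim
          case (elim s)
          show ?case
          proof (cases "s \<in> {0<..<t}")
            case True
            then have h: "L2_on \<Omega> (G s)" "(z s, cls (restr \<Omega> (G s))) \<in> form_dom \<Omega>" using elim t by (auto simp: H10_iff z_def)
            show ?thesis using integral_inner_cls[OF h(1) L2(2)] eig[OF h(2), of k] re by (simp add: set_lebesgue_integral_def)
          qed simp
        qed
      qed
      then show ?thesis using fub(2) by simp
    qed
    ultimately show "z t \<bullet> e k + l k * (LBINT s:{0<..<t}. z s \<bullet> e k) = (LBINT s:{0<..<t}. L s \<bullet> e k)"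
      using eq[OF H t] by simp
  qed
  have sk: "fst (sol T) \<bullet> e k = coef k T" for k
  proof (rule coef_unique[where a = "%t. fst (sol t) \<bullet> e k"])
    show "continuous_on {0..T} (%t. fst (sol t) \<bullet> e k)" by (intro continuous_intros sol_cont)
    show "T \<in> {0..T}" using T by simp
    fix t assume t: "t \<in> {0..T}"
    have "(LBINT s:{0<..<t}. snd (sol s) \<bullet> g k) = (LBINT s:{0<..<t}. l k * (fst (sol s) \<bullet> e k))"
      by (rule set_lebesgue_integral_cong) (use sol_in_V eig[of "fst (sol _)" "snd (sol _)"] t in auto)
    then show "fst (sol t) \<bullet> e k + l k * (LBINT s:{0<..<t}. fst (sol s) \<bullet> e k) = (LBINT s:{0<..<t}. L s \<bullet> e k)"
      using sol_equation[OF eV, of t k] t by simp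
  qed
  have TT: "T \<in> {0..T}" using T by simp
  show "L2_on \<Omega> (u T)" by (rule uL[OF TT])
  have s1: "supported \<Omega> (z T)" unfolding z_def using uL[OF TT] by (intro supported_cls_restr) (simp add: L2_on_iff)
  have s2: "supported \<Omega> (fst (sol T))" by (rule form_dom_supported(1)[OF \<Omega>, of _ "snd (sol T)"]) (use sol_in_V[of T] T in simp)
  show "cls (restr \<Omega> (u T)) = fst (sol T)"
    using sums_unique2[OF expand[OF s1] , of "fst (sol T)"] expand[OF s2] zk[OF TT] sk by (simp add: z_def)
qed

end

subsection \<open>Maximisers of a linear functional under a volume constraint\<close>

text \<open>
  Moving mass from \<open>{P < b}\<close> to \<open>{P > a}\<close>, \<open>b <= a\<close>, would increase the functional.
\<close>

lemma (in finite_measure) bathtub: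
  fixes P f :: "'a => real"
  assumes [measurable]: "P \<in> borel_measurable M" "f \<in> borel_measurable M" and iP: "integrable M P"
    and f01: "AE z in M. 0 <= f z \<and> f z <= 1"
    and n0: "\<not> (AE z in M. f z = 0)" and n1: "\<not> (AE z in M. f z = 1)"
    and opt: "\<And>f'. f' \<in> borel_measurable M ==> AE z in M. 0 <= f' z \<and> f' z <= 1 ==>
      (LINT z|M. f' z) = (LINT z|M. f z) ==> (LINT z|M. f' z * P z) <= (LINT z|M. f z * P z)"
  obtains c where "AE z in M. (c < P z --> f z = 1) \<and> (P z < c --> f z = 0)"
proof -
  define NA where "NA a \<longleftrightarrow> (AE z in M. a < P z --> f z = 1)" for a
  define NB where "NB b \<longleftrightarrow> (AE z in M. P z < b --> f z = 0)" for b
  have bdd: "integrable M w" "integrable M (%z. w z * P z)"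
    if [measurable]: "w \<in> borel_measurable M" and w: "AE z in M. 0 <= w z \<and> w z <= 1" for w :: "'a => real"
  proof -
    show "integrable M w" by (rule integrable_const_bound[where B = 1]) (use w in \<open>auto elim: eventually_mono\<close>)
    show "integrable M (%z. w z * P z)"
    proof (rule Bochner_Integration.integrable_bound[OF iP])
      show "AE z in M. norm (w z * P z) <= norm (P z)"
        using w by eventually_elim (auto simp: abs_mult intro!: mult_left_le_one_le)
    qed measurable
  qed
  have key: "NA a \<or> NB b" if ab: "b <= a" for a b
  proof (rule ccontr)
    assume no: "\<not> (NA a \<or> NB b)"
    define u where "u z = (if a < P z then 1 - f z else 0)" for z
    define v where "v z = (if P z < b then f z else 0)" for z
    have [measurable]: "u \<in> borel_measurable M" "v \<in> borel_measurable M" unfolding u_def v_def by measurable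
    have u01: "AE z in M. 0 <= u z \<and> u z <= 1" and v01: "AE z in M. 0 <= v z \<and> v z <= 1"
      using f01 by (eventually_elim, auto simp: u_def v_def)+
    note iu = bdd[OF _ u01, simplified] and iv = bdd[OF _ v01, simplified] and if' = bdd[OF _ f01, simplified]
    define \<alpha> where "\<alpha> = (LINT z|M. u z)"
    define \<beta> where "\<beta> = (LINT z|M. v z)"
    have "0 <= \<alpha>" unfolding \<alpha>_def using u01 by (intro integral_nonneg_AE) (auto elim: eventually_mono)
    moreover have "\<alpha> \<noteq> 0"
    proof
      assume "\<alpha> = 0"
      then have "AE z in M. u z = 0"
        unfolding \<alpha>_def using u01 by (subst (asm) integral_nonneg_eq_0_iff_AE[OF iu(1)]) (auto elim: eventually_mono)
      then have "NA a" unfolding NA_def by eventually_elim (auto simp: u_def)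
      then show False using no by simp
    qed
    ultimately have \<alpha>: "0 < \<alpha>" by simp
    have "0 <= \<beta>" unfolding \<beta>_def using v01 by (intro integral_nonneg_AE) (auto elim: eventually_mono)
    moreover have "\<beta> \<noteq> 0"
    proof
      assume "\<beta> = 0"
      then have "AE z in M. v z = 0"
        unfolding \<beta>_def using v01 by (subst (asm) integral_nonneg_eq_0_iff_AE[OF iv(1)]) (auto elim: eventually_mono)
      then have "NB b" unfolding NB_def by eventually_elim (auto simp: v_def)
      then show False using no by simp
    qed
    ultimately have \<beta>: "0 < \<beta>" by simp
    \<comment> \<open>Adding \<open>\<beta> / m\<close> times \<open>u\<close> and removing
      \<open>\<alpha> / m\<close> times \<open>v\<close> exchanges equal masses; dividing by the
      maximum keeps both fractions at most 1, so the new function stays between 0 and 1.\<close>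
    define m where "m = max \<alpha> \<beta>"
    have m: "0 < m" "0 <= \<beta> / m" "\<beta> / m <= 1" "0 <= \<alpha> / m" "\<alpha> / m <= 1" using \<alpha> \<beta> by (auto simp: m_def)
    define f' where "f' z = f z + (\<beta> / m) * u z - (\<alpha> / m) * v z" for z
    have "(LINT z|M. f' z * P z) <= (LINT z|M. f z * P z)"
    proof (rule opt)
      show "f' \<in> borel_measurable M" unfolding f'_def by measurable
      show "AE z in M. 0 <= f' z \<and> f' z <= 1"
        using f01
      proof eventually_elim
        case (elim z)
        have "(\<beta> / m) * (1 - f z) <= 1 - f z" "0 <= (\<beta> / m) * (1 - f z)" "(\<alpha> / m) * f z <= f z" "0 <= (\<alpha> / m) * f z"
          using m elim mult_right_mono[of "\<beta> / m" 1 "1 - f z"] mult_right_mono[of "\<alpha> / m" 1 "f z"]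
          by (simp_all only: mult_1 mult_nonneg_nonneg diff_ge_0_iff_ge)
        then show ?case using elim ab by (auto simp: f'_def u_def v_def)
      qed
      have "(LINT z|M. f' z) = (LINT z|M. f z) + (\<beta> / m) * \<alpha> - (\<alpha> / m) * \<beta>"
        unfolding f'_def \<alpha>_def \<beta>_def using iu iv if' by simp
      then show "(LINT z|M. f' z) = (LINT z|M. f z)" by simp
    qed
    moreover have "(LINT z|M. f' z * P z) = (LINT z|M. f z * P z) + (\<beta> / m) * (LINT z|M. u z * P z) - (\<alpha> / m) * (LINT z|M. v z * P z)"
    proof -
      have "f' z * P z = f z * P z + (\<beta> / m) * (u z * P z) - (\<alpha> / m) * (v z * P z)" for z
        by (simp add: f'_def algebra_simps)
      then show ?thesis using iu iv if' by simp
    qed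
    ultimately have "(\<beta> / m) * (LINT z|M. u z * P z) <= (\<alpha> / m) * (LINT z|M. v z * P z)" by simp
    then have le: "\<beta> * (LINT z|M. u z * P z) <= \<alpha> * (LINT z|M. v z * P z)" using m(1) by (simp add: divide_le_cancel)
    have "a * \<alpha> < (LINT z|M. u z * P z)"
    proof -
      have i: "integrable M (%z. u z * P z - a * u z)" using iu by simp
      have nn: "AE z in M. 0 <= u z * P z - a * u z"
        using f01
      proof eventually_elim
        case (elim z)
        show ?case using mult_left_mono[of a "P z" "1 - f z"] elim by (auto simp: u_def mult.commute)
      qed
      have "(LINT z|M. u z * P z - a * u z) \<noteq> 0"
      proof
        assume "(LINT z|M. u z * P z - a * u z) = 0"
        then have "AE z in M. u z * P z - a * u z = 0" using integral_nonneg_eq_0_iff_AE[OF i nn] by simp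
        then have "NA a" unfolding NA_def by eventually_elim (auto simp: u_def algebra_simps)
        then show False using no by simp
      qed
      moreover have "0 <= (LINT z|M. u z * P z - a * u z)" by (rule integral_nonneg_AE[OF nn])
      ultimately show ?thesis using iu by (simp add: \<alpha>_def)
    qed
    then have "\<beta> * (a * \<alpha>) < \<beta> * (LINT z|M. u z * P z)" using \<beta> by simp
    moreover have "(LINT z|M. v z * P z) <= b * \<beta>"
    proof -
      have "(LINT z|M. v z * P z) <= (LINT z|M. b * v z)"
      proof (rule integral_mono_AE)
        show "AE z in M. v z * P z <= b * v z"
          using f01
        proof eventually_elim
          case (elim z)
          show ?case using mult_left_mono[of "P z" b "f z"] elim by (auto simp: v_def mult.commute)
        qed
      qed (use iv in auto)
      then show ?thesis by (simp add: \<beta>_def)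
    qed
    then have "\<alpha> * (LINT z|M. v z * P z) <= \<alpha> * (b * \<beta>)" using \<alpha> by simp
    moreover have "\<alpha> * (b * \<beta>) <= \<beta> * (a * \<alpha>)" using ab \<alpha> \<beta> mult_right_mono[OF ab, of "\<alpha> * \<beta>"] by (simp add: algebra_simps)
    ultimately show False using le by linarith
  qed
  \<comment> \<open>The level is finite: a threshold at minus infinity would mean
    \<open>f = 1\<close> almost everywhere, one at plus infinity \<open>f = 0\<close>.\<close>
  have "\<not> (\<forall>n. NA (- real n))"
  proof
    assume "\<forall>n. NA (- real n)"
    then have "AE z in M. \<forall>n. - real n < P z --> f z = 1" unfolding NA_def by (subst AE_all_countable)
    then have "AE z in M. f z = 1"
    proof eventually_elim
      case (elim z)
      obtain n where "- P z < real n" using reals_Archimedean2 by blast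
      then have "- real n < P z" by simp
      then show ?case using elim by blast
    qed
    then show False using n1 by simp
  qed
  then obtain na where na: "\<not> NA (- real na)" by blast
  have "\<not> (\<forall>n. NB (real n))"
  proof
    assume "\<forall>n. NB (real n)"
    then have "AE z in M. \<forall>n. P z < real n --> f z = 0" unfolding NB_def by (subst AE_all_countable)
    then have "AE z in M. f z = 0"
    proof eventually_elim
      case (elim z)
      obtain n where "P z < real n" using reals_Archimedean2 by blast
      then show ?case using elim by blast
    qed
    then show False using n0 by simp
  qed
  then obtain nb where nb: "\<not> NB (real nb)" by blast
  define S where "S = {a. \<not> NA a}"
  have Sn: "S \<noteq> {}" using na by (auto simp: S_def)
  have bd: "bdd_above S"
  proof (rule bdd_aboveI)
    fix a assume "a \<in> S"
    then show "a <= real nb" using key[of "real nb" a] nb by (cases "real nb <= a") (auto simp: S_def)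
  qed
  \<comment> \<open>By \<open>key\<close>, \<open>NB\<close> holds below any level at which
    \<open>NA\<close> fails, and above the supremum of those levels \<open>NA\<close> holds. The
    strict inequalities at \<open>c\<close> itself follow along the steps
    \<open>1 / (n + 2)\<close>.\<close>
  define c where "c = Sup S"
  have "NA (c + 1 / (real n + 2))" for n
  proof (rule ccontr)
    assume "\<not> NA (c + 1 / (real n + 2))"
    then have "c + 1 / (real n + 2) <= Sup S" by (intro cSup_upper bd) (simp add: S_def)
    then show False by (simp add: c_def[symmetric])
  qed
  then have "AE z in M. \<forall>n. c + 1 / (real n + 2) < P z --> f z = 1" unfolding NA_def by (subst AE_all_countable) blast
  moreover have "NB (c - 1 / (real n + 2))" for n
  proof -
    have "c - 1 / (real n + 2) < Sup S" by (simp add: c_def)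
    then obtain a where "a \<in> S" "c - 1 / (real n + 2) < a" using less_cSup_iff[OF Sn bd] by blast
    then show ?thesis using key[of "c - 1 / (real n + 2)" a] by (auto simp: S_def)
  qed
  then have "AE z in M. \<forall>n. P z < c - 1 / (real n + 2) --> f z = 0" unfolding NB_def by (subst AE_all_countable) blast
  ultimately have "AE z in M. (c < P z --> f z = 1) \<and> (P z < c --> f z = 0)"
  proof eventually_elim
    case (elim z)
    have l: "(%n. c + 1 / (real n + 2)) \<longlonglongrightarrow> c + 0" "(%n. c - 1 / (real n + 2)) \<longlonglongrightarrow> c - 0"
      by (intro tendsto_intros lim_const_over_n_plus_2)+
    show ?case
    proof (intro conjI impI)
      assume "c < P z"
      then have "\<forall>\<^sub>F n in sequentially. c + 1 / (real n + 2) < P z" using order_tendstoD(2)[OF l(1)] by simp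
      then show "f z = 1" using elim(1) eventually_happens'[OF sequentially_bot] by blast
    next
      assume "P z < c"
      then have "\<forall>\<^sub>F n in sequentially. P z < c - 1 / (real n + 2)" using order_tendstoD(1)[OF l(2)] by simp
      then show "f z = 0" using elim(2) eventually_happens'[OF sequentially_bot] by blast
    qed
  qed
  then show thesis by (rule that)
qed

subsection \<open>Structure of an optimal source\<close>

context ball_heat
begin

text \<open>The backward heat flow with final datum the indicator of \<open>E\<close>, as a jointly
  measurable function. It is specified through \<open>flow\<close> because positivity, norm bounds
  and duality are all available there.\<close>

definition is_adjoint :: "real => 'a set => (real => 'a => real) => bool" where
  "is_adjoint T E p \<longleftrightarrow> (%(t, x). p t x) \<in> borel_measurable borel \<and>
     (\<forall>t\<in>{0..T}. L2_on \<Omega> (p t) \<and> cls (restr \<Omega> (p t)) = flow (T - t) (cls (indicator E)))"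

lemma is_adjoint_exists: "\<exists>p. is_adjoint T E p"
proof -
  define w where "w = cls (indicator E :: 'a => real)"
  let ?c = "%k t. exp (- (l k * (T - t))) * (w \<bullet> e k)"
  have c: "(%t. indicator {0..T} t * ?c k t) \<in> borel_measurable borel" for k by measurable
  have bd: "(norm (flow (T - t) w - (\<Sum>k<n. ?c k t *\<^sub>R e k)))\<^sup>2 <= (\<Sum>k. (w \<bullet> e (k + n))\<^sup>2)" if t: "t \<in> {0..T}" for t n
    unfolding flow_def mult_def
  proof (rule orthogonal_series(2)[OF orth_e_all _ bessel(1)])
    fix k
    have "exp (- (l k * (T - t))) * norm (e k) <= 1 * 1"
      using flow_bd[of "T - t" k] norm_e_le[of k] t by (intro mult_mono) auto
    then have "(exp (- (l k * (T - t))) * norm (e k))\<^sup>2 <= 1" by (simp add: power_le_one)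
    then have "(w \<bullet> e k)\<^sup>2 * (exp (- (l k * (T - t))) * norm (e k))\<^sup>2 <= (w \<bullet> e k)\<^sup>2" by (intro mult_right_le_one_le) auto
    then show "(?c k t)\<^sup>2 * (norm (e k))\<^sup>2 <= (w \<bullet> e k)\<^sup>2" by (simp add: power_mult_distrib mult_ac)
  qed
  have sup: "supported \<Omega> (flow (T - t) w)" if "t \<in> {0..T}" for t using that by (intro supported_flow) simp
  obtain p where "(%(t, x). p t x) \<in> borel_measurable borel" "\<And>t. t \<in> {0..T} ==> L2_on \<Omega> (p t)"
    "\<And>t. t \<in> {0..T} ==> cls (restr \<Omega> (p t)) = flow (T - t) w"
    by (rule spectral_representative[of \<Omega> "{0..T}" ?c "%t. flow (T - t) w" e "%n. \<Sum>k. (w \<bullet> e (k + n))\<^sup>2"])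
      (use c bd suminf_exist_split2[OF bessel(1)[of w]] sup in auto)
  then show ?thesis unfolding is_adjoint_def w_def by blast
qed

context
  fixes E :: "'a set"
  assumes E: "E \<in> sets borel" "E \<subseteq> \<Omega>"
begin

lemma indicator_facts:
  "L2_fun (indicator E :: 'a => real)" "supported \<Omega> (cls (indicator E :: 'a => real))"
  "AE x in lborel. 0 <= rep_L2 (cls (indicator E :: 'a => real)) x" "(norm (cls (indicator E :: 'a => real)))\<^sup>2 = measure lborel E"
proof -
  have fin: "emeasure lborel E < top" using emeasure_bounded_finite[OF bounded_subset[OF bounded_ball E(2)]] by simp
  show sq: "L2_fun (indicator E :: 'a => real)" using E fin by (intro L2_fun_indicator)
  show "supported \<Omega> (cls (indicator E :: 'a => real))" unfolding supported_def
    using rep_L2_cls[OF sq] by eventually_elim (use E in \<open>auto simp: indicator_def\<close>)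
  show "AE x in lborel. 0 <= rep_L2 (cls (indicator E :: 'a => real)) x"
    using rep_L2_cls[OF sq] by eventually_elim simp
  have "(norm (cls (indicator E :: 'a => real)))\<^sup>2 = (LBINT x. indicator E x)"
    unfolding norm_cls[OF sq] by (intro Bochner_Integration.integral_cong) (auto simp: indicator_def)
  then show "(norm (cls (indicator E :: 'a => real)))\<^sup>2 = measure lborel E" using E by simp
qed

lemma adjoint_slab:
  assumes p: "is_adjoint T E p" and T: "0 < T"
  shows "L2_on ({0<..<T} \<times> \<Omega>) (%(t, x). p t x)"
    and "(LBINT (s, x):{0<..<T} \<times> \<Omega>. p s x \<bullet> p s x) <= T * measure lborel E"
proof -
  have bd: "(norm (cls (restr \<Omega> (p t))))\<^sup>2 <= measure lborel E" if "t \<in> {0<..<T}" for t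
  proof -
    have "norm (cls (restr \<Omega> (p t))) <= norm (cls (indicator E :: 'a => real))"
      using p that norm_flow_le[of "T - t"] by (simp add: is_adjoint_def)
    then show ?thesis unfolding indicator_facts(4)[symmetric] by (intro power_mono) auto
  qed
  show L: "L2_on ({0<..<T} \<times> \<Omega>) (%(t, x). p t x)"
    by (rule L2_on_slab[where C = "measure lborel E"]) (use p bd in \<open>auto simp: is_adjoint_def\<close>)
  have "(LBINT (s, x):{0<..<T} \<times> \<Omega>. p s x \<bullet> p s x) = (LBINT s:{0<..<T}. (LBINT x:\<Omega>. p s x \<bullet> p s x))"
    by (rule slab_fubini(2)[OF L L])
  also have "\<dots> <= (LBINT s:{0<..<T}. measure lborel E)"
  proof (rule set_integral_mono[OF slab_fubini(1)[OF L L]])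
    show "set_integrable lborel {0<..<T} (%s. measure lborel E)"
      using emeasure_Ioo_finite[of 0 T] by (simp add: set_integrable_def less_top)
    fix s assume s: "s \<in> {0<..<T}"
    then have "L2_on \<Omega> (p s)" using p by (simp add: is_adjoint_def)
    then show "(LBINT x:\<Omega>. p s x \<bullet> p s x) <= measure lborel E"
      using integral_inner_cls[of \<Omega> "p s" "p s"] bd[OF s] by (simp add: power2_norm_eq_inner)
  qed
  also have "\<dots> = T * measure lborel E" using T by (simp add: set_lebesgue_integral_def)
  finally show "(LBINT (s, x):{0<..<T} \<times> \<Omega>. p s x \<bullet> p s x) <= T * measure lborel E" .
qed

text \<open>\<open>flow_pos\<close> gives positivity almost everywhere in space at each time; joint
  measurability turns this into positivity almost everywhere on the slab.\<close>

lemma adjoint_pos: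
  assumes p: "is_adjoint T E p" and T: "0 < T" and E0: "0 < measure lborel E"
  shows "AE z in lborel. z \<in> {0<..<T} \<times> \<Omega> --> 0 < p (fst z) (snd z)"
proof -
  have ne: "cls (indicator E :: 'a => real) \<noteq> 0" using E0 indicator_facts(4) by auto
  have "AE x in lborel. (t, x) \<in> {0<..<T} \<times> \<Omega> --> 0 < p t x" for t
  proof (cases "t \<in> {0<..<T}")
    case True
    then have pt: "L2_on \<Omega> (p t)" "cls (restr \<Omega> (p t)) = flow (T - t) (cls (indicator E))" using p by (auto simp: is_adjoint_def)
    have "AE x in lborel. x \<in> \<Omega> --> 0 < rep_L2 (cls (restr \<Omega> (p t))) x"
      unfolding pt(2) using True by (intro flow_pos indicator_facts ne) simp
    moreover have "AE x in lborel. rep_L2 (cls (restr \<Omega> (p t))) x = restr \<Omega> (p t) x"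
      using pt(1) by (intro rep_L2_cls) (simp add: L2_on_iff)
    ultimately show ?thesis by eventually_elim (auto simp: restr_def)
  qed auto
  then have "AE t in lborel. AE x in lborel. (t, x) \<in> {0<..<T} \<times> \<Omega> --> 0 < p (fst (t, x)) (snd (t, x))" by simp
  moreover have "{z \<in> space (lborel \<Otimes>\<^sub>M lborel). z \<in> {0<..<T} \<times> \<Omega> --> 0 < p (fst z) (snd z)} \<in> sets (lborel \<Otimes>\<^sub>M lborel)"
  proof -
    have [measurable]: "(%z. p (fst z) (snd z)) \<in> borel_measurable borel" using p by (simp add: is_adjoint_def case_prod_beta')
    have [measurable]: "{0<..<T} \<times> \<Omega> \<in> sets borel" by (intro borel_Times) auto
    have "{z. z \<in> {0<..<T} \<times> \<Omega> --> 0 < p (fst z) (snd z)} \<in> sets borel" by measurable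
    then show ?thesis unfolding lborel_prod by simp
  qed
  ultimately have "AE z in lborel \<Otimes>\<^sub>M lborel. z \<in> {0<..<T} \<times> \<Omega> --> 0 < p (fst z) (snd z)"
    by (intro lborel_pair.AE_pair_measure)
  then show ?thesis by (simp only: lborel_prod)
qed

end

text \<open>The representative chosen by \<open>SOME\<close> does no harm, since the class of the
  solution at time \<open>T\<close> is determined. The last claim is duality for an indicator: it
  makes the integral of the solution over \<open>E\<close> a linear functional of the
  source.\<close>

lemma heat_value:
  assumes T: "0 < T" and f: "f \<in> admissible_sources \<Omega> T V"
  defines "u \<equiv> heat_solution \<Omega> T f T"
  shows "L2_on \<Omega> u"
    and "AE x in lborel. x \<in> \<Omega> --> 0 <= restr \<Omega> u x"
    and "E \<in> sets borel ==> E \<subseteq> \<Omega> ==> is_adjoint T E p ==>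
      (LBINT x:E. restr \<Omega> u x) = (LBINT z:{0<..<T} \<times> \<Omega>. f z * p (fst z) (snd z))"
proof -
  interpret S: ball_source R e g l T f
    by unfold_locales (use T f in \<open>auto simp: admissible_sources_def\<close>)
  have "is_heat_solution \<Omega> T f (heat_solution \<Omega> T f)"
    unfolding heat_solution_def by (rule someI_ex[OF S.heat_solution_exists])
  note uniq = S.heat_solution_unique[OF this, folded u_def]
  show uL: "L2_on \<Omega> u" by (rule uniq)
  have uz: "cls (restr \<Omega> u) = fst (S.sol T)" by (rule uniq)
  have sq: "L2_fun (restr \<Omega> u)" using uL by (simp add: L2_on_iff)
  have dual: "(LBINT x:E. restr \<Omega> u x) = (LBINT s:{0<..<T}. S.L s \<bullet> flow (T - s) (cls (indicator E)))"
    if E: "E \<in> sets borel" "E \<subseteq> \<Omega>" for E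
    using inner_cls[OF sq indicator_facts(1)[OF E]] S.duality[of "cls (indicator E)"]
    by (simp add: uz set_lebesgue_integral_def mult.commute)
  show "(LBINT x:E. restr \<Omega> u x) = (LBINT z:{0<..<T} \<times> \<Omega>. f z * p (fst z) (snd z))"
    if E: "E \<in> sets borel" "E \<subseteq> \<Omega>" and p: "is_adjoint T E p"
  proof -
    have "(LBINT x:\<Omega>. S.F s x \<bullet> p s x) = S.L s \<bullet> flow (T - s) (cls (indicator E))" if "s \<in> {0<..<T}" for s
      using integral_inner_cls[OF S.F_sq(3), of "p s" s] p that by (simp add: is_adjoint_def S.F_sq(2) S.L_def)
    then have "(LBINT s:{0<..<T}. (LBINT x:\<Omega>. S.F s x \<bullet> p s x))
      = (LBINT s:{0<..<T}. S.L s \<bullet> flow (T - s) (cls (indicator E)))"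
      by (intro set_lebesgue_integral_cong) auto
    then show ?thesis
      using dual[OF E] S.source_integral[OF adjoint_slab(1)[OF E p T]] by (simp add: case_prod_beta')
  qed
  have um [measurable]: "restr \<Omega> u \<in> borel_measurable borel" using sq by (simp add: L2_fun_def)
  \<comment> \<open>Nonnegativity comes from duality too: the integral of the solution over the set
    where it is negative is a pairing of nonnegative functions.\<close>
  define B where "B = {x \<in> \<Omega>. restr \<Omega> u x < 0}"
  have B: "B \<in> sets borel" "B \<subseteq> \<Omega>" unfolding B_def by (measurable, auto)
  have "0 <= (LBINT x:B. restr \<Omega> u x)" unfolding dual[OF B]
  proof (rule set_integral_nonneg)
    fix s assume s: "s \<in> {0<..<T}"
    have "AE x in lborel. 0 <= rep_L2 (flow (T - s) (cls (indicator B))) x"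
      using s by (intro flow_nonneg indicator_facts B) simp
    moreover have "AE x in lborel. 0 <= rep_L2 (S.L s) x"
      using rep_L2_cls[OF S.F_sq(1)[of s]] unfolding S.L_def by eventually_elim (simp add: S.F_bd)
    ultimately have "AE x in lborel. 0 <= rep_L2 (S.L s) x \<bullet> rep_L2 (flow (T - s) (cls (indicator B))) x"
      by eventually_elim simp
    then show "0 <= S.L s \<bullet> flow (T - s) (cls (indicator B))" unfolding inner_L2_eq by (rule integral_nonneg_AE)
  qed
  moreover have i: "integrable lborel (%x. - (indicator B x *\<^sub>R restr \<Omega> u x))"
    using L2_fun_inner[OF sq indicator_facts(1)[OF B]] by (simp add: mult.commute)
  moreover have nn: "0 <= - (indicator B x *\<^sub>R restr \<Omega> u x)" for x by (auto simp: B_def indicator_def)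
  ultimately have "(LBINT x. - (indicator B x *\<^sub>R restr \<Omega> u x)) = 0"
    using Bochner_Integration.integral_nonneg[of lborel "%x. - (indicator B x *\<^sub>R restr \<Omega> u x)", OF nn]
    by (simp add: set_lebesgue_integral_def)
  then have "AE x in lborel. - (indicator B x *\<^sub>R restr \<Omega> u x) = 0"
    using integral_nonneg_eq_0_iff_AE[OF i] nn by simp
  then show "AE x in lborel. x \<in> \<Omega> --> 0 <= restr \<Omega> u x"
    by eventually_elim (auto simp: B_def indicator_def split: if_splits)
qed

text \<open>All competitors are tested on the one set \<open>E\<close> that is extremal for
  \<open>f\<close>: their integrals over \<open>E\<close> are at most their own rearranged
  integrals, which the assumed ordering bounds by that of \<open>f\<close>. So \<open>f\<close>
  maximises a linear functional with density \<open>p\<close>, and \<open>K\<close> is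
  \<open>1 / c\<^sup>2\<close> for the resulting level \<open>c\<close>.\<close>

lemma optimal_source_structure:
  assumes T: "0 < T" and V: "0 < V" "V < measure lborel ({0<..<T} \<times> \<Omega>)"
    and f: "f \<in> admissible_sources \<Omega> T V"
    and opt: "\<And>f'. f' \<in> admissible_sources \<Omega> T V ==>
      less_concentrated R (heat_solution \<Omega> T f' T) (heat_solution \<Omega> T f T)"
    and r: "0 < r" "r < R" and small: "4 * (T * measure lborel (ball (0::'a) r)) < V"
  obtains E p K where "E \<in> sets borel" "E \<subseteq> \<Omega>" "measure lborel E = measure lborel (ball (0::'a) r)" "is_adjoint T E p"
    "AE z in lborel. z \<in> {0<..<T} \<times> \<Omega> --> \<bar>f z - indicator E (snd z)\<bar> <= K * (p (fst z) (snd z) - indicator E (snd z))\<^sup>2"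
proof -
  let ?Q = "{0<..<T} \<times> \<Omega>"
  let ?u = "%f. restr \<Omega> (heat_solution \<Omega> T f T)"
  let ?I = "%f. LBINT x:ball 0 r. schwarz_rearrangement R (?u f) x"
  have prem: "?u f' \<in> borel_measurable borel" "set_integrable lborel \<Omega> (?u f')" "AE x in lborel. x \<in> \<Omega> --> 0 <= ?u f' x"
    if f': "f' \<in> admissible_sources \<Omega> T V" for f'
  proof -
    have sq: "L2_fun (?u f')" using heat_value(1)[OF T f'] by (simp add: L2_on_iff)
    then show "?u f' \<in> borel_measurable borel" by (simp add: L2_fun_def)
    show "set_integrable lborel \<Omega> (?u f')"
      using L2_fun_inner[OF indicator_facts(1)[of \<Omega>] sq] by (simp add: set_integrable_def)
    show "AE x in lborel. x \<in> \<Omega> --> 0 <= ?u f' x" by (rule heat_value(2)[OF T f'])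
  qed
  have cong: "schwarz_rearrangement R (heat_solution \<Omega> T f' T) = schwarz_rearrangement R (?u f')" for f'
    by (rule is_schwarz_cong) (simp add: restr_def)
  obtain E where E: "E \<in> sets borel" "E \<subseteq> \<Omega>" "measure lborel E = measure lborel (ball (0::'a) r)"
    and att: "(LBINT x:E. ?u f x) = ?I f"
    using schwarz_attained[OF R prem[OF f] r] by metis
  obtain p where p: "is_adjoint T E p" using is_adjoint_exists by blast
  define P where "P z = p (fst z) (snd z)" for z
  have best: "(LBINT z:?Q. f' z * P z) <= (LBINT z:?Q. f z * P z)" if f': "f' \<in> admissible_sources \<Omega> T V" for f'
  proof -
    have "(LBINT x:E. ?u f' x) <= ?I f'"
      using schwarz_attained[OF R prem[OF f'] r] E by metis
    also have "\<dots> <= ?I f" using opt[OF f'] r unfolding less_concentrated_def cong by simp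
    finally show ?thesis unfolding P_def att[symmetric] heat_value(3)[OF T f' E(1,2) p] heat_value(3)[OF T f E(1,2) p] .
  qed
  have Q: "?Q \<in> sets borel" by (intro borel_Times) auto
  then have Qs [simp]: "?Q \<inter> space lborel \<in> sets lborel" by simp
  have Qfin: "emeasure lborel ?Q \<noteq> \<infinity>"
    using emeasure_bounded_finite[of ?Q] by (simp add: bounded_Times)
  define N where "N = restrict_space lborel ?Q"
  have Nint: "integral\<^sup>L N h = (LBINT z:?Q. h z)" for h :: "real \<times> 'a => real"
    unfolding N_def set_lebesgue_integral_def by (rule integral_restrict_space[OF Qs])
  have NAE: "(AE z in N. X z) \<longleftrightarrow> (AE z in lborel. z \<in> ?Q --> X z)" for X
    unfolding N_def by (rule AE_restrict_space_iff[OF Qs])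
  have Nm: "h \<in> borel_measurable N \<longleftrightarrow> set_borel_measurable lborel ?Q h" for h :: "real \<times> 'a => real"
    unfolding N_def set_borel_measurable_def by (rule borel_measurable_restrict_space_iff[OF Qs])
  have Nsp: "space N = ?Q" "emeasure N ?Q = emeasure lborel ?Q"
    using Q by (simp_all add: N_def space_restrict_space emeasure_restrict_space)
  interpret N: finite_measure N by (rule finite_measureI) (use Qfin Nsp in simp)
  have admiss: "f' \<in> admissible_sources \<Omega> T V \<longleftrightarrow> f' \<in> borel_measurable N \<and> (AE z in N. 0 <= f' z \<and> f' z <= 1) \<and> integral\<^sup>L N f' = V" for f'
    unfolding admissible_sources_def Nint NAE Nm by simp
  note fN = f[unfolded admiss]
  have Pm: "P \<in> borel_measurable N" unfolding N_def
    using p by (intro measurable_restrict_space1) (simp add: is_adjoint_def P_def[abs_def] case_prod_beta')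
  note slab = adjoint_slab[OF E(1,2) p T]
  have iP: "integrable N P"
  proof -
    have "L2_fun (restr \<Omega> (%_. 1 :: real))"
      using indicator_facts(1)[of \<Omega>] by (simp add: restr_def)
    then have "L2_on ?Q (%(t, x). (1::real))" by (intro L2_on_slab_const) (simp_all add: L2_on_iff)
    from slab_fubini(3)[OF slab(1) this] show ?thesis
      unfolding N_def set_integrable_def by (simp add: integrable_restrict_space[OF Qs] P_def case_prod_beta')
  qed
  have iP2: "integrable N (%z. (P z)\<^sup>2)" "(LINT z|N. (P z)\<^sup>2) <= T * measure lborel E"
    using slab_fubini(3)[OF slab(1) slab(1)] slab(2) unfolding Nint
    by (simp_all add: N_def set_integrable_def integrable_restrict_space[OF Qs] P_def case_prod_beta' power2_eq_square)
  have n0: "\<not> (AE z in N. f z = 0)"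
  proof
    assume "AE z in N. f z = 0"
    then have "integral\<^sup>L N f = (LINT z|N. 0)" using fN by (intro integral_cong_AE) auto
    then show False using fN V by simp
  qed
  have n1: "\<not> (AE z in N. f z = 1)"
  proof
    assume "AE z in N. f z = 1"
    then have "integral\<^sup>L N f = (LINT z|N. 1)" using fN by (intro integral_cong_AE) auto
    then show False using fN V Nsp by (simp add: measure_def)
  qed
  have best': "(LINT z|N. f' z * P z) <= (LINT z|N. f z * P z)"
    if "f' \<in> borel_measurable N" "AE z in N. 0 <= f' z \<and> f' z <= 1" "integral\<^sup>L N f' = integral\<^sup>L N f" for f'
    unfolding Nint using best[of f'] that fN by (simp add: admiss)
  obtain c where c: "AE z in N. (c < P z --> f z = 1) \<and> (P z < c --> f z = 0)"
    by (rule N.bathtub[OF Pm _ iP _ n0 n1 best']) (use fN in auto)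
  have f01: "AE z in N. 0 <= f z \<and> f z <= 1" using fN by simp
  have E0: "0 < measure lborel E" unfolding E(3) using r(1) by (simp add: measure_ball_0)
  have Ppos: "AE z in N. 0 < P z" unfolding NAE P_def by (rule adjoint_pos[OF E(1,2) p T E0])
  \<comment> \<open>The density is positive on the slab, so a level at most 0 would force
    \<open>f = 1\<close> almost everywhere, against the strict upper bound on
    \<open>V\<close>.\<close>
  have c0: "0 < c"
  proof (rule ccontr)
    assume "\<not> 0 < c"
    have "AE z in N. f z = 1" using c Ppos by eventually_elim (use \<open>\<not> 0 < c\<close> in auto)
    then show False using n1 by simp
  qed
  \<comment> \<open>If \<open>c\<close> exceeded 1/2, then \<open>f\<close> would vanish where
    \<open>P z < c\<close>, and elsewhere 4 P^2 would be at least 1. So \<open>f\<close> would be at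
    most 4 P^2 almost everywhere, and integration contradicts \<open>small\<close>, whose factor 4
    comes from here.\<close>
  have c1: "c <= 1/2"
  proof (rule ccontr)
    assume cc: "\<not> c <= 1/2"
    have "integral\<^sup>L N f <= (LINT z|N. 4 * (P z)\<^sup>2)"
    proof (rule integral_mono_AE)
      show "integrable N f" using fN by (intro N.integrable_const_bound[where B = 1]) (auto elim: eventually_mono)
      show "AE z in N. f z <= 4 * (P z)\<^sup>2"
        using c f01
      proof eventually_elim
        case (elim z)
        show ?case
        proof (cases "P z < c")
          case False
          then have "(1/2)\<^sup>2 <= (P z)\<^sup>2" using cc by (intro power_mono) auto
          then show ?thesis using elim by (simp add: power2_eq_square)
        qed (use elim in simp)
      qed
    qed (use iP2 in simp)
    also have "\<dots> <= 4 * (T * measure lborel E)" using iP2(2) by simp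
    finally show False using small fN by (simp add: E(3))
  qed
  have "AE z in N. \<bar>f z - indicator E (snd z)\<bar> <= (1 / c\<^sup>2) * (P z - indicator E (snd z))\<^sup>2"
    using c f01
  proof eventually_elim
    case (elim z)
    show ?case
    proof (cases "f z = indicator E (snd z)")
      case False
      \<comment> \<open>Inside \<open>E\<close>, a value of \<open>f\<close> other than 1 means
        \<open>P z <= c\<close>, so the distance is at least \<open>1 - c\<close>, hence at least
        \<open>c\<close>. Outside \<open>E\<close>, a value other than 0 means
        \<open>P z >= c\<close>.\<close>
      have "c <= \<bar>P z - indicator E (snd z)\<bar>"
        using False elim c0 c1 by (cases "snd z \<in> E") auto
      then have "c\<^sup>2 <= (P z - indicator E (snd z))\<^sup>2" using c0 abs_le_square_iff[of c "P z - indicator E (snd z)"] by simp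
      then have "1 <= (1 / c\<^sup>2) * (P z - indicator E (snd z))\<^sup>2" using c0 by simp
      moreover have "\<bar>f z - indicator E (snd z)\<bar> <= 1" using elim by (auto simp: indicator_def)
      ultimately show ?thesis by linarith
    qed simp
  qed
  then have "AE z in lborel. z \<in> ?Q --> \<bar>f z - indicator E (snd z)\<bar> <= (1 / c\<^sup>2) * (p (fst z) (snd z) - indicator E (snd z))\<^sup>2"
    unfolding NAE P_def .
  then show thesis by (rule that[OF E p])
qed

text \<open>The two indicators are compared through \<open>f\<close>: their difference is at most
  the sum of the two errors, and integration over space at time \<open>t\<close> turns this into a
  combination of the squared distances that the flow has moved the two indicators during
  \<open>T - t\<close>. These tend to 0, so the volume difference cannot be positive.\<close>

lemma near_final_time:
  assumes E1: "E1 \<in> sets borel" "E1 \<subseteq> \<Omega>" and E2: "E2 \<in> sets borel" "E2 \<subseteq> \<Omega>"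
    and p: "is_adjoint T E1 p1" "is_adjoint T E2 p2" and T: "0 < T"
    and f1: "AE z in lborel. z \<in> {0<..<T} \<times> \<Omega> --> \<bar>f z - indicator E1 (snd z)\<bar> <= K1 * (p1 (fst z) (snd z) - indicator E1 (snd z))\<^sup>2"
    and f2: "AE z in lborel. z \<in> {0<..<T} \<times> \<Omega> --> \<bar>f z - indicator E2 (snd z)\<bar> <= K2 * (p2 (fst z) (snd z) - indicator E2 (snd z))\<^sup>2"
  shows "measure lborel E2 <= measure lborel E1"
proof (rule ccontr)
  let ?d = "measure lborel E2 - measure lborel E1"
  assume "\<not> measure lborel E2 <= measure lborel E1"
  then have d: "0 < ?d" by simp
  define w1 where "w1 = cls (indicator E1 :: 'a => real)"
  define w2 where "w2 = cls (indicator E2 :: 'a => real)"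
  define \<Phi> where "\<Phi> s = K1 * (norm (flow s w1 - w1))\<^sup>2 + K2 * (norm (flow s w2 - w2))\<^sup>2" for s
  note i1 = indicator_facts[OF E1] and i2 = indicator_facts[OF E2]
  have "AE z in lborel \<Otimes>\<^sub>M lborel. z \<in> {0<..<T} \<times> \<Omega> --> indicator E2 (snd z) - indicator E1 (snd z)
    <= K1 * (p1 (fst z) (snd z) - indicator E1 (snd z))\<^sup>2 + K2 * (p2 (fst z) (snd z) - indicator E2 (snd z))\<^sup>2"
    unfolding lborel_prod using f1 f2 by eventually_elim (auto simp: abs_le_iff)
  from lborel_pair.AE_pair[OF this]
  have large: "AE t in lborel. t \<in> {0<..<T} --> ?d <= \<Phi> (T - t)"
  proof eventually_elim
    case (elim t)
    show ?case
    proof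
      assume t: "t \<in> {0<..<T}"
      have P: "L2_fun (restr \<Omega> (p1 t))" "L2_fun (restr \<Omega> (p2 t))"
        "cls (restr \<Omega> (p1 t)) = flow (T - t) w1" "cls (restr \<Omega> (p2 t)) = flow (T - t) w2"
        using p t by (auto simp: is_adjoint_def L2_on_iff w1_def w2_def)
      let ?q1 = "%x. (norm (restr \<Omega> (p1 t) x - indicator E1 x))\<^sup>2" and ?q2 = "%x. (norm (restr \<Omega> (p2 t) x - indicator E2 x))\<^sup>2"
      have n: "(LBINT x. ?q1 x) = (norm (flow (T - t) w1 - w1))\<^sup>2" "(LBINT x. ?q2 x) = (norm (flow (T - t) w2 - w2))\<^sup>2"
        using norm_cls_diff[OF P(1) i1(1)] norm_cls_diff[OF P(2) i2(1)] by (simp_all add: P w1_def w2_def)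
      have iq: "integrable lborel ?q1" "integrable lborel ?q2"
        using L2_fun_diff[OF P(1) i1(1)] L2_fun_diff[OF P(2) i2(1)] by (simp_all add: L2_fun_def)
      have fin: "emeasure lborel E < top" if "E \<subseteq> \<Omega>" for E
        using emeasure_bounded_finite[OF bounded_subset[OF bounded_ball that]] by simp
      have ii: "integrable lborel (indicator E1 :: 'a => real)" "integrable lborel (indicator E2 :: 'a => real)"
        using E1 E2 fin by (simp_all add: less_top)
      have "?d = (LBINT x. indicator E2 x - indicator E1 x)" using ii E1 E2 by simp
      also have "\<dots> <= (LBINT x. K1 * ?q1 x + K2 * ?q2 x)"
      proof (rule integral_mono_AE)
        show "AE x in lborel. indicator E2 x - indicator E1 x <= K1 * ?q1 x + K2 * ?q2 x"
          using elim
        proof eventually_elim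
          case (elim x)
          show ?case
          proof (cases "x \<in> \<Omega>")
            case True
            then show ?thesis using elim t by (simp add: restr_def)
          next
            case False
            then have "x \<notin> E1" "x \<notin> E2" using E1 E2 by auto
            then show ?thesis using False by (simp add: restr_def)
          qed
        qed
      qed (use ii iq in simp_all)
      also have "\<dots> = \<Phi> (T - t)" using iq by (simp add: n \<Phi>_def del: real_norm_def)
      finally show "?d <= \<Phi> (T - t)" .
    qed
  qed
  obtain \<tau> where \<tau>: "0 < \<tau>" "\<And>s. 0 <= s ==> s < \<tau> ==> \<Phi> s < ?d"
  proof -
    have "continuous_on {0..} \<Phi>" unfolding \<Phi>_def by (intro continuous_intros continuous_on_flow)
    then have "(\<Phi> \<longlongrightarrow> \<Phi> 0) (at 0 within {0..})" by (simp add: continuous_on_def)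
    moreover have "\<Phi> 0 = 0" using flow_0_supported[OF i1(2)] flow_0_supported[OF i2(2)] by (simp add: \<Phi>_def w1_def w2_def)
    ultimately have "\<forall>\<^sub>F s in at 0 within {0..}. \<Phi> s < ?d" using d by (intro order_tendstoD(2)) auto
    then obtain \<tau> where "0 < \<tau>" "\<And>s. s \<in> {0..} ==> s \<noteq> 0 ==> dist s 0 < \<tau> ==> \<Phi> s < ?d"
      unfolding eventually_at by blast
    moreover have "\<Phi> 0 < ?d" using \<open>\<Phi> 0 = 0\<close> d by simp
    ultimately have "\<Phi> s < ?d" if "0 <= s" "s < \<tau>" for s using that by (cases "s = 0") (simp_all add: dist_real_def)
    then show thesis using \<open>0 < \<tau>\<close> by (intro that[of \<tau>])
  qed
  \<comment> \<open>The estimate holds for almost every time, so the contradiction needs a whole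
    interval of times before \<open>T\<close>, which has positive length.\<close>
  define a where "a = max 0 (T - \<tau>)"
  have a: "0 <= a" "a < T" "T - \<tau> <= a" using T \<tau>(1) by (auto simp: a_def)
  have "AE t in lborel. t \<notin> {a<..<T}"
    using large
  proof eventually_elim
    case (elim t)
    show ?case
    proof
      assume "t \<in> {a<..<T}"
      then have "t \<in> {0<..<T}" "\<Phi> (T - t) < ?d" using a by (auto intro!: \<tau>(2))
      then show False using elim by simp
    qed
  qed
  then have "emeasure lborel {a<..<T} = 0"
    by (subst (asm) AE_iff_measurable[of "{a<..<T}"]) auto
  then show False using a by simp
qed

end

theorem theorem1:
  fixes R T V\<^sub>0 :: real and \<Omega> :: "'a::euclidean_space set"
  assumes "R > 0" and "T > 0"
    and "\<Omega> = ball 0 R"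
    and "0 < V\<^sub>0" and "V\<^sub>0 < measure lborel ({0<..<T} \<times> \<Omega>)"
  shows "\<not> (\<exists>fopt \<in> admissible_sources \<Omega> T V\<^sub>0. \<forall>f \<in> admissible_sources \<Omega> T V\<^sub>0.
            less_concentrated R (heat_solution \<Omega> T f T) (heat_solution \<Omega> T fopt T))"
proof
  assume "\<exists>fopt \<in> admissible_sources \<Omega> T V\<^sub>0. \<forall>f \<in> admissible_sources \<Omega> T V\<^sub>0.
            less_concentrated R (heat_solution \<Omega> T f T) (heat_solution \<Omega> T fopt T)"
  then obtain f where f: "f \<in> admissible_sources (ball (0::'a) R) T V\<^sub>0"
    and opt: "\<And>f'. f' \<in> admissible_sources (ball (0::'a) R) T V\<^sub>0 ==>
      less_concentrated R (heat_solution (ball 0 R) T f' T) (heat_solution (ball 0 R) T f T)"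
    unfolding assms(3) by blast
  obtain e :: "nat => ('a, real) L2" and g l where "ball_heat R e g l"
    by (rule ball_heat_exists[OF assms(1)])
  then interpret ball_heat R e g l .
  have B: "0 < measure lborel (ball (0::'a) R)" using assms(1) by (simp add: measure_ball_0)
  \<comment> \<open>The first bound makes \<open>4 * (T * v)\<close> at most half of
    \<open>V\<^sub>0\<close>, as the upper bound on the level requires; the second keeps the radius
    strictly below \<open>R\<close>.\<close>
  define v where "v = min (V\<^sub>0 / (8 * T)) (measure lborel (ball (0::'a) R) / 2)"
  have v: "0 < v" "v < measure lborel (ball (0::'a) R)" "4 * (T * v) < V\<^sub>0"
  proof -
    show "0 < v" using assms B by (simp add: v_def)
    have "v <= measure lborel (ball (0::'a) R) / 2" by (simp add: v_def)
    then show "v < measure lborel (ball (0::'a) R)" using B by linarith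
    have "4 * (T * v) <= 4 * (T * (V\<^sub>0 / (8 * T)))" using assms(2) by (intro mult_left_mono) (auto simp: v_def)
    also have "\<dots> < V\<^sub>0" using assms by simp
    finally show "4 * (T * v) < V\<^sub>0" .
  qed
  have ex: "\<exists>E p K. E \<in> sets borel \<and> E \<subseteq> ball 0 R \<and> measure lborel E = y \<and> is_adjoint T E p \<and>
    (AE z in lborel. z \<in> {0<..<T} \<times> ball 0 R --> \<bar>f z - indicator E (snd z)\<bar> <= K * (p (fst z) (snd z) - indicator E (snd z))\<^sup>2)"
    if y: "0 < y" "y <= v" for y
  proof -
    obtain r where r: "0 <= r" "r <= R" "measure lborel (ball (0::'a) r) = y"
      by (rule ball_of_measure[of y R]) (use y v assms in auto)
    have r': "0 < r" "r < R" using r y v by (auto simp: less_le)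
    have "4 * (T * y) <= 4 * (T * v)" using y assms(2) by simp
    then have small: "4 * (T * measure lborel (ball (0::'a) r)) < V\<^sub>0" using v(3) r(3) by simp
    show ?thesis
    proof (rule optimal_source_structure[OF assms(2,4) assms(5)[unfolded assms(3)] f _ r' small])
      show "less_concentrated R (heat_solution (ball 0 R) T f' T) (heat_solution (ball 0 R) T f T)"
        if "f' \<in> admissible_sources (ball (0::'a) R) T V\<^sub>0" for f'
        using that by (rule opt)
    next
      fix E p K
      assume a: "E \<in> sets borel" "E \<subseteq> ball 0 R" "measure lborel E = measure lborel (ball (0::'a) r)" "is_adjoint T E p"
        "AE z in lborel. z \<in> {0<..<T} \<times> ball 0 R --> \<bar>f z - indicator E (snd z)\<bar> <= K * (p (fst z) (snd z) - indicator E (snd z))\<^sup>2"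
      show ?thesis
        by (rule exI[of _ E], rule exI[of _ p], rule exI[of _ K]) (intro conjI a a(3)[unfolded r(3)])
    qed
  qed
  have half: "v / 2 <= v" using v(1) by simp
  obtain E1 p1 K1 where
    1: "E1 \<in> sets borel" "E1 \<subseteq> ball 0 R" "measure lborel E1 = v / 2" "is_adjoint T E1 p1"
      "AE z in lborel. z \<in> {0<..<T} \<times> ball 0 R --> \<bar>f z - indicator E1 (snd z)\<bar> <= K1 * (p1 (fst z) (snd z) - indicator E1 (snd z))\<^sup>2"
    using ex[OF half_gt_zero[OF v(1)] half] by (elim exE conjE) (rule that)
  obtain E2 p2 K2 where
    2: "E2 \<in> sets borel" "E2 \<subseteq> ball 0 R" "measure lborel E2 = v" "is_adjoint T E2 p2"
      "AE z in lborel. z \<in> {0<..<T} \<times> ball 0 R --> \<bar>f z - indicator E2 (snd z)\<bar> <= K2 * (p2 (fst z) (snd z) - indicator E2 (snd z))\<^sup>2"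
    using ex[OF v(1) order_refl] by (elim exE conjE) (rule that)
  have "v <= v / 2" using near_final_time[OF 1(1,2) 2(1,2) 1(4) 2(4) assms(2) 1(5) 2(5)] 1(3) 2(3) by simp
  then show False using v(1) by simp
qed

end
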